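(* Let $s\in\mathbb{Z}$, let $P$ be a Gaussian isotropic spin-$s$ random field on $\mathbb{S}^2$ with angular power spectrum $(C_l)$ satisfying the spectrum condition: there are $\alpha>2$, $c_0>0$ and a smooth function $g$ such that $C_l=l^{-\alpha}g(l)>0$ with $c_0^{-1}\le g(l)\le c_0$ for all $l$, and for every $r\in\mathbb{N}$ there is $c_r>0$ with $|\frac{d^r}{du^r}g(u)|\le c_r u^{-r}$ for $u\in(|s|,\infty)$. Let $G\subset\mathbb{S}^2$ be the (measurable) masked region, let $\varepsilon>0$ be fixed, $G^{\varepsilon}=\{x\in\mathbb{S}^2: d(x,G)\le\varepsilon\}$, with $\mathbb{S}^2\setminus G^{\varepsilon}\neq\emptyset$. Let $\beta^{*}_{jk;s}=\int_{\mathbb{S}^2\setminus G}P(x)\overline{\psi_{jk;s}(x)}\,dx$ be the spin needlet coefficients computed from the data on $\mathbb{S}^2\setminus G$, and $$\widehat{\Gamma}^{*}_{j;sG}:=\Big\{\sum_{k:\xi_{jk}\in\mathbb{S}^2\setminus G^{\varepsilon}}\lambda_{jk}\Big\}^{-1}\sum_{k:\xi_{jk}\in\mathbb{S}^2\setminus G^{\varepsilon}}|\beta^{*}_{jk;s}|^2 ,\qquad \Gamma_{j;s}:=\sum_{l}b^2\Big(\frac{\sqrt{e_{ls}}}{B^j}\Big)\frac{2l+1}{4\pi}C_l .$$ Then, as $j\to\infty$, $$\frac{\widehat{\Gamma}^{*}_{j;sG}-\Gamma_{j;s}}{\sqrt{\mathrm{Var}\{\widehat{\Gamma}^{*}_{j;sG}\}}}\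 \longrightarrow_d\ N(0,1).$$
   Context: $d$ is geodesic distance on the unit sphere $\mathbb{S}^2$; $dx$ is surface measure (if $G=\emptyset$, $G^\varepsilon=\emptyset$). Spin harmonics. For $s\in\mathbb{Z}$, $l\ge|s|$, $m=-l,\dots,l$, in the fixed chart with spherical coordinates $(\vartheta,\varphi)$ on $\mathbb{S}^2\setminus\{\text{poles}\}$, the spin-$s$ spherical harmonics are $Y_{l;ms}(\vartheta,\varphi)=(-1)^m\sqrt{\frac{2l+1}{4\pi}}\,e^{im\varphi}d^l_{-m,s}(\vartheta)$, where $d^l_{mn}$ are the Wigner (small) $d$-functions, i.e. the Wigner matrices of $SO(3)$ are $D^l_{mn}(\alpha,\beta,\gamma)=e^{-im\alpha}d^l_{mn}(\beta)e^{-in\gamma}$. They are orthonormal in $L^2(\mathbb{S}^2)$ and $\sum_m|Y_{l;ms}|^2=\frac{2l+1}{4\pi}$. A change of chart only multiplies spin-$s$ quantities by a unimodular phase, so all quantities $|\cdot|^2$ below do not depend on the chart. Put $e_{ls}=(l-s)(l+s+1)$. Sums over $l$ run over $l\ge|s|$ (and $l\geq 1$). Spin needlets. Fix $B>1$ and a nonnegative $b\in C^\infty$ with compact support in $[1/B,B]$, and $\sum_{j\in\mathbb{Z}}b^2(u/B^j)=1$ for all $u>0$. For each $j\ge0$ there are finitely many cubature points $\xi_{jk}\in\mathbb{S}^2$ and weights $\lambda_{jk}>0$ (nested in $j$), with $\sum_k\lambda_{jk}=4\pi$ and $\sum_k\lambda_{jk}Y_{l;ms}(\xi_{jk})\overline{Y_{l';m's}(\xi_{jk})}=\delta_l^{l'}\delta_m^{m'}$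 for all $l,l'$ with $\sqrt{e_{ls}},\sqrt{e_{l's}}\le B^{j+1}$; with constants independent of $j$, $cB^{-2j}\le\lambda_{jk}\le c'B^{-2j}$, the number of points is bounded above and below by constants times $B^{2j}$, distinct points are at distance $\ge\kappa'B^{-j}$, and each point of $\mathbb{S}^2$ is within $\kappa B^{-j}$ of some $\xi_{jk}$. The spin needlets are $\psi_{jk;s}(x)=\sqrt{\lambda_{jk}}\sum_l b\big(\frac{\sqrt{e_{ls}}}{B^j}\big)\sum_{m=-l}^lY_{l;ms}(x)\overline{Y_{l;ms}(\xi_{jk})}$. Random field. A Gaussian isotropic spin-$s$ field with (total) angular power spectrum $(C_l)$ is $P=\sum_{l}\sum_{m=-l}^l a_{l;ms}Y_{l;ms}$ (convergence in mean square), where $(a_{l;ms})$ are jointly Gaussian, zero-mean, complex with $E\,a_{l;ms}\overline{a_{l';m's}}=C_l\delta_l^{l'}\delta_m^{m'}$ and $E\,a_{l;ms}a_{l';m's}=0$. *)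

theory Defs
  imports "HOL-Probability.Probability"
begin

section \<open>The unit sphere\<close>

definition spherical :: "real \<Rightarrow> real \<Rightarrow> real^3" where
  "spherical \<theta> \<phi> = vector [sin \<theta> * cos \<phi>, sin \<theta> * sin \<phi>, cos \<theta>]"

definition colatitude :: "real^3 \<Rightarrow> real" where
  "colatitude x = arccos (x $ 3)"

(* At the two poles, where the longitude is undetermined, Arg 0 = 0 selects the value 0. *)
definition longitude :: "real^3 \<Rightarrow> real" where
  "longitude x = Arg (Complex (x $ 1) (x $ 2))"

(* The image of sin \<theta> d\<theta> d\<phi> under spherical coordinates, completed. *)
definition surface_measure :: "(real^3) measure" where
  "surface_measure = completion
     (distr (density lborel
               (\<lambda>(\<theta>, \<phi>). indicator ({0..pi} \<times> {-pi<..pi}) (\<theta>, \<phi>) * ennreal (sin \<theta>)))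
            (restrict_space borel (sphere 0 1))
            (\<lambda>(\<theta>, \<phi>). spherical \<theta> \<phi>))"

definition geodesic_dist :: "real^3 \<Rightarrow> real^3 \<Rightarrow> real" where
  "geodesic_dist x y = arccos (x \<bullet> y)"

(* The empty set is treated separately because Inf {} is unspecified on the reals. *)
definition enlargement :: "(real^3) set \<Rightarrow> real \<Rightarrow> (real^3) set" where
  "enlargement G \<epsilon> =
     (if G = {} then {} else {x \<in> sphere 0 1. (INF y\<in>G. geodesic_dist x y) \<le> \<epsilon>})"

section \<open>Spin spherical harmonics\<close>

(* Wigner's explicit formula, in the phase convention in which
   e^(-i m \<alpha>) * wigner_d l m n \<beta> * e^(-i n \<gamma>) is the matrix element of
   exp (-i \<alpha> J_z) exp (-i \<beta> J_y) exp (-i \<gamma> J_z); meant for \<bar>m\<bar>, \<bar>n\<bar> \<le> l.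
   The summation range makes every argument of nat nonnegative. *)
definition wigner_d :: "nat \<Rightarrow> int \<Rightarrow> int \<Rightarrow> real \<Rightarrow> real" where
  "wigner_d l m n \<beta> =
     sqrt (fact (nat (int l + m)) * fact (nat (int l - m)) *
           fact (nat (int l + n)) * fact (nat (int l - n))) *
     (\<Sum>k\<in>{max 0 (n - m)..min (int l + n) (int l - m)}.
        (-1) ^ nat (m - n + k) *
        cos (\<beta> / 2) ^ nat (2 * int l + n - m - 2 * k) * sin (\<beta> / 2) ^ nat (m - n + 2 * k) /
        (fact (nat (int l + n - k)) * fact (nat k) *
         fact (nat (m - n + k)) * fact (nat (int l - m - k))))"

(* At a pole the value is the limit along the meridian of longitude 0.  Approaching along another
   meridian multiplies all harmonics of spin s by a common phase independent of l and m, as a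
   change of chart does. *)
definition spin_harmonic :: "nat \<Rightarrow> int \<Rightarrow> int \<Rightarrow> real^3 \<Rightarrow> complex" where
  "spin_harmonic l m s x =
     of_real ((-1) powi m * sqrt ((2 * real l + 1) / (4 * pi)) * wigner_d l (-m) s (colatitude x)) *
     cis (of_int m * longitude x)"

definition spin_eigenvalue :: "nat \<Rightarrow> int \<Rightarrow> real" where
  "spin_eigenvalue l s = of_int ((int l - s) * (int l + s + 1))"

definition multipoles :: "int \<Rightarrow> nat set" where
  "multipoles s = {l. \<bar>s\<bar> \<le> int l \<and> 1 \<le> l}"

section \<open>Spin needlets\<close>

definition smooth_on :: "real set \<Rightarrow> (real \<Rightarrow> real) \<Rightarrow> bool" where
  "smooth_on S f \<longleftrightarrow> (\<forall>n. \<forall>x\<in>S. (deriv ^^ n) f field_differentiable (at x))"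

definition needlet_window :: "real \<Rightarrow> (real \<Rightarrow> real) \<Rightarrow> bool" where
  "needlet_window B b \<longleftrightarrow>
     smooth_on UNIV b \<and> (\<forall>u. 0 \<le> b u) \<and> closure {u. b u \<noteq> 0} \<subseteq> {1 / B..B} \<and>
     (\<forall>u>0. ((\<lambda>j::int. (b (u / B powi j))\<^sup>2) has_sum 1) UNIV)"

(* At level j the points and weights are \<xi> j k and w j k for k < N j. *)
definition spin_cubature ::
  "real \<Rightarrow> int \<Rightarrow> (nat \<Rightarrow> nat) \<Rightarrow> (nat \<Rightarrow> nat \<Rightarrow> real^3) \<Rightarrow> (nat \<Rightarrow> nat \<Rightarrow> real) \<Rightarrow> bool" where
  "spin_cubature B s N \<xi> w \<longleftrightarrow>
     (\<forall>j. \<forall>k<N j. \<xi> j k \<in> sphere 0 1 \<and> 0 < w j k) \<and>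
     (\<forall>j. \<xi> j ` {..<N j} \<subseteq> \<xi> (Suc j) ` {..<N (Suc j)}) \<and>
     (\<forall>j. (\<Sum>k<N j. w j k) = 4 * pi) \<and>
     (\<forall>j l l' m m'. \<bar>s\<bar> \<le> int l \<and> \<bar>s\<bar> \<le> int l' \<and> \<bar>m\<bar> \<le> int l \<and> \<bar>m'\<bar> \<le> int l' \<and>
        sqrt (spin_eigenvalue l s) \<le> B ^ (j + 1) \<and> sqrt (spin_eigenvalue l' s) \<le> B ^ (j + 1) \<longrightarrow>
        (\<Sum>k<N j. of_real (w j k) * spin_harmonic l m s (\<xi> j k) * cnj (spin_harmonic l' m' s (\<xi> j k))) =
        (if l = l' \<and> m = m' then 1 else 0)) \<and>
     (\<exists>c>0. \<exists>c'>0. \<forall>j. \<forall>k<N j. c / B ^ (2 * j) \<le> w j k \<and> w j k \<le> c' / B ^ (2 * j)) \<and>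
     (\<exists>c>0. \<exists>c'>0. \<forall>j. c * B ^ (2 * j) \<le> real (N j) \<and> real (N j) \<le> c' * B ^ (2 * j)) \<and>
     (\<exists>\<kappa>'>0. \<forall>j. \<forall>k<N j. \<forall>k'<N j. k \<noteq> k' \<longrightarrow> \<kappa>' / B ^ j \<le> geodesic_dist (\<xi> j k) (\<xi> j k')) \<and>
     (\<exists>\<kappa>>0. \<forall>j. \<forall>x\<in>sphere 0 1. \<exists>k<N j. geodesic_dist x (\<xi> j k) \<le> \<kappa> / B ^ j)"

definition spin_needlet ::
  "real \<Rightarrow> (real \<Rightarrow> real) \<Rightarrow> int \<Rightarrow> (nat \<Rightarrow> nat \<Rightarrow> real^3) \<Rightarrow> (nat \<Rightarrow> nat \<Rightarrow> real) \<Rightarrow>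
     nat \<Rightarrow> nat \<Rightarrow> real^3 \<Rightarrow> complex" where
  "spin_needlet B b s \<xi> w j k x =
     of_real (sqrt (w j k)) *
     (\<Sum>\<^sub>\<infinity>l\<in>multipoles s. of_real (b (sqrt (spin_eigenvalue l s) / B ^ j)) *
        (\<Sum>m = - int l..int l. spin_harmonic l m s x * cnj (spin_harmonic l m s (\<xi> j k))))"

section \<open>Gaussian isotropic spin fields\<close>

(* Point masses count as degenerate Gaussians. *)
definition gaussian_rv :: "'a measure \<Rightarrow> ('a \<Rightarrow> real) \<Rightarrow> bool" where
  "gaussian_rv M X \<longleftrightarrow> X \<in> borel_measurable M \<and>
     ((\<exists>\<mu>. distr M borel X = return borel \<mu>) \<or>
      (\<exists>\<mu> \<sigma>. 0 < \<sigma> \<and> distributed M lborel X (normal_density \<mu> \<sigma>)))"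

definition jointly_gaussian :: "'a measure \<Rightarrow> 'i set \<Rightarrow> ('i \<Rightarrow> 'a \<Rightarrow> complex) \<Rightarrow> bool" where
  "jointly_gaussian M I X \<longleftrightarrow>
     (\<forall>J p q. finite J \<and> J \<subseteq> I \<longrightarrow>
        gaussian_rv M (\<lambda>\<omega>. \<Sum>i\<in>J. p i * Re (X i \<omega>) + q i * Im (X i \<omega>)))"

(* Mean-square convergence is stated with the nonnegative integral, since the Bochner integral of
   a non-integrable function is 0.  Joint measurability of P is what makes integrals of P over
   subsets of the sphere random variables. *)
definition gaussian_spin_field ::
  "'a measure \<Rightarrow> int \<Rightarrow> (nat \<Rightarrow> real) \<Rightarrow> ('a \<Rightarrow> real^3 \<Rightarrow> complex) \<Rightarrow> bool" where
  "gaussian_spin_field M s C P \<longleftrightarrow>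
     (\<lambda>(\<omega>, x). P \<omega> x) \<in> borel_measurable (M \<Otimes>\<^sub>M surface_measure) \<and>
     (\<exists>a :: nat \<Rightarrow> int \<Rightarrow> 'a \<Rightarrow> complex.
        jointly_gaussian M (SIGMA l:multipoles s. {- int l..int l}) (\<lambda>(l, m). a l m) \<and>
        (\<forall>l\<in>multipoles s. \<forall>m\<in>{- int l..int l}. prob_space.expectation M (a l m) = 0) \<and>
        (\<forall>l\<in>multipoles s. \<forall>m\<in>{- int l..int l}. \<forall>l'\<in>multipoles s. \<forall>m'\<in>{- int l'..int l'}.
           prob_space.expectation M (\<lambda>\<omega>. a l m \<omega> * cnj (a l' m' \<omega>)) =
             (if l = l' \<and> m = m' then of_real (C l) else 0) \<and>
           prob_space.expectation M (\<lambda>\<omega>. a l m \<omega> * a l' m' \<omega>) = 0) \<and>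
        (\<forall>x\<in>sphere 0 1.
           (\<lambda>L. \<integral>\<^sup>+\<omega>. ennreal ((cmod (P \<omega> x -
                  (\<Sum>l\<in>multipoles s \<inter> {..L}. \<Sum>m = - int l..int l.
                     a l m \<omega> * spin_harmonic l m s x)))\<^sup>2) \<partial>M) \<longlonglongrightarrow> 0))"

definition spectrum_condition :: "int \<Rightarrow> (nat \<Rightarrow> real) \<Rightarrow> bool" where
  "spectrum_condition s C \<longleftrightarrow>
     (\<exists>\<alpha>>2. \<exists>c\<^sub>0>0. \<exists>g :: real \<Rightarrow> real.
        smooth_on {of_int \<bar>s\<bar><..} g \<and>
        (\<forall>l\<in>multipoles s. C l = real l powr (- \<alpha>) * g (real l) \<and> 0 < C l \<and>
           1 / c\<^sub>0 \<le> g (real l) \<and> g (real l) \<le> c\<^sub>0) \<and>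
        (\<forall>r::nat. \<exists>c>0. \<forall>u>of_int \<bar>s\<bar>. \<bar>(deriv ^^ r) g u\<bar> \<le> c / u ^ r))"

section \<open>Needlet estimator of the angular power spectrum from masked data\<close>

definition masked_coeff ::
  "(real^3) set \<Rightarrow> ('a \<Rightarrow> real^3 \<Rightarrow> complex) \<Rightarrow> (real^3 \<Rightarrow> complex) \<Rightarrow> 'a \<Rightarrow> complex" where
  "masked_coeff G P \<psi> \<omega> = (LINT x:sphere 0 1 - G|surface_measure. P \<omega> x * cnj (\<psi> x))"

definition masked_estimator ::
  "real \<Rightarrow> (real \<Rightarrow> real) \<Rightarrow> int \<Rightarrow> (nat \<Rightarrow> nat) \<Rightarrow> (nat \<Rightarrow> nat \<Rightarrow> real^3) \<Rightarrow> (nat \<Rightarrow> nat \<Rightarrow> real) \<Rightarrow>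
     (real^3) set \<Rightarrow> real \<Rightarrow> ('a \<Rightarrow> real^3 \<Rightarrow> complex) \<Rightarrow> nat \<Rightarrow> 'a \<Rightarrow> real" where
  "masked_estimator B b s N \<xi> w G \<epsilon> P j \<omega> =
     (let K = {k. k < N j \<and> \<xi> j k \<in> sphere 0 1 - enlargement G \<epsilon>}
      in (\<Sum>k\<in>K. (cmod (masked_coeff G P (spin_needlet B b s \<xi> w j k) \<omega>))\<^sup>2) / (\<Sum>k\<in>K. w j k))"

definition needlet_spectrum :: "real \<Rightarrow> (real \<Rightarrow> real) \<Rightarrow> int \<Rightarrow> (nat \<Rightarrow> real) \<Rightarrow> nat \<Rightarrow> real" where
  "needlet_spectrum B b s C j =
     (\<Sum>\<^sub>\<infinity>l\<in>multipoles s.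
        (b (sqrt (spin_eigenvalue l s) / B ^ j))\<^sup>2 * ((2 * real l + 1) / (4 * pi)) * C l)"

end

theory Submission
  imports Defs
begin

text \<open>
  Only the values of the needlets matter near an unmasked cubature point: summation by parts in \<open>l\<close>
  shows that a needlet decays faster than every power of \<open>B ^ j\<close> away from its centre, and the mask stays
  at a fixed distance from the centres which are used.  Hence the observed coefficients agree in mean square,
  up to a super-polynomially small error, with the ones computed from the whole sphere.  By the cubature
  formula and Bessel's inequality the covariance operator of the latter is bounded by the largest \<open>C l\<close> in
  the band, while each variance is of the same order; since the number of unmasked points tends to infinity,
  the operator norm is negligible against the Hilbert--Schmidt norm.  Diagonalising the covariance turns the
  estimator into a weighted sum of independent \<open>\<chi>\<^sup>2\<close> variables with uniformly small weights,
  which is asymptotically normal.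
\<close>

section \<open>A central limit theorem for Gaussian quadratic forms\<close>

text \<open>Covariances between different coefficients are never estimated. Operator norm and
  variances of the covariance both have the order B^(-\<alpha> j), so with n unmasked points the
  ratio of operator to Hilbert-Schmidt norm is O(1 / sqrt n); any divergence of n suffices. The
  localisation must cope with the spin. It enters the kernel of a multipole only through a factor
  independent of \<open>l\<close>, because the kernel is a diagonal matrix element of the rotation
  taking \<open>y\<close> to \<open>x\<close>, acting on binary forms of degree
  \<open>2 * l\<close>. Multiplication of the kernel by 1 - cos of the distance then acts on
  multipole coefficients by the three-term recurrence of Jacobi polynomials. On coefficients smooth
  at scale B^j this is a difference operator that gains B^(-j), and iteration gives any power. Since
  the Wigner functions are an explicit sum, the addition formula is derived from the SU(2)-invariant
  pairing of binary forms, and orthonormality from Beta integrals.\<close>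

lemma orthonormal_family_card_le:
  fixes v :: "nat \<Rightarrow> 'i \<Rightarrow> real"
  assumes I: "finite I"
    and on: "\<And>r r'. r < n \<Longrightarrow> r' < n \<Longrightarrow> (\<Sum>i\<in>I. v r i * v r' i) = (if r = r' then 1 else 0)"
  shows "n \<le> card I"
proof -
  \<comment> \<open>Project the unit vector at \<open>k\<close> onto the span of the family: the
    projection \<open>?p\<close> has squared norm \<open>?c\<close> and its coordinate at
    \<open>k\<close> is also \<open>?c\<close>, whence \<open>?c\<^sup>2 \<le> ?c\<close>. Summing
    \<open>?c \<le> 1\<close> over \<open>k\<close> counts the vectors.\<close>
  have bessel: "(\<Sum>r<n. (v r k)\<^sup>2) \<le> 1" if k: "k \<in> I" for k
  proof -
    let ?c = "\<Sum>r<n. (v r k)\<^sup>2"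
    let ?p = "\<lambda>i. \<Sum>r<n. v r k * v r i"
    have "(\<Sum>i\<in>I. (?p i)\<^sup>2) = (\<Sum>i\<in>I. \<Sum>r<n. \<Sum>r'<n. v r k * v r' k * (v r i * v r' i))"
      by (simp add: power2_eq_square sum_product algebra_simps)
    also have "\<dots> = (\<Sum>r<n. \<Sum>r'<n. v r k * v r' k * (\<Sum>i\<in>I. v r i * v r' i))"
      by (subst sum.swap, rule sum.cong[OF refl], subst sum.swap, simp add: sum_distrib_left)
    also have "\<dots> = (\<Sum>r<n. \<Sum>r'<n. if r = r' then v r k * v r' k else 0)"
      by (intro sum.cong refl) (simp add: on)
    also have "\<dots> = ?c" by (simp add: power2_eq_square)
    finally have p2: "(\<Sum>i\<in>I. (?p i)\<^sup>2) = ?c" .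
    have "(?p k)\<^sup>2 \<le> (\<Sum>i\<in>I. (?p i)\<^sup>2)"
      by (rule member_le_sum) (use I k in auto)
    then have "?c\<^sup>2 \<le> ?c" unfolding p2 by (simp add: power2_eq_square)
    moreover have "0 \<le> ?c" by (simp add: sum_nonneg)
    ultimately show ?thesis
      by (cases "?c = 0") (auto simp: power2_eq_square mult_le_cancel_left)
  qed
  have "real n = (\<Sum>r<n. \<Sum>i\<in>I. v r i * v r i)" by (simp add: on)
  also have "\<dots> = (\<Sum>i\<in>I. \<Sum>r<n. (v r i)\<^sup>2)"
    by (subst sum.swap) (simp add: power2_eq_square)
  also have "\<dots> \<le> (\<Sum>i\<in>I. 1)" by (intro sum_mono bessel)
  finally show ?thesis by simp
qed

text \<open>The unit sphere of the orthogonal complement of the \<open>v r\<close> is compact, and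
  homogeneity extends the bound from it to every \<open>w\<close>. The vector \<open>e\<close>
  witnesses that this sphere is not empty.\<close>

lemma quadratic_form_attains_max:
  fixes A :: "'i \<Rightarrow> 'i \<Rightarrow> real" and v :: "nat \<Rightarrow> 'i \<Rightarrow> real"
  assumes I: "finite I"
    and e: "e0 \<in> I" "e e0 \<noteq> 0" "\<And>r. r < n \<Longrightarrow> (\<Sum>i\<in>I. e i * v r i) = 0"
  obtains u where "(\<Sum>i\<in>I. (u i)\<^sup>2) = 1" "\<And>r. r < n \<Longrightarrow> (\<Sum>i\<in>I. u i * v r i) = 0"
    "\<And>w. (\<And>r. r < n \<Longrightarrow> (\<Sum>i\<in>I. w i * v r i) = 0) \<Longrightarrow>
       (\<Sum>i\<in>I. \<Sum>k\<in>I. w i * A i k * w k) \<le>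
       (\<Sum>i\<in>I. \<Sum>k\<in>I. u i * A i k * u k) * (\<Sum>i\<in>I. (w i)\<^sup>2)"
proof -
  let ?B = "\<lambda>u. \<Sum>i\<in>I. \<Sum>k\<in>I. u i * A i k * u k"
  \<comment> \<open>Vectors are functions on the whole index type. Freezing the coordinates outside
    \<open>I\<close> at 0 makes the constraint box compact in the product topology, by
    Tychonoff.\<close>
  let ?K = "\<lambda>i. if i \<in> I then {-1..1} else {0::real}"
  define S where "S = PiE UNIV ?K \<inter> {u. (\<Sum>i\<in>I. (u i)\<^sup>2) = 1} \<inter> (\<Inter>r\<in>{..<n}. {u. (\<Sum>i\<in>I. u i * v r i) = 0})"
  have cont: "continuous_on UNIV (\<lambda>u::'i \<Rightarrow> real. u i)" for i
    by (rule continuous_on_product_coordinates)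
  have "compactin (product_topology (\<lambda>i. euclidean) UNIV) (PiE UNIV ?K)"
    by (subst compactin_PiE) auto
  then have "compact (PiE UNIV ?K)"
    by (simp add: euclidean_product_topology)
  moreover have "closed {u :: 'i \<Rightarrow> real. (\<Sum>i\<in>I. (u i)\<^sup>2) = 1}"
    by (intro closed_Collect_eq continuous_on_sum continuous_on_power continuous_on_mult
        continuous_on_const cont)
  moreover have "closed (\<Inter>r\<in>{..<n}. {u. (\<Sum>i\<in>I. u i * v r i) = 0})"
    by (intro closed_INT ballI closed_Collect_eq continuous_on_sum continuous_on_mult
        continuous_on_const cont)
  ultimately have comp: "compact S" unfolding S_def by (intro compact_Int_closed)
  have normalise: "(\<lambda>i. if i \<in> I then w i / sqrt (\<Sum>i\<in>I. (w i)\<^sup>2) else 0) \<in> S"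
    if w: "0 < (\<Sum>i\<in>I. (w i)\<^sup>2)" and orth: "\<And>r. r < n \<Longrightarrow> (\<Sum>i\<in>I. w i * v r i) = 0" for w
  proof -
    let ?c = "\<Sum>i\<in>I. (w i)\<^sup>2"
    have "\<bar>w i\<bar> \<le> sqrt ?c" if "i \<in> I" for i
      by (rule real_le_rsqrt) (use member_le_sum[of i I "\<lambda>i. (w i)\<^sup>2"] that I in auto)
    then have "-1 \<le> w i / sqrt ?c \<and> w i / sqrt ?c \<le> 1" if "i \<in> I" for i
      using that w by (force simp: field_simps abs_le_iff)
    moreover have "(\<Sum>i\<in>I. (w i / sqrt ?c)\<^sup>2) = 1"
      using w by (simp add: power_divide sum_divide_distrib[symmetric] sum_nonneg)
    moreover have "(\<Sum>i\<in>I. w i / sqrt ?c * v r i) = 0" if "r < n" for r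
      using orth[OF that] by (simp add: sum_divide_distrib[symmetric])
    ultimately show ?thesis by (auto simp: S_def)
  qed
  have "(e e0)\<^sup>2 \<le> (\<Sum>i\<in>I. (e i)\<^sup>2)" by (rule member_le_sum) (use I e in auto)
  then have "0 < (\<Sum>i\<in>I. (e i)\<^sup>2)" using e by (smt (verit) zero_less_power2)
  then have "S \<noteq> {}" using normalise[of e] e(3) by blast
  moreover have "continuous_on S ?B"
    by (rule continuous_on_subset[OF _ subset_UNIV])
       (intro continuous_on_sum continuous_on_mult continuous_on_const cont)
  ultimately obtain u where u: "u \<in> S" and max: "\<And>y. y \<in> S \<Longrightarrow> ?B y \<le> ?B u"
    using continuous_attains_sup[OF comp] by blast
  have "?B w \<le> ?B u * (\<Sum>i\<in>I. (w i)\<^sup>2)" if orth: "\<And>r. r < n \<Longrightarrow> (\<Sum>i\<in>I. w i * v r i) = 0" for w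
  proof (cases "(\<Sum>i\<in>I. (w i)\<^sup>2) = 0")
    case True
    then have "\<forall>i\<in>I. w i = 0" using I by (simp add: sum_nonneg_eq_0_iff)
    then show ?thesis using True by simp
  next
    case False
    then have pos: "0 < (\<Sum>i\<in>I. (w i)\<^sup>2)" by (simp add: order_less_le sum_nonneg)
    let ?c = "\<Sum>i\<in>I. (w i)\<^sup>2"
    have "?B (\<lambda>i. if i \<in> I then w i / sqrt ?c else 0) = (\<Sum>i\<in>I. \<Sum>k\<in>I. w i * A i k * w k / ?c)"
      using pos by (intro sum.cong refl) (auto simp: field_simps)
    then have "?B w / ?c \<le> ?B u"
      using max[OF normalise[OF pos orth]] by (simp add: sum_divide_distrib)
    then show ?thesis using pos by (simp add: field_simps)
  qed
  then show thesis using that[of u] u by (auto simp: S_def)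
qed

text \<open>An orthonormal family of eigenvectors of maximal size is complete: otherwise the form
  has a maximiser on the unit sphere of the orthogonal complement, and the first-order condition
  makes it one more eigenvector. Completeness is stated as a resolution of the identity, the form in
  which it serves to change coordinates.\<close>

lemma symmetric_form_diagonalisation:
  fixes A :: "'i \<Rightarrow> 'i \<Rightarrow> real"
  assumes I: "finite I" and sym: "\<And>i k. i \<in> I \<Longrightarrow> k \<in> I \<Longrightarrow> A i k = A k i"
  obtains n and v :: "nat \<Rightarrow> 'i \<Rightarrow> real" and \<mu> :: "nat \<Rightarrow> real"
  where "\<And>i k. i \<in> I \<Longrightarrow> k \<in> I \<Longrightarrow> (\<Sum>r<n. v r i * v r k) = (if i = k then 1 else 0)"
    and "\<And>r r'. r < n \<Longrightarrow> r' < n \<Longrightarrow> (\<Sum>i\<in>I. v r i * v r' i) = (if r = r' then 1 else 0)"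
    and "\<And>r i. r < n \<Longrightarrow> i \<in> I \<Longrightarrow> (\<Sum>k\<in>I. A i k * v r k) = \<mu> r * v r i"
proof -
  define P where "P n v \<mu> \<longleftrightarrow>
     (\<forall>r<n. \<forall>r'<n. (\<Sum>i\<in>I. v r i * v r' i) = (if r = r' then 1 else 0)) \<and>
     (\<forall>r<n. \<forall>i\<in>I. (\<Sum>k\<in>I. A i k * v r k) = \<mu> r * v r i)"
    for n :: nat and v :: "nat \<Rightarrow> 'i \<Rightarrow> real" and \<mu> :: "nat \<Rightarrow> real"
  have bound: "n \<le> card I" if "\<exists>v \<mu>. P n v \<mu>" for n
    using that orthonormal_family_card_le[OF I] unfolding P_def by blast
  have "\<exists>v \<mu>. P 0 v \<mu>" by (simp add: P_def)
  then obtain n where n: "\<exists>v \<mu>. P n v \<mu>" and nmax: "\<And>m. \<exists>v \<mu>. P m v \<mu> \<Longrightarrow> m \<le> n"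
    using Nat.ex_has_greatest_nat[of "\<lambda>n. \<exists>v \<mu>. P n v \<mu>" 0 "card I"] bound by blast
  then obtain v \<mu> where P: "P n v \<mu>" by blast
  then have on: "r < n \<Longrightarrow> r' < n \<Longrightarrow> (\<Sum>i\<in>I. v r i * v r' i) = (if r = r' then 1 else 0)"
    and eig: "r < n \<Longrightarrow> i \<in> I \<Longrightarrow> (\<Sum>k\<in>I. A i k * v r k) = \<mu> r * v r i" for r r' i
    unfolding P_def by auto
  have complete: "(\<Sum>r<n. v r a * v r b) = (if a = b then 1 else 0)" if ab: "a \<in> I" "b \<in> I" for a b
  proof (rule ccontr)
    assume neq: "(\<Sum>r<n. v r a * v r b) \<noteq> (if a = b then 1 else 0)"
    \<comment> \<open>The residual of the unit vector at \<open>a\<close> after projection onto the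
      family; the assumed failure at \<open>b\<close> says that \<open>e b\<close> is
      nonzero.\<close>
    define e where "e k = (if a = k then 1 else 0) - (\<Sum>r<n. v r a * v r k)" for k
    have e_orth: "(\<Sum>i\<in>I. e i * v r i) = 0" if "r < n" for r
    proof -
      have "(\<Sum>i\<in>I. e i * v r i) = (\<Sum>i\<in>I. (if a = i then v r i else 0)) - (\<Sum>i\<in>I. \<Sum>r'<n. v r' a * (v r' i * v r i))"
        unfolding sum_subtractf[symmetric]
        by (intro sum.cong refl) (simp add: e_def left_diff_distrib sum_distrib_right mult.assoc)
      also have "(\<Sum>i\<in>I. \<Sum>r'<n. v r' a * (v r' i * v r i)) = (\<Sum>r'<n. v r' a * (\<Sum>i\<in>I. v r' i * v r i))"
        by (subst sum.swap) (simp add: sum_distrib_left)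
      also have "\<dots> = (\<Sum>r'<n. if r' = r then v r' a else 0)"
        by (intro sum.cong refl) (simp add: on that)
      finally show ?thesis using I ab that by simp
    qed
    obtain u where u1: "(\<Sum>i\<in>I. (u i)\<^sup>2) = 1" and uorth: "\<And>r. r < n \<Longrightarrow> (\<Sum>i\<in>I. u i * v r i) = 0"
      and umax: "\<And>w. (\<And>r. r < n \<Longrightarrow> (\<Sum>i\<in>I. w i * v r i) = 0) \<Longrightarrow>
       (\<Sum>i\<in>I. \<Sum>k\<in>I. w i * A i k * w k) \<le>
       (\<Sum>i\<in>I. \<Sum>k\<in>I. u i * A i k * u k) * (\<Sum>i\<in>I. (w i)\<^sup>2)"
      using quadratic_form_attains_max[OF I ab(2), of e n v A] e_orth neq unfolding e_def
      by (smt (verit, best))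
    define B where "B x y = (\<Sum>i\<in>I. \<Sum>k\<in>I. x i * A i k * y k)" for x y
    have B_sym: "B x y = B y x" for x y
      unfolding B_def by (subst sum.swap) (intro sum.cong refl, use sym in \<open>auto simp: mult_ac\<close>)
    define L where "L = B u u"
    define w where "w i = (\<Sum>k\<in>I. A i k * u k) - L * u i" for i
    have Bw: "B x u = (\<Sum>i\<in>I. x i * w i) + L * (\<Sum>i\<in>I. x i * u i)" for x
      by (simp add: B_def w_def sum_distrib_left right_diff_distrib sum_subtractf algebra_simps)
    have Beig: "B x (v r) = \<mu> r * (\<Sum>i\<in>I. x i * v r i)" if "r < n" for x r
    proof -
      have "B x (v r) = (\<Sum>i\<in>I. x i * (\<Sum>k\<in>I. A i k * v r k))"
        by (simp add: B_def sum_distrib_left mult.assoc)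
      also have "\<dots> = (\<Sum>i\<in>I. \<mu> r * (x i * v r i))"
        by (intro sum.cong refl) (simp add: eig that)
      finally show ?thesis by (simp add: sum_distrib_left)
    qed
    have worth: "(\<Sum>i\<in>I. w i * v r i) = 0" if "r < n" for r
    proof -
      have "B (v r) u = 0" using Beig[OF that, of u] uorth[OF that] B_sym by simp
      then show ?thesis using Bw[of "v r"] uorth[OF that] by (simp add: mult.commute)
    qed
    have wu: "(\<Sum>i\<in>I. u i * w i) = 0"
      using Bw[of u] u1 by (simp add: L_def power2_eq_square)
    have Bwu: "B w u = (\<Sum>i\<in>I. (w i)\<^sup>2)"
      using Bw[of w] wu by (simp add: power2_eq_square mult.commute)
    let ?W = "\<Sum>i\<in>I. (w i)\<^sup>2"
    \<comment> \<open>Along \<open>w\<close> the form grows at first order by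
      \<open>2 * t * ?W\<close>, against a cost of second order in \<open>t\<close>. Comparison with
      the maximum and division by \<open>t\<close> give this inequality, which for small
      \<open>t\<close> forces \<open>?W\<close> to vanish.\<close>
    have ineq: "2 * ?W \<le> t * (L * ?W - B w w)" if t: "0 < t" for t
    proof -
      let ?y = "\<lambda>i. u i + t * w i"
      have "(\<Sum>i\<in>I. ?y i * v r i) = 0" if "r < n" for r
        using uorth[OF that] worth[OF that]
        by (simp add: distrib_right sum.distrib mult.assoc sum_distrib_left[symmetric])
      then have "B ?y ?y \<le> L * (\<Sum>i\<in>I. (?y i)\<^sup>2)"
        using umax[of ?y] by (simp add: B_def L_def)
      moreover have "B ?y ?y = L + t * B u w + t * B w u + t\<^sup>2 * B w w"
        by (simp add: B_def L_def algebra_simps sum.distrib sum_distrib_left power2_eq_square)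
      moreover have "(\<Sum>i\<in>I. (?y i)\<^sup>2) = 1 + t\<^sup>2 * ?W"
      proof -
        have "(\<Sum>i\<in>I. (?y i)\<^sup>2) = (\<Sum>i\<in>I. (u i)\<^sup>2) + 2 * t * (\<Sum>i\<in>I. u i * w i) + t\<^sup>2 * ?W"
          by (simp add: power2_eq_square algebra_simps sum.distrib sum_distrib_left)
        then show ?thesis using u1 wu by simp
      qed
      ultimately have "2 * t * ?W + t\<^sup>2 * B w w \<le> t\<^sup>2 * (L * ?W)"
        using B_sym[of u w] Bwu by (simp add: algebra_simps)
      then have "t * (2 * ?W) \<le> t * (t * (L * ?W - B w w))"
        by (simp add: algebra_simps power2_eq_square)
      then show ?thesis using t by (simp add: mult_le_cancel_left)
    qed
    have "?W \<le> 0"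
    proof (rule ccontr)
      assume "\<not> ?W \<le> 0"
      then have W: "0 < ?W" by simp
      let ?D = "L * ?W - B w w"
      have "0 < ?D" using ineq[of 1] W by simp
      \<comment> \<open>With \<open>t = ?W / ?D\<close> the inequality reads
        \<open>2 * ?W \<le> ?W\<close>.\<close>
      then show False using ineq[of "?W / ?D"] W by simp
    qed
    then have w0: "w i = 0" if "i \<in> I" for i
      using I that sum_nonneg_eq_0_iff[of I "\<lambda>i. (w i)\<^sup>2"] sum_nonneg[of I "\<lambda>i. (w i)\<^sup>2"] by force
    have "P (Suc n) (v(n := u)) (\<mu>(n := L))"
      unfolding P_def
    proof (intro conjI allI impI ballI)
      fix r r' assume "r < Suc n" "r' < Suc n"
      then show "(\<Sum>i\<in>I. (v(n := u)) r i * (v(n := u)) r' i) = (if r = r' then 1 else 0)"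
        using on[of r r'] uorth[of r] uorth[of r'] u1
        by (auto simp: less_Suc_eq power2_eq_square mult.commute)
    next
      fix r i assume "r < Suc n" "i \<in> I"
      then show "(\<Sum>k\<in>I. A i k * (v(n := u)) r k) = (\<mu>(n := L)) r * (v(n := u)) r i"
        using eig[of r i] w0[of i] by (auto simp: less_Suc_eq w_def)
    qed
    then show False using nmax[of "Suc n"] by auto
  qed
  show thesis by (rule that[OF complete on eig])
qed

section \<open>Independence from factorising characteristic functions\<close>

context prob_space
begin

text \<open>Tilting the measure by \<open>V\<close> changes the characteristic function of
  \<open>X\<close> only by the factor \<open>c\<close>, so Levy's uniqueness theorem identifies the
  tilted law. As \<open>V\<close> may be negative, it is first shifted by a constant and normalised
  to a probability density.\<close>

lemma char_swap_indicator_real: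
  fixes X V :: "'a \<Rightarrow> real"
  assumes X[measurable]: "random_variable borel X" and V[measurable]: "random_variable borel V"
    and bound: "\<And>\<omega>. \<bar>V \<omega>\<bar> \<le> K"
    and ch: "\<And>t. expectation (\<lambda>\<omega>. complex_of_real (V \<omega>) * iexp (t * X \<omega>)) =
               complex_of_real c * expectation (\<lambda>\<omega>. iexp (t * X \<omega>))"
    and A[measurable]: "A \<in> sets borel"
  shows "expectation (\<lambda>\<omega>. V \<omega> * indicator A (X \<omega>)) = c * prob (X -` A \<inter> space M)"
proof -
  have intV: "integrable M V"
    by (rule integrable_const_bound[of _ K]) (use bound in auto)
  have "complex_of_real c = complex_of_real (expectation V)"
    using ch[of 0] by (simp add: prob_space)
  then have c: "c = expectation V" using of_real_eq_iff by blast
  have K0: "0 \<le> K" using bound by (meson abs_ge_zero order_trans)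
  have "\<bar>c\<bar> \<le> K"
  proof -
    have "norm (expectation V) \<le> expectation (\<lambda>\<omega>. norm (V \<omega>))" by (rule integral_norm_bound)
    also have "\<dots> \<le> expectation (\<lambda>\<omega>. K)" using intV bound by (intro integral_mono) auto
    finally show ?thesis by (simp add: c prob_space)
  qed
  \<comment> \<open>Larger than the bound by 1, so that \<open>c + L\<close> is positive even if
    \<open>c = - K\<close>.\<close>
  define L where "L = K + 1"
  have cL: "0 < c + L" using \<open>\<bar>c\<bar> \<le> K\<close> by (simp add: L_def)
  define f where "f \<omega> = (V \<omega> + L) / (c + L)" for \<omega>
  have VL: "0 \<le> V \<omega> + L" for \<omega> using bound[of \<omega>] by (simp add: L_def)
  have f0: "0 \<le> f \<omega>" for \<omega> using VL[of \<omega>] cL by (simp add: f_def)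
  have fm[measurable]: "random_variable borel f" unfolding f_def by measurable
  have fint: "integrable M f" unfolding f_def using intV by simp
  have "expectation f = (c + L) / (c + L)"
    unfolding f_def using intV by (simp add: c prob_space)
  then have "expectation f = 1" using cL by simp
  define N where "N = density M (\<lambda>\<omega>. ennreal (f \<omega>))"
  have N: "prob_space N"
    unfolding N_def
    by (rule prob_spaceI)
       (simp add: emeasure_density nn_integral_eq_integral fint f0 \<open>expectation f = 1\<close>
          cong: nn_integral_cong)
  interpret N: prob_space N by fact
  have XN: "X \<in> borel_measurable N" by (simp add: N_def)
  have intiexp: "integrable M (\<lambda>\<omega>. iexp (t * X \<omega>))" for t
    by (rule integrable_const_bound[of _ 1]) auto
  have intViexp: "integrable M (\<lambda>\<omega>. complex_of_real (V \<omega>) * iexp (t * X \<omega>))" for t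
    by (rule integrable_const_bound[of _ K]) (use bound in \<open>auto simp: norm_mult\<close>)
  have "char (distr N borel X) = char (distr M borel X)"
  proof
    fix t
    have "char (distr N borel X) t = (CLINT \<omega>|N. iexp (t * X \<omega>))"
      unfolding char_def by (subst integral_distr) (use XN in auto)
    also have "\<dots> = (CLINT \<omega>|M. f \<omega> *\<^sub>R iexp (t * X \<omega>))"
      unfolding N_def by (subst integral_density) (auto simp: f0)
    also have "\<dots> = (CLINT \<omega>|M. (complex_of_real (V \<omega>) * iexp (t * X \<omega>) + of_real L * iexp (t * X \<omega>)) / of_real (c + L))"
      by (intro Bochner_Integration.integral_cong refl)
         (simp add: f_def scaleR_conv_of_real algebra_simps)
    also have "\<dots> = (of_real c * (CLINT \<omega>|M. iexp (t * X \<omega>)) + of_real L * (CLINT \<omega>|M. iexp (t * X \<omega>))) / of_real (c + L)"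
      using intiexp intViexp by (simp add: ch[simplified])
    also have "\<dots> = (CLINT \<omega>|M. iexp (t * X \<omega>))"
      using cL by (simp flip: of_real_add distrib_right)
    also have "\<dots> = char (distr M borel X) t"
      unfolding char_def by (subst integral_distr) auto
    finally show "char (distr N borel X) t = char (distr M borel X) t" .
  qed
  then have eq: "distr N borel X = distr M borel X"
    by (intro Levy_uniqueness N.real_distribution_distr real_distribution_distr) (use XN in auto)
  have inti: "integrable M (\<lambda>\<omega>. V \<omega> * indicator A (X \<omega>))"
    by (rule integrable_const_bound[of _ K]) (use bound K0 in \<open>auto simp: indicator_def\<close>)
  have intA: "integrable M (\<lambda>\<omega>. indicator A (X \<omega>) :: real)"
    by (rule integrable_const_bound[of _ 1]) (auto simp: indicator_def)
  have PA: "expectation (\<lambda>\<omega>. indicator A (X \<omega>)) = prob (X -` A \<inter> space M)"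
  proof -
    have "expectation (\<lambda>\<omega>. indicator A (X \<omega>) :: real) = expectation (indicator (X -` A \<inter> space M))"
      by (intro Bochner_Integration.integral_cong) (auto simp: indicator_def)
    then show ?thesis by simp
  qed
  have "prob (X -` A \<inter> space M) = measure (distr M borel X) A" by (simp add: measure_distr)
  also have "\<dots> = measure N (X -` A \<inter> space N)" using XN by (simp add: eq[symmetric] measure_distr)
  also have "\<dots> = (LINT \<omega>|N. indicator A (X \<omega>))"
  proof -
    have "(LINT \<omega>|N. indicator A (X \<omega>) :: real) = (LINT \<omega>|N. indicator (X -` A \<inter> space N) \<omega>)"
      by (intro Bochner_Integration.integral_cong) (auto simp: indicator_def)
    then show ?thesis using XN by simp
  qed
  also have "\<dots> = expectation (\<lambda>\<omega>. f \<omega> * indicator A (X \<omega>))"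
    unfolding N_def by (subst integral_density) (auto simp: f0)
  also have "\<dots> = (expectation (\<lambda>\<omega>. V \<omega> * indicator A (X \<omega>)) + L * prob (X -` A \<inter> space M)) / (c + L)"
    using inti intA by (simp add: f_def PA algebra_simps flip: add_divide_distrib)
  finally show ?thesis using cL by (simp add: field_simps)
qed

text \<open>Conjugating the hypothesis at \<open>- t\<close> yields it for \<open>cnj V\<close> with
  \<open>cnj c\<close>. It therefore passes to \<open>Re V\<close> and \<open>Im V\<close>, where
  the real case applies.\<close>

lemma char_swap_indicator:
  fixes X :: "'a \<Rightarrow> real" and V :: "'a \<Rightarrow> complex"
  assumes X[measurable]: "random_variable borel X" and V[measurable]: "random_variable borel V"
    and bound: "\<And>\<omega>. cmod (V \<omega>) \<le> K"
    and ch: "\<And>t. expectation (\<lambda>\<omega>. V \<omega> * iexp (t * X \<omega>)) = c * expectation (\<lambda>\<omega>. iexp (t * X \<omega>))"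
    and A[measurable]: "A \<in> sets borel"
  shows "expectation (\<lambda>\<omega>. V \<omega> * indicator A (X \<omega>)) = c * of_real (prob (X -` A \<inter> space M))"
proof -
  let ?P = "prob (X -` A \<inter> space M)"
  have int: "integrable M (\<lambda>\<omega>. V \<omega> * iexp (t * X \<omega>))" for t
    by (rule integrable_const_bound[of _ K]) (use bound in \<open>auto simp: norm_mult\<close>)
  have [measurable]: "(\<lambda>\<omega>. cnj (V \<omega>)) \<in> borel_measurable M"
    using borel_measurable_continuous_on[OF continuous_on_cnj[OF continuous_on_id] V] by simp
  have ch': "expectation (\<lambda>\<omega>. cnj (V \<omega>) * iexp (t * X \<omega>)) = cnj c * expectation (\<lambda>\<omega>. iexp (t * X \<omega>))" for t
  proof -
    have cnjE: "cnj (expectation (\<lambda>\<omega>. iexp (- t * X \<omega>))) = expectation (\<lambda>\<omega>. iexp (t * X \<omega>))"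
      unfolding Bochner_Integration.integral_cnj[symmetric] by (simp add: exp_cnj)
    have "expectation (\<lambda>\<omega>. cnj (V \<omega>) * iexp (t * X \<omega>)) =
        cnj (expectation (\<lambda>\<omega>. V \<omega> * iexp (- t * X \<omega>)))"
      unfolding Bochner_Integration.integral_cnj[symmetric] by (simp add: exp_cnj)
    also have "\<dots> = cnj c * expectation (\<lambda>\<omega>. iexp (t * X \<omega>))"
      unfolding ch complex_cnj_mult cnjE ..
    finally show ?thesis .
  qed
  have int': "integrable M (\<lambda>\<omega>. cnj (V \<omega>) * iexp (t * X \<omega>))" for t
    by (rule integrable_const_bound[of _ K]) (use bound in \<open>auto simp: norm_mult\<close>)
  have Re: "expectation (\<lambda>\<omega>. Re (V \<omega>) * indicator A (X \<omega>)) = Re c * ?P"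
  proof (rule char_swap_indicator_real[where K = K])
    fix t
    have "expectation (\<lambda>\<omega>. complex_of_real (Re (V \<omega>)) * iexp (t * X \<omega>)) =
       expectation (\<lambda>\<omega>. (V \<omega> * iexp (t * X \<omega>) + cnj (V \<omega>) * iexp (t * X \<omega>)) / 2)"
      by (intro Bochner_Integration.integral_cong refl)
         (simp add: complex_add_cnj flip: distrib_right)
    also have "\<dots> = (c + cnj c) / 2 * expectation (\<lambda>\<omega>. iexp (t * X \<omega>))"
      using int int' by (simp add: ch[simplified] ch'[simplified] algebra_simps add_divide_distrib)
    finally show "expectation (\<lambda>\<omega>. complex_of_real (Re (V \<omega>)) * iexp (t * X \<omega>)) =
       complex_of_real (Re c) * expectation (\<lambda>\<omega>. iexp (t * X \<omega>))" by (simp add: complex_add_cnj)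
  qed (use bound abs_Re_le_cmod order_trans in \<open>auto, blast\<close>)
  have Im: "expectation (\<lambda>\<omega>. Im (V \<omega>) * indicator A (X \<omega>)) = Im c * ?P"
  proof (rule char_swap_indicator_real[where K = K])
    fix t
    have Im_eq: "complex_of_real (Im z) = (z - cnj z) / (2 * \<i>)" for z
      by (simp add: complex_eq_iff Re_divide Im_divide)
    have "expectation (\<lambda>\<omega>. complex_of_real (Im (V \<omega>)) * iexp (t * X \<omega>)) =
       expectation (\<lambda>\<omega>. (V \<omega> * iexp (t * X \<omega>) - cnj (V \<omega>) * iexp (t * X \<omega>)) / (2 * \<i>))"
      by (intro Bochner_Integration.integral_cong refl)
         (simp add: Im_eq left_diff_distrib diff_divide_distrib)
    also have "\<dots> = (c - cnj c) / (2 * \<i>) * expectation (\<lambda>\<omega>. iexp (t * X \<omega>))"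
      using int int' by (simp add: ch[simplified] ch'[simplified] left_diff_distrib diff_divide_distrib)
    finally show "expectation (\<lambda>\<omega>. complex_of_real (Im (V \<omega>)) * iexp (t * X \<omega>)) =
       complex_of_real (Im c) * expectation (\<lambda>\<omega>. iexp (t * X \<omega>))" by (simp only: Im_eq)
  qed (use bound abs_Im_le_cmod order_trans in \<open>auto, blast\<close>)
  have intA: "integrable M (\<lambda>\<omega>. V \<omega> * indicator A (X \<omega>))"
    by (rule integrable_const_bound[of _ K])
       (use bound order_trans[OF norm_ge_zero bound] in \<open>auto simp: indicator_def\<close>)
  have "Re (expectation (\<lambda>\<omega>. V \<omega> * indicator A (X \<omega>))) = expectation (\<lambda>\<omega>. Re (V \<omega>) * indicator A (X \<omega>))"
    by (subst integral_Re[OF intA, symmetric]) (intro Bochner_Integration.integral_cong, auto simp: indicator_def)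
  moreover have "Im (expectation (\<lambda>\<omega>. V \<omega> * indicator A (X \<omega>))) = expectation (\<lambda>\<omega>. Im (V \<omega>) * indicator A (X \<omega>))"
    by (subst integral_Im[OF intA, symmetric]) (intro Bochner_Integration.integral_cong, auto simp: indicator_def)
  ultimately show ?thesis by (simp add: complex_eq_iff Re Im)
qed

text \<open>Exponentials are replaced by indicators one coordinate at a time. In each replacement
  the product over the other coordinates, part indicators and part exponentials, is the bounded
  weight \<open>V\<close> of \<open>char_swap_indicator\<close>; varying the frequency of the one
  remaining coordinate supplies its hypothesis.\<close>

lemma indep_vars_if_char_factorises:
  fixes X :: "'i \<Rightarrow> 'a \<Rightarrow> real"
  assumes I: "finite I" and X[measurable]: "\<And>i. i \<in> I \<Longrightarrow> random_variable borel (X i)"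
    and ch: "\<And>t. expectation (\<lambda>\<omega>. iexp (\<Sum>i\<in>I. t i * X i \<omega>)) =
               (\<Prod>i\<in>I. expectation (\<lambda>\<omega>. iexp (t i * X i \<omega>)))"
  shows "indep_vars (\<lambda>_. borel) X I"
proof (cases "I = {}")
  case False
  let ?Pr = "\<lambda>A i. complex_of_real (prob (X i -` A i \<inter> space M))"
  have hybrid: "expectation (\<lambda>\<omega>. (\<Prod>i\<in>J. indicator (A i) (X i \<omega>)) * (\<Prod>i\<in>I - J. iexp (t i * X i \<omega>))) =
      (\<Prod>i\<in>J. ?Pr A i) * (\<Prod>i\<in>I - J. expectation (\<lambda>\<omega>. iexp (t i * X i \<omega>)))"
    if "J \<subseteq> I" "\<And>i. i \<in> I \<Longrightarrow> A i \<in> sets borel" for J A t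
    using finite_subset[OF that(1) I] that(1)
  proof (induction J arbitrary: t rule: finite_induct)
    case empty
    then show ?case
      using ch[of t] by (simp add: exp_sum[OF I] sum_distrib_left)
  next
    case (insert k J)
    have kI: "k \<in> I" and JI: "J \<subseteq> I" using insert.prems by auto
    note A = that(2)
    let ?R = "I - insert k J"
    have R: "I - J = insert k ?R" using kI insert.hyps by auto
    have finR: "finite ?R" "k \<notin> ?R" using I by auto
    define V where "V \<omega> = (\<Prod>i\<in>J. indicator (A i) (X i \<omega>)) * (\<Prod>i\<in>?R. iexp (t i * X i \<omega>))" for \<omega>
    define c where "c = (\<Prod>i\<in>J. ?Pr A i) * (\<Prod>i\<in>?R. expectation (\<lambda>\<omega>. iexp (t i * X i \<omega>)))"
    have "expectation (\<lambda>\<omega>. V \<omega> * indicator (A k) (X k \<omega>)) = c * ?Pr A k"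
    proof (rule char_swap_indicator[where K = 1])
      have "(\<lambda>\<omega>. \<Prod>i\<in>J. indicator (A i) (X i \<omega>) :: complex) \<in> borel_measurable M"
        using JI A by (intro borel_measurable_prod) (auto intro!: measurable_compose[OF X] borel_measurable_indicator)
      moreover have "(\<lambda>\<omega>. \<Prod>i\<in>?R. iexp (t i * X i \<omega>)) \<in> borel_measurable M"
        by (intro borel_measurable_prod) measurable
      ultimately show "random_variable borel V" unfolding V_def by measurable
      show "cmod (V \<omega>) \<le> 1" for \<omega>
        unfolding V_def norm_mult prod_norm[symmetric]
        by (intro mult_le_one prod_le_1 prod_nonneg) (auto simp: indicator_def)
      fix s
      have "(\<Prod>i\<in>I - J. iexp ((t(k := s)) i * X i \<omega>)) = iexp (s * X k \<omega>) * (\<Prod>i\<in>?R. iexp (t i * X i \<omega>))" for \<omega>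
        unfolding R using finR by (subst prod.insert) (auto intro!: prod.cong)
      moreover have "(\<Prod>i\<in>I - J. expectation (\<lambda>\<omega>. iexp ((t(k := s)) i * X i \<omega>))) =
          expectation (\<lambda>\<omega>. iexp (s * X k \<omega>)) * (\<Prod>i\<in>?R. expectation (\<lambda>\<omega>. iexp (t i * X i \<omega>)))"
        unfolding R using finR by (subst prod.insert) (auto intro!: prod.cong)
      ultimately show "expectation (\<lambda>\<omega>. V \<omega> * iexp (s * X k \<omega>)) = c * expectation (\<lambda>\<omega>. iexp (s * X k \<omega>))"
        using insert.IH[OF JI, of "t(k := s)"] unfolding V_def c_def by (simp add: mult_ac)
    qed (use kI A in auto)
    then show ?case
      using insert.hyps unfolding V_def c_def by (simp add: mult_ac)
  qed
  have "prob (\<Inter>i\<in>I. X i -` A i \<inter> space M) = (\<Prod>i\<in>I. prob (X i -` A i \<inter> space M))"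
    if A: "\<And>i. i \<in> I \<Longrightarrow> A i \<in> sets borel" for A
  proof -
    have "complex_of_real (prob (\<Inter>i\<in>I. X i -` A i \<inter> space M)) =
        expectation (\<lambda>\<omega>. complex_of_real (indicator (\<Inter>i\<in>I. X i -` A i \<inter> space M) \<omega>))"
    proof -
      have "(\<Inter>i\<in>I. X i -` A i \<inter> space M) \<in> sets M"
        using A False I by (intro sets.finite_INT) (auto intro!: measurable_sets[OF X])
      then show ?thesis by (simp add: integral_complex_of_real)
    qed
    also have "\<dots> = expectation (\<lambda>\<omega>. \<Prod>i\<in>I. indicator (A i) (X i \<omega>))"
    proof (intro Bochner_Integration.integral_cong refl)
      fix \<omega> assume w: "\<omega> \<in> space M"
      show "complex_of_real (indicator (\<Inter>i\<in>I. X i -` A i \<inter> space M) \<omega>) = (\<Prod>i\<in>I. indicator (A i) (X i \<omega>))"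
      proof (cases "\<forall>i\<in>I. X i \<omega> \<in> A i")
        case True
        then show ?thesis using w by simp
      next
        case F: False
        then obtain i where "i \<in> I" "X i \<omega> \<notin> A i" by blast
        then have "(\<Prod>i\<in>I. indicator (A i) (X i \<omega>) :: complex) = 0"
          by (intro prod_zero[OF I] bexI[of _ i]) auto
        then show ?thesis using F by (auto simp: indicator_def)
      qed
    qed
    also have "\<dots> = (\<Prod>i\<in>I. ?Pr A i)" using hybrid[of I A] A by simp
    finally show ?thesis by (simp flip: of_real_prod)
  qed
  then show ?thesis
    using False I X
    by (subst indep_vars_finite[where E = "\<lambda>_. sets borel"])
       (auto simp: Int_stable_def sets.sigma_sets_eq[of borel, simplified] Pi_iff sets.space_closed[of borel, simplified])
qed (simp add: indep_vars_def2 indep_sets_def)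

end

section \<open>Moments and characteristic function of a centred squared Gaussian variable\<close>

definition std_normal_cube :: real where
  "std_normal_cube = (LINT x|std_normal_distribution. \<bar>x\<^sup>2 - 1\<bar> ^ 3) / 6"

lemma std_normal_cube_nonneg: "0 \<le> std_normal_cube"
  unfolding std_normal_cube_def by simp

lemma std_normal_centred_square:
  shows "integrable std_normal_distribution (\<lambda>x. (x\<^sup>2 - 1) ^ k)"
    and "integrable std_normal_distribution (\<lambda>x. \<bar>x\<^sup>2 - 1\<bar> ^ k)"
    and "(LINT x|std_normal_distribution. x\<^sup>2 - 1) = 0"
    and "(LINT x|std_normal_distribution. (x\<^sup>2 - 1)\<^sup>2) = 2"
proof -
  interpret Z: real_distribution std_normal_distribution by (rule real_dist_normal_dist)
  note [simp] = integrable_std_normal_distribution_moment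
  show *: "integrable std_normal_distribution (\<lambda>x. (x\<^sup>2 - 1) ^ k)" for k
  proof -
    have "integrable std_normal_distribution (\<lambda>x::real. \<Sum>i\<le>k. of_nat (k choose i) * (x\<^sup>2) ^ i * (-1) ^ (k - i))"
      unfolding power_mult[symmetric] by (intro Bochner_Integration.integrable_sum) simp
    then show ?thesis
      unfolding diff_conv_add_uminus binomial_ring .
  qed
  then show "integrable std_normal_distribution (\<lambda>x. \<bar>x\<^sup>2 - 1\<bar> ^ k)"
    unfolding power_abs[symmetric] by (rule integrable_abs)
  have m2: "(LINT x|std_normal_distribution. x\<^sup>2) = 1"
    using std_normal_distribution_even_moments(1)[of 1] by simp
  have m4: "(LINT x|std_normal_distribution. x^4) = 3"
    using std_normal_distribution_even_moments(1)[of 2] by (simp add: fact_numeral)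
  show "(LINT x|std_normal_distribution. x\<^sup>2 - 1) = 0"
    using Z.prob_space by (simp add: m2)
  have "(LINT x|std_normal_distribution. (x\<^sup>2 - 1)\<^sup>2) = (LINT x|std_normal_distribution. x^4 - 2 * x\<^sup>2 + 1)"
    by (intro Bochner_Integration.integral_cong refl) (simp add: power2_eq_square power4_eq_xxxx algebra_simps)
  also have "\<dots> = 2" using Z.prob_space by (simp add: m2 m4)
  finally show "(LINT x|std_normal_distribution. (x\<^sup>2 - 1)\<^sup>2) = 2" .
qed

text \<open>The centred square has mean 0 and variance 2, so both terms equal
  \<open>1 - y\<^sup>2\<close> up to higher order; \<open>std_normal_cube\<close> is the constant of
  the cubic Taylor remainder. The factor \<open>y\<^sup>2\<close> stays in front because such errors
  are later summed over frequencies whose squares have a fixed sum.\<close>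

lemma char_centred_square_approx:
  "cmod ((CLINT x|std_normal_distribution. iexp (y * (x\<^sup>2 - 1))) - of_real (exp (- y\<^sup>2)))
     \<le> y\<^sup>2 * (\<bar>y\<bar> * std_normal_cube + y\<^sup>2)"
proof -
  interpret Z: real_distribution std_normal_distribution by (rule real_dist_normal_dist)
  note sq = std_normal_centred_square
  let ?X = "\<lambda>x::real. x\<^sup>2 - 1"
  let ?ch = "CLINT x|std_normal_distribution. iexp (y * ?X x)"
  have approx: "cmod (char (distr std_normal_distribution borel ?X) y - (1 - y\<^sup>2 * 2 / 2)) \<le>
      y\<^sup>2 / 6 * (LINT x|std_normal_distribution. min (6 * (?X x)\<^sup>2) (\<bar>y\<bar> * \<bar>?X x\<bar> ^ 3))"
    by (rule Z.char_approx3'[OF _ _ _ _ _ refl]) (use sq(1)[of 1] sq(1)[of 2] sq(3,4) in auto)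
  have "(LINT x|std_normal_distribution. min (6 * (?X x)\<^sup>2) (\<bar>y\<bar> * \<bar>?X x\<bar> ^ 3)) \<le>
      (LINT x|std_normal_distribution. \<bar>y\<bar> * \<bar>?X x\<bar> ^ 3)"
    by (intro integral_mono integrable_min) (use sq(1)[of 2] sq(2)[of 3] in auto)
  also have "\<dots> = 6 * (\<bar>y\<bar> * std_normal_cube)"
    by (simp add: std_normal_cube_def)
  finally have "y\<^sup>2 / 6 * (LINT x|std_normal_distribution. min (6 * (?X x)\<^sup>2) (\<bar>y\<bar> * \<bar>?X x\<bar> ^ 3))
      \<le> y\<^sup>2 / 6 * (6 * (\<bar>y\<bar> * std_normal_cube))"
    by (rule mult_left_mono) simp
  then have 1: "cmod (?ch - of_real (1 - y\<^sup>2)) \<le> y\<^sup>2 * (\<bar>y\<bar> * std_normal_cube)"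
  proof -
    assume a: "y\<^sup>2 / 6 * (LINT x|std_normal_distribution. min (6 * (?X x)\<^sup>2) (\<bar>y\<bar> * \<bar>?X x\<bar> ^ 3))
      \<le> y\<^sup>2 / 6 * (6 * (\<bar>y\<bar> * std_normal_cube))"
    have "char (distr std_normal_distribution borel ?X) y = ?ch"
      unfolding char_def by (subst integral_distr) auto
    moreover have "complex_of_real (1 - y\<^sup>2 * 2 / 2) = of_real (1 - y\<^sup>2)" by simp
    moreover have "y\<^sup>2 / 6 * (6 * (\<bar>y\<bar> * std_normal_cube)) = y\<^sup>2 * (\<bar>y\<bar> * std_normal_cube)" by simp
    ultimately show ?thesis using order_trans[OF approx a] by (simp only:)
  qed
  have "\<bar>exp (- y\<^sup>2) - (1 - y\<^sup>2)\<bar> \<le> y\<^sup>2 * y\<^sup>2"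
  proof -
    have "1 - y\<^sup>2 \<le> exp (- y\<^sup>2)" using exp_ge_add_one_self[of "- y\<^sup>2"] by simp
    moreover have "exp (- y\<^sup>2) \<le> 1 - y\<^sup>2 + y\<^sup>2 * y\<^sup>2"
    proof -
      have "exp (- y\<^sup>2) * (1 + y\<^sup>2) \<le> exp (- y\<^sup>2) * exp (y\<^sup>2)"
        using exp_ge_add_one_self[of "y\<^sup>2"] by (intro mult_left_mono) auto
      also have "\<dots> = 1" by (simp flip: exp_add)
      \<comment> \<open>The product on the right is \<open>1 + y ^ 6\<close>.\<close>
      also have "1 \<le> (1 - y\<^sup>2 + y\<^sup>2 * y\<^sup>2) * (1 + y\<^sup>2)"
        by (simp add: algebra_simps)
      finally show ?thesis
        by (rule mult_right_le_imp_le) (simp add: add_pos_nonneg)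
    qed
    ultimately show ?thesis by (simp add: abs_le_iff)
  qed
  then have 2: "cmod (of_real (1 - y\<^sup>2) - of_real (exp (- y\<^sup>2))) \<le> y\<^sup>2 * y\<^sup>2"
    unfolding of_real_diff[symmetric] norm_of_real by (simp add: abs_minus_commute)
  have "cmod (?ch - of_real (exp (- y\<^sup>2))) \<le> cmod (?ch - of_real (1 - y\<^sup>2)) + cmod (of_real (1 - y\<^sup>2) - of_real (exp (- y\<^sup>2)))"
    using norm_triangle_ineq[of "?ch - of_real (1 - y\<^sup>2)" "of_real (1 - y\<^sup>2) - of_real (exp (- y\<^sup>2))"]
    by (simp only: diff_add_cancel add_diff_eq)
  then show ?thesis using 1 2 by (simp add: algebra_simps)
qed

text \<open>Joint Gaussianity and centring are both encoded in the characteristic function.\<close>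

definition (in prob_space) centred_gaussian :: "'i set \<Rightarrow> ('i \<Rightarrow> 'a \<Rightarrow> real) \<Rightarrow> bool" where
  "centred_gaussian I X \<longleftrightarrow> (\<forall>i\<in>I. random_variable borel (X i) \<and> integrable M (\<lambda>\<omega>. (X i \<omega>)\<^sup>2)) \<and>
     (\<forall>u. expectation (\<lambda>\<omega>. iexp (\<Sum>i\<in>I. u i * X i \<omega>)) =
          of_real (exp (- expectation (\<lambda>\<omega>. (\<Sum>i\<in>I. u i * X i \<omega>)\<^sup>2) / 2)))"

section \<open>Principal components and quadratic forms of a Gaussian vector\<close>

context prob_space
begin

lemma centred_gaussianD:
  assumes "centred_gaussian I X"
  shows "i \<in> I \<Longrightarrow> random_variable borel (X i)" "i \<in> I \<Longrightarrow> integrable M (\<lambda>\<omega>. (X i \<omega>)\<^sup>2)"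
    "expectation (\<lambda>\<omega>. iexp (\<Sum>i\<in>I. u i * X i \<omega>)) =
          of_real (exp (- expectation (\<lambda>\<omega>. (\<Sum>i\<in>I. u i * X i \<omega>)\<^sup>2) / 2))"
proof -
  show "i \<in> I \<Longrightarrow> random_variable borel (X i)" "i \<in> I \<Longrightarrow> integrable M (\<lambda>\<omega>. (X i \<omega>)\<^sup>2)"
    using assms unfolding centred_gaussian_def by blast+
  show "expectation (\<lambda>\<omega>. iexp (\<Sum>i\<in>I. u i * X i \<omega>)) =
          of_real (exp (- expectation (\<lambda>\<omega>. (\<Sum>i\<in>I. u i * X i \<omega>)\<^sup>2) / 2))"
    using assms unfolding centred_gaussian_def by (elim conjE) (erule spec)
qed

lemma integrable_mult_L2:
  fixes X Y :: "'a \<Rightarrow> real"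
  assumes [measurable]: "random_variable borel X" "random_variable borel Y"
    and "integrable M (\<lambda>\<omega>. (X \<omega>)\<^sup>2)" "integrable M (\<lambda>\<omega>. (Y \<omega>)\<^sup>2)"
  shows "integrable M (\<lambda>\<omega>. X \<omega> * Y \<omega>)"
proof (rule Bochner_Integration.integrable_bound)
  show "integrable M (\<lambda>\<omega>. (X \<omega>)\<^sup>2 + (Y \<omega>)\<^sup>2)" using assms by simp
  show "AE \<omega> in M. norm (X \<omega> * Y \<omega>) \<le> norm ((X \<omega>)\<^sup>2 + (Y \<omega>)\<^sup>2)"
  proof (rule AE_I2)
    fix \<omega>
    have "2 * (\<bar>X \<omega>\<bar> * \<bar>Y \<omega>\<bar>) \<le> (X \<omega>)\<^sup>2 + (Y \<omega>)\<^sup>2"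
      using sum_squares_bound[of "\<bar>X \<omega>\<bar>" "\<bar>Y \<omega>\<bar>"] by simp
    then show "norm (X \<omega> * Y \<omega>) \<le> norm ((X \<omega>)\<^sup>2 + (Y \<omega>)\<^sup>2)"
      using mult_nonneg_nonneg[OF abs_ge_zero[of "X \<omega>"] abs_ge_zero[of "Y \<omega>"]]
      unfolding real_norm_def abs_mult by linarith
  qed
qed measurable

text \<open>In an orthonormal eigenbasis of the covariance matrix the coordinates are uncorrelated,
  and the Gaussian joint characteristic function turns this into independence. The laws are given as
  scaled images of the standard normal law because eigenvalues may vanish. The last conclusion
  bounds the Hilbert-Schmidt norm of the covariance from below by its diagonal, so that variances
  alone control it.\<close>

lemma centred_gaussian_principal_components:
  fixes X :: "'i \<Rightarrow> 'a \<Rightarrow> real"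
  assumes I: "finite I" and X: "centred_gaussian I X"
    and op: "\<And>u. expectation (\<lambda>\<omega>. (\<Sum>i\<in>I. u i * X i \<omega>)\<^sup>2) \<le> \<nu> * (\<Sum>i\<in>I. (u i)\<^sup>2)"
  obtains n :: nat and g :: "nat \<Rightarrow> 'a \<Rightarrow> real" and \<mu> :: "nat \<Rightarrow> real"
  where "indep_vars (\<lambda>_. borel) g {..<n}"
    and "\<And>r. r < n \<Longrightarrow> distr M borel (g r) = distr std_normal_distribution borel (\<lambda>x. sqrt (\<mu> r) * x)"
    and "\<And>r. r < n \<Longrightarrow> 0 \<le> \<mu> r" "\<And>r. r < n \<Longrightarrow> \<mu> r \<le> \<nu>"
    and "\<And>\<omega>. (\<Sum>i\<in>I. (X i \<omega>)\<^sup>2) = (\<Sum>r<n. (g r \<omega>)\<^sup>2)"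
    and "(\<Sum>i\<in>I. (expectation (\<lambda>\<omega>. (X i \<omega>)\<^sup>2))\<^sup>2) \<le> (\<Sum>r<n. (\<mu> r)\<^sup>2)"
proof -
  note Xm[measurable] = centred_gaussianD(1)[OF X] and X2 = centred_gaussianD(2)[OF X]
    and ch = centred_gaussianD(3)[OF X]
  define A where "A i k = expectation (\<lambda>\<omega>. X i \<omega> * X k \<omega>)" for i k
  have XX: "integrable M (\<lambda>\<omega>. X i \<omega> * X k \<omega>)" if "i \<in> I" "k \<in> I" for i k
    using that by (intro integrable_mult_L2 Xm X2)
  have sym: "A i k = A k i" for i k by (simp add: A_def mult.commute)
  obtain n and v :: "nat \<Rightarrow> 'i \<Rightarrow> real" and \<mu>
    where complete: "\<And>i k. i \<in> I \<Longrightarrow> k \<in> I \<Longrightarrow> (\<Sum>r<n. v r i * v r k) = (if i = k then 1 else 0)"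
    and on: "\<And>r r'. r < n \<Longrightarrow> r' < n \<Longrightarrow> (\<Sum>i\<in>I. v r i * v r' i) = (if r = r' then 1 else 0)"
    and eig: "\<And>r i. r < n \<Longrightarrow> i \<in> I \<Longrightarrow> (\<Sum>k\<in>I. A i k * v r k) = \<mu> r * v r i"
    by (rule symmetric_form_diagonalisation[of I A, OF I sym]) (rule that)
  define g where "g r \<omega> = (\<Sum>i\<in>I. v r i * X i \<omega>)" for r \<omega>
  have gm[measurable]: "random_variable borel (g r)" for r
    unfolding g_def by measurable
  have gg_eq: "g r \<omega> * g r' \<omega> = (\<Sum>i\<in>I. \<Sum>k\<in>I. v r i * v r' k * (X i \<omega> * X k \<omega>))" for r r' \<omega>
    unfolding g_def sum_product by (intro sum.cong refl) (simp add: mult_ac)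
  have gg: "integrable M (\<lambda>\<omega>. g r \<omega> * g r' \<omega>)" for r r'
    unfolding gg_eq using XX by simp
  have Egg: "expectation (\<lambda>\<omega>. g r \<omega> * g r' \<omega>) = (if r = r' then \<mu> r else 0)"
    if "r < n" "r' < n" for r r'
  proof -
    have "expectation (\<lambda>\<omega>. g r \<omega> * g r' \<omega>) = (\<Sum>i\<in>I. \<Sum>k\<in>I. v r i * v r' k * A i k)"
      unfolding gg_eq using XX by (simp add: A_def)
    also have "\<dots> = (\<Sum>i\<in>I. v r i * (\<Sum>k\<in>I. A i k * v r' k))"
      by (simp add: sum_distrib_left mult_ac)
    also have "\<dots> = (\<Sum>i\<in>I. \<mu> r' * (v r i * v r' i))"
      by (intro sum.cong refl) (simp add: eig that)
    also have "\<dots> = (if r = r' then \<mu> r else 0)"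
      using on[OF that] by (simp flip: sum_distrib_left)
    finally show ?thesis .
  qed
  have lin: "(\<Sum>r<n. t r * g r \<omega>) = (\<Sum>i\<in>I. (\<Sum>r<n. t r * v r i) * X i \<omega>)" for t \<omega>
    unfolding g_def sum_distrib_left sum_distrib_right
    by (subst sum.swap) (simp add: mult.assoc)
  have Elin: "expectation (\<lambda>\<omega>. (\<Sum>r<n. t r * g r \<omega>)\<^sup>2) = (\<Sum>r<n. (t r)\<^sup>2 * \<mu> r)" for t
  proof -
    have "expectation (\<lambda>\<omega>. (\<Sum>r<n. t r * g r \<omega>)\<^sup>2) =
        expectation (\<lambda>\<omega>. \<Sum>r<n. \<Sum>r'<n. t r * t r' * (g r \<omega> * g r' \<omega>))"
      by (simp add: power2_eq_square sum_product mult_ac)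
    also have "\<dots> = (\<Sum>r<n. \<Sum>r'<n. t r * t r' * expectation (\<lambda>\<omega>. g r \<omega> * g r' \<omega>))"
      using gg by simp
    also have "\<dots> = (\<Sum>r<n. \<Sum>r'<n. if r = r' then t r * t r' * \<mu> r else 0)"
      by (intro sum.cong refl) (simp add: Egg)
    also have "\<dots> = (\<Sum>r<n. (t r)\<^sup>2 * \<mu> r)" by (simp add: power2_eq_square)
    finally show ?thesis .
  qed
  \<comment> \<open>By \<open>lin\<close> a combination of the \<open>g r\<close> is one of the
    \<open>X i\<close>, so Gaussianity passes to the rotated coordinates; the absence of cross terms
    in \<open>Elin\<close> makes the exponent a sum over \<open>r\<close>.\<close>
  have jch: "expectation (\<lambda>\<omega>. iexp (\<Sum>r<n. t r * g r \<omega>)) = of_real (exp (- (\<Sum>r<n. (t r)\<^sup>2 * \<mu> r) / 2))" for t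
    using ch[of "\<lambda>i. \<Sum>r<n. t r * v r i"] unfolding lin[symmetric] Elin .
  have ch1: "expectation (\<lambda>\<omega>. iexp (t * g r \<omega>)) = of_real (exp (- (t\<^sup>2 * \<mu> r) / 2))" if "r < n" for r t
  proof -
    have "(\<Sum>r'<n. (if r' = r then t else 0) * g r' \<omega>) = t * g r \<omega>" for \<omega>
      using that by (simp add: if_distrib[of "\<lambda>x. x * _"] cong: if_cong)
    moreover have "(\<Sum>r'<n. (if r' = r then t else 0)\<^sup>2 * \<mu> r') = t\<^sup>2 * \<mu> r"
      using that by (simp add: if_distrib[of "\<lambda>x. x\<^sup>2 * _"] cong: if_cong)
    ultimately show ?thesis using jch[of "\<lambda>r'. if r' = r then t else 0"] by (simp only:)
  qed
  have indep: "indep_vars (\<lambda>_. borel) g {..<n}"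
  proof (rule indep_vars_if_char_factorises)
    fix t :: "nat \<Rightarrow> real"
    have "expectation (\<lambda>\<omega>. iexp (\<Sum>r<n. t r * g r \<omega>)) = of_real (\<Prod>r<n. exp (- ((t r)\<^sup>2 * \<mu> r) / 2))"
      unfolding jch by (simp add: exp_sum sum_negf flip: sum_divide_distrib exp_sum)
    also have "\<dots> = (\<Prod>r<n. expectation (\<lambda>\<omega>. iexp (t r * g r \<omega>)))"
      unfolding of_real_prod by (intro prod.cong refl) (simp only: ch1 lessThan_iff)
    finally show "expectation (\<lambda>\<omega>. iexp (\<Sum>r<n. t r * g r \<omega>)) =
        (\<Prod>r<n. expectation (\<lambda>\<omega>. iexp (t r * g r \<omega>)))" .
  qed auto
  have mu0: "0 \<le> \<mu> r" if "r < n" for r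
  proof -
    have "0 \<le> expectation (\<lambda>\<omega>. g r \<omega> * g r \<omega>)" by (rule Bochner_Integration.integral_nonneg) simp
    then show ?thesis using Egg[OF that that] by simp
  qed
  \<comment> \<open>\<open>\<mu> r\<close> is the variance in the unit direction \<open>v r\<close>,
    to which the operator bound applies.\<close>
  have mule: "\<mu> r \<le> \<nu>" if "r < n" for r
    using op[of "v r"] Egg[OF that that] on[OF that that] by (simp add: g_def power2_eq_square)
  have distr: "distr M borel (g r) = distr std_normal_distribution borel (\<lambda>x. sqrt (\<mu> r) * x)" if "r < n" for r
  proof (rule Levy_uniqueness)
    interpret Z: real_distribution std_normal_distribution by (rule real_dist_normal_dist)
    show "real_distribution (distr M borel (g r))" by (intro real_distribution_distr gm)
    show "real_distribution (distr std_normal_distribution borel (\<lambda>x. sqrt (\<mu> r) * x))"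
      by (intro Z.real_distribution_distr) simp
    show "char (distr M borel (g r)) = char (distr std_normal_distribution borel (\<lambda>x. sqrt (\<mu> r) * x))"
    proof
      fix t
      have "char (distr M borel (g r)) t = of_real (exp (- (t\<^sup>2 * \<mu> r) / 2))"
        unfolding char_def using ch1[OF that, of t] by (subst integral_distr) auto
      also have "\<dots> = char std_normal_distribution (t * sqrt (\<mu> r))"
        using mu0[OF that] by (simp add: char_std_normal_distribution power_mult_distrib)
      also have "\<dots> = char (distr std_normal_distribution borel (\<lambda>x. sqrt (\<mu> r) * x)) t"
        unfolding char_def by (subst integral_distr) (auto simp: mult.assoc)
      finally show "char (distr M borel (g r)) t = char (distr std_normal_distribution borel (\<lambda>x. sqrt (\<mu> r) * x)) t" .
    qed
  qed
  have Xg: "X i \<omega> = (\<Sum>r<n. v r i * g r \<omega>)" if "i \<in> I" for i \<omega>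
  proof -
    have "(\<Sum>r<n. v r i * g r \<omega>) = (\<Sum>k\<in>I. (\<Sum>r<n. v r i * v r k) * X k \<omega>)"
      by (rule lin)
    also have "\<dots> = (\<Sum>k\<in>I. if i = k then X k \<omega> else 0)"
      by (intro sum.cong refl) (simp add: complete that)
    finally show ?thesis using I that by simp
  qed
  have Q: "(\<Sum>i\<in>I. (X i \<omega>)\<^sup>2) = (\<Sum>r<n. (g r \<omega>)\<^sup>2)" for \<omega>
  proof -
    have "(\<Sum>i\<in>I. (X i \<omega>)\<^sup>2) = (\<Sum>i\<in>I. X i \<omega> * (\<Sum>r<n. v r i * g r \<omega>))"
      by (intro sum.cong refl) (simp add: Xg power2_eq_square)
    also have "\<dots> = (\<Sum>r<n. g r \<omega> * (\<Sum>i\<in>I. v r i * X i \<omega>))"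
      unfolding sum_distrib_left by (subst sum.swap) (simp add: mult_ac)
    finally show ?thesis by (simp add: g_def[symmetric] power2_eq_square)
  qed
  have "(\<Sum>i\<in>I. (expectation (\<lambda>\<omega>. (X i \<omega>)\<^sup>2))\<^sup>2) \<le> (\<Sum>i\<in>I. \<Sum>r<n. (\<mu> r)\<^sup>2 * (v r i)\<^sup>2)"
  proof (rule sum_mono)
    fix i assume i: "i \<in> I"
    have "expectation (\<lambda>\<omega>. (X i \<omega>)\<^sup>2) = (\<Sum>r<n. (\<mu> r * v r i) * v r i)"
      using Elin[of "\<lambda>r. v r i"] Xg[OF i] by (simp add: power2_eq_square mult_ac)
    \<comment> \<open>A diagonal entry is an average of the eigenvalues with the weights
      \<open>(v r i)\<^sup>2\<close>, which sum to 1; its square is at most the average of the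
      squared eigenvalues.\<close>
    also have "\<dots>\<^sup>2 \<le> (\<Sum>r<n. (\<mu> r * v r i)\<^sup>2) * (\<Sum>r<n. (v r i)\<^sup>2)"
      by (rule Cauchy_Schwarz_ineq_sum)
    also have "(\<Sum>r<n. (v r i)\<^sup>2) = 1" using complete[OF i i] by (simp add: power2_eq_square)
    finally show "(expectation (\<lambda>\<omega>. (X i \<omega>)\<^sup>2))\<^sup>2 \<le> (\<Sum>r<n. (\<mu> r)\<^sup>2 * (v r i)\<^sup>2)"
      by (simp add: power_mult_distrib)
  qed
  also have "\<dots> = (\<Sum>r<n. (\<mu> r)\<^sup>2 * (\<Sum>i\<in>I. v r i * v r i))"
    unfolding sum_distrib_left by (subst sum.swap) (simp add: power2_eq_square)
  also have "\<dots> = (\<Sum>r<n. (\<mu> r)\<^sup>2)" by (intro sum.cong refl) (simp add: on)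
  finally have T: "(\<Sum>i\<in>I. (expectation (\<lambda>\<omega>. (X i \<omega>)\<^sup>2))\<^sup>2) \<le> (\<Sum>r<n. (\<mu> r)\<^sup>2)" .
  show thesis
    by (rule that, rule indep, erule distr, erule mu0, erule mule, rule Q, rule T)
qed

text \<open>The centred form is a sum of independent centred squares with weights
  \<open>\<mu> r\<close>. The factors of its characteristic function are compared one by one with
  Gaussian ones: the squared frequencies have a fixed sum while each frequency is at most
  \<open>\<bar>t\<bar> * \<nu> / sqrt (2 * T)\<close>, which is a quantitative Lindeberg
  bound.\<close>

lemma gaussian_quadratic_form_char:
  fixes X :: "'i \<Rightarrow> 'a \<Rightarrow> real"
  assumes I: "finite I" and X: "centred_gaussian I X"
    and op: "\<And>u. expectation (\<lambda>\<omega>. (\<Sum>i\<in>I. u i * X i \<omega>)\<^sup>2) \<le> \<nu> * (\<Sum>i\<in>I. (u i)\<^sup>2)"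
  defines "Q \<equiv> \<lambda>\<omega>. \<Sum>i\<in>I. (X i \<omega>)\<^sup>2"
    and "T \<equiv> \<Sum>i\<in>I. (expectation (\<lambda>\<omega>. (X i \<omega>)\<^sup>2))\<^sup>2"
  assumes T: "0 < T"
  shows "2 * T \<le> variance Q" (is ?var)
    and "cmod (expectation (\<lambda>\<omega>. iexp (t * ((Q \<omega> - expectation Q) / sqrt (variance Q)))) - of_real (exp (- t\<^sup>2 / 2)))
      \<le> t\<^sup>2 / 2 * (\<bar>t\<bar> * \<nu> / sqrt (2 * T) * std_normal_cube + (\<bar>t\<bar> * \<nu> / sqrt (2 * T))\<^sup>2)" (is ?char)
proof -
  obtain n :: nat and g :: "nat \<Rightarrow> 'a \<Rightarrow> real" and \<mu> :: "nat \<Rightarrow> real"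
  where indep: "indep_vars (\<lambda>_. borel) g {..<n}"
    and distr: "\<And>r. r < n \<Longrightarrow> distr M borel (g r) = distr std_normal_distribution borel (\<lambda>x. sqrt (\<mu> r) * x)"
    and mu0: "\<And>r. r < n \<Longrightarrow> 0 \<le> \<mu> r" and mule: "\<And>r. r < n \<Longrightarrow> \<mu> r \<le> \<nu>"
    and Q: "\<And>\<omega>. (\<Sum>i\<in>I. (X i \<omega>)\<^sup>2) = (\<Sum>r<n. (g r \<omega>)\<^sup>2)"
    and Tle: "(\<Sum>i\<in>I. (expectation (\<lambda>\<omega>. (X i \<omega>)\<^sup>2))\<^sup>2) \<le> (\<Sum>r<n. (\<mu> r)\<^sup>2)"
    by (rule centred_gaussian_principal_components[OF I X op]) (rule that)
  have gm[measurable]: "r < n \<Longrightarrow> random_variable borel (g r)" for r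
    using indep unfolding indep_vars_def by auto
  interpret Z: real_distribution std_normal_distribution by (rule real_dist_normal_dist)
  have transfer: "expectation (\<lambda>\<omega>. f (g r \<omega>)) = (LINT x|std_normal_distribution. f (sqrt (\<mu> r) * x))"
    and transfer_int: "integrable M (\<lambda>\<omega>. f (g r \<omega>)) \<longleftrightarrow> integrable std_normal_distribution (\<lambda>x. f (sqrt (\<mu> r) * x))"
    if "r < n" and [measurable]: "f \<in> borel_measurable borel" for r and f :: "real \<Rightarrow> 'b::{banach, second_countable_topology}"
  proof -
    show "expectation (\<lambda>\<omega>. f (g r \<omega>)) = (LINT x|std_normal_distribution. f (sqrt (\<mu> r) * x))"
      using integral_distr[OF gm[OF that(1)] that(2)]
        integral_distr[of "\<lambda>x. sqrt (\<mu> r) * x" std_normal_distribution borel f]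
      by (simp add: distr[OF that(1)])
    show "integrable M (\<lambda>\<omega>. f (g r \<omega>)) \<longleftrightarrow> integrable std_normal_distribution (\<lambda>x. f (sqrt (\<mu> r) * x))"
      using integrable_distr_eq[OF gm[OF that(1)] that(2)]
        integrable_distr_eq[of "\<lambda>x. sqrt (\<mu> r) * x" std_normal_distribution borel f]
      by (simp add: distr[OF that(1)])
  qed
  define Y where "Y r \<omega> = (g r \<omega>)\<^sup>2 - \<mu> r" for r \<omega>
  have scaled: "(sqrt (\<mu> r) * x)\<^sup>2 - \<mu> r = \<mu> r * (x\<^sup>2 - 1)" if "r < n" for r x
    using mu0[OF that] by (simp add: power_mult_distrib algebra_simps)
  note sq = std_normal_centred_square
  have Yint: "integrable M (Y r)" and Y2int: "integrable M (\<lambda>\<omega>. (Y r \<omega>)\<^sup>2)"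
    and EY: "expectation (Y r) = 0" and EY2: "expectation (\<lambda>\<omega>. (Y r \<omega>)\<^sup>2) = 2 * (\<mu> r)\<^sup>2" if r: "r < n" for r
  proof -
    note tr = transfer[OF r, of "\<lambda>x. x\<^sup>2 - \<mu> r", unfolded scaled[OF r]]
      transfer_int[OF r, of "\<lambda>x. x\<^sup>2 - \<mu> r", unfolded scaled[OF r]]
    note tr2 = transfer[OF r, of "\<lambda>x. (x\<^sup>2 - \<mu> r)\<^sup>2", unfolded scaled[OF r], unfolded power_mult_distrib]
      transfer_int[OF r, of "\<lambda>x. (x\<^sup>2 - \<mu> r)\<^sup>2", unfolded scaled[OF r], unfolded power_mult_distrib]
    show "integrable M (Y r)" using tr sq(1)[of 1] unfolding Y_def by simp
    show "expectation (Y r) = 0" using tr sq(3) unfolding Y_def by simp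
    show "integrable M (\<lambda>\<omega>. (Y r \<omega>)\<^sup>2)" using tr2 sq(1)[of 2] unfolding Y_def by simp
    show "expectation (\<lambda>\<omega>. (Y r \<omega>)\<^sup>2) = 2 * (\<mu> r)\<^sup>2" using tr2 sq(4) unfolding Y_def by simp
  qed
  have indepY: "indep_vars (\<lambda>_. borel) Y {..<n}"
    unfolding Y_def by (rule indep_vars_compose2[OF indep, of "\<lambda>r x. x\<^sup>2 - \<mu> r"]) auto
  have Ym[measurable]: "r < n \<Longrightarrow> random_variable borel (Y r)" for r
    using indepY unfolding indep_vars_def by auto
  have EYY: "expectation (\<lambda>\<omega>. Y r \<omega> * Y r' \<omega>) = (if r = r' then 2 * (\<mu> r)\<^sup>2 else 0)"
    if "r < n" "r' < n" for r r'
  proof (cases "r = r'")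
    case True
    then show ?thesis using EY2[OF that(1)] by (simp add: power2_eq_square)
  next
    case False
    have "indep_vars (\<lambda>_. borel) Y {r, r'}" by (rule indep_vars_subset[OF indepY]) (use that in auto)
    then have "expectation (\<lambda>\<omega>. \<Prod>i\<in>{r, r'}. Y i \<omega>) = (\<Prod>i\<in>{r, r'}. expectation (Y i))"
      by (intro indep_vars_lebesgue_integral) (use that Yint in auto)
    then show ?thesis using False EY that by simp
  qed
  have YY: "integrable M (\<lambda>\<omega>. Y r \<omega> * Y r' \<omega>)" if "r < n" "r' < n" for r r'
    using that by (intro integrable_mult_L2 Ym Y2int)
  have QY: "Q \<omega> = (\<Sum>r<n. Y r \<omega>) + (\<Sum>r<n. \<mu> r)" for \<omega>
    by (simp add: Q_def Q Y_def sum_subtractf)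
  have EQ: "expectation Q = (\<Sum>r<n. \<mu> r)"
  proof -
    have "expectation Q = expectation (\<lambda>\<omega>. \<Sum>r<n. Y r \<omega>) + expectation (\<lambda>_. \<Sum>r<n. \<mu> r)"
      unfolding QY[abs_def] by (intro Bochner_Integration.integral_add Bochner_Integration.integrable_sum) (auto intro: Yint)
    also have "expectation (\<lambda>\<omega>. \<Sum>r<n. Y r \<omega>) = (\<Sum>r<n. expectation (Y r))"
      by (rule Bochner_Integration.integral_sum) (simp add: Yint)
    finally show ?thesis by (simp add: EY prob_space)
  qed
  have QEQ: "Q \<omega> - expectation Q = (\<Sum>r<n. Y r \<omega>)" for \<omega>
    by (simp add: EQ QY)
  define V where "V = variance Q"
  have V: "V = 2 * (\<Sum>r<n. (\<mu> r)\<^sup>2)"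
  proof -
    have "V = expectation (\<lambda>\<omega>. \<Sum>r<n. \<Sum>r'<n. Y r \<omega> * Y r' \<omega>)"
      unfolding V_def QEQ by (simp add: power2_eq_square sum_product)
    also have "\<dots> = (\<Sum>r<n. \<Sum>r'<n. expectation (\<lambda>\<omega>. Y r \<omega> * Y r' \<omega>))"
      by (subst Bochner_Integration.integral_sum, force intro: YY, intro sum.cong refl,
          subst Bochner_Integration.integral_sum) (auto intro: YY)
    also have "\<dots> = (\<Sum>r<n. \<Sum>r'<n. if r = r' then 2 * (\<mu> r)\<^sup>2 else 0)"
      by (intro sum.cong refl) (simp add: EYY)
    finally show ?thesis by (simp add: sum_distrib_left)
  qed
  show var: ?var using Tle unfolding V_def[symmetric] V T_def by simp
  have Vpos: "0 < V" using var T unfolding V_def by linarith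
  \<comment> \<open>The frequency at which the centred square number \<open>r\<close> is evaluated.
    The variance is twice the sum of the \<open>(\<mu> r)\<^sup>2\<close>, so the squares of the
    \<open>y r\<close> add up to \<open>t\<^sup>2 / 2\<close>, the exponent of the limit.\<close>
  define y where "y r = t * \<mu> r / sqrt V" for r
  have y2: "(\<Sum>r<n. (y r)\<^sup>2) = t\<^sup>2 / 2"
    using Vpos V by (simp add: y_def power_divide power_mult_distrib flip: sum_divide_distrib sum_distrib_left)
  define m where "m = \<bar>t\<bar> * \<nu> / sqrt (2 * T)"
  have ym: "\<bar>y r\<bar> \<le> m" if "r < n" for r
  proof -
    have "\<bar>y r\<bar> = \<bar>t\<bar> * \<mu> r / sqrt V" using mu0[OF that] Vpos by (simp add: y_def abs_mult)
    also have "\<dots> \<le> \<bar>t\<bar> * \<nu> / sqrt (2 * T)"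
      using mule[OF that] mu0[OF that] var T unfolding V_def[symmetric]
      by (intro frac_le mult_left_mono) auto
    finally show ?thesis by (simp add: m_def)
  qed
  have "expectation (\<lambda>\<omega>. iexp (t * ((Q \<omega> - expectation Q) / sqrt V))) =
      expectation (\<lambda>\<omega>. \<Prod>r<n. iexp (t / sqrt V * Y r \<omega>))"
    unfolding QEQ by (simp add: exp_sum sum_distrib_left sum_divide_distrib)
  also have "\<dots> = (\<Prod>r<n. expectation (\<lambda>\<omega>. iexp (t / sqrt V * Y r \<omega>)))"
  proof (rule indep_vars_lebesgue_integral)
    show "indep_vars (\<lambda>_. borel) (\<lambda>r \<omega>. iexp (t / sqrt V * Y r \<omega>)) {..<n}"
      by (rule indep_vars_compose2[OF indepY, of "\<lambda>_ x. iexp (t / sqrt V * x)"]) auto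
    show "integrable M (\<lambda>\<omega>. iexp (t / sqrt V * Y r \<omega>))" if "r \<in> {..<n}" for r
      by (rule integrable_const_bound[of _ 1]) (use that in auto)
  qed simp
  also have "\<dots> = (\<Prod>r<n. CLINT x|std_normal_distribution. iexp (y r * (x\<^sup>2 - 1)))"
  proof (intro prod.cong refl)
    fix r assume "r \<in> {..<n}"
    then have r: "r < n" by simp
    have "expectation (\<lambda>\<omega>. iexp (t / sqrt V * Y r \<omega>)) =
        (CLINT x|std_normal_distribution. iexp (t / sqrt V * ((sqrt (\<mu> r) * x)\<^sup>2 - \<mu> r)))"
      unfolding Y_def by (rule transfer[OF r]) measurable
    then show "expectation (\<lambda>\<omega>. iexp (t / sqrt V * Y r \<omega>)) =
        (CLINT x|std_normal_distribution. iexp (y r * (x\<^sup>2 - 1)))"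
      unfolding scaled[OF r] by (simp add: y_def mult_ac)
  qed
  finally have *: "expectation (\<lambda>\<omega>. iexp (t * ((Q \<omega> - expectation Q) / sqrt V))) =
      (\<Prod>r<n. CLINT x|std_normal_distribution. iexp (y r * (x\<^sup>2 - 1)))" .
  have e: "complex_of_real (exp (- t\<^sup>2 / 2)) = (\<Prod>r<n. of_real (exp (- (y r)\<^sup>2)))"
    using y2 by (simp add: sum_negf flip: of_real_prod exp_sum)
  have "cmod (expectation (\<lambda>\<omega>. iexp (t * ((Q \<omega> - expectation Q) / sqrt V))) - of_real (exp (- t\<^sup>2 / 2)))
      \<le> (\<Sum>r<n. cmod ((CLINT x|std_normal_distribution. iexp (y r * (x\<^sup>2 - 1))) - of_real (exp (- (y r)\<^sup>2))))"
    unfolding * e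
  proof (rule norm_prod_diff)
    fix r
    have "cmod (CLINT x|std_normal_distribution. iexp (y r * (x\<^sup>2 - 1))) \<le>
        (LINT x|std_normal_distribution. cmod (iexp (y r * (x\<^sup>2 - 1))))" by (rule integral_norm_bound)
    also have "\<dots> = 1" using Z.prob_space by (simp del: of_real_mult of_real_diff of_real_power)
    finally show "cmod (CLINT x|std_normal_distribution. iexp (y r * (x\<^sup>2 - 1))) \<le> 1" .
  qed simp
  also have "\<dots> \<le> (\<Sum>r<n. (y r)\<^sup>2 * (m * std_normal_cube + m\<^sup>2))"
  proof (rule sum_mono)
    fix r assume "r \<in> {..<n}"
    then have r: "\<bar>y r\<bar> \<le> m" using ym by simp
    then have "(y r)\<^sup>2 \<le> m\<^sup>2" by (simp add: abs_le_square_iff[symmetric])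
    then have "(y r)\<^sup>2 * (\<bar>y r\<bar> * std_normal_cube + (y r)\<^sup>2) \<le> (y r)\<^sup>2 * (m * std_normal_cube + m\<^sup>2)"
      using r std_normal_cube_nonneg by (intro mult_left_mono add_mono mult_right_mono) auto
    then show "cmod ((CLINT x|std_normal_distribution. iexp (y r * (x\<^sup>2 - 1))) - of_real (exp (- (y r)\<^sup>2)))
        \<le> (y r)\<^sup>2 * (m * std_normal_cube + m\<^sup>2)"
      using char_centred_square_approx[of "y r"] by linarith
  qed
  also have "\<dots> = t\<^sup>2 / 2 * (m * std_normal_cube + m\<^sup>2)"
    using y2 by (simp flip: sum_distrib_right)
  finally show ?char unfolding V_def m_def .
qed

end

text \<open>Levy's continuity theorem applied to the preceding estimate. \<open>T j\<close> takes
  the place of the squared Hilbert-Schmidt norm because it involves single variances only, and the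
  centring \<open>m j\<close> may miss the mean by any amount that is small against
  \<open>sqrt (T j)\<close>.\<close>

theorem (in prob_space) gaussian_quadratic_form_clt:
  fixes X :: "nat \<Rightarrow> 'i \<Rightarrow> 'a \<Rightarrow> real" and I :: "nat \<Rightarrow> 'i set" and \<nu> m T :: "nat \<Rightarrow> real"
    and Q F :: "nat \<Rightarrow> 'a \<Rightarrow> real"
  assumes I: "\<And>j. finite (I j)" and X: "\<And>j. centred_gaussian (I j) (X j)"
    and op: "\<And>u j. expectation (\<lambda>\<omega>. (\<Sum>i\<in>I j. u i * X j i \<omega>)\<^sup>2) \<le> \<nu> j * (\<Sum>i\<in>I j. (u i)\<^sup>2)"
    and Q: "\<And>j. Q j = (\<lambda>\<omega>. \<Sum>i\<in>I j. (X j i \<omega>)\<^sup>2)"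
    and T: "\<And>j. T j = (\<Sum>i\<in>I j. (expectation (\<lambda>\<omega>. (X j i \<omega>)\<^sup>2))\<^sup>2)"
    and Tpos: "eventually (\<lambda>j. 0 < T j) sequentially"
    and \<nu>T: "(\<lambda>j. \<nu> j / sqrt (T j)) \<longlonglongrightarrow> 0"
    and bias: "(\<lambda>j. (expectation (Q j) - m j) / sqrt (T j)) \<longlonglongrightarrow> 0"
    and Fm[measurable]: "\<And>j. F j \<in> borel_measurable M"
    and F: "eventually (\<lambda>j. \<forall>\<omega>. F j \<omega> = (Q j \<omega> - m j) / sqrt (variance (Q j))) sequentially"
  shows "weak_conv_m (\<lambda>j. distr M borel (F j)) std_normal_distribution"
proof (rule levy_continuity)
  show "real_distribution (distr M borel (F j))" for j by (intro real_distribution_distr Fm)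
  show "real_distribution std_normal_distribution" by (rule real_dist_normal_dist)
  fix t
  \<comment> \<open>The bias in units of the standard deviation. It enters the characteristic
    function as a factor of modulus 1 which tends to 1.\<close>
  define d where "d j = (expectation (Q j) - m j) / sqrt (variance (Q j))" for j
  define q where "q j = \<bar>t\<bar> * \<nu> j / sqrt (2 * T j)" for j
  have q: "q \<longlonglongrightarrow> 0"
  proof -
    have "(\<lambda>j. \<bar>t\<bar> / sqrt 2 * (\<nu> j / sqrt (T j))) \<longlonglongrightarrow> \<bar>t\<bar> / sqrt 2 * 0"
      by (intro tendsto_intros \<nu>T)
    then show ?thesis by (simp add: q_def[abs_def] real_sqrt_mult)
  qed
  have var: "2 * T j \<le> variance (Q j)" if "0 < T j" for j
    using gaussian_quadratic_form_char(1)[OF I[of j] X[of j] op[of _ j]] that by (simp only: Q T)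
  have main: "cmod (expectation (\<lambda>\<omega>. iexp (t * ((Q j \<omega> - expectation (Q j)) / sqrt (variance (Q j))))) - of_real (exp (- t\<^sup>2 / 2)))
      \<le> t\<^sup>2 / 2 * (q j * std_normal_cube + (q j)\<^sup>2)" if "0 < T j" for j
    using gaussian_quadratic_form_char(2)[OF I[of j] X[of j] op[of _ j]] that by (simp only: q_def Q T)
  have "(\<lambda>j. t\<^sup>2 / 2 * (q j * std_normal_cube + (q j)\<^sup>2)) \<longlonglongrightarrow> t\<^sup>2 / 2 * (0 * std_normal_cube + 0\<^sup>2)"
    by (intro tendsto_intros q)
  then have q0: "(\<lambda>j. t\<^sup>2 / 2 * (q j * std_normal_cube + (q j)\<^sup>2)) \<longlonglongrightarrow> 0" by simp
  have "(\<lambda>j. expectation (\<lambda>\<omega>. iexp (t * ((Q j \<omega> - expectation (Q j)) / sqrt (variance (Q j))))) - of_real (exp (- t\<^sup>2 / 2))) \<longlonglongrightarrow> 0"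
    by (rule Lim_null_comparison[OF eventually_mono[OF Tpos main] q0])
  then have lim1: "(\<lambda>j. expectation (\<lambda>\<omega>. iexp (t * ((Q j \<omega> - expectation (Q j)) / sqrt (variance (Q j)))))) \<longlonglongrightarrow> of_real (exp (- t\<^sup>2 / 2))"
    by (rule Lim_null[THEN iffD2])
  have "d \<longlonglongrightarrow> 0"
  proof (rule Lim_null_comparison)
    show "(\<lambda>j. \<bar>(expectation (Q j) - m j) / sqrt (T j)\<bar>) \<longlonglongrightarrow> 0"
      using bias by (rule tendsto_rabs_zero)
    show "eventually (\<lambda>j. norm (d j) \<le> \<bar>(expectation (Q j) - m j) / sqrt (T j)\<bar>) sequentially"
      using Tpos
    proof eventually_elim
      case (elim j)
      have "T j \<le> variance (Q j)" using var[OF elim] elim by linarith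
      then show ?case
        using elim unfolding d_def real_norm_def abs_divide
        by (intro divide_left_mono) (auto intro!: mult_pos_pos)
    qed
  qed
  then have "(\<lambda>j. iexp (t * d j)) \<longlonglongrightarrow> iexp (t * 0)"
    by (intro tendsto_intros)
  then have lim2: "(\<lambda>j. iexp (t * d j)) \<longlonglongrightarrow> 1" by simp
  have "eventually (\<lambda>j. char (distr M borel (F j)) t =
      expectation (\<lambda>\<omega>. iexp (t * ((Q j \<omega> - expectation (Q j)) / sqrt (variance (Q j))))) * iexp (t * d j)) sequentially"
    using F
  proof eventually_elim
    case (elim j)
    have "char (distr M borel (F j)) t = expectation (\<lambda>\<omega>. iexp (t * F j \<omega>))"
      unfolding char_def by (subst integral_distr) auto
    also have "\<dots> = expectation (\<lambda>\<omega>. iexp (t * ((Q j \<omega> - expectation (Q j)) / sqrt (variance (Q j)))) * iexp (t * d j))"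
    proof (intro Bochner_Integration.integral_cong refl)
      fix \<omega>
      have "F j \<omega> = (Q j \<omega> - expectation (Q j)) / sqrt (variance (Q j)) + d j"
        using elim by (simp add: d_def diff_divide_distrib)
      then show "iexp (t * F j \<omega>) =
          iexp (t * ((Q j \<omega> - expectation (Q j)) / sqrt (variance (Q j)))) * iexp (t * d j)"
        by (simp add: distrib_left flip: exp_add)
    qed
    finally show ?case by simp
  qed
  moreover have "(\<lambda>j. expectation (\<lambda>\<omega>. iexp (t * ((Q j \<omega> - expectation (Q j)) / sqrt (variance (Q j))))) * iexp (t * d j))
      \<longlonglongrightarrow> of_real (exp (- t\<^sup>2 / 2)) * 1"
    by (intro tendsto_mult lim1 lim2)
  ultimately show "(\<lambda>j. char (distr M borel (F j)) t) \<longlonglongrightarrow> char std_normal_distribution t"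
    unfolding char_std_normal_distribution by (simp add: tendsto_cong)
qed

section \<open>The kernel of the spin harmonics of one multipole\<close>

lemma coeff_linear_poly_power':
  fixes a b :: "'a :: comm_semiring_1"
  shows "coeff ([:a, b:] ^ n) i = of_nat (n choose i) * b ^ i * a ^ (n - i)"
proof (cases "i \<le> n")
  case False
  have "degree ([:a, b:] ^ n) \<le> degree [:a, b:] * n" by (rule degree_power_le)
  also have "\<dots> \<le> 1 * n" by (intro mult_right_mono) auto
  finally show ?thesis using False by (simp add: coeff_eq_0 binomial_eq_0)
qed (rule coeff_linear_poly_power)

lemma degree_linear_power_le:
  fixes a b :: "'a :: comm_semiring_1"
  shows "degree ([:a, b:] ^ n) \<le> n"
  by (rule degree_le) (auto simp: coeff_linear_poly_power' binomial_eq_0)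

lemma degree_linear_powers_le:
  fixes a b c d :: "'a :: comm_semiring_1"
  shows "degree ([:a, b:] ^ p * [:c, d:] ^ q) \<le> p + q"
  by (rule order_trans[OF degree_mult_le add_mono[OF degree_linear_power_le degree_linear_power_le]])

lemma coeff_linear_powers:
  fixes a b c d :: "'a :: comm_semiring_1"
  shows "coeff ([:a, b:] ^ p * [:c, d:] ^ q) k =
    (\<Sum>i\<le>k. of_nat (p choose i) * b ^ i * a ^ (p - i) * (of_nat (q choose (k - i)) * d ^ (k - i) * c ^ (q - (k - i))))"
  by (simp add: coeff_mult coeff_linear_poly_power')

text \<open>Substituting two polynomials into the binary form of degree \<open>n\<close> with dehomogenisation \<open>P\<close>.\<close>

definition subst_form :: "nat \<Rightarrow> 'a::comm_ring_1 poly \<Rightarrow> 'a poly \<Rightarrow> 'a poly \<Rightarrow> 'a poly" where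
  "subst_form n P Z Z' = (\<Sum>k\<le>n. smult (coeff P k) (Z ^ k * Z' ^ (n - k)))"

lemma smult_sum_right: "smult c (\<Sum>i\<in>S. f i) = (\<Sum>i\<in>S. smult c (f i))"
  by (induction S rule: infinite_finite_induct) (auto simp: smult_add_right)

text \<open>The coefficients of the product are a shifted and an unshifted copy of those of
  \<open>P\<close>; the degree bound removes the boundary term \<open>coeff P (Suc n)\<close> of the
  unshifted one.\<close>

lemma subst_form_mult_linear:
  assumes "degree P \<le> n"
  shows "subst_form (Suc n) ([:u', u:] * P) Z Z' = (smult u Z + smult u' Z') * subst_form n P Z Z'"
proof -
  have P: "coeff P (Suc n) = 0" using assms by (simp add: coeff_eq_0)
  let ?f = "\<lambda>k. smult (coeff P k) (Z ^ k * Z' ^ (Suc n - k))"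
  let ?g = "\<lambda>k. smult (if k = 0 then 0 else coeff P (k - 1)) (Z ^ k * Z' ^ (Suc n - k))"
  have "coeff ([:u', u:] * P) k = u' * coeff P k + u * (if k = 0 then 0 else coeff P (k - 1))" for k
    by (simp add: coeff_pCons split: nat.split)
  then have "subst_form (Suc n) ([:u', u:] * P) Z Z' = smult u' (\<Sum>k\<le>Suc n. ?f k) + smult u (\<Sum>k\<le>Suc n. ?g k)"
    unfolding subst_form_def
    by (simp only: smult_add_left smult_smult[symmetric] sum.distrib smult_sum_right)
  moreover have "(\<Sum>k\<le>Suc n. ?f k) = Z' * subst_form n P Z Z'"
    unfolding subst_form_def
    by (simp add: P sum_distrib_left Suc_diff_le algebra_simps)
  moreover have "(\<Sum>k\<le>Suc n. ?g k) = Z * subst_form n P Z Z'"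
    unfolding subst_form_def
    by (subst sum.atMost_Suc_shift) (simp add: sum_distrib_left algebra_simps)
  ultimately show ?thesis by (simp add: algebra_simps)
qed

lemma subst_form_linear_powers:
  "subst_form (p + q) ([:u', u:] ^ p * [:v', v:] ^ q) Z Z' =
     (smult u Z + smult u' Z') ^ p * (smult v Z + smult v' Z') ^ q"
proof (induction p)
  case 0
  show ?case
  proof (induction q)
    case 0
    show ?case by (simp add: subst_form_def)
  next
    case (Suc q)
    then show ?case
      using subst_form_mult_linear[OF degree_linear_power_le, where Z = Z and Z' = Z'] by simp
  qed
next
  case (Suc p)
  have "subst_form (Suc (p + q)) ([:u', u:] * ([:u', u:] ^ p * [:v', v:] ^ q)) Z Z' =
      (smult u Z + smult u' Z') * subst_form (p + q) ([:u', u:] ^ p * [:v', v:] ^ q) Z Z'"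
    by (rule subst_form_mult_linear[OF degree_linear_powers_le])
  then show ?case unfolding Suc.IH by (simp only: add_Suc power_Suc mult.assoc)
qed

text \<open>Both sides are the product of the factorials of \<open>p\<close>, \<open>q\<close>,
  \<open>k\<close>, \<open>k'\<close> divided by those of the entries of a 2 by 2 table with row
  sums \<open>p\<close>, \<open>q\<close>, column sums \<open>k\<close>, \<open>k'\<close> and
  corner \<open>i\<close>. This is symmetric under transposing the table; if an entry would be
  negative, both sides are 0.\<close>

lemma fact_binomial_exchange:
  assumes "p + q = k + k'" "i \<le> p" "i \<le> k"
  shows "fact p * fact q * ((k choose i) * (k' choose (p - i))) =
    (fact k * fact k' * ((p choose i) * (q choose (k - i))) :: nat)"
proof (cases "k - i \<le> q")
  case True
  then have le: "p - i \<le> k'" and eq: "k' - (p - i) = q - (k - i)" using assms by linarith+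
  have pi: "fact p = fact i * fact (p - i) * (p choose i :: nat)"
    and ki: "fact k = fact i * fact (k - i) * (k choose i :: nat)"
    and qi: "fact q = fact (k - i) * fact (q - (k - i)) * (q choose (k - i) :: nat)"
    and ki': "fact k' = fact (p - i) * fact (q - (k - i)) * (k' choose (p - i) :: nat)"
    using binomial_fact_lemma[OF assms(2)] binomial_fact_lemma[OF assms(3)]
      binomial_fact_lemma[OF True] binomial_fact_lemma[OF le] eq by simp_all
  show ?thesis unfolding pi ki qi ki' by (simp only: mult_ac)
next
  case False
  then have "k' < p - i" using assms by linarith
  then show ?thesis using False by (simp add: binomial_eq_0)
qed

text \<open>On binary forms the matrix of a substitution and that of the transposed substitution
  agree up to factorial weights. Each summand on one side corresponds to a 2 by 2 table and the same
  summand on the other side to its transpose.\<close>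

lemma coeff_linear_powers_transpose:
  fixes a b a' b' :: "'a :: {comm_ring_1, semiring_char_0}"
  assumes n: "p + q = k + k'"
  shows "fact p * fact q * coeff ([:b, a:] ^ k * [:b', a':] ^ k') p =
    fact k * fact k' * coeff ([:a', a:] ^ p * [:b', b:] ^ q) k"
proof -
  let ?f = "\<lambda>i. of_nat (fact p * fact q * ((k choose i) * (k' choose (p - i)))) *
      (a ^ i * b ^ (k - i) * (a' ^ (p - i) * b' ^ (k' - (p - i))))"
  let ?g = "\<lambda>i. of_nat (fact k * fact k' * ((p choose i) * (q choose (k - i)))) *
      (a ^ i * a' ^ (p - i) * (b ^ (k - i) * b' ^ (q - (k - i))))"
  have "fact p * fact q * coeff ([:b, a:] ^ k * [:b', a':] ^ k') p = (\<Sum>i\<le>p. ?f i)"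
    unfolding coeff_linear_powers sum_distrib_left by (intro sum.cong refl) (simp add: mult_ac)
  also have "\<dots> = (\<Sum>i\<le>min p k. ?f i)"
    by (intro sum.mono_neutral_right ballI) (auto simp: not_le binomial_eq_0)
  also have "\<dots> = (\<Sum>i\<le>min p k. ?g i)"
  proof (intro sum.cong refl)
    fix i assume "i \<in> {..min p k}"
    then have i: "i \<le> p" "i \<le> k" by auto
    show "?f i = ?g i"
      unfolding fact_binomial_exchange[OF n i]
    proof (cases "k - i \<le> q")
      case True
      then have "k' - (p - i) = q - (k - i)" using n i by linarith
      then show "of_nat (fact k * fact k' * ((p choose i) * (q choose (k - i)))) *
      (a ^ i * b ^ (k - i) * (a' ^ (p - i) * b' ^ (k' - (p - i)))) = ?g i"
        by (simp add: mult_ac)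
    qed (simp add: binomial_eq_0)
  qed
  also have "\<dots> = (\<Sum>i\<le>k. ?g i)"
    by (intro sum.mono_neutral_left ballI) (auto simp: not_le binomial_eq_0)
  also have "\<dots> = fact k * fact k' * coeff ([:a', a:] ^ p * [:b', b:] ^ q) k"
    unfolding coeff_linear_powers sum_distrib_left by (intro sum.cong refl) (simp add: mult_ac)
  finally show ?thesis .
qed

text \<open>The weights \<open>k! (n - k)!\<close> make the coefficientwise pairing of binary forms of degree \<open>n\<close>
  invariant under \<open>SU(2)\<close>.\<close>

lemma weighted_pairing_linear_powers:
  fixes a b a' b' u v u' v' :: "'a :: {comm_ring_1, semiring_char_0}"
  shows "(\<Sum>k\<le>p+q. fact k * fact (p + q - k) *
        (coeff ([:u', u:] ^ p * [:v', v:] ^ q) k * coeff ([:a', a:] ^ p * [:b', b:] ^ q) k)) =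
      fact p * fact q *
      coeff ([:u * b + u' * b', u * a + u' * a':] ^ p * [:v * b + v' * b', v * a + v' * a':] ^ q) p"
proof -
  let ?P = "[:u', u:] ^ p * [:v', v:] ^ q"
  have "(\<Sum>k\<le>p+q. fact k * fact (p + q - k) * (coeff ?P k * coeff ([:a', a:] ^ p * [:b', b:] ^ q) k)) =
      (\<Sum>k\<le>p+q. coeff ?P k * (fact p * fact q * coeff ([:b, a:] ^ k * [:b', a':] ^ (p + q - k)) p))"
  proof (intro sum.cong refl)
    fix k assume "k \<in> {..p+q}"
    then have "p + q = k + (p + q - k)" by simp
    note tr = coeff_linear_powers_transpose[OF this, of b a b' a']
    show "fact k * fact (p + q - k) * (coeff ?P k * coeff ([:a', a:] ^ p * [:b', b:] ^ q) k) =
      coeff ?P k * (fact p * fact q * coeff ([:b, a:] ^ k * [:b', a':] ^ (p + q - k)) p)"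
      unfolding tr by (simp only: mult_ac)
  qed
  also have "\<dots> = fact p * fact q * coeff (subst_form (p + q) ?P [:b, a:] [:b', a':]) p"
    by (simp add: subst_form_def coeff_sum sum_distrib_left mult_ac)
  also have "subst_form (p + q) ?P [:b, a:] [:b', a':] =
      [:u * b + u' * b', u * a + u' * a':] ^ p * [:v * b + v' * b', v * a + v' * a':] ^ q"
    unfolding subst_form_linear_powers by simp
  finally show ?thesis .
qed

text \<open>\<open>jacobi b r x\<close> is the Jacobi polynomial of degree \<open>r\<close> with parameters \<open>(0, b)\<close> at \<open>1 - 2 * x\<close>.\<close>

definition jacobi :: "nat \<Rightarrow> nat \<Rightarrow> real \<Rightarrow> real" where
  "jacobi b r x = (\<Sum>j\<le>r. (-1) ^ j * of_nat (r choose j) * of_nat ((r + b) choose j) * (1 - x) ^ (r - j) * x ^ j)"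

text \<open>Pairing each \<open>\<alpha>\<close> with a \<open>cnj \<alpha>\<close> and each
  \<open>\<beta>\<close> with a \<open>cnj \<beta>\<close> leaves moduli and one surplus power; by
  truncated subtraction one of the exponents \<open>p - q\<close>, \<open>q - p\<close> is 0. For
  harmonics \<open>p\<close> and \<open>q\<close> will differ by twice the spin, so the surplus
  power does not depend on the multipole.\<close>

lemma coeff_su2_diagonal:
  fixes \<alpha> \<beta> :: complex
  assumes su2: "(cmod \<alpha>)\<^sup>2 + (cmod \<beta>)\<^sup>2 = 1"
  shows "coeff ([:\<beta>, \<alpha>:] ^ p * [:cnj \<alpha>, - cnj \<beta>:] ^ q) p =
    \<alpha> ^ (p - q) * cnj \<alpha> ^ (q - p) * of_real (jacobi (p - q + (q - p)) (min p q) ((cmod \<beta>)\<^sup>2))"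
proof -
  let ?x = "(cmod \<beta>)\<^sup>2"
  have aa: "\<alpha> * cnj \<alpha> = of_real (1 - ?x)" and bb: "\<beta> * cnj \<beta> = of_real ?x"
    using arg_cong[OF su2, of complex_of_real] by (simp_all add: algebra_simps flip: complex_norm_square)
  have "coeff ([:\<beta>, \<alpha>:] ^ p * [:cnj \<alpha>, - cnj \<beta>:] ^ q) p =
    (\<Sum>i\<le>p. of_nat (p choose i) * \<alpha> ^ i * \<beta> ^ (p - i) * (of_nat (q choose (p - i)) * (- cnj \<beta>) ^ (p - i) * cnj \<alpha> ^ (q - (p - i))))"
    by (rule coeff_linear_powers)
  also have "\<dots> = (\<Sum>j\<le>p. of_nat (p choose j) * \<alpha> ^ (p - j) * \<beta> ^ j * (of_nat (q choose j) * (- cnj \<beta>) ^ j * cnj \<alpha> ^ (q - j)))"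
    unfolding atMost_atLeast0
    by (subst sum.atLeastAtMost_rev, intro sum.cong refl) (simp add: binomial_symmetric[symmetric])
  also have "\<dots> = (\<Sum>j\<le>min p q. of_nat (p choose j) * \<alpha> ^ (p - j) * \<beta> ^ j * (of_nat (q choose j) * (- cnj \<beta>) ^ j * cnj \<alpha> ^ (q - j)))"
    by (intro sum.mono_neutral_right ballI) (auto simp: not_le binomial_eq_0)
  also have "\<dots> = (\<Sum>j\<le>min p q. \<alpha> ^ (p - q) * cnj \<alpha> ^ (q - p) * of_real ((-1) ^ j * of_nat (min p q choose j) *
      of_nat ((min p q + (p - q + (q - p))) choose j) * (1 - ?x) ^ (min p q - j) * ?x ^ j))"
  proof (intro sum.cong refl)
    fix j assume "j \<in> {..min p q}"
    then have j: "j \<le> p" "j \<le> q" by auto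
    have "p - j = p - q + (min p q - j)" "q - j = q - p + (min p q - j)" using j by auto
    then have A: "\<alpha> ^ (p - j) * cnj \<alpha> ^ (q - j) = \<alpha> ^ (p - q) * cnj \<alpha> ^ (q - p) * (\<alpha> * cnj \<alpha>) ^ (min p q - j)"
      by (simp add: power_add power_mult_distrib)
    have B: "\<beta> ^ j * (- cnj \<beta>) ^ j = (-1) ^ j * (\<beta> * cnj \<beta>) ^ j"
      by (subst power_minus) (simp add: power_mult_distrib)
    have C: "(p choose j) * (q choose j) = (min p q choose j) * ((min p q + (p - q + (q - p))) choose j)"
      by (cases "p \<le> q") (auto simp: min_def)
    have "of_nat (p choose j) * \<alpha> ^ (p - j) * \<beta> ^ j * (of_nat (q choose j) * (- cnj \<beta>) ^ j * cnj \<alpha> ^ (q - j)) =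
      of_nat ((p choose j) * (q choose j)) * (\<alpha> ^ (p - j) * cnj \<alpha> ^ (q - j)) * (\<beta> ^ j * (- cnj \<beta>) ^ j)"
      by (simp only: of_nat_mult mult_ac)
    also have "\<dots> = \<alpha> ^ (p - q) * cnj \<alpha> ^ (q - p) * of_real ((-1) ^ j * of_nat (min p q choose j) *
      of_nat ((min p q + (p - q + (q - p))) choose j) * (1 - ?x) ^ (min p q - j) * ?x ^ j)"
      unfolding A B C aa bb by (simp add: mult_ac)
    finally show "of_nat (p choose j) * \<alpha> ^ (p - j) * \<beta> ^ j * (of_nat (q choose j) * (- cnj \<beta>) ^ j * cnj \<alpha> ^ (q - j)) =
      \<alpha> ^ (p - q) * cnj \<alpha> ^ (q - p) * of_real ((-1) ^ j * of_nat (min p q choose j) *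
      of_nat ((min p q + (p - q + (q - p))) choose j) * (1 - ?x) ^ (min p q - j) * ?x ^ j)" .
  qed
  finally show ?thesis by (simp add: jacobi_def sum_distrib_left)
qed

section \<open>From Wigner functions to the kernel of a multipole\<close>

lemma coeff_linear_powers_scale:
  fixes a b a' b' w z :: "'a :: comm_ring_1"
  assumes k: "k \<le> p + q"
  shows "coeff ([:a' * z, a * w:] ^ p * [:b' * z, b * w:] ^ q) k =
    w ^ k * z ^ (p + q - k) * coeff ([:a', a:] ^ p * [:b', b:] ^ q) k"
  unfolding coeff_linear_powers sum_distrib_left
proof (intro sum.cong refl)
  fix i assume i: "i \<in> {..k}"
  show "of_nat (p choose i) * (a * w) ^ i * (a' * z) ^ (p - i) *
         (of_nat (q choose (k - i)) * (b * w) ^ (k - i) * (b' * z) ^ (q - (k - i))) =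
         w ^ k * z ^ (p + q - k) *
         (of_nat (p choose i) * a ^ i * a' ^ (p - i) *
          (of_nat (q choose (k - i)) * b ^ (k - i) * b' ^ (q - (k - i))))"
  proof (cases "i \<le> p \<and> k - i \<le> q")
    case True
    then have "k = i + (k - i)" "p + q - k = (p - i) + (q - (k - i))"
      using i k by auto
    then have "w ^ k = w ^ i * w ^ (k - i)" "z ^ (p + q - k) = z ^ (p - i) * z ^ (q - (k - i))"
      by (metis power_add)+
    then show ?thesis by (simp add: power_mult_distrib mult_ac)
  qed (auto simp: binomial_eq_0 not_le)
qed

text \<open>The rotation by \<open>\<beta>\<close> about the second axis lifts to
  \<open>SU(2)\<close> with half angles, and the Wigner function is a matrix entry of its action on
  binary forms of degree \<open>2 * l\<close>. The square root normalises the monomials.\<close>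

lemma wigner_d_coeff:
  assumes m: "\<bar>m\<bar> \<le> int l" and n: "\<bar>n\<bar> \<le> int l"
  defines "p \<equiv> nat (int l + n)" and "q \<equiv> nat (int l - n)" and "k \<equiv> nat (int l + m)" and "k' \<equiv> nat (int l - m)"
  shows "wigner_d l m n \<beta> = sqrt (fact k * fact k' / (fact p * fact q)) *
    coeff ([:sin (\<beta> / 2), cos (\<beta> / 2):] ^ p * [:cos (\<beta> / 2), - sin (\<beta> / 2):] ^ q) k"
proof -
  let ?c = "cos (\<beta> / 2)" and ?s = "sin (\<beta> / 2)"
  have ip: "int p = int l + n" and iq: "int q = int l - n" and ik: "int k = int l + m"
    and ik': "int k' = int l - m"
    using m n by (simp_all add: p_def q_def k_def k'_def)
  let ?t = "\<lambda>i. (-1) ^ (k - i) * ?c ^ (i + (q - (k - i))) * ?s ^ ((k - i) + (p - i)) /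
      (fact i * fact (p - i) * fact (k - i) * fact (q - (k - i)))"
  have "(\<Sum>j\<in>{max 0 (n - m)..min (int l + n) (int l - m)}.
        (-1) ^ nat (m - n + j) *
        ?c ^ nat (2 * int l + n - m - 2 * j) * ?s ^ nat (m - n + 2 * j) /
        (fact (nat (int l + n - j)) * fact (nat j) *
         fact (nat (m - n + j)) * fact (nat (int l - m - j)))) =
      (\<Sum>i\<in>{i. i \<le> k \<and> i \<le> p \<and> k - i \<le> q}. ?t i)"
  \<comment> \<open>Wigner's summation index is the number \<open>p - i\<close> of factors of the
    first power that contribute their constant term, while \<open>i\<close> factors contribute their
    linear term.\<close>
  proof (rule sum.reindex_bij_witness[where i = "\<lambda>i. int p - int i" and j = "\<lambda>j. nat (int p - j)"])
    fix j assume j: "j \<in> {max 0 (n - m)..min (int l + n) (int l - m)}"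
    define i where "i = nat (int p - j)"
    have ij: "int i = int p - j" using j ip by (simp add: i_def)
    have "i \<le> k" "i \<le> p" "k - i \<le> q" using ij j ip iq ik by auto
    then show "nat (int p - j) \<in> {i. i \<le> k \<and> i \<le> p \<and> k - i \<le> q}" by (simp add: i_def)
    show "int p - int (nat (int p - j)) = j" using ij by (simp add: i_def)
    have *: "nat (m - n + j) = k - i" "nat (2 * int l + n - m - 2 * j) = i + (q - (k - i))"
      "nat (m - n + 2 * j) = (k - i) + (p - i)" "nat (int l + n - j) = i" "nat j = p - i"
      "nat (int l - m - j) = q - (k - i)"
      using ij j ip iq ik by auto
    show "?t (nat (int p - j)) = (-1) ^ nat (m - n + j) *
        ?c ^ nat (2 * int l + n - m - 2 * j) * ?s ^ nat (m - n + 2 * j) /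
        (fact (nat (int l + n - j)) * fact (nat j) *
         fact (nat (m - n + j)) * fact (nat (int l - m - j)))"
      unfolding * i_def[symmetric] ..
  next
    fix i assume i: "i \<in> {i. i \<le> k \<and> i \<le> p \<and> k - i \<le> q}"
    then show "nat (int p - (int p - int i)) = i" by simp
    show "int p - int i \<in> {max 0 (n - m)..min (int l + n) (int l - m)}"
      using i ip iq ik by auto
  qed
  also have "\<dots> = (\<Sum>i\<in>{i. i \<le> k \<and> i \<le> p \<and> k - i \<le> q}. 1 / (fact p * fact q) *
      (real (p choose i) * ?c ^ i * ?s ^ (p - i) * (real (q choose (k - i)) * (- ?s) ^ (k - i) * ?c ^ (q - (k - i)))))"
  proof (intro sum.cong refl)
    fix i assume "i \<in> {i. i \<le> k \<and> i \<le> p \<and> k - i \<le> q}"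
    then have i: "i \<le> p" "k - i \<le> q" by auto
    have e: "(- ?s) ^ (k - i) = (-1) ^ (k - i) * ?s ^ (k - i)" by (rule power_minus)
    show "?t i = 1 / (fact p * fact q) *
      (real (p choose i) * ?c ^ i * ?s ^ (p - i) * (real (q choose (k - i)) * (- ?s) ^ (k - i) * ?c ^ (q - (k - i))))"
      unfolding binomial_fact[OF i(1)] binomial_fact[OF i(2)] e power_add by (simp add: mult_ac)
  qed
  also have "\<dots> = 1 / (fact p * fact q) *
    coeff ([:?s, ?c:] ^ p * [:?c, - ?s:] ^ q) k"
    unfolding coeff_linear_powers sum_distrib_left
    by (intro sum.mono_neutral_left ballI) (auto simp: not_le binomial_eq_0)
  finally have W: "wigner_d l m n \<beta> = sqrt (fact k * fact k' * fact p * fact q) * (1 / (fact p * fact q) *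
    coeff ([:?s, ?c:] ^ p * [:?c, - ?s:] ^ q) k)"
    unfolding wigner_d_def p_def q_def k_def k'_def by simp
  have "sqrt (fact k * fact k' * fact p * fact q) = sqrt (fact k * fact k' / (fact p * fact q)) * (fact p * fact q)"
  proof -
    have "(fact k * fact k' * fact p * fact q :: real) = (fact k * fact k' / (fact p * fact q)) * (fact p * fact q)\<^sup>2"
      by (simp add: power2_eq_square)
    then show ?thesis by (simp only: real_sqrt_mult real_sqrt_abs) simp
  qed
  then show ?thesis unfolding W by simp
qed

text \<open>The poles need no exception: there the sine of the colatitude vanishes and the longitude
  chosen by \<open>Arg 0\<close> does not matter.\<close>

lemma unit_vector_eq_spherical:
  assumes "x \<in> sphere 0 1"
  shows "x $ 1 = sin (colatitude x) * cos (longitude x)" "x $ 2 = sin (colatitude x) * sin (longitude x)"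
    "x $ 3 = cos (colatitude x)"
proof -
  have n: "(x $ 1)\<^sup>2 + (x $ 2)\<^sup>2 + (x $ 3)\<^sup>2 = 1"
    using assms by (simp add: norm_eq_sqrt_inner inner_vec_def sum_3 power2_eq_square)
  have "(x $ 3)\<^sup>2 \<le> 1"
    using n zero_le_power2[of "x $ 1"] zero_le_power2[of "x $ 2"] by linarith
  then have x3: "-1 \<le> x $ 3" "x $ 3 \<le> 1" by (simp_all add: abs_square_le_1 abs_le_iff)
  then show "x $ 3 = cos (colatitude x)" by (simp add: colatitude_def cos_arccos)
  let ?z = "Complex (x $ 1) (x $ 2)"
  have "sin (colatitude x) = sqrt (1 - (x $ 3)\<^sup>2)"
    unfolding colatitude_def using x3 by (rule sin_arccos)
  also have "\<dots> = cmod ?z" using n by (simp add: cmod_def eq_diff_eq[symmetric])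
  finally have "?z = of_real (sin (colatitude x)) * cis (longitude x)"
    unfolding longitude_def by (metis rcis_cmod_Arg rcis_def)
  then show "x $ 1 = sin (colatitude x) * cos (longitude x)" "x $ 2 = sin (colatitude x) * sin (longitude x)"
    by (simp_all add: complex_eq_iff)
qed

definition spin_kernel :: "int \<Rightarrow> nat \<Rightarrow> real^3 \<Rightarrow> real^3 \<Rightarrow> complex" where
  "spin_kernel s l x y = (\<Sum>m = - int l..int l. spin_harmonic l m s x * cnj (spin_harmonic l m s y))"

lemma of_real_coeff_linear_powers:
  "complex_of_real (coeff ([:a, b:] ^ p * [:c, d:] ^ q) k) =
     coeff ([:of_real a, of_real b:] ^ p * [:of_real c, of_real d:] ^ q) k"
  by (simp add: coeff_linear_powers)

text \<open>\<open>\<alpha>\<close> and \<open>\<beta>\<close> are the entries of the element of \<open>SU(2)\<close> which rotates \<open>y\<close> to \<open>x\<close>.\<close>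

lemma spin_kernel_coeff:
  fixes x y :: "real^3"
  assumes s: "\<bar>s\<bar> \<le> int l"
  defines "c \<equiv> cos (colatitude x / 2)" and "d \<equiv> sin (colatitude x / 2)"
    and "c' \<equiv> cos (colatitude y / 2)" and "d' \<equiv> sin (colatitude y / 2)"
    and "\<zeta> \<equiv> cis ((longitude x - longitude y) / 2)"
  defines "\<alpha> \<equiv> of_real (c * c') * cnj \<zeta> + of_real (d * d') * \<zeta>"
    and "\<beta> \<equiv> of_real (d * c') * \<zeta> - of_real (c * d') * cnj \<zeta>"
  shows "spin_kernel s l x y = of_real ((2 * real l + 1) / (4 * pi)) *
    coeff ([:\<beta>, \<alpha>:] ^ nat (int l + s) * [:cnj \<alpha>, - cnj \<beta>:] ^ nat (int l - s)) (nat (int l + s))"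
proof -
  define p q where "p = nat (int l + s)" and "q = nat (int l - s)"
  have pq: "p + q = 2 * l" and ip: "int p = int l + s" and iq: "int q = int l - s"
    using s by (auto simp: p_def q_def)
  let ?C = "complex_of_real ((2 * real l + 1) / (4 * pi))"
  let ?R = "coeff ([:complex_of_real d, of_real c:] ^ p * [:of_real c, - of_real d:] ^ q)"
  let ?R' = "coeff ([:complex_of_real d', of_real c':] ^ p * [:of_real c', - of_real d':] ^ q)"
  \<comment> \<open>The phases of both longitudes are absorbed into the second form by scaling its
    variables with \<open>\<zeta>\<close> and \<open>cnj \<zeta>\<close>; the sum over
    \<open>m\<close> then is the invariant pairing of two products of linear powers.\<close>
  let ?T = "coeff ([:of_real d' * \<zeta>, of_real c' * cnj \<zeta>:] ^ p * [:of_real c' * \<zeta>, - of_real d' * cnj \<zeta>:] ^ q)"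
  have summand: "spin_harmonic l m s x * cnj (spin_harmonic l m s y) =
      ?C * (1 / (fact p * fact q) * (fact k * fact (p + q - k) * (?R k * ?T k)))"
    if m: "m \<in> {- int l..int l}" and k: "k = nat (int l - m)" for m k
  proof -
    have k2: "nat (int l + (- m)) = k" "nat (int l - (- m)) = p + q - k" "k \<le> p + q"
      using m k pq by auto
    have absm: "\<bar>- m\<bar> \<le> int l" using m by auto
    let ?w = "sqrt (fact k * fact (p + q - k) / (fact p * fact q))"
    have dx: "complex_of_real (wigner_d l (- m) s (colatitude x)) = of_real ?w * ?R k"
      and dy: "complex_of_real (wigner_d l (- m) s (colatitude y)) = of_real ?w * ?R' k"
      using wigner_d_coeff[OF absm s, of "colatitude x"] wigner_d_coeff[OF absm s, of "colatitude y"]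
      unfolding k2 p_def[symmetric] q_def[symmetric] c_def d_def c'_def d'_def
      by (simp_all add: of_real_coeff_linear_powers del: of_real_sqrt)
    have ww: "complex_of_real ?w * of_real ?w = fact k * fact (p + q - k) / (fact p * fact q)"
      by (simp del: of_real_sqrt flip: of_real_mult) simp
    have sgn: "complex_of_real ((-1) powi m) * of_real ((-1) powi m) = 1"
      by (simp add: power_int_mult_distrib[symmetric] del: of_real_power_int flip: of_real_mult)
    have sq: "complex_of_real (sqrt ((2 * real l + 1) / (4 * pi))) * of_real (sqrt ((2 * real l + 1) / (4 * pi))) = ?C"
      unfolding of_real_mult[symmetric] by (simp only: real_sqrt_mult_self) simp
    have phase: "cis (of_int m * longitude x) * cnj (cis (of_int m * longitude y)) = cnj \<zeta> ^ k * \<zeta> ^ (p + q - k)"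
    proof -
      have "real k = real l - of_int m" "real (p + q - k) = real l + of_int m" using m k pq by auto
      then have "cnj \<zeta> ^ k * \<zeta> ^ (p + q - k) =
          cis ((real l - of_int m) * (- ((longitude x - longitude y) / 2)) +
               (real l + of_int m) * ((longitude x - longitude y) / 2))"
        unfolding \<zeta>_def cis_cnj Complex.DeMoivre cis_mult by simp
      also have "(real l - of_int m) * (- ((longitude x - longitude y) / 2)) +
               (real l + of_int m) * ((longitude x - longitude y) / 2) = of_int m * longitude x + - (of_int m * longitude y)"
        by (simp add: field_simps)
      finally show ?thesis by (simp add: cis_cnj cis_mult)
    qed
    have T: "?T k = cnj \<zeta> ^ k * \<zeta> ^ (p + q - k) * ?R' k"
      by (rule coeff_linear_powers_scale[OF k2(3)])
    have "spin_harmonic l m s x * cnj (spin_harmonic l m s y) =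
        (complex_of_real ((-1) powi m) * of_real ((-1) powi m)) *
        (of_real (sqrt ((2 * real l + 1) / (4 * pi))) * of_real (sqrt ((2 * real l + 1) / (4 * pi)))) *
        (of_real (wigner_d l (- m) s (colatitude x)) * of_real (wigner_d l (- m) s (colatitude y))) *
        (cis (of_int m * longitude x) * cnj (cis (of_int m * longitude y)))"
      unfolding spin_harmonic_def complex_cnj_mult complex_cnj_complex_of_real of_real_mult by (simp only: mult_ac)
    also have "\<dots> = ?C * ((of_real ?w * of_real ?w) * (?R k * ?T k))"
      unfolding sgn sq dx dy phase T by (simp only: mult_ac mult_1)
    finally show ?thesis unfolding ww by simp
  qed
  have "spin_kernel s l x y = (\<Sum>k\<le>p+q. ?C * (1 / (fact p * fact q) * (fact k * fact (p + q - k) * (?R k * ?T k))))"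
    unfolding spin_kernel_def
    by (rule sum.reindex_bij_witness[where i = "\<lambda>k. int l - int k" and j = "\<lambda>m. nat (int l - m)"])
       (use pq in \<open>auto simp: summand\<close>)
  also have "\<dots> = ?C * (1 / (fact p * fact q) * (\<Sum>k\<le>p+q. fact k * fact (p + q - k) * (?R k * ?T k)))"
    by (simp add: sum_distrib_left)
  also have "(\<Sum>k\<le>p+q. fact k * fact (p + q - k) * (?R k * ?T k)) = fact p * fact q *
     coeff ([:\<beta>, \<alpha>:] ^ p * [:cnj \<alpha>, - cnj \<beta>:] ^ q) p"
    unfolding weighted_pairing_linear_powers
    by (simp add: \<alpha>_def \<beta>_def algebra_simps)
  finally show ?thesis by (simp add: p_def q_def)
qed

text \<open>The two moduli are the cosine and sine of half the angle between \<open>x\<close> and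
  \<open>y\<close>. After the double-angle formulas both claims are polynomial identities modulo the
  relations cos^2 + sin^2 = 1 for the three half angles.\<close>

lemma spin_kernel_su2:
  fixes x y :: "real^3"
  assumes x: "x \<in> sphere 0 1" and y: "y \<in> sphere 0 1"
  defines "c \<equiv> cos (colatitude x / 2)" and "d \<equiv> sin (colatitude x / 2)"
    and "c' \<equiv> cos (colatitude y / 2)" and "d' \<equiv> sin (colatitude y / 2)"
    and "\<zeta> \<equiv> cis ((longitude x - longitude y) / 2)"
  defines "\<alpha> \<equiv> of_real (c * c') * cnj \<zeta> + of_real (d * d') * \<zeta>"
    and "\<beta> \<equiv> of_real (d * c') * \<zeta> - of_real (c * d') * cnj \<zeta>"
  shows "(cmod \<alpha>)\<^sup>2 = (1 + x \<bullet> y) / 2" "(cmod \<beta>)\<^sup>2 = (1 - x \<bullet> y) / 2"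
proof -
  define t u where "t = cos ((longitude x - longitude y) / 2)" and "u = sin ((longitude x - longitude y) / 2)"
  have tu: "t\<^sup>2 + u\<^sup>2 = 1" by (simp add: t_def u_def)
  have cd: "c\<^sup>2 + d\<^sup>2 = 1" "c'\<^sup>2 + d'\<^sup>2 = 1" by (simp_all add: c_def d_def c'_def d'_def)
  have cosx: "cos (colatitude x) = c\<^sup>2 - d\<^sup>2" and cosy: "cos (colatitude y) = c'\<^sup>2 - d'\<^sup>2"
    and sinx: "sin (colatitude x) = 2 * d * c" and siny: "sin (colatitude y) = 2 * d' * c'"
    unfolding c_def d_def c'_def d'_def
    using cos_double[of "colatitude x / 2"] cos_double[of "colatitude y / 2"]
      sin_double[of "colatitude x / 2"] sin_double[of "colatitude y / 2"] by simp_all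
  have "cos (longitude x - longitude y) = t\<^sup>2 - u\<^sup>2"
  proof -
    have "2 * ((longitude x - longitude y) / 2) = longitude x - longitude y"
      by (simp add: diff_divide_distrib)
    then show ?thesis
      using cos_double[of "(longitude x - longitude y) / 2"] unfolding t_def u_def by (simp only:)
  qed
  then have lon: "cos (longitude x) * cos (longitude y) + sin (longitude x) * sin (longitude y) = t\<^sup>2 - u\<^sup>2"
    by (simp add: cos_diff)
  have "x \<bullet> y = sin (colatitude x) * sin (colatitude y) *
      (cos (longitude x) * cos (longitude y) + sin (longitude x) * sin (longitude y)) +
      cos (colatitude x) * cos (colatitude y)"
    unfolding inner_vec_def sum_3 unit_vector_eq_spherical[OF x] unit_vector_eq_spherical[OF y]
    by (simp add: algebra_simps)
  then have dot: "x \<bullet> y = 4 * (d * c) * (d' * c') * (t\<^sup>2 - u\<^sup>2) + (c\<^sup>2 - d\<^sup>2) * (c'\<^sup>2 - d'\<^sup>2)"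
    unfolding lon cosx cosy sinx siny by simp
  have "(cmod \<alpha>)\<^sup>2 = ((c * c' + d * d') * t)\<^sup>2 + ((d * d' - c * c') * u)\<^sup>2"
    unfolding \<alpha>_def \<zeta>_def cmod_power2 t_def u_def by (simp add: algebra_simps)
  moreover have "(cmod \<beta>)\<^sup>2 = ((d * c' - c * d') * t)\<^sup>2 + ((d * c' + c * d') * u)\<^sup>2"
    unfolding \<beta>_def \<zeta>_def cmod_power2 t_def u_def by (simp add: algebra_simps)
  ultimately show "(cmod \<alpha>)\<^sup>2 = (1 + x \<bullet> y) / 2" "(cmod \<beta>)\<^sup>2 = (1 - x \<bullet> y) / 2"
    using tu cd unfolding dot by algebra+
qed

text \<open>The factor \<open>\<zeta>\<close> is a power, with exponent given by \<open>s\<close>,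
  of an entry of the rotation taking \<open>y\<close> to \<open>x\<close>. Its independence of
  \<open>l\<close> reduces sums over multipoles to sums of scalar Jacobi polynomials. Only
  \<open>cmod \<zeta> \<le> 1\<close> is available in general because that entry vanishes for
  antipodal points.\<close>

lemma spin_kernel_jacobi:
  assumes x: "x \<in> sphere 0 1" and y: "y \<in> sphere 0 1"
  obtains \<zeta> where "cmod \<zeta> \<le> 1" and "x = y \<Longrightarrow> \<zeta> = 1"
    and "\<And>l. \<bar>s\<bar> \<le> int l \<Longrightarrow> spin_kernel s l x y =
      of_real ((2 * real l + 1) / (4 * pi)) * \<zeta> * of_real (jacobi (2 * nat \<bar>s\<bar>) (l - nat \<bar>s\<bar>) ((1 - x \<bullet> y) / 2))"
proof -
  define c d c' d' \<zeta> where "c = cos (colatitude x / 2)" and "d = sin (colatitude x / 2)"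
    and "c' = cos (colatitude y / 2)" and "d' = sin (colatitude y / 2)"
    and "\<zeta> = cis ((longitude x - longitude y) / 2)"
  define \<alpha> \<beta> where "\<alpha> = of_real (c * c') * cnj \<zeta> + of_real (d * d') * \<zeta>"
    and "\<beta> = of_real (d * c') * \<zeta> - of_real (c * d') * cnj \<zeta>"
  note defs = c_def d_def c'_def d'_def \<zeta>_def \<alpha>_def \<beta>_def
  have a2: "(cmod \<alpha>)\<^sup>2 = (1 + x \<bullet> y) / 2" and b2: "(cmod \<beta>)\<^sup>2 = (1 - x \<bullet> y) / 2"
    unfolding defs by (rule spin_kernel_su2[OF x y])+
  have su2: "(cmod \<alpha>)\<^sup>2 + (cmod \<beta>)\<^sup>2 = 1" unfolding a2 b2 by (simp add: field_simps)
  then have "(cmod \<alpha>)\<^sup>2 \<le> 1" using zero_le_power2[of "cmod \<beta>"] by linarith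
  then have a1: "cmod \<alpha> \<le> 1" by (simp add: abs_square_le_1)
  define Z where "Z = \<alpha> ^ (nat (2 * s)) * cnj \<alpha> ^ nat (- (2 * s))"
  show thesis
  proof (rule that[of Z])
    show "cmod Z \<le> 1"
      unfolding Z_def norm_mult norm_power complex_mod_cnj
      by (intro mult_le_one power_le_one zero_le_power a1 norm_ge_zero)
    show "Z = 1" if "x = y"
    proof -
      have e: "c' = c" "d' = d" "\<zeta> = 1"
        unfolding c_def d_def c'_def d'_def \<zeta>_def using that by simp_all
      have "\<alpha> = of_real (c * c + d * d)" unfolding \<alpha>_def e by simp
      also have "c * c + d * d = 1" by (simp add: c_def d_def)
      finally have "\<alpha> = 1" by simp
      then show ?thesis by (simp add: Z_def)
    qed
    fix l assume s: "\<bar>s\<bar> \<le> int l"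
    have e: "nat (int l + s) - nat (int l - s) = nat (2 * s)" "nat (int l - s) - nat (int l + s) = nat (- (2 * s))"
      "nat (2 * s) + nat (- (2 * s)) = 2 * nat \<bar>s\<bar>" "min (nat (int l + s)) (nat (int l - s)) = l - nat \<bar>s\<bar>"
      using s by auto
    show "spin_kernel s l x y =
      of_real ((2 * real l + 1) / (4 * pi)) * Z * of_real (jacobi (2 * nat \<bar>s\<bar>) (l - nat \<bar>s\<bar>) ((1 - x \<bullet> y) / 2))"
      unfolding spin_kernel_coeff[OF s] defs[symmetric] coeff_su2_diagonal[OF su2] e b2 Z_def by simp
  qed
qed

section \<open>Diagonal values and pointwise bounds\<close>

lemma jacobi_0: "jacobi b r 0 = 1"
proof -
  have "jacobi b r 0 = (\<Sum>j\<in>{0}. (-1) ^ j * of_nat (r choose j) * of_nat ((r + b) choose j) * (1 - 0) ^ (r - j) * 0 ^ j)"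
    unfolding jacobi_def by (rule sum.mono_neutral_right) auto
  then show ?thesis by simp
qed

lemma spin_kernel_diagonal:
  assumes "x \<in> sphere 0 1" "\<bar>s\<bar> \<le> int l"
  shows "spin_kernel s l x x = of_real ((2 * real l + 1) / (4 * pi))"
proof -
  have "x \<bullet> x = 1" using assms by (simp add: power2_norm_eq_inner[symmetric])
  then show ?thesis
    using spin_kernel_jacobi[OF assms(1,1), of s] assms(2) by (metis diff_self div_0 jacobi_0 mult.right_neutral of_real_1)
qed

lemma sum_spin_harmonic_norm:
  assumes "x \<in> sphere 0 1" "\<bar>s\<bar> \<le> int l"
  shows "(\<Sum>m = - int l..int l. (cmod (spin_harmonic l m s x))\<^sup>2) = (2 * real l + 1) / (4 * pi)"
proof -
  have "complex_of_real (\<Sum>m = - int l..int l. (cmod (spin_harmonic l m s x))\<^sup>2) = spin_kernel s l x x"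
    unfolding spin_kernel_def by (simp only: of_real_sum complex_norm_square)
  also note spin_kernel_diagonal[OF assms]
  finally show ?thesis using of_real_eq_iff by blast
qed

lemma spin_kernel_bound:
  assumes x: "x \<in> sphere 0 1" and y: "y \<in> sphere 0 1" and s: "\<bar>s\<bar> \<le> int l"
  shows "cmod (spin_kernel s l x y) \<le> (2 * real l + 1) / (4 * pi)"
proof -
  let ?Y = "\<lambda>z m. cmod (spin_harmonic l m s z)"
  have "cmod (spin_kernel s l x y) \<le> (\<Sum>m = - int l..int l. ?Y x m * ?Y y m)"
    unfolding spin_kernel_def by (rule order_trans[OF norm_sum]) (simp add: norm_mult)
  also have "\<dots> \<le> (\<Sum>m = - int l..int l. ((?Y x m)\<^sup>2 + (?Y y m)\<^sup>2) / 2)"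
  proof (rule sum_mono)
    fix m
    show "?Y x m * ?Y y m \<le> ((?Y x m)\<^sup>2 + (?Y y m)\<^sup>2) / 2"
      using sum_squares_bound[of "?Y x m" "?Y y m"] by simp
  qed
  also have "\<dots> = (2 * real l + 1) / (4 * pi)"
    unfolding sum_divide_distrib[symmetric] sum.distrib sum_spin_harmonic_norm[OF x s] sum_spin_harmonic_norm[OF y s]
    by (simp add: field_simps)
  finally show ?thesis .
qed

text \<open>Expanding \<open>(1 - x) ^ (r - j)\<close> and collecting powers of \<open>x\<close>
  produces a Vandermonde convolution. The range \<open>N\<close> is left free so that neighbouring
  degrees can be compared over a common range.\<close>

lemma jacobi_expand:
  assumes "r \<le> N"
  shows "jacobi b r x = (\<Sum>i\<le>N. (-1) ^ i * real (r choose i) * real ((r + b + i) choose i) * x ^ i)"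
proof -
  have pw: "(1 - x) ^ (r - j) * x ^ j = (\<Sum>i\<le>r. if j \<le> i then real ((r - j) choose (i - j)) * (-1) ^ (i - j) * x ^ i else 0)"
    if j: "j \<le> r" for j
  proof -
    have "(1 - x) ^ (r - j) = (\<Sum>k\<le>r - j. real ((r - j) choose k) * (- x) ^ k)"
      using binomial_ring[of "- x" 1 "r - j"] by simp
    note E = this
    have "(1 - x) ^ (r - j) * x ^ j = (\<Sum>k\<le>r - j. real ((r - j) choose k) * (-1) ^ k * x ^ (k + j))"
      unfolding E sum_distrib_right by (intro sum.cong refl) (simp add: power_minus[of x] power_add)
    also have "\<dots> = (\<Sum>i\<in>{j..r}. real ((r - j) choose (i - j)) * (-1) ^ (i - j) * x ^ i)"
      by (rule sum.reindex_bij_witness[where i = "\<lambda>i. i - j" and j = "\<lambda>k. k + j"]) (use j in auto)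
    also have "\<dots> = (\<Sum>i\<le>r. if j \<le> i then real ((r - j) choose (i - j)) * (-1) ^ (i - j) * x ^ i else 0)"
      by (intro sum.mono_neutral_cong_left) auto
    finally show ?thesis .
  qed
  have "jacobi b r x = (\<Sum>j\<le>r. \<Sum>i\<le>r. if j \<le> i then (-1) ^ i * x ^ i * real (r choose i) * real ((i choose j) * ((r + b) choose j)) else 0)"
    unfolding jacobi_def
  proof (intro sum.cong refl)
    fix j assume "j \<in> {..r}"
    then have j: "j \<le> r" by simp
    have "(-1) ^ j * real (r choose j) * real ((r + b) choose j) * (1 - x) ^ (r - j) * x ^ j =
       (-1) ^ j * real (r choose j) * real ((r + b) choose j) * ((1 - x) ^ (r - j) * x ^ j)" by simp
    also have "\<dots> = (\<Sum>i\<le>r. if j \<le> i then (-1) ^ i * x ^ i * real (r choose i) * real ((i choose j) * ((r + b) choose j)) else 0)"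
      unfolding pw[OF j] sum_distrib_left
    proof (intro sum.cong refl)
      fix i assume "i \<in> {..r}"
      then have i: "i \<le> r" by simp
      show "(-1) ^ j * real (r choose j) * real ((r + b) choose j) *
          (if j \<le> i then real ((r - j) choose (i - j)) * (-1) ^ (i - j) * x ^ i else 0) =
        (if j \<le> i then (-1) ^ i * x ^ i * real (r choose i) * real ((i choose j) * ((r + b) choose j)) else 0)"
      proof (cases "j \<le> i")
        case True
        have c: "real (r choose j) * real ((r - j) choose (i - j)) = real (r choose i) * real (i choose j)"
          using choose_mult[OF True i] by (simp flip: of_nat_mult)
        have s: "(-1) ^ j * (-1) ^ (i - j) = ((-1) ^ i :: real)"
          using True by (simp flip: power_add)
        have "(-1) ^ j * real (r choose j) * real ((r + b) choose j) * (real ((r - j) choose (i - j)) * (-1) ^ (i - j) * x ^ i) =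
           ((-1) ^ j * (-1) ^ (i - j)) * (real (r choose j) * real ((r - j) choose (i - j))) * real ((r + b) choose j) * x ^ i"
          by (simp only: mult_ac)
        then show ?thesis using True unfolding c s by (simp add: mult_ac)
      qed simp
    qed
    finally show "(-1) ^ j * real (r choose j) * real ((r + b) choose j) * (1 - x) ^ (r - j) * x ^ j =
      (\<Sum>i\<le>r. if j \<le> i then (-1) ^ i * x ^ i * real (r choose i) * real ((i choose j) * ((r + b) choose j)) else 0)" .
  qed
  also have "\<dots> = (\<Sum>i\<le>r. \<Sum>j\<le>r. if j \<le> i then (-1) ^ i * x ^ i * real (r choose i) * real ((i choose j) * ((r + b) choose j)) else 0)"
    by (rule sum.swap)
  also have "\<dots> = (\<Sum>i\<le>r. (-1) ^ i * real (r choose i) * real ((r + b + i) choose i) * x ^ i)"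
  proof (intro sum.cong refl)
    fix i assume "i \<in> {..r}"
    then have i: "i \<le> r" by simp
    have "(\<Sum>j\<le>i. ((r + b) choose j) * (i choose (i - j))) = (r + b + i) choose i"
      by (rule vandermonde)
    then have v: "(\<Sum>j\<le>i. (i choose j) * ((r + b) choose j)) = (r + b + i) choose i"
      by (simp add: binomial_symmetric[symmetric] mult.commute)
    have "(\<Sum>j\<le>r. if j \<le> i then (-1) ^ i * x ^ i * real (r choose i) * real ((i choose j) * ((r + b) choose j)) else 0) =
        (\<Sum>j\<le>i. (-1) ^ i * x ^ i * real (r choose i) * real ((i choose j) * ((r + b) choose j)))"
      by (rule sum.mono_neutral_cong_right) (use i in auto)
    also have "\<dots> = (-1) ^ i * x ^ i * real (r choose i) * real (\<Sum>j\<le>i. (i choose j) * ((r + b) choose j))"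
      by (simp only: sum_distrib_left of_nat_sum)
    finally show "(\<Sum>j\<le>r. if j \<le> i then (-1) ^ i * x ^ i * real (r choose i) * real ((i choose j) * ((r + b) choose j)) else 0) =
       (-1) ^ i * real (r choose i) * real ((r + b + i) choose i) * x ^ i"
      unfolding v by (simp only: mult_ac)
  qed
  also have "\<dots> = (\<Sum>i\<le>N. (-1) ^ i * real (r choose i) * real ((r + b + i) choose i) * x ^ i)"
    by (rule sum.mono_neutral_left) (use assms in auto)
  finally show ?thesis .
qed

section \<open>Three-term recurrence of the Jacobi polynomials\<close>

lemma binomial_real_absorb:
  "real (Suc n) * real (n choose i) = (real (Suc n) - real i) * real (Suc n choose i)"
proof (cases "i \<le> Suc n")
  case True
  have "(Suc n - i) * (Suc n choose i) = Suc n * (n choose i)"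
    using binomial_absorb_comp[of "Suc n" i] by simp
  then have "real (Suc n - i) * real (Suc n choose i) = real (Suc n) * real (n choose i)"
    by (simp only: flip: of_nat_mult)
  then show ?thesis using True by (simp add: of_nat_diff)
qed (simp add: binomial_eq_0)

text \<open>Signs aside, \<open>C0\<close>, \<open>C1\<close>, \<open>C2\<close> are the
  coefficients of the \<open>i\<close>-th power in three consecutive Jacobi polynomials, and
  \<open>C1'\<close> is the one coming from \<open>x\<close> times the middle polynomial. All four
  are explicit multiples of one quantity \<open>X\<close>, which leaves a polynomial identity in
  \<open>r\<close>, \<open>c\<close> and \<open>k\<close>.\<close>

lemma jacobi_coeff_recurrence:
  fixes n b i :: nat
  defines "r \<equiv> real n + 1" and "c \<equiv> real b" and "k \<equiv> real i"
  defines "C0 \<equiv> real (n choose i) * real ((n + b + i) choose i)"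
    and "C1 \<equiv> real (Suc n choose i) * real ((Suc n + b + i) choose i)"
    and "C2 \<equiv> real (Suc (Suc n) choose i) * real ((Suc (Suc n) + b + i) choose i)"
    and "C1' \<equiv> (if i = 0 then 0 else real (Suc n choose (i - 1)) * real ((Suc n + b + (i - 1)) choose (i - 1)))"
  shows "(2 * r + c) * (2 * r + c + 1) * (2 * r + c + 2) * (C1 + 2 * C1') =
    2 * r * (r + c) * (2 * r + c + 2) * C0 + c\<^sup>2 * (2 * r + c + 1) * C1 + 2 * (r + 1) * (r + c + 1) * (2 * r + c) * C2"
proof -
  define q e where "q = real (Suc (Suc n) choose i)" and "e = real ((n + b + i) choose i)"
  have pos: "r > 0" "r + c > 0" "r + 1 > 0" "r + c + 1 > 0" by (simp_all add: r_def c_def)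
  define X where "X = q * e / ((r + 1) * (r + c))"
  have q1: "(r + 1) * real (Suc n choose i) = (r + 1 - k) * q"
    using binomial_real_absorb[of "Suc n" i] by (simp add: q_def r_def k_def add_ac)
  have q0: "r * real (n choose i) = (r - k) * real (Suc n choose i)"
    using binomial_real_absorb[of n i] by (simp add: r_def k_def add_ac)
  have e1: "(r + c) * real ((Suc n + b + i) choose i) = (r + c + k) * e"
    using binomial_real_absorb[of "n + b + i" i] by (simp add: e_def r_def c_def k_def algebra_simps)
  have e2: "(r + c + 1) * real ((Suc (Suc n) + b + i) choose i) = (r + c + 1 + k) * real ((Suc n + b + i) choose i)"
    using binomial_real_absorb[of "Suc n + b + i" i] by (simp add: r_def c_def k_def algebra_simps)
  have C1: "C1 = (r + 1 - k) * (r + c + k) * X"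
  proof -
    have "real (Suc n choose i) = (r + 1 - k) * q / (r + 1)" "real ((Suc n + b + i) choose i) = (r + c + k) * e / (r + c)"
      using q1 e1 pos by (simp_all add: field_simps)
    then show ?thesis unfolding C1_def X_def by simp
  qed
  have C0: "r * C0 = (r + c) * (r - k) * (r + 1 - k) * X"
  proof -
    have q1': "real (Suc n choose i) = (r + 1 - k) * q / (r + 1)"
      using q1 pos by (simp add: field_simps)
    have "r * C0 = (r * real (n choose i)) * e" by (simp add: C0_def e_def)
    also have "\<dots> = (r - k) * ((r + 1 - k) * q / (r + 1)) * e" unfolding q0 q1' ..
    also have "\<dots> = (r + c) * (r - k) * (r + 1 - k) * X" using pos by (simp add: X_def)
    finally show ?thesis .
  qed
  have C2: "(r + c + 1) * C2 = (r + 1) * (r + c + 1 + k) * (r + c + k) * X"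
  proof -
    have e1': "real ((Suc n + b + i) choose i) = (r + c + k) * e / (r + c)"
      using e1 pos by (simp add: field_simps)
    have "(r + c + 1) * C2 = q * ((r + c + 1) * real ((Suc (Suc n) + b + i) choose i))"
      by (simp add: C2_def q_def)
    also have "\<dots> = q * ((r + c + 1 + k) * ((r + c + k) * e / (r + c)))" unfolding e2 e1' ..
    also have "\<dots> = (r + 1) * (r + c + 1 + k) * (r + c + k) * X" using pos by (simp add: X_def)
    finally show ?thesis .
  qed
  have C1': "C1' = k\<^sup>2 * X"
  proof (cases i)
    case 0
    then show ?thesis by (simp add: C1'_def k_def)
  next
    case (Suc i')
    have kq: "k * q = (r + 1) * real (Suc n choose i')"
      using Suc_times_binomial[of i' "Suc n"] unfolding q_def k_def Suc r_def
      by (simp add: algebra_simps flip: of_nat_mult of_nat_Suc)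
    have ke: "k * real ((Suc n + b + i) choose i) = (r + c + k) * real ((Suc n + b + i') choose i')"
      using Suc_times_binomial[of i' "Suc n + b + i'"] unfolding k_def Suc r_def c_def
      by (simp add: algebra_simps flip: of_nat_mult of_nat_Suc of_nat_add)
    have "(r + c + k) * (real ((Suc n + b + i') choose i') * (r + c)) = (r + c + k) * (k * e)"
      using e1 ke by (metis mult.commute mult.left_commute)
    moreover have "r + c + k > 0" using pos by (simp add: k_def)
    ultimately have "real ((Suc n + b + i') choose i') * (r + c) = k * e"
      by (metis less_irrefl mult_left_cancel)
    then have "real ((Suc n + b + i') choose i') = k * e / (r + c)"
      using pos by (metis less_irrefl nonzero_eq_divide_eq)
    moreover have "real (Suc n choose i') = k * q / (r + 1)"
      using pos kq by (simp add: nonzero_eq_divide_eq mult.commute)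
    ultimately show ?thesis unfolding C1'_def X_def Suc by (simp add: power2_eq_square)
  qed
  have "(2 * r + c) * (2 * r + c + 1) * (2 * r + c + 2) * (C1 + 2 * C1') =
      2 * (r + c) * (2 * r + c + 2) * (r * C0) + c\<^sup>2 * (2 * r + c + 1) * C1 + 2 * (r + 1) * (2 * r + c) * ((r + c + 1) * C2)"
    unfolding C1 C1' C0 C2 by algebra
  then show ?thesis by (simp add: mult_ac)
qed

lemma jacobi_recurrence:
  fixes n b :: nat and x :: real
  defines "r \<equiv> real n + 1" and "c \<equiv> real b"
  shows "(2 * r + c) * (2 * r + c + 1) * (2 * r + c + 2) * ((1 - 2 * x) * jacobi b (Suc n) x) =
    2 * r * (r + c) * (2 * r + c + 2) * jacobi b n x + c\<^sup>2 * (2 * r + c + 1) * jacobi b (Suc n) x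
    + 2 * (r + 1) * (r + c + 1) * (2 * r + c) * jacobi b (Suc (Suc n)) x"
proof -
  define N where "N = Suc (Suc n)"
  let ?c = "\<lambda>r i. real (r choose i) * real ((r + b + i) choose i)"
  let ?c' = "\<lambda>i. if i = 0 then 0 else ?c (Suc n) (i - 1)"
  have J: "jacobi b r x = (\<Sum>i\<le>N. (-1) ^ i * x ^ i * ?c r i)" if "r \<le> N" for r
    unfolding jacobi_expand[OF that] by (simp add: mult_ac)
  have "x * jacobi b (Suc n) x = (\<Sum>i\<le>Suc n. (-1) ^ i * x ^ Suc i * ?c (Suc n) i)"
    unfolding jacobi_expand[OF order_refl] sum_distrib_left by (intro sum.cong refl) (simp add: mult_ac)
  also have "\<dots> = (\<Sum>i\<le>N. - ((-1) ^ i * x ^ i * ?c' i))"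
    unfolding N_def by (subst sum.atMost_Suc_shift) (simp add: mult_ac)
  finally have xJ: "- (2 * (x * jacobi b (Suc n) x)) = (\<Sum>i\<le>N. (-1) ^ i * x ^ i * (2 * ?c' i))"
    by (simp add: sum_negf sum_distrib_left mult_ac)
  have "(1 - 2 * x) * jacobi b (Suc n) x = jacobi b (Suc n) x + - (2 * (x * jacobi b (Suc n) x))"
    by (simp add: algebra_simps)
  also have "\<dots> = (\<Sum>i\<le>N. (-1) ^ i * x ^ i * (?c (Suc n) i + 2 * ?c' i))"
    unfolding xJ by (subst J) (simp_all add: N_def distrib_left sum.distrib)
  finally have "(2 * r + c) * (2 * r + c + 1) * (2 * r + c + 2) * ((1 - 2 * x) * jacobi b (Suc n) x) =
     (\<Sum>i\<le>N. (-1) ^ i * x ^ i * ((2 * r + c) * (2 * r + c + 1) * (2 * r + c + 2) * (?c (Suc n) i + 2 * ?c' i)))"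
    by (simp only: sum_distrib_left mult_ac)
  also have "\<dots> = (\<Sum>i\<le>N. (-1) ^ i * x ^ i * (2 * r * (r + c) * (2 * r + c + 2) * ?c n i
      + c\<^sup>2 * (2 * r + c + 1) * ?c (Suc n) i + 2 * (r + 1) * (r + c + 1) * (2 * r + c) * ?c (Suc (Suc n)) i))"
    unfolding r_def c_def jacobi_coeff_recurrence ..
  also have "\<dots> = 2 * r * (r + c) * (2 * r + c + 2) * jacobi b n x + c\<^sup>2 * (2 * r + c + 1) * jacobi b (Suc n) x
    + 2 * (r + 1) * (r + c + 1) * (2 * r + c) * jacobi b (Suc (Suc n)) x"
    using J[of n] J[of "Suc n"] J[of "Suc (Suc n)"]
    by (simp add: N_def distrib_left sum.distrib sum_distrib_left mult_ac del: sum.atMost_Suc)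
  finally show ?thesis .
qed

text \<open>The multiplication by \<open>1 - cos \<theta> = 2 * x\<close>, in terms of the multipole \<open>l\<close>.\<close>

lemma jacobi_recurrence_multipole:
  fixes \<sigma> l :: nat and x :: real
  assumes l: "\<sigma> < l"
  defines "J \<equiv> \<lambda>l. jacobi (2 * \<sigma>) (l - \<sigma>) x"
  shows "2 * x * ((2 * real l + 1) * J l) =
    (2 * real l + 1) * J l
    - (2 * real l + 1) * (real \<sigma>)\<^sup>2 / (real l * (real l + 1)) * J l
    - ((real l)\<^sup>2 - (real \<sigma>)\<^sup>2) / real l * J (l - 1)
    - ((real l + 1)\<^sup>2 - (real \<sigma>)\<^sup>2) / (real l + 1) * J (Suc l)"
proof -
  define n where "n = l - \<sigma> - 1"
  have n: "l = Suc n + \<sigma>" using l by (simp add: n_def)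
  have e: "l - \<sigma> = Suc n" "l - 1 - \<sigma> = n" "Suc l - \<sigma> = Suc (Suc n)" using n by auto
  define L S where "L = real l" and "S = real \<sigma>"
  have L: "real n + 1 = L - S" "real (2 * \<sigma>) = 2 * S" using n by (simp_all add: L_def S_def)
  have pos: "L > 0" using l by (simp add: L_def)
  note rec = jacobi_recurrence[of n "2 * \<sigma>" x, unfolded L]
  have "2 * L * (2 * L + 1) * (2 * L + 2) * ((1 - 2 * x) * J l) =
     2 * (L - S) * (L + S) * (2 * L + 2) * J (l - 1) + 4 * S\<^sup>2 * (2 * L + 1) * J l
     + 2 * (L - S + 1) * (L + S + 1) * (2 * L) * J (Suc l)"
    using rec unfolding J_def e by (simp add: algebra_simps power2_eq_square)
  then have "2 * L * (2 * L + 2) * ((2 * L + 1) * ((1 - 2 * x) * J l)) = 2 * L * (2 * L + 2) *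
    ((2 * L + 1) * S\<^sup>2 / (L * (L + 1)) * J l + (L\<^sup>2 - S\<^sup>2) / L * J (l - 1) + ((L + 1)\<^sup>2 - S\<^sup>2) / (L + 1) * J (Suc l))"
  proof -
    assume rec: "2 * L * (2 * L + 1) * (2 * L + 2) * ((1 - 2 * x) * J l) =
     2 * (L - S) * (L + S) * (2 * L + 2) * J (l - 1) + 4 * S\<^sup>2 * (2 * L + 1) * J l
     + 2 * (L - S + 1) * (L + S + 1) * (2 * L) * J (Suc l)"
    have "2 * L * (2 * L + 2) * ((2 * L + 1) * S\<^sup>2 / (L * (L + 1)) * J l) = 4 * S\<^sup>2 * (2 * L + 1) * J l"
    proof -
      define K where "K = L * (L + 1)"
      have K: "2 * L * (2 * L + 2) = 4 * K" by (simp add: K_def algebra_simps)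
      have "K \<noteq> 0" using pos by (simp add: K_def)
      then show ?thesis unfolding K K_def[symmetric] by simp
    qed
    moreover have "2 * L * (2 * L + 2) * ((L\<^sup>2 - S\<^sup>2) / L * J (l - 1)) = 2 * (L - S) * (L + S) * (2 * L + 2) * J (l - 1)"
      using pos by (simp add: power2_eq_square square_diff_square_factored)
    moreover have "2 * L * (2 * L + 2) * (((L + 1)\<^sup>2 - S\<^sup>2) / (L + 1) * J (Suc l)) = 2 * (L - S + 1) * (L + S + 1) * (2 * L) * J (Suc l)"
    proof -
      define K P where "K = L + 1" and "P = (L - S + 1) * (L + S + 1)"
      have e: "2 * L + 2 = 2 * K" "(L + 1)\<^sup>2 - S\<^sup>2 = P"
        by (simp_all add: K_def P_def power2_eq_square algebra_simps)
      have p: "2 * (L - S + 1) * (L + S + 1) * (2 * L) * J (Suc l) = 4 * (P * (L * J (Suc l)))"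
        unfolding P_def by simp
      have "K \<noteq> 0" using pos by (simp add: K_def)
      then show ?thesis unfolding e p unfolding K_def[symmetric] by simp
    qed
    ultimately show ?thesis using rec by (simp only: distrib_left mult_ac)
  qed
  then have "(2 * L + 1) * ((1 - 2 * x) * J l) =
    (2 * L + 1) * S\<^sup>2 / (L * (L + 1)) * J l + (L\<^sup>2 - S\<^sup>2) / L * J (l - 1) + ((L + 1)\<^sup>2 - S\<^sup>2) / (L + 1) * J (Suc l)"
    using pos by (subst (asm) mult_left_cancel) auto
  moreover have "(2 * L + 1) * ((1 - 2 * x) * J l) = (2 * L + 1) * J l - 2 * x * ((2 * L + 1) * J l)"
    by (simp add: algebra_simps)
  ultimately show ?thesis unfolding L_def[symmetric] S_def[symmetric] by linarith
qed

section \<open>Orthonormality of the spin harmonics\<close>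

text \<open>The Jacobi polynomial of degree \<open>r\<close> with parameters \<open>(a, b)\<close>
  at \<open>1 - 2 * x\<close>, divided by the factorials of \<open>r + a\<close> and
  \<open>r + b\<close>; this scaling makes it symmetric enough to read off moments termwise.\<close>

definition wigner_poly :: "nat \<Rightarrow> nat \<Rightarrow> nat \<Rightarrow> real \<Rightarrow> real" where
  "wigner_poly a b r x = (\<Sum>i\<le>r. (-1) ^ i * ((1 - x) ^ (r - i) * x ^ i) /
     (fact i * fact (a + i) * fact (r - i) * fact (b + (r - i))))"

text \<open>The index symmetries of the Wigner functions reduce every sign pattern of
  \<open>m\<close> and \<open>n\<close> to the absolute values of \<open>m - n\<close> and
  \<open>m + n\<close>. Recording only \<open>\<sigma>\<^sup>2 = 1\<close> is enough: in products of
  two functions of the same degree the sign is squared, and products of different degrees will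
  integrate to 0.\<close>

lemma wigner_d_canonical:
  assumes m: "\<bar>m\<bar> \<le> int l" and n: "\<bar>n\<bar> \<le> int l"
  defines "a \<equiv> nat \<bar>m - n\<bar>" and "b \<equiv> nat \<bar>m + n\<bar>" and "r \<equiv> l - nat (max \<bar>m\<bar> \<bar>n\<bar>)"
  obtains \<sigma> :: real where "\<sigma>\<^sup>2 = 1" and "\<And>\<beta>. wigner_d l m n \<beta> =
    \<sigma> * sqrt (fact r * fact (r + a) * fact (r + b) * fact (r + a + b)) *
    (sin (\<beta> / 2) ^ a * cos (\<beta> / 2) ^ b * wigner_poly a b r ((sin (\<beta> / 2))\<^sup>2))"
proof
  define k0 where "k0 = max 0 (n - m)"
  define k1 where "k1 = min (int l + n) (int l - m)"
  define \<sigma> where "\<sigma> = ((-1) ^ nat (m - n + k0) :: real)"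
  show "\<sigma>\<^sup>2 = 1" unfolding \<sigma>_def by (simp flip: power_mult)
  fix \<beta> :: real
  let ?c = "cos (\<beta> / 2)" and ?s = "sin (\<beta> / 2)"
  have k1: "k1 = k0 + int r"
    using m n unfolding k0_def k1_def r_def by (auto simp: max_def min_def abs_if split: if_splits)
  have sq: "fact (nat (int l + m)) * fact (nat (int l - m)) * fact (nat (int l + n)) * fact (nat (int l - n)) =
      (fact r * fact (r + a) * fact (r + b) * fact (r + a + b) :: real)"
  proof -
    \<comment> \<open>In each case the four factorial arguments are a permutation of
      \<open>r\<close>, \<open>r + a\<close>, \<open>r + b\<close> and
      \<open>r + a + b\<close>.\<close>
    consider "n \<ge> m" "n + m \<le> 0" | "n \<ge> m" "n + m > 0" | "n < m" "n + m \<le> 0" | "n < m" "n + m > 0" by linarith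
    then show ?thesis
    proof cases
      case 1
      then have "nat (int l + m) = r" "nat (int l - m) = r + a + b" "nat (int l + n) = r + a" "nat (int l - n) = r + b"
        using m n unfolding a_def b_def r_def by auto
      then show ?thesis by (simp only: mult_ac)
    next
      case 2
      then have "nat (int l + m) = r + b" "nat (int l - m) = r + a" "nat (int l + n) = r + a + b" "nat (int l - n) = r"
        using m n unfolding a_def b_def r_def by auto
      then show ?thesis by (simp only: mult_ac)
    next
      case 3
      then have "nat (int l + m) = r + a" "nat (int l - m) = r + b" "nat (int l + n) = r" "nat (int l - n) = r + a + b"
        using m n unfolding a_def b_def r_def by auto
      then show ?thesis by (simp only: mult_ac)
    next
      case 4
      then have "nat (int l + m) = r + a + b" "nat (int l - m) = r" "nat (int l + n) = r + b" "nat (int l - n) = r + a"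
        using m n unfolding a_def b_def r_def by auto
      then show ?thesis by (simp only: mult_ac)
    qed
  qed
  have summand: "(-1) ^ nat (m - n + k) * ?c ^ nat (2 * int l + n - m - 2 * k) * ?s ^ nat (m - n + 2 * k) /
        (fact (nat (int l + n - k)) * fact (nat k) * fact (nat (m - n + k)) * fact (nat (int l - m - k))) =
      \<sigma> * (?s ^ a * ?c ^ b * ((-1) ^ i * ((1 - ?s\<^sup>2) ^ (r - i) * (?s\<^sup>2) ^ i) /
     (fact i * fact (a + i) * fact (r - i) * fact (b + (r - i)))))"
    if k: "k = k0 + int i" and i: "i \<le> r" for k i
  proof -
    have sgn: "(-1) ^ nat (m - n + k) = \<sigma> * (-1) ^ i"
    proof -
      have "nat (m - n + k) = nat (m - n + k0) + i" unfolding k k0_def by (simp add: max_def nat_add_distrib)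
      then show ?thesis by (simp add: \<sigma>_def power_add)
    qed
    have es: "nat (m - n + 2 * k) = a + 2 * i" unfolding k k0_def a_def by (cases "m \<le> n") (auto simp: max_def)
    have "2 * int l + n - m = 2 * k1 + int b" unfolding k1_def b_def by (auto simp: min_def)
    then have "2 * int l + n - m - 2 * k = int b + 2 * int (r - i)"
      using i unfolding k k1 by (simp add: of_nat_diff)
    then have ec: "nat (2 * int l + n - m - 2 * k) = b + 2 * (r - i)" by linarith
    have f1: "fact (nat k) * fact (nat (m - n + k)) = (fact i * fact (a + i) :: real)"
    proof (cases "n \<ge> m")
      case True
      then have "nat k = a + i" "nat (m - n + k) = i" unfolding k k0_def a_def by auto
      then show ?thesis by simp
    next
      case False
      then have "nat k = i" "nat (m - n + k) = a + i" unfolding k k0_def a_def by auto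
      then show ?thesis by simp
    qed
    have f2: "fact (nat (int l + n - k)) * fact (nat (int l - m - k)) = (fact (r - i) * fact (b + (r - i)) :: real)"
    proof (cases "n + m \<le> 0")
      case True
      then have "nat (int l + n - k) = r - i" "nat (int l - m - k) = b + (r - i)"
        using i k k1 unfolding k1_def b_def by auto
      then show ?thesis by simp
    next
      case False
      then have "nat (int l + n - k) = b + (r - i)" "nat (int l - m - k) = r - i"
        using i k k1 unfolding k1_def b_def by auto
      then show ?thesis by simp
    qed
    have c2: "1 - ?s\<^sup>2 = ?c\<^sup>2" by (simp add: cos_squared_eq)
    have f12: "fact (nat (int l + n - k)) * fact (nat k) * fact (nat (m - n + k)) * fact (nat (int l - m - k)) =
       (fact i * fact (a + i) :: real) * (fact (r - i) * fact (b + (r - i)))"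
      unfolding f1[symmetric] f2[symmetric] by (simp only: mult_ac)
    show ?thesis unfolding f12 sgn es ec c2 power_add power_mult by (simp add: mult_ac)
  qed
  have "(\<Sum>k\<in>{k0..k1}. (-1) ^ nat (m - n + k) * ?c ^ nat (2 * int l + n - m - 2 * k) * ?s ^ nat (m - n + 2 * k) /
        (fact (nat (int l + n - k)) * fact (nat k) * fact (nat (m - n + k)) * fact (nat (int l - m - k)))) =
     (\<Sum>i\<le>r. \<sigma> * (?s ^ a * ?c ^ b * ((-1) ^ i * ((1 - ?s\<^sup>2) ^ (r - i) * (?s\<^sup>2) ^ i) /
     (fact i * fact (a + i) * fact (r - i) * fact (b + (r - i))))))"
  proof (rule sum.reindex_bij_witness[where i = "\<lambda>i. k0 + int i" and j = "\<lambda>k. nat (k - k0)"])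
    fix k assume k: "k \<in> {k0..k1}"
    show "\<sigma> * (?s ^ a * ?c ^ b * ((-1) ^ nat (k - k0) * ((1 - ?s\<^sup>2) ^ (r - nat (k - k0)) * (?s\<^sup>2) ^ nat (k - k0)) /
        (fact (nat (k - k0)) * fact (a + nat (k - k0)) * fact (r - nat (k - k0)) * fact (b + (r - nat (k - k0)))))) =
      (-1) ^ nat (m - n + k) * ?c ^ nat (2 * int l + n - m - 2 * k) * ?s ^ nat (m - n + 2 * k) /
        (fact (nat (int l + n - k)) * fact (nat k) * fact (nat (m - n + k)) * fact (nat (int l - m - k)))"
    proof -
      have "k = k0 + int (nat (k - k0))" "nat (k - k0) \<le> r" using k k1 by auto
      from summand[OF this] show ?thesis by (rule sym)
    qed
  qed (auto simp: k1)
  also have "\<dots> = \<sigma> * (?s ^ a * ?c ^ b * wigner_poly a b r (?s\<^sup>2))"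
    unfolding wigner_poly_def by (simp only: sum_distrib_left times_divide_eq_right)
  finally show "wigner_d l m n \<beta> =
    \<sigma> * sqrt (fact r * fact (r + a) * fact (r + b) * fact (r + a + b)) *
    (?s ^ a * ?c ^ b * wigner_poly a b r (?s\<^sup>2))"
    unfolding wigner_d_def sq k0_def k1_def by simp
qed

section \<open>Orthogonality of the Wigner functions in the colatitude\<close>

lemma has_derivative_cos_half:
  "((\<lambda>t. (cos (t / 2))\<^sup>2) has_real_derivative - (sin t / 2)) (at t within A)"
  using sin_double[of "t / 2"]
  by (auto intro!: derivative_eq_intros simp: field_simps)

lemma has_derivative_sin_half:
  "((\<lambda>t. (sin (t / 2))\<^sup>2) has_real_derivative sin t / 2) (at t within A)"
  using sin_double[of "t / 2"]
  by (auto intro!: derivative_eq_intros simp: field_simps)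

text \<open>A Beta integral under the substitution \<open>x = (sin (t / 2))\<^sup>2\<close>. The
  induction integrates by parts, shifting a power from sine to cosine; the boundary terms vanish at
  both ends.\<close>

lemma has_integral_sin_half_powers:
  "((\<lambda>t. sin t * ((cos (t / 2))\<^sup>2) ^ p * ((sin (t / 2))\<^sup>2) ^ q) has_integral
     2 * fact p * fact q / fact (p + q + 1)) {0..pi}"
proof (induction q arbitrary: p)
  case 0
  have D: "((\<lambda>t. - 2 / real (Suc p) * ((cos (t / 2))\<^sup>2) ^ Suc p) has_vector_derivative
     sin t * ((cos (t / 2))\<^sup>2) ^ p) (at t within {0..pi})" for t
    unfolding has_real_derivative_iff_has_vector_derivative[symmetric]
    by (rule DERIV_cong[OF DERIV_cmult[OF DERIV_power_Suc[OF has_derivative_cos_half]]])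
       (simp add: field_simps)
  have "((\<lambda>t. sin t * ((cos (t / 2))\<^sup>2) ^ p) has_integral
      - 2 / real (Suc p) * ((cos (pi / 2))\<^sup>2) ^ Suc p - - 2 / real (Suc p) * ((cos (0 / 2))\<^sup>2) ^ Suc p) {0..pi}"
    by (rule fundamental_theorem_of_calculus[OF pi_ge_zero D])
  moreover have "2 * fact p * fact 0 / fact (p + 0 + 1) = 2 / real (Suc p)" by simp
  ultimately show ?case by simp
next
  case (Suc q)
  have D: "((\<lambda>t. ((cos (t / 2))\<^sup>2) ^ Suc p * ((sin (t / 2))\<^sup>2) ^ Suc q) has_vector_derivative
     - (real (Suc p) / 2) * (sin t * ((cos (t / 2))\<^sup>2) ^ p * ((sin (t / 2))\<^sup>2) ^ Suc q)
     + real (Suc q) / 2 * (sin t * ((cos (t / 2))\<^sup>2) ^ Suc p * ((sin (t / 2))\<^sup>2) ^ q)) (at t within {0..pi})" for t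
    unfolding has_real_derivative_iff_has_vector_derivative[symmetric]
    by (rule DERIV_cong[OF DERIV_mult[OF DERIV_power_Suc[OF has_derivative_cos_half]
          DERIV_power_Suc[OF has_derivative_sin_half]]])
       (simp add: field_simps)
  let ?f = "\<lambda>t. sin t * ((cos (t / 2))\<^sup>2) ^ p * ((sin (t / 2))\<^sup>2) ^ Suc q"
  let ?g = "\<lambda>t. sin t * ((cos (t / 2))\<^sup>2) ^ Suc p * ((sin (t / 2))\<^sup>2) ^ q"
  have "((\<lambda>t. - (real (Suc p) / 2) * ?f t + real (Suc q) / 2 * ?g t) has_integral
      ((cos (pi / 2))\<^sup>2) ^ Suc p * ((sin (pi / 2))\<^sup>2) ^ Suc q - ((cos (0 / 2))\<^sup>2) ^ Suc p * ((sin (0 / 2))\<^sup>2) ^ Suc q) {0..pi}"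
    by (rule fundamental_theorem_of_calculus[OF pi_ge_zero D])
  then have "((\<lambda>t. - (real (Suc p) / 2) * ?f t + real (Suc q) / 2 * ?g t) has_integral 0) {0..pi}" by simp
  from has_integral_diff[OF has_integral_mult_right[OF Suc.IH[of "Suc p"], of "real (Suc q) / 2"] this]
  have "((\<lambda>t. real (Suc p) / 2 * ?f t) has_integral
      real (Suc q) / 2 * (2 * fact (Suc p) * fact q / fact (Suc p + q + 1))) {0..pi}"
    by (simp add: algebra_simps)
  from has_integral_mult_right[OF this, of "2 / real (Suc p)"]
  have "(?f has_integral 2 / real (Suc p) * (real (Suc q) / 2 * (2 * fact (Suc p) * fact q / fact (Suc p + q + 1)))) {0..pi}"
    by (simp add: mult.assoc del: of_nat_Suc power_Suc)
  also have "2 / real (Suc p) * (real (Suc q) / 2 * (2 * fact (Suc p) * fact q / fact (Suc p + q + 1))) =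
      2 * fact p * fact (Suc q) / fact (p + Suc q + 1)"
    by (simp add: fact_Suc[of p] fact_Suc[of q] del: of_nat_Suc fact_Suc)
  finally show ?case .
qed

text \<open>The quotient of factorials is a monic polynomial of degree \<open>q\<close> in
  \<open>i\<close>, and the sum is, up to sign, its \<open>r\<close>-th finite difference: 0 below
  degree \<open>r\<close>, and a factorial at degree \<open>r\<close>. The induction takes one
  difference by Pascal's rule.\<close>

lemma alternating_factorial_sum:
  "q \<le> r \<Longrightarrow> (\<Sum>i\<le>r. (-1) ^ i * real (r choose i) * (fact (a + i + q) / fact (a + i))) =
    (if q = r then (-1) ^ r * fact r else 0)"
proof (induction r arbitrary: q a)
  case 0
  then show ?case by simp
next
  case (Suc r)
  let ?g = "\<lambda>a i. fact (a + i + q) / fact (a + i) :: real"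
  have "(\<Sum>i\<le>Suc r. (-1) ^ i * real (Suc r choose i) * ?g a i) =
      (\<Sum>i\<le>Suc r. (-1) ^ i * real (r choose i) * ?g a i) +
      (\<Sum>i\<le>Suc r. (-1) ^ i * (if i = 0 then 0 else real (r choose (i - 1))) * ?g a i)"
    unfolding sum.distrib[symmetric]
  proof (intro sum.cong refl)
    fix i
    have split: "real (Suc r choose i) = real (r choose i) + (if i = 0 then 0 else real (r choose (i - 1)))"
      by (cases i) simp_all
    show "(-1) ^ i * real (Suc r choose i) * ?g a i =
       (-1) ^ i * real (r choose i) * ?g a i + (-1) ^ i * (if i = 0 then 0 else real (r choose (i - 1))) * ?g a i"
      unfolding split by (simp only: distrib_left distrib_right)
  qed
  also have "(\<Sum>i\<le>Suc r. (-1) ^ i * real (r choose i) * ?g a i) = (\<Sum>i\<le>r. (-1) ^ i * real (r choose i) * ?g a i)"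
    by (simp add: binomial_eq_0)
  also have "(\<Sum>i\<le>Suc r. (-1) ^ i * (if i = 0 then 0 else real (r choose (i - 1))) * ?g a i) =
      (\<Sum>i\<le>r. - ((-1) ^ i * real (r choose i) * ?g (Suc a) i))"
    by (subst sum.atMost_Suc_shift) simp
  also have "(\<Sum>i\<le>r. (-1) ^ i * real (r choose i) * ?g a i) + (\<Sum>i\<le>r. - ((-1) ^ i * real (r choose i) * ?g (Suc a) i)) =
      (\<Sum>i\<le>r. (-1) ^ i * real (r choose i) * (?g a i - ?g (Suc a) i))"
    by (simp add: sum.distrib[symmetric] algebra_simps)
  finally have step: "(\<Sum>i\<le>Suc r. (-1) ^ i * real (Suc r choose i) * ?g a i) =
      (\<Sum>i\<le>r. (-1) ^ i * real (r choose i) * (?g a i - ?g (Suc a) i))" .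
  show ?case
  proof (cases q)
    case 0
    then show ?thesis unfolding step by simp
  next
    case (Suc q')
    \<comment> \<open>Differencing a rising factorial lowers its degree by one and brings down the
      factor \<open>q\<close>; the base \<open>a\<close> moves up, hence the induction over
      arbitrary \<open>a\<close>.\<close>
    have "?g a i - ?g (Suc a) i = - real q * (fact (Suc a + i + q') / fact (Suc a + i))" for i
    proof -
      define F G where "F = (fact (a + i) :: real)" and "G = (fact (Suc (a + i + q')) :: real)"
      have "fact (a + i + q) = G" "fact (Suc a + i + q) = (real (a + i + q') + 2) * G"
        "fact (Suc a + i) = (real (a + i) + 1) * F" "fact (Suc a + i + q') = G" "F \<noteq> 0"
        by (simp_all add: F_def G_def Suc algebra_simps)
      then show ?thesis unfolding F_def[symmetric] by (simp only:) (simp add: Suc divide_simps, simp add: algebra_simps)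
    qed
    then have "(\<Sum>i\<le>r. (-1) ^ i * real (r choose i) * (?g a i - ?g (Suc a) i)) =
       - real q * (\<Sum>i\<le>r. (-1) ^ i * real (r choose i) * (fact (Suc a + i + q') / fact (Suc a + i)))"
      by (simp add: sum_distrib_left mult_ac)
    also have "\<dots> = - real q * (if q' = r then (-1) ^ r * fact r else 0)"
      using Suc.IH[of q' "Suc a"] Suc.prems Suc by simp
    finally have S: "(\<Sum>i\<le>r. (-1) ^ i * real (r choose i) * (?g a i - ?g (Suc a) i)) =
       - real q * (if q' = r then (-1) ^ r * fact r else 0)" .
    show ?thesis unfolding step S using Suc by (simp add: algebra_simps)
  qed
qed

text \<open>Integrating term by term gives Beta integrals whose denominators do not depend on
  \<open>i\<close>. What remains is the alternating sum, so the polynomial is orthogonal to all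
  lower powers of the squared sine.\<close>

lemma has_integral_wigner_poly_power:
  assumes "q \<le> r"
  shows "((\<lambda>t. sin t * ((cos (t / 2))\<^sup>2) ^ b * ((sin (t / 2))\<^sup>2) ^ a * wigner_poly a b r ((sin (t / 2))\<^sup>2) * ((sin (t / 2))\<^sup>2) ^ q)
    has_integral (if q = r then 2 * (-1) ^ r / fact (a + b + 2 * r + 1) else 0)) {0..pi}"
proof -
  let ?S = "\<lambda>t::real. (sin (t / 2))\<^sup>2" and ?C = "\<lambda>t::real. (cos (t / 2))\<^sup>2"
  let ?k = "\<lambda>i. (-1) ^ i / (fact i * fact (a + i) * fact (r - i) * fact (b + (r - i))) :: real"
  have "((\<lambda>t. \<Sum>i\<le>r. ?k i * (sin t * ?C t ^ (b + (r - i)) * ?S t ^ (a + i + q))) has_integral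
      (\<Sum>i\<le>r. ?k i * (2 * fact (b + (r - i)) * fact (a + i + q) / fact (b + (r - i) + (a + i + q) + 1)))) {0..pi}"
    by (intro has_integral_sum has_integral_mult_right has_integral_sin_half_powers) simp
  moreover have "(\<Sum>i\<le>r. ?k i * (sin t * ?C t ^ (b + (r - i)) * ?S t ^ (a + i + q))) =
      sin t * ?C t ^ b * ?S t ^ a * wigner_poly a b r (?S t) * ?S t ^ q" for t
  proof -
    have "1 - ?S t = ?C t" by (simp add: cos_squared_eq)
    then show ?thesis unfolding wigner_poly_def sum_distrib_left sum_distrib_right power_add
      by (intro sum.cong refl) (simp add: mult_ac)
  qed
  moreover have "(\<Sum>i\<le>r. ?k i * (2 * fact (b + (r - i)) * fact (a + i + q) / fact (b + (r - i) + (a + i + q) + 1))) =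
      (if q = r then 2 * (-1) ^ r / fact (a + b + 2 * r + 1) else 0)"
  proof -
    have "(\<Sum>i\<le>r. ?k i * (2 * fact (b + (r - i)) * fact (a + i + q) / fact (b + (r - i) + (a + i + q) + 1))) =
       (\<Sum>i\<le>r. 2 / (fact r * fact (a + b + r + q + 1)) * ((-1) ^ i * real (r choose i) * (fact (a + i + q) / fact (a + i))))"
    proof (intro sum.cong refl)
      fix i assume "i \<in> {..r}"
      then have i: "i \<le> r" by simp
      then have e: "b + (r - i) + (a + i + q) + 1 = a + b + r + q + 1" by simp
      show "?k i * (2 * fact (b + (r - i)) * fact (a + i + q) / fact (b + (r - i) + (a + i + q) + 1)) =
        2 / (fact r * fact (a + b + r + q + 1)) * ((-1) ^ i * real (r choose i) * (fact (a + i + q) / fact (a + i)))"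
      proof -
        define F where "F = (fact (a + b + r + q + 1) :: real)"
        have "F \<noteq> 0" by (simp add: F_def)
        then show ?thesis unfolding e binomial_fact[OF i] F_def[symmetric] by (simp add: mult_ac)
      qed
    qed
    also have "\<dots> = 2 / (fact r * fact (a + b + r + q + 1)) * (if q = r then (-1) ^ r * fact r else 0)"
      unfolding sum_distrib_left[symmetric] alternating_factorial_sum[OF assms] ..
    also have "\<dots> = (if q = r then 2 * (-1) ^ r / fact (a + b + 2 * r + 1) else 0)"
    proof (cases "q = r")
      case True
      have "a + b + r + r + 1 = a + b + 2 * r + 1" by simp
      then show ?thesis unfolding True by (simp only: if_True) simp
    qed simp
    finally show ?thesis .
  qed
  ultimately show ?thesis by simp
qed

text \<open>For the norm only the leading coefficient matters, since all lower powers are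
  orthogonal; it is a Vandermonde sum.\<close>

lemma wigner_poly_power_basis:
  obtains e where "\<And>x. wigner_poly a b r x = (\<Sum>q\<le>r. e q * x ^ q)"
    and "e r = (-1) ^ r * real ((2 * r + a + b) choose r) / (fact (r + a) * fact (r + b))"
proof -
  let ?k = "\<lambda>i. (-1) ^ i / (fact i * fact (a + i) * fact (r - i) * fact (b + (r - i))) :: real"
  define Q where "Q = (\<Sum>i\<le>r. smult (?k i) ([:1, -1:] ^ (r - i) * [:0, 1:] ^ i))"
  have deg: "degree Q \<le> r"
    unfolding Q_def
  proof (intro degree_sum_le order_trans[OF degree_smult_le])
    fix i assume "i \<in> {..r}"
    then show "degree ([:1, -1:] ^ (r - i) * [:0, 1::real:] ^ i) \<le> r"
      using degree_linear_powers_le[of 1 "-1" "r - i" 0 1 i] by simp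
  qed simp
  have "wigner_poly a b r x = poly Q x" for x
    by (simp add: Q_def wigner_poly_def poly_sum mult_ac)
  also have "poly Q x = (\<Sum>q\<le>r. coeff Q q * x ^ q)" for x
    unfolding poly_altdef by (rule sum.mono_neutral_left) (use deg in \<open>auto simp: coeff_eq_0\<close>)
  finally have "wigner_poly a b r x = (\<Sum>q\<le>r. coeff Q q * x ^ q)" for x .
  moreover have "coeff Q r = (-1) ^ r * real ((2 * r + a + b) choose r) / (fact (r + a) * fact (r + b))"
  proof -
    have "coeff Q r = (\<Sum>i\<le>r. ?k i * (-1) ^ (r - i))"
    proof -
      have "coeff ([:1, -1:] ^ (r - i) * [:0, 1::real:] ^ i) r = (-1) ^ (r - i)" if "i \<le> r" for i
      proof -
        have "[:0, 1::real:] ^ i = monom 1 i" by (simp add: monom_altdef)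
        then show ?thesis using that by (simp add: mult.commute[of _ "monom 1 i"] coeff_monom_mult coeff_linear_poly_power')
      qed
      then show ?thesis unfolding Q_def by (simp add: coeff_sum)
    qed
    also have "\<dots> = (\<Sum>i\<le>r. (-1) ^ r / (fact (r + a) * fact (r + b)) * real (((r + b) choose i) * ((r + a) choose (r - i))))"
    proof (intro sum.cong refl)
      fix i assume "i \<in> {..r}"
      then have i: "i \<le> r" by simp
      have "(-1) ^ i * (-1) ^ (r - i) = ((-1) ^ r :: real)" using i by (simp flip: power_add)
      moreover have "real ((r + b) choose i) = fact (r + b) / (fact i * fact (b + (r - i)))"
      proof -
        have "i \<le> r + b" "r + b - i = b + (r - i)" using i by auto
        then show ?thesis using binomial_fact[of i "r + b"] by simp
      qed
      moreover have "real ((r + a) choose (r - i)) = fact (r + a) / (fact (r - i) * fact (a + i))"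
      proof -
        have "r - i \<le> r + a" "r + a - (r - i) = a + i" using i by auto
        then show ?thesis using binomial_fact[of "r - i" "r + a"] by simp
      qed
      ultimately show "?k i * (-1) ^ (r - i) =
         (-1) ^ r / (fact (r + a) * fact (r + b)) * real (((r + b) choose i) * ((r + a) choose (r - i)))"
        unfolding of_nat_mult by (simp add: mult_ac)
    qed
    also have "\<dots> = (-1) ^ r / (fact (r + a) * fact (r + b)) * real (\<Sum>i\<le>r. ((r + b) choose i) * ((r + a) choose (r - i)))"
      by (simp only: sum_distrib_left of_nat_sum)
    also have "(\<Sum>i\<le>r. ((r + b) choose i) * ((r + a) choose (r - i))) = (2 * r + a + b) choose r"
      unfolding vandermonde by (simp add: mult_2 add_ac)
    finally show ?thesis by simp
  qed
  ultimately show thesis by (rule that)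
qed

text \<open>Of the factor of smaller degree, expanded in powers, at most the leading term survives
  against the other factor.\<close>

lemma has_integral_wigner_poly_product:
  assumes "r' \<le> r"
  shows "((\<lambda>t. sin t * ((cos (t / 2))\<^sup>2) ^ b * ((sin (t / 2))\<^sup>2) ^ a *
      wigner_poly a b r ((sin (t / 2))\<^sup>2) * wigner_poly a b r' ((sin (t / 2))\<^sup>2))
    has_integral (if r' = r then 2 / (real (2 * r + a + b + 1) * (fact r * fact (r + a) * fact (r + b) * fact (r + a + b))) else 0)) {0..pi}"
proof -
  obtain e where e: "\<And>x. wigner_poly a b r' x = (\<Sum>q\<le>r'. e q * x ^ q)"
    and lead: "e r' = (-1) ^ r' * real ((2 * r' + a + b) choose r') / (fact (r' + a) * fact (r' + b))"
    using wigner_poly_power_basis[of a b r'] by blast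
  let ?S = "\<lambda>t::real. (sin (t / 2))\<^sup>2" and ?C = "\<lambda>t::real. (cos (t / 2))\<^sup>2"
  have "((\<lambda>t. \<Sum>q\<le>r'. e q * (sin t * ?C t ^ b * ?S t ^ a * wigner_poly a b r (?S t) * ?S t ^ q)) has_integral
      (\<Sum>q\<le>r'. e q * (if q = r then 2 * (-1) ^ r / fact (a + b + 2 * r + 1) else 0))) {0..pi}"
    by (intro has_integral_sum has_integral_mult_right has_integral_wigner_poly_power) (use assms in auto)
  moreover have "(\<Sum>q\<le>r'. e q * (sin t * ?C t ^ b * ?S t ^ a * wigner_poly a b r (?S t) * ?S t ^ q)) =
     sin t * ?C t ^ b * ?S t ^ a * wigner_poly a b r (?S t) * wigner_poly a b r' (?S t)" for t
    unfolding e by (simp add: sum_distrib_left mult_ac)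
  moreover have "(\<Sum>q\<le>r'. e q * (if q = r then 2 * (-1) ^ r / fact (a + b + 2 * r + 1) else 0)) =
    (if r' = r then 2 / (real (2 * r + a + b + 1) * (fact r * fact (r + a) * fact (r + b) * fact (r + a + b))) else 0)"
  proof (cases "r' = r")
    case True
    have "(\<Sum>q\<le>r'. e q * (if q = r then 2 * (-1) ^ r / fact (a + b + 2 * r + 1) else 0)) =
       e r * (2 * (-1) ^ r / fact (a + b + 2 * r + 1))"
      using True by (subst sum.mono_neutral_right[of _ "{r}"]) auto
    also have "\<dots> = 2 * ((-1) ^ r * (-1) ^ r) * (real ((2 * r + a + b) choose r) / (fact (r + a) * fact (r + b))) / fact (a + b + 2 * r + 1)"
      using lead unfolding True by simp
    also have "\<dots> = 2 / (real (2 * r + a + b + 1) * (fact r * fact (r + a) * fact (r + b) * fact (r + a + b)))"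
    proof -
      have 1: "(-1) ^ r * (-1) ^ r = (1::real)" by (simp flip: power_add)
      have 2: "real ((2 * r + a + b) choose r) = fact (2 * r + a + b) / (fact r * fact (r + a + b))"
        using binomial_fact[of r "2 * r + a + b"] by (simp add: mult_2 add_ac)
      have 3: "fact (a + b + 2 * r + 1) = real (2 * r + a + b + 1) * fact (2 * r + a + b)"
        by (simp add: add_ac)
      show ?thesis unfolding 1 2 3 by (simp del: of_nat_add of_nat_mult)
    qed
    finally show ?thesis using True by simp
  next
    case False
    then show ?thesis using assms by (intro sum.neutral[THEN trans]) auto
  qed
  ultimately show ?thesis by simp
qed

lemma has_integral_wigner_d_product:
  assumes m: "\<bar>m\<bar> \<le> int l" "\<bar>m\<bar> \<le> int l'" and n: "\<bar>n\<bar> \<le> int l" "\<bar>n\<bar> \<le> int l'"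
  shows "((\<lambda>t. sin t * (wigner_d l m n t * wigner_d l' m n t)) has_integral
    (if l = l' then 2 / (2 * real l + 1) else 0)) {0..pi}"
  using assms
proof (induction l' l rule: linorder_wlog)
  case (le l' l)
  define a b r r' where "a = nat \<bar>m - n\<bar>" and "b = nat \<bar>m + n\<bar>" and "r = l - nat (max \<bar>m\<bar> \<bar>n\<bar>)"
    and "r' = l' - nat (max \<bar>m\<bar> \<bar>n\<bar>)"
  obtain \<sigma> :: real where \<sigma>: "\<sigma>\<^sup>2 = 1" and d: "\<And>\<beta>. wigner_d l m n \<beta> =
    \<sigma> * sqrt (fact r * fact (r + a) * fact (r + b) * fact (r + a + b)) *
    (sin (\<beta> / 2) ^ a * cos (\<beta> / 2) ^ b * wigner_poly a b r ((sin (\<beta> / 2))\<^sup>2))"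
    by (rule wigner_d_canonical[OF le(2,4), folded a_def b_def r_def]) (rule that)
  let ?N = "fact r * fact (r + a) * fact (r + b) * fact (r + a + b) :: real"
  show ?case
  proof (cases "l = l'")
    case True
    \<comment> \<open>\<open>a + b\<close> is twice the larger of the absolute values of
      \<open>m\<close> and \<open>n\<close>, so the norm depends on \<open>l\<close> alone.\<close>
    have rl: "real (2 * r + a + b + 1) = 2 * real l + 1" using le by (auto simp: r_def a_def b_def)
    have eq: "sin t * (wigner_d l m n t * wigner_d l' m n t) = ?N *
      (sin t * ((cos (t / 2))\<^sup>2) ^ b * ((sin (t / 2))\<^sup>2) ^ a *
        wigner_poly a b r ((sin (t / 2))\<^sup>2) * wigner_poly a b r ((sin (t / 2))\<^sup>2))" for t
    proof -
      have "sin t * (wigner_d l m n t * wigner_d l' m n t) = \<sigma>\<^sup>2 * (sqrt ?N)\<^sup>2 *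
        (sin t * ((cos (t / 2))\<^sup>2) ^ b * ((sin (t / 2))\<^sup>2) ^ a *
          wigner_poly a b r ((sin (t / 2))\<^sup>2) * wigner_poly a b r ((sin (t / 2))\<^sup>2))"
        unfolding True[symmetric] d by (simp add: power_mult_distrib power2_eq_square mult_ac del: real_sqrt_pow2 real_sqrt_mult_self)
      then show ?thesis using \<sigma> by simp
    qed
    have "((\<lambda>t. sin t * (wigner_d l m n t * wigner_d l' m n t)) has_integral
        ?N * (if r = r then 2 / (real (2 * r + a + b + 1) * ?N) else 0)) {0..pi}"
      unfolding eq by (intro has_integral_mult_right has_integral_wigner_poly_product order_refl)
    then show ?thesis using True unfolding rl by simp
  next
    case False
    obtain \<sigma>' :: real where d': "\<And>\<beta>. wigner_d l' m n \<beta> =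
      \<sigma>' * sqrt (fact r' * fact (r' + a) * fact (r' + b) * fact (r' + a + b)) *
      (sin (\<beta> / 2) ^ a * cos (\<beta> / 2) ^ b * wigner_poly a b r' ((sin (\<beta> / 2))\<^sup>2))"
      by (rule wigner_d_canonical[OF le(3,5), folded a_def b_def r'_def]) (rule that)
    let ?N' = "fact r' * fact (r' + a) * fact (r' + b) * fact (r' + a + b) :: real"
    have "nat (max \<bar>m\<bar> \<bar>n\<bar>) \<le> l'" using le by linarith
    then have rr: "r' \<le> r" "r' \<noteq> r" using le(1) False unfolding r_def r'_def by linarith+
    have eq: "sin t * (wigner_d l m n t * wigner_d l' m n t) = (\<sigma> * sqrt ?N) * (\<sigma>' * sqrt ?N') *
      (sin t * ((cos (t / 2))\<^sup>2) ^ b * ((sin (t / 2))\<^sup>2) ^ a *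
        wigner_poly a b r ((sin (t / 2))\<^sup>2) * wigner_poly a b r' ((sin (t / 2))\<^sup>2))" for t
    proof -
      define K K' where "K = \<sigma> * sqrt ?N" and "K' = \<sigma>' * sqrt ?N'"
      show ?thesis unfolding d d' K_def[symmetric] K'_def[symmetric]
        by (simp add: power_mult_distrib power2_eq_square mult_ac)
    qed
    have "((\<lambda>t. sin t * (wigner_d l m n t * wigner_d l' m n t)) has_integral
        (\<sigma> * sqrt ?N) * (\<sigma>' * sqrt ?N') * (if r' = r then 2 / (real (2 * r + a + b + 1) * ?N) else 0)) {0..pi}"
      unfolding eq by (intro has_integral_mult_right has_integral_wigner_poly_product rr)
    then show ?thesis using rr False by simp
  qed
next
  case (sym l' l)
  then show ?case by (cases "l = l'") (simp_all add: mult.commute)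
qed

section \<open>Integration over the sphere in spherical coordinates\<close>

lemma continuous_on_wigner_d: "continuous_on A (wigner_d l m n)"
  unfolding wigner_d_def[abs_def] by (intro continuous_intros) auto

lemma spherical_on_sphere: "spherical \<theta> \<phi> \<in> sphere 0 1"
proof -
  have "(sin \<theta> * cos \<phi>)\<^sup>2 + (sin \<theta> * sin \<phi>)\<^sup>2 + (cos \<theta>)\<^sup>2 =
      (sin \<theta>)\<^sup>2 * ((sin \<phi>)\<^sup>2 + (cos \<phi>)\<^sup>2) + (cos \<theta>)\<^sup>2"
    by (simp add: power_mult_distrib algebra_simps del: sin_cos_squared_add sin_cos_squared_add2)
  then have "(sin \<theta> * cos \<phi>)\<^sup>2 + (sin \<theta> * sin \<phi>)\<^sup>2 + (cos \<theta>)\<^sup>2 = 1" by simp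
  then show ?thesis
    by (simp add: norm_eq_sqrt_inner inner_vec_def sum_3 spherical_def power2_eq_square)
qed

lemma colatitude_spherical: "0 \<le> \<theta> \<Longrightarrow> \<theta> \<le> pi \<Longrightarrow> colatitude (spherical \<theta> \<phi>) = \<theta>"
  by (simp add: colatitude_def spherical_def arccos_cos)

lemma longitude_spherical:
  assumes "0 < \<theta>" "\<theta> < pi" "-pi < \<phi>" "\<phi> \<le> pi"
  shows "longitude (spherical \<theta> \<phi>) = \<phi>"
proof -
  have "Complex (sin \<theta> * cos \<phi>) (sin \<theta> * sin \<phi>) = rcis (sin \<theta>) \<phi>"
    by (simp add: rcis_def complex_eq_iff)
  moreover have "0 < sin \<theta>" using assms by (intro sin_gt_zero)
  ultimately show ?thesis
    using assms by (simp add: longitude_def spherical_def Arg_rcis)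
qed

definition sphere_chart_density :: "real \<times> real \<Rightarrow> real" where
  "sphere_chart_density = (\<lambda>(\<theta>, \<phi>). indicator ({0..pi} \<times> {-pi<..pi}) (\<theta>, \<phi>) * sin \<theta>)"

lemma sphere_chart_density_nonneg: "0 \<le> sphere_chart_density p"
  by (auto simp: sphere_chart_density_def indicator_def sin_ge_zero split: prod.split)

lemma sphere_chart_density_measurable[measurable]: "sphere_chart_density \<in> borel_measurable lborel"
proof -
  have "(\<lambda>p::real\<times>real. sin (fst p)) \<in> borel_measurable borel"
    by (intro borel_measurable_continuous_onI continuous_intros)
  moreover have "{0..pi} \<times> {-pi<..pi} \<in> sets (borel :: (real \<times> real) measure)"
    by (simp add: borel_prod[symmetric])
  ultimately have "(\<lambda>p. indicator ({0..pi} \<times> {-pi<..pi}) p * sin (fst p)) \<in> borel_measurable borel"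
    by simp
  then show ?thesis by (simp add: sphere_chart_density_def case_prod_beta')
qed

lemma spherical_measurable[measurable]:
  "(\<lambda>(\<theta>, \<phi>). spherical \<theta> \<phi>) \<in> lborel \<rightarrow>\<^sub>M restrict_space borel (sphere 0 1)"
proof -
  have "(\<lambda>(\<theta>, \<phi>). spherical \<theta> \<phi>) = (\<lambda>p. (sin (fst p) * cos (snd p)) *\<^sub>R axis 1 1 +
      (sin (fst p) * sin (snd p)) *\<^sub>R axis 2 1 + cos (fst p) *\<^sub>R (axis 3 1 :: real^3))"
    by (auto simp: fun_eq_iff spherical_def vec_eq_iff forall_3 axis_def)
  then have "continuous_on UNIV (\<lambda>(\<theta>, \<phi>). spherical \<theta> \<phi>)"
    by (simp only:) (intro continuous_intros)
  then have "(\<lambda>(\<theta>, \<phi>). spherical \<theta> \<phi>) \<in> lborel \<rightarrow>\<^sub>M borel"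
    by (simp add: borel_measurable_continuous_onI)
  then show ?thesis
    by (rule measurable_restrict_space2[rotated]) (use spherical_on_sphere in auto)
qed

definition sphere_borel_measure :: "(real^3) measure" where
  "sphere_borel_measure = distr (density lborel (\<lambda>p. ennreal (sphere_chart_density p)))
     (restrict_space borel (sphere 0 1)) (\<lambda>(\<theta>, \<phi>). spherical \<theta> \<phi>)"

lemma surface_measure_eq: "surface_measure = completion sphere_borel_measure"
proof -
  have "(\<lambda>(\<theta>, \<phi>). indicator ({0..pi} \<times> {-pi<..pi}) (\<theta>, \<phi>) * ennreal (sin \<theta>)) =
      (\<lambda>p. ennreal (sphere_chart_density p))"
    by (auto simp: fun_eq_iff sphere_chart_density_def indicator_def)
  then show ?thesis unfolding surface_measure_def sphere_borel_measure_def by simp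
qed

lemma sets_sphere_borel_measure: "sets sphere_borel_measure = sets (restrict_space borel (sphere 0 1))"
  by (simp add: sphere_borel_measure_def)

lemma space_surface_measure[simp]: "space surface_measure = sphere 0 1"
  by (simp add: surface_measure_eq sphere_borel_measure_def space_restrict_space)

lemma measurable_surface_measure:
  assumes "f \<in> restrict_space borel (sphere 0 1) \<rightarrow>\<^sub>M N"
  shows "f \<in> surface_measure \<rightarrow>\<^sub>M N"
proof -
  have "f \<in> sphere_borel_measure \<rightarrow>\<^sub>M N"
    using assms by (simp cong: measurable_cong_sets add: sets_sphere_borel_measure)
  then show ?thesis unfolding surface_measure_eq by (rule measurable_completion)
qed

lemma finite_measure_surface_measure: "finite_measure surface_measure"
proof
  have int: "(\<integral>\<^sup>+ p. ennreal (sphere_chart_density p) \<partial>lborel) \<le>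
      (\<integral>\<^sup>+ p. indicator (cbox (0, -pi) (pi, pi)) p \<partial>lborel)"
    by (intro nn_integral_mono)
       (auto simp: sphere_chart_density_def indicator_def cbox_Pair_eq sin_ge_zero split: prod.split)
  also have "\<dots> < \<infinity>" by (simp add: emeasure_lborel_cbox_finite[unfolded infinity_ennreal_def])
  finally have fin: "(\<integral>\<^sup>+ p. ennreal (sphere_chart_density p) \<partial>lborel) < \<infinity>" .
  let ?S = "sphere 0 1 :: (real^3) set"
  have "?S \<in> sets sphere_borel_measure"
    using sets.top[of "restrict_space borel ?S"] unfolding sets_sphere_borel_measure by (simp add: space_restrict_space)
  then have "emeasure surface_measure ?S = emeasure sphere_borel_measure ?S"
    unfolding surface_measure_eq by simp
  also have "\<dots> \<le> (\<integral>\<^sup>+ p. ennreal (sphere_chart_density p) \<partial>lborel)"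
  proof -
    let ?D = "density lborel (\<lambda>p. ennreal (sphere_chart_density p))"
    have "?S \<in> sets (restrict_space borel ?S)"
      using sets.top[of "restrict_space borel ?S"] by (simp add: space_restrict_space)
    moreover have "(\<lambda>(\<theta>, \<phi>). spherical \<theta> \<phi>) \<in> ?D \<rightarrow>\<^sub>M restrict_space borel ?S"
      using spherical_measurable by simp
    ultimately have "emeasure sphere_borel_measure ?S \<le> emeasure ?D (space ?D)"
      unfolding sphere_borel_measure_def by (simp only: emeasure_distr emeasure_space)
    then show ?thesis by (simp add: emeasure_density)
  qed
  finally show "emeasure surface_measure (space surface_measure) \<noteq> \<infinity>"
    using fin by auto
qed

lemma integral_surface_measure:
  fixes f :: "real^3 \<Rightarrow> 'b::{banach, second_countable_topology}"
  assumes f: "f \<in> restrict_space borel (sphere 0 1) \<rightarrow>\<^sub>M borel"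
  shows "(LINT x|surface_measure. f x) = (LINT p|lborel. sphere_chart_density p *\<^sub>R f (case p of (\<theta>, \<phi>) \<Rightarrow> spherical \<theta> \<phi>))"
proof -
  have "f \<in> sphere_borel_measure \<rightarrow>\<^sub>M borel"
    using f by (simp cong: measurable_cong_sets add: sets_sphere_borel_measure)
  then have "(LINT x|surface_measure. f x) = (LINT x|sphere_borel_measure. f x)"
    unfolding surface_measure_eq by (rule integral_completion)
  also have "\<dots> = (LINT p|density lborel (\<lambda>p. ennreal (sphere_chart_density p)). f (case p of (\<theta>, \<phi>) \<Rightarrow> spherical \<theta> \<phi>))"
    unfolding sphere_borel_measure_def by (rule integral_distr) (use f spherical_measurable in simp_all)
  also have "\<dots> = (LINT p|lborel. sphere_chart_density p *\<^sub>R f (case p of (\<theta>, \<phi>) \<Rightarrow> spherical \<theta> \<phi>))"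
    by (rule integral_density)
       (use measurable_compose[OF spherical_measurable f] sphere_chart_density_nonneg in auto)
  finally show ?thesis .
qed

text \<open>\<open>Arg\<close> is continuous off the nonpositive real axis and takes only the values
  0 and \<open>pi\<close> on it.\<close>

lemma Arg_measurable: "Arg \<in> borel_measurable borel"
proof -
  have eq: "Arg = (\<lambda>z. if z \<in> \<real>\<^sub>\<le>\<^sub>0 then (if z = 0 then 0 else pi) else Arg z)"
  proof
    fix z show "Arg z = (if z \<in> \<real>\<^sub>\<le>\<^sub>0 then (if z = 0 then 0 else pi) else Arg z)"
      using Arg_eq_pi[of z]
      by (cases "z = 0") (auto simp: complex_nonpos_Reals_iff Arg_zero, auto simp: complex_eq_iff)
  qed
  have m: "(\<lambda>z::complex. if z = 0 then 0 else pi) \<in> borel_measurable borel" by measurable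
  have "(\<lambda>z. if z \<in> \<real>\<^sub>\<le>\<^sub>0 then (if z = 0 then 0 else pi) else Arg z) \<in> borel_measurable borel"
  proof (subst measurable_If_restrict_space_iff)
    have "closed (\<real>\<^sub>\<le>\<^sub>0 :: complex set)" by (rule closed_nonpos_Reals_complex)
    then show "{z \<in> space borel. z \<in> (\<real>\<^sub>\<le>\<^sub>0 :: complex set)} \<in> sets borel" by simp
    have "Arg \<in> borel_measurable (restrict_space borel (- \<real>\<^sub>\<le>\<^sub>0))"
      by (intro borel_measurable_continuous_on_restrict continuous_on_Arg)
    then show "(\<lambda>z. if z = 0 then 0 else pi) \<in> borel_measurable (restrict_space borel {z::complex. z \<in> \<real>\<^sub>\<le>\<^sub>0}) \<and>
      Arg \<in> borel_measurable (restrict_space borel {z. z \<notin> \<real>\<^sub>\<le>\<^sub>0})"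
      using measurable_restrict_space1[OF m] by (simp add: Compl_eq)
  qed
  then show ?thesis by (subst eq)
qed

lemma spin_harmonic_measurable:
  "spin_harmonic l m s \<in> borel_measurable (restrict_space borel (sphere 0 1))"
proof -
  let ?S = "restrict_space borel (sphere 0 1) :: (real^3) measure"
  have "continuous_on (sphere 0 1) (\<lambda>x::real^3. arccos (x $ 3))"
  proof (intro continuous_intros ballI)
    fix x :: "real^3" assume "x \<in> sphere 0 1"
    then show "-1 \<le> x $ 3 \<and> x $ 3 \<le> 1" using component_le_norm_cart[of x 3] by auto
  qed
  then have "colatitude \<in> borel_measurable ?S"
    unfolding colatitude_def[abs_def] by (rule borel_measurable_continuous_on_restrict)
  then have w: "(\<lambda>x. wigner_d l (- m) s (colatitude x)) \<in> borel_measurable ?S"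
    by (rule measurable_compose) (intro borel_measurable_continuous_onI continuous_on_wigner_d)
  have "(\<lambda>x::real^3. Complex (x $ 1) (x $ 2)) \<in> borel_measurable ?S"
    unfolding Complex_eq by (intro measurable_restrict_space1 borel_measurable_continuous_onI continuous_intros)
  from measurable_compose[OF this Arg_measurable] have "longitude \<in> borel_measurable ?S"
    unfolding longitude_def[abs_def] .
  then have "(\<lambda>x. cis (of_int m * longitude x)) \<in> borel_measurable ?S"
    by (rule measurable_compose) (intro borel_measurable_continuous_onI continuous_intros)
  then show ?thesis
    unfolding spin_harmonic_def[abs_def] using w by measurable
qed

lemma spin_harmonic_bound:
  assumes "x \<in> sphere 0 1" "\<bar>s\<bar> \<le> int l" "\<bar>m\<bar> \<le> int l"
  shows "(cmod (spin_harmonic l m s x))\<^sup>2 \<le> (2 * real l + 1) / (4 * pi)"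
  unfolding sum_spin_harmonic_norm[OF assms(1,2), symmetric]
  by (rule member_le_sum) (use assms in auto)

lemma integral_cis_period:
  "(LINT t|lborel. indicator {-pi<..pi} t *\<^sub>R cis (of_int k * t)) = (if k = 0 then 2 * of_real pi else 0)"
proof -
  have c: "continuous_on {-pi..pi} (\<lambda>t. cis (of_int k * t))" by (intro continuous_intros)
  have "(LINT t|lborel. indicator {-pi<..pi} t *\<^sub>R cis (of_int k * t)) = (LINT t:{-pi..pi}|lborel. cis (of_int k * t))"
    unfolding set_lebesgue_integral_def
  proof (rule integral_cong_AE)
    have [measurable]: "(\<lambda>t. cis (of_int k * t)) \<in> borel_measurable borel"
      by (intro borel_measurable_continuous_onI continuous_intros)
    show "(\<lambda>t. indicator {-pi<..pi} t *\<^sub>R cis (of_int k * t)) \<in> borel_measurable lborel"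
      "(\<lambda>t. indicator {-pi..pi} t *\<^sub>R cis (of_int k * t)) \<in> borel_measurable lborel" by measurable
    show "AE t in lborel. indicator {-pi<..pi} t *\<^sub>R cis (of_int k * t) = indicator {-pi..pi} t *\<^sub>R cis (of_int k * t)"
      by (rule eventually_mono[OF AE_lborel_singleton[of "-pi"]]) (auto simp: indicator_def)
  qed
  also have "\<dots> = integral {-pi..pi} (\<lambda>t. cis (of_int k * t))"
    by (rule set_borel_integral_eq_integral) (rule borel_integrable_atLeastAtMost'[OF c])
  also have "\<dots> = (if k = 0 then 2 * of_real pi else 0)"
  proof (cases "k = 0")
    case True
    then show ?thesis by (simp add: scaleR_conv_of_real)
  next
    case False
    have "((\<lambda>t. cis (of_int k * t)) has_integral
        cis (of_int k * pi) / (\<i> * of_int k) - cis (of_int k * (- pi)) / (\<i> * of_int k)) {-pi..pi}"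
    proof (rule fundamental_theorem_of_calculus)
      fix t assume "t \<in> {-pi..pi}"
      have "((\<lambda>z. exp (\<i> * of_int k * z) / (\<i> * of_int k)) has_field_derivative exp (\<i> * of_int k * of_real t)) (at (of_real t))"
        using False by (auto intro!: derivative_eq_intros)
      from has_vector_derivative_real_field[OF this, of "{-pi..pi}"]
      show "((\<lambda>t. cis (of_int k * t) / (\<i> * of_int k)) has_vector_derivative cis (of_int k * t)) (at t within {-pi..pi})"
        by (simp add: cis_conv_exp mult_ac)
    qed simp
    moreover have "cis (of_int k * pi) = cis (of_int k * (- pi))"
      by (auto simp: complex_eq_iff sin_zero_iff_int2)
    ultimately show ?thesis using False by (simp add: integral_unique)
  qed
  finally show ?thesis .
qed

text \<open>The integrand splits into a colatitude and a longitude factor. The latter forces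
  \<open>m = m'\<close>; then both Wigner functions have the same indices and their orthogonality in
  \<open>l\<close> applies.\<close>

lemma spin_harmonic_orthonormal:
  assumes l: "\<bar>s\<bar> \<le> int l" "\<bar>s\<bar> \<le> int l'" and m: "\<bar>m\<bar> \<le> int l" "\<bar>m'\<bar> \<le> int l'"
  shows "(LINT x|surface_measure. spin_harmonic l m s x * cnj (spin_harmonic l' m' s x)) =
    (if l = l' \<and> m = m' then 1 else 0)"
proof -
  let ?Y = "\<lambda>x. spin_harmonic l m s x * cnj (spin_harmonic l' m' s x)"
  let ?c = "\<lambda>l m. (-1) powi m * sqrt ((2 * real l + 1) / (4 * pi))"
  let ?A = "\<lambda>t. indicator {0..pi} t *\<^sub>R (sin t * (wigner_d l (- m) s t * wigner_d l' (- m') s t))"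
  let ?B = "\<lambda>t. indicator {-pi<..pi} t *\<^sub>R cis (of_int (m - m') * t)"
  have Ym: "?Y \<in> restrict_space borel (sphere 0 1) \<rightarrow>\<^sub>M borel"
    using spin_harmonic_measurable[of l m s] spin_harmonic_measurable[of l' m' s]
    by (intro borel_measurable_times) (auto intro: borel_measurable_continuous_on[OF continuous_on_cnj[OF continuous_on_id]])
  let ?K = "complex_of_real (?c l m * ?c l' m')"
  have eq: "sphere_chart_density p *\<^sub>R ?Y (case p of (\<theta>, \<phi>) \<Rightarrow> spherical \<theta> \<phi>) =
      ?K * (of_real (?A (fst p)) * ?B (snd p))" for p
  proof (cases p)
    case (Pair \<theta> \<phi>)
    show ?thesis
    proof (cases "0 < \<theta> \<and> \<theta> < pi \<and> -pi < \<phi> \<and> \<phi> \<le> pi")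
      case True
      have "cis (of_int m * \<phi>) * cnj (cis (of_int m' * \<phi>)) = cis (of_int (m - m') * \<phi>)"
        by (simp add: cis_cnj cis_mult left_diff_distrib)
      then show ?thesis
        using True unfolding Pair
        by (simp add: sphere_chart_density_def spin_harmonic_def colatitude_spherical longitude_spherical scaleR_conv_of_real mult_ac)
           (simp add: mult.left_commute mult.assoc)?
    next
      \<comment> \<open>On the edges \<open>\<theta> = 0\<close> and \<open>\<theta> = pi\<close>
        the longitude does not recover \<open>\<phi>\<close>, but both sides vanish there together
        with \<open>sin \<theta>\<close>.\<close>
      case False
      then have "sphere_chart_density p = 0 \<and> (?A \<theta> = 0 \<or> ?B \<phi> = 0)"
        unfolding Pair sphere_chart_density_def by (auto simp: indicator_def not_less)
      then show ?thesis unfolding Pair by auto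
    qed
  qed
  have cA: "continuous_on {0..pi} (\<lambda>t. sin t * (wigner_d l (- m) s t * wigner_d l' (- m') s t))"
    by (intro continuous_intros continuous_on_wigner_d)
  have intA: "integrable lborel ?A"
    using borel_integrable_atLeastAtMost'[OF cA] unfolding set_integrable_def .
  have intB: "integrable lborel ?B"
  proof (rule integrableI_bounded_set[of "{-pi<..pi}" _ _ 1])
    have "(\<lambda>t. cis (of_int (m - m') * t)) \<in> borel_measurable borel"
      by (intro borel_measurable_continuous_onI continuous_intros)
    then show "?B \<in> borel_measurable lborel" by simp
  qed (auto simp: indicator_def)
  have intA': "integrable lborel (\<lambda>t. complex_of_real (?A t))" using intA by (rule integrable_of_real)
  have "(LINT x|surface_measure. ?Y x) = ?K * (LINT p|lborel. of_real (?A (fst p)) * ?B (snd p))"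
    unfolding integral_surface_measure[OF Ym] eq by (rule integral_mult_right_zero)
  also have "(LINT p|lborel. of_real (?A (fst p)) * ?B (snd p)) =
      (LINT p|(lborel \<Otimes>\<^sub>M lborel). of_real (?A (fst p)) * ?B (snd p))"
    by (simp add: lborel_prod)
  also have "\<dots> = (LINT x|lborel. LINT y|lborel. of_real (?A x) * ?B y)"
  proof -
    have "integrable (lborel \<Otimes>\<^sub>M lborel) (\<lambda>p. complex_of_real (?A (fst p)) * ?B (snd p))"
    proof (rule lborel_pair.Fubini_integrable)
      have "(\<lambda>p. complex_of_real (?A (fst p))) \<in> borel_measurable (lborel \<Otimes>\<^sub>M lborel)"
        by (rule measurable_compose[OF measurable_fst borel_measurable_integrable[OF intA']])
      moreover have "(\<lambda>p. ?B (snd p)) \<in> borel_measurable (lborel \<Otimes>\<^sub>M lborel)"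
        by (rule measurable_compose[OF measurable_snd borel_measurable_integrable[OF intB]])
      ultimately show "(\<lambda>p. complex_of_real (?A (fst p)) * ?B (snd p)) \<in> borel_measurable (lborel \<Otimes>\<^sub>M lborel)"
        by (rule borel_measurable_times)
      show "integrable lborel (\<lambda>x. LINT y|lborel. norm (complex_of_real (?A (fst (x, y))) * ?B (snd (x, y))))"
        unfolding fst_conv snd_conv norm_mult integral_mult_right_zero
        by (rule integrable_mult_left[OF integrable_norm[OF intA']])
      show "AE x in lborel. integrable lborel (\<lambda>y. complex_of_real (?A (fst (x, y))) * ?B (snd (x, y)))"
        unfolding fst_conv snd_conv by (rule AE_I2, rule integrable_mult_right[OF intB])
    qed
    from lborel_pair.integral_fst'[OF this] show ?thesis by simp
  qed
  also have "\<dots> = (LINT x|lborel. of_real (?A x)) * (LINT y|lborel. ?B y)"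
    unfolding integral_mult_right_zero by (rule integral_mult_left_zero)
  also have "(LINT y|lborel. ?B y) = (if m = m' then 2 * of_real pi else 0)"
    unfolding integral_cis_period by simp
  also have "(LINT x|lborel. complex_of_real (?A x)) = of_real (LINT x|lborel. ?A x)"
    by (rule integral_complex_of_real)
  finally have main: "(LINT x|surface_measure. ?Y x) =
      ?K * (of_real (LINT x|lborel. ?A x) * (if m = m' then 2 * of_real pi else 0))" .
  show ?thesis
  proof (cases "m = m'")
    case False
    then show ?thesis unfolding main by simp
  next
    case True
    have "(LINT x|lborel. ?A x) = integral {0..pi} (\<lambda>t. sin t * (wigner_d l (- m) s t * wigner_d l' (- m') s t))"
      using set_borel_integral_eq_integral(2)[OF borel_integrable_atLeastAtMost'[OF cA]]
      unfolding set_lebesgue_integral_def .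
    also have "\<dots> = (if l = l' then 2 / (2 * real l + 1) else 0)"
      unfolding True using has_integral_wigner_d_product[of "- m'" l l' s] assms True
      by (simp add: integral_unique)
    finally have A: "(LINT x|lborel. ?A x) = (if l = l' then 2 / (2 * real l + 1) else 0)" .
    have "?c l m * ?c l m = (2 * real l + 1) / (4 * pi)"
    proof -
      have "(-1) powi m * (-1) powi m = (1::real)" by (simp flip: power_int_mult_distrib)
      moreover have "sqrt ((2 * real l + 1) / (4 * pi)) * sqrt ((2 * real l + 1) / (4 * pi)) = (2 * real l + 1) / (4 * pi)"
        by (rule real_sqrt_mult_self[THEN trans]) simp
      moreover have "?c l m * ?c l m = ((-1) powi m * (-1) powi m) *
          (sqrt ((2 * real l + 1) / (4 * pi)) * sqrt ((2 * real l + 1) / (4 * pi)))" by (simp only: mult_ac)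
      ultimately show ?thesis by simp
    qed
    then have c2: "?c l m * ?c l m = (2 * real l + 1) / (4 * pi)" .
    show ?thesis
    proof (cases "l = l'")
      case ll: True
      define D where "D = 2 * real l + 1"
      have "D \<noteq> 0" by (simp add: D_def)
      then have 1: "?c l m * ?c l m * (2 / (2 * real l + 1) * (2 * pi)) = 1"
        unfolding c2 unfolding D_def[symmetric] by simp
      have "(LINT x|surface_measure. ?Y x) = of_real (?c l m * ?c l m * (2 / (2 * real l + 1) * (2 * pi)))"
        unfolding main A using True ll by simp
      then show ?thesis unfolding 1 using True ll by simp
    next
      case False
      then show ?thesis unfolding main A by simp
    qed
  qed
qed

section \<open>Localisation of needlets\<close>

definition fdiff :: "('a::ring_1 \<Rightarrow> real) \<Rightarrow> 'a \<Rightarrow> real" where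
  "fdiff f x = f (x + 1) - f x"

text \<open>A discrete symbol class of order \<open>R\<close> and gain \<open>k\<close>: for
  \<open>r \<le> R\<close> the \<open>r\<close>-th difference in \<open>l\<close> is of order
  \<open>1 / B ^ ((k + r) * j)\<close>, uniformly in \<open>l\<close> and eventually in
  \<open>j\<close>. The recursion mirrors the inductions on \<open>R\<close> below, in which one
  difference trades an order for a gain.\<close>

primrec symbol_class :: "real \<Rightarrow> nat \<Rightarrow> nat \<Rightarrow> (nat \<Rightarrow> int \<Rightarrow> real) \<Rightarrow> bool" where
  "symbol_class B 0 k F \<longleftrightarrow> (\<exists>C. \<forall>\<^sub>F j in sequentially. \<forall>l. \<bar>F j l\<bar> \<le> C / B ^ (k * j))"
| "symbol_class B (Suc R) k F \<longleftrightarrow> (\<exists>C. \<forall>\<^sub>F j in sequentially. \<forall>l. \<bar>F j l\<bar> \<le> C / B ^ (k * j)) \<and>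
     symbol_class B R (Suc k) (\<lambda>j. fdiff (F j))"

lemma symbol_class_bound:
  "symbol_class B R k F \<Longrightarrow> \<exists>C. \<forall>\<^sub>F j in sequentially. \<forall>l. \<bar>F j l\<bar> \<le> C / B ^ (k * j)"
  by (cases R) simp_all

lemma symbol_class_cong:
  assumes "symbol_class B R k F" "\<forall>\<^sub>F j in sequentially. \<forall>l. F j l = G j l"
  shows "symbol_class B R k G"
  using assms
proof (induction R arbitrary: k F G)
  case 0
  then obtain C where "\<forall>\<^sub>F j in sequentially. \<forall>l. \<bar>F j l\<bar> \<le> C / B ^ (k * j)" by auto
  then have "\<forall>\<^sub>F j in sequentially. \<forall>l. \<bar>G j l\<bar> \<le> C / B ^ (k * j)"
    using 0(2) by eventually_elim auto
  then show ?case by auto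
next
  case (Suc R)
  then obtain C where "\<forall>\<^sub>F j in sequentially. \<forall>l. \<bar>F j l\<bar> \<le> C / B ^ (k * j)" by auto
  then have "\<forall>\<^sub>F j in sequentially. \<forall>l. \<bar>G j l\<bar> \<le> C / B ^ (k * j)"
    using Suc(3) by eventually_elim auto
  moreover have "symbol_class B R (Suc k) (\<lambda>j. fdiff (G j))"
  proof (rule Suc.IH)
    show "symbol_class B R (Suc k) (\<lambda>j. fdiff (F j))" using Suc.prems by simp
    show "\<forall>\<^sub>F j in sequentially. \<forall>l. fdiff (F j) l = fdiff (G j) l"
      using Suc(3) by eventually_elim (auto simp: fdiff_def)
  qed
  ultimately show ?case by auto
qed

lemma symbol_class_add:
  assumes "symbol_class B R k F" "symbol_class B R k G"
  shows "symbol_class B R k (\<lambda>j l. F j l + G j l)"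
  using assms
proof (induction R arbitrary: k F G)
  case 0
  then obtain C D where "\<forall>\<^sub>F j in sequentially. \<forall>l. \<bar>F j l\<bar> \<le> C / B ^ (k * j)"
    "\<forall>\<^sub>F j in sequentially. \<forall>l. \<bar>G j l\<bar> \<le> D / B ^ (k * j)" by auto
  then have "\<forall>\<^sub>F j in sequentially. \<forall>l. \<bar>F j l + G j l\<bar> \<le> (C + D) / B ^ (k * j)"
    by eventually_elim (auto simp: add_divide_distrib intro!: order_trans[OF abs_triangle_ineq] add_mono)
  then show ?case by auto
next
  case (Suc R)
  then obtain C D where "\<forall>\<^sub>F j in sequentially. \<forall>l. \<bar>F j l\<bar> \<le> C / B ^ (k * j)"
    "\<forall>\<^sub>F j in sequentially. \<forall>l. \<bar>G j l\<bar> \<le> D / B ^ (k * j)" by auto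
  then have "\<forall>\<^sub>F j in sequentially. \<forall>l. \<bar>F j l + G j l\<bar> \<le> (C + D) / B ^ (k * j)"
    by eventually_elim (auto simp: add_divide_distrib intro!: order_trans[OF abs_triangle_ineq] add_mono)
  moreover have "fdiff (\<lambda>l. F j l + G j l) = (\<lambda>l. fdiff (F j) l + fdiff (G j) l)" for j
    by (auto simp: fdiff_def)
  ultimately show ?case using Suc.IH[of "Suc k" "\<lambda>j. fdiff (F j)" "\<lambda>j. fdiff (G j)"] Suc.prems by auto
qed

lemma symbol_class_cmult:
  assumes "symbol_class B R k F"
  shows "symbol_class B R k (\<lambda>j l. c * F j l)"
  using assms
proof (induction R arbitrary: k F)
  case 0
  then obtain C where "\<forall>\<^sub>F j in sequentially. \<forall>l. \<bar>F j l\<bar> \<le> C / B ^ (k * j)" by auto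
  then have "\<forall>\<^sub>F j in sequentially. \<forall>l. \<bar>c * F j l\<bar> \<le> (\<bar>c\<bar> * C) / B ^ (k * j)"
    by eventually_elim (auto simp: abs_mult intro!: mult_left_mono simp flip: times_divide_eq_right)
  then show ?case by auto
next
  case (Suc R)
  then obtain C where "\<forall>\<^sub>F j in sequentially. \<forall>l. \<bar>F j l\<bar> \<le> C / B ^ (k * j)" by auto
  then have "\<forall>\<^sub>F j in sequentially. \<forall>l. \<bar>c * F j l\<bar> \<le> (\<bar>c\<bar> * C) / B ^ (k * j)"
    by eventually_elim (auto simp: abs_mult intro!: mult_left_mono simp flip: times_divide_eq_right)
  moreover have "fdiff (\<lambda>l. c * F j l) = (\<lambda>l. c * fdiff (F j) l)" for j
    by (auto simp: fdiff_def right_diff_distrib)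
  ultimately show ?case using Suc.IH[of "Suc k" "\<lambda>j. fdiff (F j)"] Suc.prems by auto
qed

lemma symbol_class_shift:
  assumes "symbol_class B R k F"
  shows "symbol_class B R k (\<lambda>j l. F j (l + d))"
  using assms
proof (induction R arbitrary: k F)
  case 0
  then obtain C where "\<forall>\<^sub>F j in sequentially. \<forall>l. \<bar>F j l\<bar> \<le> C / B ^ (k * j)" by auto
  then have "\<forall>\<^sub>F j in sequentially. \<forall>l. \<bar>F j (l + d)\<bar> \<le> C / B ^ (k * j)" by eventually_elim auto
  then show ?case by auto
next
  case (Suc R)
  then obtain C where "\<forall>\<^sub>F j in sequentially. \<forall>l. \<bar>F j l\<bar> \<le> C / B ^ (k * j)" by auto
  then have "\<forall>\<^sub>F j in sequentially. \<forall>l. \<bar>F j (l + d)\<bar> \<le> C / B ^ (k * j)" by eventually_elim auto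
  moreover have "fdiff (\<lambda>l. F j (l + d)) = (\<lambda>l. fdiff (F j) (l + d))" for j
    by (auto simp: fdiff_def add_ac)
  ultimately show ?case using Suc.IH[of "Suc k" "\<lambda>j. fdiff (F j)"] Suc.prems by auto
qed

lemma symbol_class_gain_mono:
  assumes B: "1 < B" and "symbol_class B R (Suc k) F"
  shows "symbol_class B R k F"
  using assms(2)
proof (induction R arbitrary: k F)
  case 0
  then obtain C where "\<forall>\<^sub>F j in sequentially. \<forall>l. \<bar>F j l\<bar> \<le> C / B ^ (Suc k * j)" by auto
  then have "\<forall>\<^sub>F j in sequentially. \<forall>l. \<bar>F j l\<bar> \<le> \<bar>C\<bar> / B ^ (k * j)"
  proof eventually_elim
    case (elim j)
    have "C / B ^ (Suc k * j) \<le> \<bar>C\<bar> / B ^ (k * j)"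
      using B by (intro frac_le power_increasing) auto
    then show ?case using elim order_trans by blast
  qed
  then show ?case by auto
next
  case (Suc R)
  then obtain C where "\<forall>\<^sub>F j in sequentially. \<forall>l. \<bar>F j l\<bar> \<le> C / B ^ (Suc k * j)" by auto
  then have "\<forall>\<^sub>F j in sequentially. \<forall>l. \<bar>F j l\<bar> \<le> \<bar>C\<bar> / B ^ (k * j)"
  proof eventually_elim
    case (elim j)
    have "C / B ^ (Suc k * j) \<le> \<bar>C\<bar> / B ^ (k * j)"
      using B by (intro frac_le power_increasing) auto
    then show ?case using elim order_trans by blast
  qed
  then show ?case using Suc by auto
qed

lemma symbol_class_order_mono: "symbol_class B (Suc R) k F \<Longrightarrow> symbol_class B R k F"
  by (induction R arbitrary: k F) auto

definition dyadic_support :: "real \<Rightarrow> (nat \<Rightarrow> int \<Rightarrow> real) \<Rightarrow> bool" where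
  "dyadic_support B F \<longleftrightarrow> (\<exists>c>0. \<exists>c'. \<forall>\<^sub>F j in sequentially. \<forall>l. F j l \<noteq> 0 \<longrightarrow> c * B ^ j \<le> of_int l \<and> of_int l \<le> c' * B ^ j)"

lemma eventually_power_ge:
  assumes "1 < (B::real)" "0 < c"
  shows "\<forall>\<^sub>F j in sequentially. D \<le> c * B ^ j"
proof -
  obtain n where n: "D / c < B ^ n" using real_arch_pow[OF assms(1)] by blast
  have "D \<le> c * B ^ j" if "n \<le> j" for j
  proof -
    have "B ^ n \<le> B ^ j" using assms(1) that by (intro power_increasing) auto
    then have "D / c \<le> B ^ j" using n by linarith
    then show ?thesis using assms(2) by (simp add: field_simps)
  qed
  then show ?thesis unfolding eventually_sequentially by blast
qed

lemma dyadic_support_imp: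
  assumes "dyadic_support B F" "\<forall>\<^sub>F j in sequentially. \<forall>l. G j l \<noteq> 0 \<longrightarrow> F j l \<noteq> 0"
  shows "dyadic_support B G"
proof -
  obtain c c' where c: "0 < c" and F: "\<forall>\<^sub>F j in sequentially. \<forall>l. F j l \<noteq> 0 \<longrightarrow> c * B ^ j \<le> of_int l \<and> of_int l \<le> c' * B ^ j"
    using assms(1) unfolding dyadic_support_def by blast
  have "\<forall>\<^sub>F j in sequentially. \<forall>l. G j l \<noteq> 0 \<longrightarrow> c * B ^ j \<le> of_int l \<and> of_int l \<le> c' * B ^ j"
    using F assms(2) by eventually_elim blast
  then show ?thesis unfolding dyadic_support_def using c by blast
qed

lemma dyadic_support_shift:
  assumes B: "1 < B" and "dyadic_support B F"
  shows "dyadic_support B (\<lambda>j l. F j (l + d))"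
proof -
  obtain c c' where c: "0 < c" and F: "\<forall>\<^sub>F j in sequentially. \<forall>l. F j l \<noteq> 0 \<longrightarrow> c * B ^ j \<le> of_int l \<and> of_int l \<le> c' * B ^ j"
    using assms(2) unfolding dyadic_support_def by blast
  have "\<forall>\<^sub>F j in sequentially. \<bar>of_int d\<bar> \<le> c / 2 * B ^ j" "\<forall>\<^sub>F j in sequentially. \<bar>of_int d\<bar> \<le> 1 * B ^ j"
    using eventually_power_ge[OF B, of "c / 2" "\<bar>of_int d\<bar>"] eventually_power_ge[OF B, of 1 "\<bar>of_int d\<bar>"] c by simp_all
  then have "\<forall>\<^sub>F j in sequentially. \<forall>l. F j (l + d) \<noteq> 0 \<longrightarrow> c / 2 * B ^ j \<le> of_int l \<and> of_int l \<le> (c' + 1) * B ^ j"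
    using F
  proof eventually_elim
    case (elim j)
    show ?case
    proof (intro allI impI)
      fix l assume "F j (l + d) \<noteq> 0"
      then have "c * B ^ j \<le> of_int l + of_int d" "of_int l + of_int d \<le> c' * B ^ j"
        using elim(3) by (metis of_int_add)+
      moreover have "c * B ^ j = c / 2 * B ^ j + c / 2 * B ^ j" "(c' + 1) * B ^ j = c' * B ^ j + 1 * B ^ j"
        by (simp_all add: algebra_simps)
      ultimately show "c / 2 * B ^ j \<le> of_int l \<and> of_int l \<le> (c' + 1) * B ^ j"
        using elim(1,2) by linarith
    qed
  qed
  then show ?thesis unfolding dyadic_support_def using c half_gt_zero by blast
qed

lemma dyadic_support_add:
  assumes "dyadic_support B F" "dyadic_support B G" and B: "1 < B"
  shows "dyadic_support B (\<lambda>j l. F j l + G j l)"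
proof -
  obtain c c' where c: "0 < c" and F: "\<forall>\<^sub>F j in sequentially. \<forall>l. F j l \<noteq> 0 \<longrightarrow> c * B ^ j \<le> of_int l \<and> of_int l \<le> c' * B ^ j"
    using assms(1) unfolding dyadic_support_def by blast
  obtain d d' where d: "0 < d" and G: "\<forall>\<^sub>F j in sequentially. \<forall>l. G j l \<noteq> 0 \<longrightarrow> d * B ^ j \<le> of_int l \<and> of_int l \<le> d' * B ^ j"
    using assms(2) unfolding dyadic_support_def by blast
  have "\<forall>\<^sub>F j in sequentially. \<forall>l. F j l + G j l \<noteq> 0 \<longrightarrow> min c d * B ^ j \<le> of_int l \<and> of_int l \<le> max c' d' * B ^ j"
    using F G
  proof eventually_elim
    case (elim j)
    have "min c d * B ^ j \<le> c * B ^ j" "min c d * B ^ j \<le> d * B ^ j" "c' * B ^ j \<le> max c' d' * B ^ j" "d' * B ^ j \<le> max c' d' * B ^ j"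
      using B by (intro mult_right_mono; simp)+
    moreover have "F j l \<noteq> 0 \<or> G j l \<noteq> 0" if "F j l + G j l \<noteq> 0" for l using that by auto
    ultimately show ?case using elim by (meson order_trans)
  qed
  moreover have "0 < min c d" using c d by simp
  ultimately show ?thesis unfolding dyadic_support_def by blast
qed

lemma dyadic_support_cmult: "dyadic_support B F \<Longrightarrow> dyadic_support B (\<lambda>j l. c * F j l)"
  by (erule dyadic_support_imp) simp

lemma dyadic_support_divide: "dyadic_support B F \<Longrightarrow> dyadic_support B (\<lambda>j l. F j l / g j l)"
  by (erule dyadic_support_imp) simp

lemma dyadic_support_fdiff:
  assumes "1 < B" "dyadic_support B F"
  shows "dyadic_support B (\<lambda>j. fdiff (F j))"
proof -
  have "dyadic_support B (\<lambda>j l. F j (l + 1) + (-1) * F j l)"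
    by (intro dyadic_support_add dyadic_support_shift dyadic_support_cmult assms)
  then show ?thesis by (simp add: fdiff_def[abs_def])
qed

lemma dyadic_support_positive:
  assumes B: "1 < B" and "dyadic_support B F"
  shows "\<forall>\<^sub>F j in sequentially. \<forall>l. F j l \<noteq> 0 \<longrightarrow> (D::real) \<le> of_int l"
proof -
  obtain c c' where c: "0 < c" and F: "\<forall>\<^sub>F j in sequentially. \<forall>l. F j l \<noteq> 0 \<longrightarrow> c * B ^ j \<le> of_int l \<and> of_int l \<le> c' * B ^ j"
    using assms(2) unfolding dyadic_support_def by blast
  show ?thesis using F eventually_power_ge[OF B c, of D] by eventually_elim (meson order_trans)
qed

text \<open>On the support \<open>l\<close> is at least \<open>c * B ^ j\<close>, so half of
  \<open>p * l\<close> eventually absorbs the offset \<open>q\<close> and the quotient gains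
  \<open>B ^ j\<close>. Off the support the quotient is 0 whatever the denominator.\<close>

lemma symbol_class_divide_bound:
  assumes B: "1 < B" and F: "dyadic_support B F" and p: "0 < p"
    and bd: "\<forall>\<^sub>F j in sequentially. \<forall>l. \<bar>F j l\<bar> \<le> C / B ^ (k * j)"
  shows "\<exists>C. \<forall>\<^sub>F j in sequentially. \<forall>l. \<bar>F j l / (p * of_int l + q)\<bar> \<le> C / B ^ (Suc k * j)"
proof -
  obtain c c' where c: "0 < c" and F: "\<forall>\<^sub>F j in sequentially. \<forall>l. F j l \<noteq> 0 \<longrightarrow> c * B ^ j \<le> of_int l \<and> of_int l \<le> c' * B ^ j"
    using F unfolding dyadic_support_def by blast
  have pc: "0 < p * c / 2" using p c by simp
  have "\<forall>\<^sub>F j in sequentially. \<forall>l. \<bar>F j l / (p * of_int l + q)\<bar> \<le> (\<bar>C\<bar> / (p * c / 2)) / B ^ (Suc k * j)"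
    using F bd eventually_power_ge[OF B pc, of "\<bar>q\<bar>"]
  proof eventually_elim
    case (elim j)
    have Bj: "0 < B ^ j" "0 < B ^ (k * j)" using B by simp_all
    show ?case
    proof
      fix l
      show "\<bar>F j l / (p * of_int l + q)\<bar> \<le> (\<bar>C\<bar> / (p * c / 2)) / B ^ (Suc k * j)"
      proof (cases "F j l = 0")
        case True
        then show ?thesis using Bj pc B by simp
      next
        case False
        then have "p * (c * B ^ j) \<le> p * of_int l" using elim(1) p by simp
        then have D: "p * c / 2 * B ^ j \<le> p * of_int l + q" using elim(3) by (simp add: algebra_simps abs_le_iff)
        have D0: "0 < p * c / 2 * B ^ j" using Bj pc by simp
        have "\<bar>F j l\<bar> \<le> \<bar>C\<bar> / B ^ (k * j)"
          using elim(2) Bj by (meson abs_ge_self divide_right_mono less_imp_le order_trans)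
        then have "\<bar>F j l\<bar> / (p * of_int l + q) \<le> (\<bar>C\<bar> / B ^ (k * j)) / (p * c / 2 * B ^ j)"
          using D D0 by (intro frac_le) auto
        also have "\<dots> = (\<bar>C\<bar> / (p * c / 2)) / B ^ (Suc k * j)" by (simp add: power_add mult_ac)
        finally show ?thesis using D D0 by (simp add: abs_divide)
      qed
    qed
  qed
  then show ?thesis by blast
qed

text \<open>The discrete quotient rule: with \<open>D = p * l + q\<close>, the difference of
  \<open>F / D\<close> is the difference of \<open>F\<close> minus \<open>p * F / D\<close>, divided
  by \<open>D + p\<close>. The numerator has the gain of the difference and one order less, so the
  induction hypothesis applies to it with the offset \<open>p + q\<close>.\<close>

lemma symbol_class_divide:
  assumes B: "1 < B" and p: "0 < p"
  shows "dyadic_support B F \<Longrightarrow> symbol_class B R k F \<Longrightarrow> symbol_class B R (Suc k) (\<lambda>j l. F j l / (p * of_int l + q))"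
proof (induction R arbitrary: k F q)
  case 0
  then show ?case using symbol_class_divide_bound[OF B 0(1) p] by auto
next
  case (Suc R)
  note supp = Suc.prems(1)
  let ?G = "\<lambda>j l. F j l / (p * of_int l + q)"
  have "symbol_class B R (Suc k) ?G" by (rule Suc.IH[OF supp symbol_class_order_mono[OF Suc.prems(2)]])
  then have "symbol_class B R (Suc k) (\<lambda>j l. fdiff (F j) l + (- p) * ?G j l)"
    using Suc.prems(2) by (intro symbol_class_add symbol_class_cmult) auto
  moreover have "dyadic_support B (\<lambda>j l. fdiff (F j) l + (- p) * ?G j l)"
    by (intro dyadic_support_add dyadic_support_fdiff dyadic_support_cmult dyadic_support_divide supp B)
  ultimately have "symbol_class B R (Suc (Suc k)) (\<lambda>j l. (fdiff (F j) l + (- p) * ?G j l) / (p * of_int l + (p + q)))"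
    by (rule Suc.IH[rotated])
  \<comment> \<open>The support eventually lies where both denominators are positive, so that the
    quotient rule is not disturbed by division by 0.\<close>
  moreover have "\<forall>\<^sub>F j in sequentially. \<forall>l. (fdiff (F j) l + (- p) * ?G j l) / (p * of_int l + (p + q)) = fdiff (?G j) l"
    using dyadic_support_positive[OF B supp, of "\<bar>q\<bar> / p + 2"]
  proof eventually_elim
    case (elim j)
    show ?case
    proof
      fix l
      define D where "D = p * of_int l + q"
      have D': "p * of_int l + (p + q) = D + p" "p * of_int (l + 1) + q = D + p" by (simp_all add: D_def algebra_simps)
      show "(fdiff (F j) l + (- p) * ?G j l) / (p * of_int l + (p + q)) = fdiff (?G j) l"
      proof (cases "F j l = 0 \<and> F j (l + 1) = 0")
        case True
        then show ?thesis by (simp add: fdiff_def)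
      next
        case False
        then have "\<bar>q\<bar> / p + 1 \<le> of_int l"
          using elim[rule_format, of l] elim[rule_format, of "l + 1"] by (cases "F j l = 0") auto
        then have "\<bar>q\<bar> + p \<le> p * of_int l" using p by (simp add: field_simps)
        then have "D > 0" using p by (simp add: D_def abs_le_iff)
        then show ?thesis unfolding fdiff_def D' D_def[symmetric] using p
          by (simp add: field_simps)
      qed
    qed
  qed
  ultimately have "symbol_class B R (Suc (Suc k)) (\<lambda>j. fdiff (?G j))" by (rule symbol_class_cong)
  moreover obtain C where "\<forall>\<^sub>F j in sequentially. \<forall>l. \<bar>F j l\<bar> \<le> C / B ^ (k * j)"
    using symbol_class_bound[OF Suc.prems(2)] by blast
  ultimately show ?case using symbol_class_divide_bound[OF B supp p] by auto
qed

text \<open>The effect on multipole coefficients of the multiplication by \<open>1 - cos \<theta>\<close>.\<close>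

definition angular_diff :: "nat \<Rightarrow> (int \<Rightarrow> real) \<Rightarrow> int \<Rightarrow> real" where
  "angular_diff \<sigma> f l = (- (1/2) * fdiff f l + 1/2 * fdiff f (l + (-1))) +
     ((- (1/2)) * ((fdiff f l + fdiff f (l + (-1))) / (2 * of_int l + 1)) +
     ((real \<sigma>)\<^sup>2 * ((fdiff f l / (1 * of_int l + 1)) / (2 * of_int l + 1)) +
      (- (real \<sigma>)\<^sup>2) * ((fdiff f (l + (-1)) / (1 * of_int l + 0)) / (2 * of_int l + 1))))"

text \<open>Every summand contains a difference of the symbol, so each application gains at least
  one power of \<open>B ^ j\<close>. Further gains, from the second difference and from the
  denominators, are given up by \<open>symbol_class_gain_mono\<close>; they can be made up by
  applying the operator more often.\<close>

lemma angular_diff_class: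
  assumes B: "1 < B" and supp: "dyadic_support B F" and F: "symbol_class B (Suc R) k F"
  shows "symbol_class B R (Suc k) (\<lambda>j. angular_diff \<sigma> (F j))" "dyadic_support B (\<lambda>j. angular_diff \<sigma> (F j))"
proof -
  have D: "symbol_class B R (Suc k) (\<lambda>j. fdiff (F j))" using F by simp
  note sD = dyadic_support_fdiff[OF B supp]
  note D' = symbol_class_shift[OF D, of "-1"] and sD' = dyadic_support_shift[OF B sD, of "-1"]
  note mono = symbol_class_gain_mono[OF B]
  show "symbol_class B R (Suc k) (\<lambda>j. angular_diff \<sigma> (F j))"
    unfolding angular_diff_def[abs_def]
    by (rule symbol_class_add[OF symbol_class_add[OF symbol_class_cmult[OF D] symbol_class_cmult[OF D']]
        symbol_class_add[OF symbol_class_cmult[OF mono[OF symbol_class_divide[OF B _ dyadic_support_add[OF sD sD' B] symbol_class_add[OF D D']]]]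
        symbol_class_add[OF
          symbol_class_cmult[OF mono[OF symbol_class_divide[OF B _ dyadic_support_divide[OF sD] mono[OF symbol_class_divide[OF B _ sD D]]]]]
          symbol_class_cmult[OF mono[OF symbol_class_divide[OF B _ dyadic_support_divide[OF sD'] mono[OF symbol_class_divide[OF B _ sD' D']]]]]]]]) simp_all
  show "dyadic_support B (\<lambda>j. angular_diff \<sigma> (F j))"
    unfolding angular_diff_def[abs_def]
    by (intro dyadic_support_add[OF _ _ B] dyadic_support_cmult dyadic_support_divide sD sD')
qed

lemma sum_Suc_zero_ends:
  fixes g :: "nat \<Rightarrow> 'a::ab_group_add"
  assumes "g 0 = 0" "g (Suc N) = 0"
  shows "(\<Sum>l\<le>N. g (Suc l)) = (\<Sum>l\<le>N. g l)"
  using sum.atMost_Suc_shift[of g N] sum.atMost_Suc[of g N] assms by simp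

text \<open>Summation by parts: the three-term recurrence ties \<open>J l\<close> to its neighbours,
  and shifting indices moves this coupling onto the coefficients. Since \<open>f\<close> vanishes up
  to \<open>\<sigma> + 1\<close>, the recurrence is used only above \<open>\<sigma>\<close>, where
  it is valid, and no lower boundary term appears.\<close>

lemma angular_diff_kernel:
  fixes f :: "int \<Rightarrow> real" and x :: real
  assumes low: "\<And>l. l \<le> int \<sigma> + 1 \<Longrightarrow> f l = 0" and high: "\<And>l. int N \<le> l \<Longrightarrow> f l = 0"
  defines "J \<equiv> \<lambda>l. jacobi (2 * \<sigma>) (l - \<sigma>) x"
  shows "2 * x * (\<Sum>l\<le>N. f (int l) * ((2 * real l + 1) * J l)) =
    (\<Sum>l\<le>N. angular_diff \<sigma> f (int l) * ((2 * real l + 1) * J l))"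
proof -
  let ?b = "\<lambda>l. ((real l)\<^sup>2 - (real \<sigma>)\<^sup>2) / real l"
  let ?g = "\<lambda>l. f (int l) * ?b l * J (l - 1)"
  let ?h = "\<lambda>l. f (int l - 1) * ?b l * J l"
  let ?d = "\<lambda>l. f (int l) * ((2 * real l + 1) - (2 * real l + 1) * (real \<sigma>)\<^sup>2 / (real l * (real l + 1))) * J l"
  have step: "2 * x * (f (int l) * ((2 * real l + 1) * J l)) = ?d l - ?g l - ?h (Suc l)" for l
  proof (cases "l \<le> \<sigma>")
    case True
    then show ?thesis using low[of "int l"] by simp
  next
    case False
    then have l: "\<sigma> < l" by simp
    have "2 * x * (f (int l) * ((2 * real l + 1) * J l)) = f (int l) * (2 * x * ((2 * real l + 1) * J l))" by simp
    also have "\<dots> = ?d l - ?g l - ?h (Suc l)"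
      unfolding J_def jacobi_recurrence_multipole[OF l] by (simp add: algebra_simps)
    finally show ?thesis .
  qed
  have g: "(\<Sum>l\<le>N. ?g (Suc l)) = (\<Sum>l\<le>N. ?g l)"
    by (rule sum_Suc_zero_ends[of ?g]) (use high[of "int (Suc N)"] low[of 0] in simp_all)
  \<comment> \<open>The upper boundary term of \<open>?h\<close> carries \<open>f (int N)\<close>;
    this is why \<open>f\<close> has to vanish from \<open>N\<close> on and not merely beyond
    it.\<close>
  have h: "(\<Sum>l\<le>N. ?h (Suc l)) = (\<Sum>l\<le>N. ?h l)"
    by (rule sum_Suc_zero_ends[of ?h]) (use high[of "int N"] low[of "-1"] in simp_all)
  have "2 * x * (\<Sum>l\<le>N. f (int l) * ((2 * real l + 1) * J l)) = (\<Sum>l\<le>N. ?d l - ?g l - ?h (Suc l))"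
    unfolding sum_distrib_left step ..
  also have "\<dots> = (\<Sum>l\<le>N. ?d l - ?g (Suc l) - ?h l)"
    unfolding sum_subtractf by (simp only: g h)
  also have "\<dots> = (\<Sum>l\<le>N. angular_diff \<sigma> f (int l) * ((2 * real l + 1) * J l))"
  proof (intro sum.cong refl)
    fix l
    show "?d l - ?g (Suc l) - ?h l = angular_diff \<sigma> f (int l) * ((2 * real l + 1) * J l)"
    proof (cases "l = 0")
      case True
      then show ?thesis using low[of 0] low[of 1] low[of "-1"] by (simp add: angular_diff_def fdiff_def)
    next
      case False
      define L S F0 F1 F2 where "L = real l" and "S = (real \<sigma>)\<^sup>2" and "F0 = f (int l)" and "F1 = f (int l + 1)" and "F2 = f (int l - 1)"
      have L: "0 < L" using False by (simp add: L_def)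
      have f1: "f (int (Suc l)) = F1" by (simp add: F1_def add.commute)
      have a: "angular_diff \<sigma> f (int l) * (2 * L + 1) =
          F0 * ((2 * L + 1) - (2 * L + 1) * S / (L * (L + 1))) - F1 * (((L + 1)\<^sup>2 - S) / (L + 1)) - F2 * ((L\<^sup>2 - S) / L)"
      proof -
        have nz: "L \<noteq> 0" "L + 1 \<noteq> 0" "2 * L + 1 \<noteq> 0" using L by auto
        have "angular_diff \<sigma> f (int l) * (2 * L + 1) =
           - (L + 1) * (F1 - F0) + L * (F0 - F2) + S * ((F1 - F0) / (L + 1)) - S * ((F0 - F2) / L)"
        proof -
          have s: "(of_int (int l) :: real) = L" "fdiff f (int l) = F1 - F0" "fdiff f (int l + -1) = F0 - F2"
            by (simp_all add: L_def fdiff_def F0_def F1_def F2_def)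
          define K P Q where "K = 2 * L + 1" and "P = (F1 - F0) / (L + 1)" and "Q = (F0 - F2) / L"
          have K: "K \<noteq> 0" using nz(3) by (simp add: K_def)
          have gen: "(a + (c * (y / K) + (S * (P / K) + (- S) * (Q / K)))) * K = a * K + c * y + S * P - S * Q" for a c y
            using K by (simp add: distrib_right left_diff_distrib)
          have "angular_diff \<sigma> f (int l) * K = (- (1/2) * (F1 - F0) + 1/2 * (F0 - F2)) * K
              + (- (1/2)) * ((F1 - F0) + (F0 - F2)) + S * P - S * Q"
            unfolding angular_diff_def s S_def[symmetric] mult_1 add_0_right K_def[symmetric] P_def[symmetric]
              Q_def[symmetric] by (rule gen)
          also have "(- (1/2) * (F1 - F0) + 1/2 * (F0 - F2)) * K + (- (1/2)) * ((F1 - F0) + (F0 - F2)) =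
              - (L + 1) * (F1 - F0) + L * (F0 - F2)"
            unfolding K_def by (simp add: field_simps)
          finally show ?thesis unfolding K_def P_def Q_def .
        qed
        also have "\<dots> = F0 * ((2 * L + 1) - (2 * L + 1) * S / (L * (L + 1))) - F1 * (((L + 1)\<^sup>2 - S) / (L + 1)) - F2 * ((L\<^sup>2 - S) / L)"
        proof -
          have 1: "(2 * L + 1) * S / (L * (L + 1)) = S / L + S / (L + 1)" using nz by (simp add: field_simps)
          have 2: "((L + 1)\<^sup>2 - S) / (L + 1) = (L + 1) - S / (L + 1)" using nz by (simp add: diff_divide_distrib power2_eq_square)
          have 3: "(L\<^sup>2 - S) / L = L - S / L" using nz by (simp add: diff_divide_distrib power2_eq_square)
          show ?thesis unfolding 1 2 3 by (simp add: algebra_simps diff_divide_distrib)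
        qed
        finally show ?thesis .
      qed
      have "?d l - ?g (Suc l) - ?h l = (F0 * ((2 * L + 1) - (2 * L + 1) * S / (L * (L + 1))) - F1 * (((L + 1)\<^sup>2 - S) / (L + 1)) - F2 * ((L\<^sup>2 - S) / L)) * J l"
        unfolding f1 by (simp add: F0_def F2_def L_def S_def left_diff_distrib add.commute)
      then show ?thesis unfolding a[symmetric] by (simp add: L_def)
    qed
  qed
  finally show ?thesis .
qed

section \<open>The needlet window as a symbol\<close>

lemma fdiff_funpow_deriv:
  fixes F G :: "real \<Rightarrow> real"
  assumes "\<And>u. a < u \<Longrightarrow> (F has_real_derivative G u) (at u)"
  shows "a < u \<Longrightarrow> ((fdiff ^^ r) F has_real_derivative (fdiff ^^ r) G u) (at u)"
proof (induction r arbitrary: u)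
  case 0
  then show ?case using assms by simp
next
  case (Suc r)
  have "((\<lambda>u. (fdiff ^^ r) F (u + 1)) has_real_derivative (fdiff ^^ r) G (u + 1)) (at u)"
    using Suc.IH[of "u + 1"] Suc.prems by (simp add: DERIV_shift)
  from DERIV_diff[OF this Suc.IH[OF Suc.prems]] show ?case
    by (simp add: fdiff_def[abs_def])
qed

text \<open>The closure of the needlet coefficients under \<open>B ^ j * d/du\<close>: with
  \<open>w = sqrt ((u - s) * (u + s + 1)) / B ^ j\<close> and \<open>v = (2 * u + 1) / B ^ j\<close> one has
  \<open>B ^ j * w' = v / (2 * w)\<close> and \<open>B ^ j * v' = 2\<close>.\<close>

definition scaled_root :: "real \<Rightarrow> int \<Rightarrow> nat \<Rightarrow> real \<Rightarrow> real" where
  "scaled_root B s j u = sqrt ((u - of_int s) * (u + of_int s + 1)) / B ^ j"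

definition scaled_centre :: "real \<Rightarrow> nat \<Rightarrow> real \<Rightarrow> real" where
  "scaled_centre B j u = (2 * u + 1) / B ^ j"

inductive window_symbol :: "real \<Rightarrow> int \<Rightarrow> (real \<Rightarrow> real) \<Rightarrow> (nat \<Rightarrow> real \<Rightarrow> real) \<Rightarrow> bool"
  for B s b where
  monomial: "window_symbol B s b (\<lambda>j u. (deriv ^^ i) b (scaled_root B s j u) * scaled_centre B j u ^ p / scaled_root B s j u ^ q)"
| add: "window_symbol B s b F \<Longrightarrow> window_symbol B s b G \<Longrightarrow> window_symbol B s b (\<lambda>j u. F j u + G j u)"
| scale: "window_symbol B s b F \<Longrightarrow> window_symbol B s b (\<lambda>j u. c * F j u)"

text \<open>The last identity bounds \<open>scaled_centre\<close> wherever the window is nonzero,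
  because \<open>scaled_root\<close> is at most \<open>B\<close> there.\<close>

lemma scaled_root_facts:
  assumes B: "1 < B" and u: "of_int \<bar>s\<bar> < u"
  shows "0 < scaled_root B s j u"
    and "(scaled_root B s j has_real_derivative scaled_centre B j u / (2 * scaled_root B s j u) / B ^ j) (at u)"
    and "(scaled_centre B j has_real_derivative 2 / B ^ j) (at u)"
    and "(scaled_centre B j u)\<^sup>2 = 4 * (scaled_root B s j u)\<^sup>2 + ((2 * of_int s + 1) / B ^ j)\<^sup>2"
proof -
  have Bj: "0 < B ^ j" using B by simp
  have e: "0 < (u - of_int s) * (u + of_int s + 1)"
    using u by (intro mult_pos_pos) linarith+
  then show w: "0 < scaled_root B s j u" using Bj by (simp add: scaled_root_def)
  have "((\<lambda>u. (u - of_int s) * (u + of_int s + 1)) has_real_derivative 2 * u + 1) (at u)"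
    by (auto intro!: derivative_eq_intros)
  note D = DERIV_cdivide[OF DERIV_chain2[OF DERIV_real_sqrt[OF e] this], of "B ^ j"]
  have gen: "inverse X / 2 * V / H = V / H / (2 * (X / H)) / H" if "X \<noteq> 0" "H \<noteq> 0" for X V H :: real
    using that by (simp add: divide_simps)
  show "(scaled_root B s j has_real_derivative scaled_centre B j u / (2 * scaled_root B s j u) / B ^ j) (at u)"
    unfolding scaled_root_def[abs_def] scaled_centre_def
    by (rule DERIV_cong[OF D], rule gen) (use e Bj real_sqrt_gt_zero[OF e] in linarith)+
  show "(scaled_centre B j has_real_derivative 2 / B ^ j) (at u)"
    unfolding scaled_centre_def[abs_def] by (auto intro!: derivative_eq_intros simp: divide_inverse)
  show "(scaled_centre B j u)\<^sup>2 = 4 * (scaled_root B s j u)\<^sup>2 + ((2 * of_int s + 1) / B ^ j)\<^sup>2"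
    unfolding scaled_centre_def scaled_root_def power_divide real_sqrt_pow2[OF less_imp_le[OF e]]
      times_divide_eq_right add_divide_distrib[symmetric]
    by (simp add: power2_eq_square algebra_simps)
qed

lemma window_symbol_deriv:
  assumes B: "1 < B" and b: "smooth_on UNIV b" and F: "window_symbol B s b F"
  shows "\<exists>G. window_symbol B s b G \<and> (\<forall>j. \<forall>u>of_int \<bar>s\<bar>. (F j has_real_derivative G j u / B ^ j) (at u))"
  using F
proof induction
  case (monomial i p q)
  let ?w = "scaled_root B s" and ?v = "scaled_centre B"
  let ?m = "\<lambda>i p q j u. (deriv ^^ i) b (?w j u) * ?v j u ^ p / ?w j u ^ q"
  \<comment> \<open>The derivatives of the window, of the power of the numerator and of the inverse
    power each give another monomial. For \<open>p = 0\<close> the truncated \<open>p - 1\<close> is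
    harmless because its coefficient is 0.\<close>
  let ?G = "\<lambda>j u. 1/2 * ?m (Suc i) (Suc p) (Suc q) j u + (2 * real p * ?m i (p - 1) q j u + (- (real q / 2)) * ?m i (Suc p) (q + 2) j u)"
  have "window_symbol B s b ?G"
    by (rule window_symbol.add[OF window_symbol.scale[OF window_symbol.monomial]
          window_symbol.add[OF window_symbol.scale[OF window_symbol.monomial] window_symbol.scale[OF window_symbol.monomial]]])
  moreover have "(?m i p q j has_real_derivative ?G j u / B ^ j) (at u)" if u: "of_int \<bar>s\<bar> < u" for j u
  proof -
    note facts = scaled_root_facts[OF B u, of j]
    define w v H where "w = ?w j u" and "v = ?v j u" and "H = B ^ j"
    have w: "0 < w" using facts(1) by (simp add: w_def)
    have H: "0 < H" using B by (simp add: H_def)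
    have "(deriv ^^ i) b field_differentiable at (?w j u)" using b unfolding smooth_on_def by blast
    then have "((deriv ^^ i) b has_real_derivative (deriv ^^ Suc i) b (?w j u)) (at (?w j u))"
      by (simp add: field_differentiable_derivI)
    note db = DERIV_chain2[OF this facts(2)]
    note dv = DERIV_power[OF facts(3), of p] and dw = DERIV_power[OF facts(2), of q]
    have "?w j u ^ q \<noteq> 0" using facts(1) by simp
    note dq = DERIV_divide[OF DERIV_mult[OF db dv] dw this]
      define b0 b1 where "b0 = (deriv ^^ i) b w" and "b1 = (deriv ^^ Suc i) b w"
      have wq: "w ^ q \<noteq> 0" using w by simp
      have "((b1 * (v / (2 * w) / H) * v ^ p + real p * (2 / H * v ^ (p - Suc 0)) * b0) * w ^ q -
          b0 * v ^ p * (real q * (v / (2 * w) / H * w ^ (q - Suc 0)))) / (w ^ q * w ^ q) =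
        (1/2 * (b1 * v ^ Suc p / w ^ Suc q) + (2 * real p * (b0 * v ^ (p - 1) / w ^ q) + (- (real q / 2)) * (b0 * v ^ Suc p / w ^ (q + 2)))) / H"
      proof -
        have t1: "b1 * (v / (2 * w) / H) * v ^ p * w ^ q / (w ^ q * w ^ q) = 1/2 * (b1 * v ^ Suc p / w ^ Suc q) / H"
          using w by (simp add: mult_ac)
        have t2: "real p * (2 / H * v ^ (p - Suc 0)) * b0 * w ^ q / (w ^ q * w ^ q) = 2 * real p * (b0 * v ^ (p - 1) / w ^ q) / H"
          using w by (simp add: mult_ac)
        have t3: "b0 * v ^ p * (real q * (v / (2 * w) / H * w ^ (q - Suc 0))) / (w ^ q * w ^ q) = real q / 2 * (b0 * v ^ Suc p / w ^ (q + 2)) / H"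
        proof (cases q)
          case 0
          then show ?thesis by simp
        next
          case (Suc q')
          have "w ^ q' \<noteq> 0" using w by simp
          then show ?thesis unfolding Suc using w by (simp add: power_add mult_ac)
        qed
        show ?thesis unfolding add_divide_distrib diff_divide_distrib distrib_right t1 t2 t3 by (simp add: add_divide_distrib)
      qed
      from DERIV_cong[OF dq this[unfolded b0_def b1_def w_def v_def H_def]] show ?thesis .
  qed
  ultimately show ?case by blast
next
  case (add F G)
  then obtain F' G' where F': "window_symbol B s b F'" "\<And>j u. of_int \<bar>s\<bar> < u \<Longrightarrow> (F j has_real_derivative F' j u / B ^ j) (at u)"
    and G': "window_symbol B s b G'" "\<And>j u. of_int \<bar>s\<bar> < u \<Longrightarrow> (G j has_real_derivative G' j u / B ^ j) (at u)" by blast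
  have "window_symbol B s b (\<lambda>j u. F' j u + G' j u)" using F'(1) G'(1) by (rule window_symbol.add)
  moreover have "((\<lambda>u. F j u + G j u) has_real_derivative (F' j u + G' j u) / B ^ j) (at u)" if "of_int \<bar>s\<bar> < u" for j u
    using DERIV_add[OF F'(2)[OF that] G'(2)[OF that]] by (simp add: add_divide_distrib)
  ultimately show ?case by blast
next
  case (scale F c)
  then obtain F' where F': "window_symbol B s b F'" "\<And>j u. of_int \<bar>s\<bar> < u \<Longrightarrow> (F j has_real_derivative F' j u / B ^ j) (at u)" by blast
  have "window_symbol B s b (\<lambda>j u. c * F' j u)" using F'(1) by (rule window_symbol.scale)
  moreover have "((\<lambda>u. c * F j u) has_real_derivative (c * F' j u) / B ^ j) (at u)" if "of_int \<bar>s\<bar> < u" for j u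
    using DERIV_cmult[OF F'(2)[OF that], of c] by simp
  ultimately show ?case by blast
qed

lemma needlet_window_deriv_zero:
  assumes "needlet_window B b" "u \<notin> {1 / B..B}"
  shows "(deriv ^^ i) b u = 0"
  using assms(2)
proof (induction i arbitrary: u)
  case 0
  have "closure {u. b u \<noteq> 0} \<subseteq> {1 / B..B}" using assms(1) by (simp add: needlet_window_def)
  then have "{u. b u \<noteq> 0} \<subseteq> {1 / B..B}" by (rule order_trans[OF closure_subset])
  then show ?case using 0 by auto
next
  case (Suc i)
  have "open (- {1 / B..B})" by (simp add: open_Compl)
  moreover have "u \<in> - {1 / B..B}" using Suc.prems by simp
  ultimately have "\<forall>\<^sub>F y in nhds u. y \<in> - {1 / B..B}" by (rule eventually_nhds_in_open)
  then have "\<forall>\<^sub>F y in nhds u. (deriv ^^ i) b y = 0" by eventually_elim (simp add: Suc.IH)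
  then have "deriv ((deriv ^^ i) b) u = deriv (\<lambda>_. 0) u" by (intro deriv_cong_ev) simp_all
  then show ?case by simp
qed

lemma window_symbol_bounded:
  assumes B: "1 < B" and b: "needlet_window B b" and F: "window_symbol B s b F"
  shows "\<exists>C. \<forall>j. \<forall>u>of_int \<bar>s\<bar>. \<bar>F j u\<bar> \<le> C"
  using F
proof induction
  case (monomial i p q)
  have "continuous_on {1 / B..B} ((deriv ^^ i) b)"
    using b unfolding needlet_window_def smooth_on_def
    by (auto intro!: continuous_at_imp_continuous_on field_differentiable_imp_continuous_at)
  then have "compact ((deriv ^^ i) b ` {1 / B..B})" by (rule compact_continuous_image) simp
  then have "bounded ((deriv ^^ i) b ` {1 / B..B})" by (rule compact_imp_bounded)
  then obtain K where K': "\<forall>y\<in>(deriv ^^ i) b ` {1 / B..B}. norm y \<le> K" unfolding bounded_iff by (rule exE)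
  have K: "\<bar>(deriv ^^ i) b w\<bar> \<le> K" if "w \<in> {1 / B..B}" for w
    using K'[rule_format, OF imageI[OF that]] by simp
  \<comment> \<open>The bound for \<open>scaled_centre\<close> on the support of the window: its
    square is four times that of a root not exceeding \<open>B\<close>, plus a spin term which is
    largest at \<open>j = 0\<close>.\<close>
  define V where "V = sqrt (4 * B\<^sup>2 + (2 * of_int s + 1)\<^sup>2)"
  have "\<bar>(deriv ^^ i) b (scaled_root B s j u) * scaled_centre B j u ^ p / scaled_root B s j u ^ q\<bar> \<le> \<bar>K\<bar> * V ^ p * B ^ q"
    if u: "of_int \<bar>s\<bar> < u" for j u
  proof (cases "scaled_root B s j u \<in> {1 / B..B}")
    case False
    then show ?thesis using needlet_window_deriv_zero[OF b False] B by (simp add: V_def)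
  next
    case True
    define w v where "w = scaled_root B s j u" and "v = scaled_centre B j u"
    note facts = scaled_root_facts[OF B u, of j, folded w_def v_def]
    have w: "1 / B \<le> w" "w \<le> B" "0 < w" using True facts(1) by (simp_all add: w_def)
    have "((2 * of_int s + 1) / B ^ j)\<^sup>2 \<le> (2 * of_int s + 1)\<^sup>2"
    proof -
      have "1 \<le> (B ^ j)\<^sup>2" using B by (simp add: one_le_power)
      from divide_left_mono[OF this, of "(2 * of_int s + 1)\<^sup>2"] show ?thesis
        unfolding power_divide using B by simp
    qed
    moreover have "w\<^sup>2 \<le> B\<^sup>2" using w by (intro power_mono) auto
    ultimately have "v\<^sup>2 \<le> 4 * B\<^sup>2 + (2 * of_int s + 1)\<^sup>2" unfolding facts(4) by linarith
    then have v: "\<bar>v\<bar> \<le> V" unfolding V_def by (simp add: real_le_rsqrt)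
    have "\<bar>(deriv ^^ i) b w\<bar> \<le> \<bar>K\<bar>" using K[OF True] by (simp add: w_def)
    moreover have "\<bar>v\<bar> ^ p \<le> V ^ p" using v by (intro power_mono) auto
    moreover have "(1 / w) ^ q \<le> B ^ q" using w B by (intro power_mono) (auto simp: field_simps)
    ultimately have "\<bar>(deriv ^^ i) b w\<bar> * \<bar>v\<bar> ^ p * (1 / w) ^ q \<le> \<bar>K\<bar> * V ^ p * B ^ q"
      using w by (intro mult_mono) (auto simp: V_def)
    then show ?thesis using w unfolding w_def[symmetric] v_def[symmetric]
      by (simp add: abs_mult power_abs power_divide)
  qed
  then show ?case by blast
next
  case (add F G)
  then obtain C D where "\<And>j u. of_int \<bar>s\<bar> < u \<Longrightarrow> \<bar>F j u\<bar> \<le> C" "\<And>j u. of_int \<bar>s\<bar> < u \<Longrightarrow> \<bar>G j u\<bar> \<le> D" by blast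
  then have "\<forall>j. \<forall>u>of_int \<bar>s\<bar>. \<bar>F j u + G j u\<bar> \<le> C + D"
    by (auto intro!: order_trans[OF abs_triangle_ineq] add_mono)
  then show ?case by blast
next
  case (scale F c)
  then obtain C where "\<And>j u. of_int \<bar>s\<bar> < u \<Longrightarrow> \<bar>F j u\<bar> \<le> C" by blast
  then have "\<forall>j. \<forall>u>of_int \<bar>s\<bar>. \<bar>c * F j u\<bar> \<le> \<bar>c\<bar> * C"
    by (auto simp: abs_mult intro!: mult_left_mono)
  then show ?case by blast
qed

text \<open>By the mean value theorem a difference is the value of a derivative at an intermediate
  point, and a derivative of a window symbol is again a window symbol divided by
  \<open>B ^ j\<close>.\<close>

lemma window_symbol_differences:
  assumes B: "1 < B" and b: "needlet_window B b"
  shows "window_symbol B s b F \<Longrightarrow> \<exists>C. \<forall>j. \<forall>u>of_int \<bar>s\<bar>. \<bar>(fdiff ^^ r) (F j) u\<bar> \<le> C / B ^ (r * j)"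
proof (induction r arbitrary: F)
  case 0
  then show ?case using window_symbol_bounded[OF B b] by simp
next
  case (Suc r)
  have sm: "smooth_on UNIV b" using b by (simp add: needlet_window_def)
  obtain G where G: "window_symbol B s b G" and D: "\<And>j u. of_int \<bar>s\<bar> < u \<Longrightarrow> (F j has_real_derivative G j u / B ^ j) (at u)"
    using window_symbol_deriv[OF B sm Suc.prems] by blast
  obtain C where C: "\<And>j u. of_int \<bar>s\<bar> < u \<Longrightarrow> \<bar>(fdiff ^^ r) (G j) u\<bar> \<le> C / B ^ (r * j)"
    using Suc.IH[OF G] by blast
  have lin: "(fdiff ^^ r) (\<lambda>u. G j u / B ^ j) u = (fdiff ^^ r) (G j) u / B ^ j" for j u
    by (induction r arbitrary: u) (simp_all add: fdiff_def diff_divide_distrib)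
  have "\<bar>(fdiff ^^ Suc r) (F j) u\<bar> \<le> C / B ^ (Suc r * j)" if u: "of_int \<bar>s\<bar> < u" for j u
  proof -
    have der: "((fdiff ^^ r) (F j) has_real_derivative (fdiff ^^ r) (G j) y / B ^ j) (at y)" if "of_int \<bar>s\<bar> < y" for y
      using fdiff_funpow_deriv[of "of_int \<bar>s\<bar>" "F j" "\<lambda>u. G j u / B ^ j", OF D that, of r] by (simp add: lin)
    obtain z where z: "u < z" and eq: "(fdiff ^^ r) (F j) (u + 1) - (fdiff ^^ r) (F j) u = (u + 1 - u) * ((fdiff ^^ r) (G j) z / B ^ j)"
      using MVT2[of u "u + 1" "(fdiff ^^ r) (F j)" "\<lambda>y. (fdiff ^^ r) (G j) y / B ^ j"] der u by (force intro: der)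
    have Bj: "0 < B ^ j" using B by simp
    have "\<bar>(fdiff ^^ Suc r) (F j) u\<bar> = \<bar>(fdiff ^^ r) (G j) z\<bar> / B ^ j"
      using eq Bj by (simp add: fdiff_def[of "(fdiff ^^ r) (F j)"])
    also have "\<dots> \<le> C / B ^ (r * j) / B ^ j"
      using C[of z j] z u Bj by (intro divide_right_mono) auto
    finally show ?thesis by (simp add: power_add mult_ac)
  qed
  then show ?case by blast
qed

lemma symbol_class_if_differences:
  assumes "\<And>r. \<exists>C. \<forall>\<^sub>F j in sequentially. \<forall>l. \<bar>(fdiff ^^ r) (F j) l\<bar> \<le> C / B ^ ((k + r) * j)"
  shows "symbol_class B R k F"
  using assms
proof (induction R arbitrary: k F)
  case 0
  then show ?case using 0[of 0] by simp
next
  case (Suc R)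
  have "symbol_class B R (Suc k) (\<lambda>j. fdiff (F j))"
  proof (rule Suc.IH)
    fix r
    show "\<exists>C. \<forall>\<^sub>F j in sequentially. \<forall>l. \<bar>(fdiff ^^ r) (fdiff (F j)) l\<bar> \<le> C / B ^ ((Suc k + r) * j)"
    proof -
      have "(fdiff ^^ r) (fdiff (F j)) = (fdiff ^^ Suc r) (F j)" for j by (simp add: funpow_swap1)
      then show ?thesis using Suc.prems[of "Suc r"] by (simp only: add_Suc add_Suc_right)
    qed
  qed
  then show ?case using Suc.prems[of 0] by simp
qed

lemma fdiff_funpow_of_int:
  fixes f :: "int \<Rightarrow> real" and g :: "real \<Rightarrow> real"
  assumes "\<And>l. a < l \<Longrightarrow> f l = g (of_int l)"
  shows "a < l \<Longrightarrow> (fdiff ^^ r) f l = (fdiff ^^ r) g (of_int l)"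
proof (induction r arbitrary: l)
  case (Suc r)
  have "(fdiff ^^ r) f (l + 1) = (fdiff ^^ r) g (of_int l + 1)" using Suc.IH[of "l + 1"] Suc.prems by simp
  then show ?case using Suc.IH[OF Suc.prems]
    by (simp add: fdiff_def[of "(fdiff ^^ r) f"] fdiff_def[of "(fdiff ^^ r) g"])
qed (simp add: assms)

lemma fdiff_funpow_zero:
  fixes f :: "int \<Rightarrow> real"
  shows "(\<And>l'. l' \<le> l + int r \<Longrightarrow> f l' = 0) \<Longrightarrow> (fdiff ^^ r) f l = 0"
proof (induction r arbitrary: l)
  case (Suc r)
  have "(fdiff ^^ r) f (l + 1) = 0" "(fdiff ^^ r) f l = 0" by (intro Suc.IH Suc.prems; simp)+
  then show ?case by (simp add: fdiff_def[of "(fdiff ^^ r) f"])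
qed simp

text \<open>Extended by 0 to all integers, so that differences can be iterated freely; the cut at
  the absolute value of \<open>s\<close> keeps the radicand in \<open>scaled_root\<close>
  positive.\<close>

definition needlet_coeff :: "real \<Rightarrow> (real \<Rightarrow> real) \<Rightarrow> int \<Rightarrow> nat \<Rightarrow> int \<Rightarrow> real" where
  "needlet_coeff B b s j l = (if \<bar>s\<bar> < l then b (scaled_root B s j (of_int l)) else 0)"

lemma needlet_coeff_support:
  assumes B: "1 < B" and b: "needlet_window B b"
  shows "dyadic_support B (needlet_coeff B b s)"
proof -
  define V where "V = sqrt (4 * B\<^sup>2 + (2 * of_int s + 1)\<^sup>2)"
  \<comment> \<open>From \<open>1 / B \<le> w\<close> and \<open>2 * w \<le> v\<close> follows
    \<open>2 / B * B ^ j \<le> 2 * l + 1\<close>; halving the constant absorbs the 1 once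
    \<open>B ^ j\<close> is large.\<close>
  have c: "0 < 1 / (2 * B)" using B by simp
  have "\<forall>\<^sub>F j in sequentially. \<forall>l. needlet_coeff B b s j l \<noteq> 0 \<longrightarrow> 1 / (2 * B) * B ^ j \<le> of_int l \<and> of_int l \<le> V * B ^ j"
    using eventually_power_ge[OF B c, of 1]
  proof eventually_elim
    case (elim j)
    have Bj: "0 < B ^ j" using B by simp
    show ?case
    proof (intro allI impI)
      fix l assume nz: "needlet_coeff B b s j l \<noteq> 0"
      then have l: "\<bar>s\<bar> < l" and bnz: "b (scaled_root B s j (of_int l)) \<noteq> 0"
        by (auto simp: needlet_coeff_def split: if_splits)
      have u: "of_int \<bar>s\<bar> < (of_int l :: real)" using l by linarith
      define w v where "w = scaled_root B s j (of_int l)" and "v = scaled_centre B j (of_int l)"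
      note facts = scaled_root_facts[OF B u, of j, folded w_def v_def]
      have "w \<in> {1 / B..B}" using needlet_window_deriv_zero[OF b, of w 0] bnz by (auto simp: w_def)
      then have w: "1 / B \<le> w" "w \<le> B" by auto
      have v0: "0 \<le> v" using l Bj by (simp add: v_def scaled_centre_def)
      have vB: "v * B ^ j = 2 * of_int l + 1" using B by (simp add: v_def scaled_centre_def)
      have "(2 * w)\<^sup>2 \<le> v\<^sup>2" unfolding facts(4) by (simp add: power_mult_distrib)
      then have "2 * w \<le> v" using v0 by (rule power2_le_imp_le)
      then have "2 / B \<le> v" using w by (simp add: field_simps)
      then have "2 / B * B ^ j \<le> 2 * of_int l + 1" unfolding vB[symmetric] using Bj by (intro mult_right_mono) auto
      moreover have "2 / B * B ^ j = 2 * (1 / (2 * B) * B ^ j) + 2 * (1 / (2 * B) * B ^ j)" by simp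
      ultimately have lower: "1 / (2 * B) * B ^ j \<le> of_int l" using elim by linarith
      have "((2 * of_int s + 1) / B ^ j)\<^sup>2 \<le> (2 * of_int s + 1)\<^sup>2"
      proof -
        have "1 \<le> (B ^ j)\<^sup>2" using B by (simp add: one_le_power)
        from divide_left_mono[OF this, of "(2 * of_int s + 1)\<^sup>2"] show ?thesis
          unfolding power_divide using B by simp
      qed
      moreover have "w\<^sup>2 \<le> B\<^sup>2" using w facts(1) by (intro power_mono) auto
      ultimately have "v\<^sup>2 \<le> 4 * B\<^sup>2 + (2 * of_int s + 1)\<^sup>2" unfolding facts(4) by linarith
      then have "v \<le> V" unfolding V_def by (rule real_le_rsqrt)
      then have "2 * of_int l + 1 \<le> V * B ^ j" unfolding vB[symmetric] using Bj by (intro mult_right_mono) auto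
      moreover have "0 \<le> (of_int l :: real)" using l by simp
      ultimately show "1 / (2 * B) * B ^ j \<le> of_int l \<and> of_int l \<le> V * B ^ j" using lower by linarith
    qed
  qed
  then show ?thesis unfolding dyadic_support_def using c by (intro exI conjI)
qed

lemma needlet_coeff_class:
  assumes B: "1 < B" and b: "needlet_window B b"
  shows "symbol_class B R 0 (needlet_coeff B b s)"
proof (rule symbol_class_if_differences)
  fix r
  let ?F = "\<lambda>j u. (deriv ^^ 0) b (scaled_root B s j u) * scaled_centre B j u ^ 0 / scaled_root B s j u ^ 0"
  obtain C where C: "\<forall>j. \<forall>u>of_int \<bar>s\<bar>. \<bar>(fdiff ^^ r) (?F j) u\<bar> \<le> C / B ^ (r * j)"
    using window_symbol_differences[OF B b window_symbol.monomial, of s r 0 0 0] by (rule exE)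
  have "\<forall>\<^sub>F j in sequentially. \<forall>l. \<bar>(fdiff ^^ r) (needlet_coeff B b s j) l\<bar> \<le> \<bar>C\<bar> / B ^ ((0 + r) * j)"
    using dyadic_support_positive[OF B needlet_coeff_support[OF B b], of s "of_int \<bar>s\<bar> + real r + 1"]
  proof eventually_elim
    case (elim j)
    have Bp: "0 < B ^ (r * j)" using B by simp
    show ?case
    proof
      fix l
      show "\<bar>(fdiff ^^ r) (needlet_coeff B b s j) l\<bar> \<le> \<bar>C\<bar> / B ^ ((0 + r) * j)"
      proof (cases "\<bar>s\<bar> < l")
        case True
        have "(fdiff ^^ r) (needlet_coeff B b s j) l = (fdiff ^^ r) (?F j) (of_int l)"
          by (rule fdiff_funpow_of_int[OF _ True]) (simp add: needlet_coeff_def)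
        moreover have "\<bar>(fdiff ^^ r) (?F j) (of_int l)\<bar> \<le> C / B ^ (r * j)"
          using C[rule_format, of "of_int l" j] True by linarith
        moreover have "C / B ^ (r * j) \<le> \<bar>C\<bar> / B ^ (r * j)" using Bp by (intro divide_right_mono) auto
        ultimately show ?thesis by simp
      next
        case False
        \<comment> \<open>The difference looks only \<open>r\<close> steps ahead, which is still
          below the support for large \<open>j\<close>; the cut therefore creates no jump.\<close>
        have "(fdiff ^^ r) (needlet_coeff B b s j) l = 0"
        proof (rule fdiff_funpow_zero)
          fix l' assume "l' \<le> l + int r"
          then have "\<not> of_int \<bar>s\<bar> + real r + 1 \<le> (of_int l' :: real)" using False by linarith
          then show "needlet_coeff B b s j l' = 0" using elim by auto
        qed
        then show ?thesis using Bp by simp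
      qed
    qed
  qed
  then show "\<exists>C. \<forall>\<^sub>F j in sequentially. \<forall>l. \<bar>(fdiff ^^ r) (needlet_coeff B b s j) l\<bar> \<le> C / B ^ ((0 + r) * j)"
    by (rule exI[where x = "\<bar>C\<bar>"])
qed

section \<open>Decay of the needlet kernel\<close>

lemma angular_diff_funpow_class:
  assumes B: "1 < B" and supp: "dyadic_support B F" and F: "\<And>R. symbol_class B R 0 F"
  shows "symbol_class B R n (\<lambda>j. (angular_diff \<sigma> ^^ n) (F j)) \<and> dyadic_support B (\<lambda>j. (angular_diff \<sigma> ^^ n) (F j))"
proof (induction n arbitrary: R)
  case 0
  then show ?case using supp F by simp
next
  case (Suc n)
  have 1: "dyadic_support B (\<lambda>j. (angular_diff \<sigma> ^^ n) (F j))"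
    and 2: "symbol_class B (Suc R) n (\<lambda>j. (angular_diff \<sigma> ^^ n) (F j))"
    using Suc.IH by blast+
  show ?case using angular_diff_class[OF B 1 2, of \<sigma>] by simp
qed

text \<open>The summation range has to contain the support of the coefficients at every intermediate
  step. The constant \<open>c\<close> is enlarged each time, but the range stays of order
  \<open>B ^ j\<close>.\<close>

lemma angular_diff_funpow_kernel:
  assumes B: "1 < B" and supp: "dyadic_support B F" and F: "\<And>R. symbol_class B R 0 F"
  shows "\<exists>c. \<forall>\<^sub>F j in sequentially. \<forall>N. c * B ^ j \<le> real N \<longrightarrow> (\<forall>x.
    (2 * x) ^ n * (\<Sum>l\<le>N. F j (int l) * ((2 * real l + 1) * jacobi (2 * \<sigma>) (l - \<sigma>) x)) =
    (\<Sum>l\<le>N. (angular_diff \<sigma> ^^ n) (F j) (int l) * ((2 * real l + 1) * jacobi (2 * \<sigma>) (l - \<sigma>) x)))"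
proof (induction n)
  case 0
  then show ?case by simp
next
  case (Suc n)
  let ?T = "\<lambda>j. (angular_diff \<sigma> ^^ n) (F j)"
  let ?K = "\<lambda>f N x. \<Sum>l\<le>N. f (int l) * ((2 * real l + 1) * jacobi (2 * \<sigma>) (l - \<sigma>) x)"
  obtain c where c: "\<forall>\<^sub>F j in sequentially. \<forall>N. c * B ^ j \<le> real N \<longrightarrow> (\<forall>x. (2 * x) ^ n * ?K (F j) N x = ?K (?T j) N x)"
    using Suc.IH by (rule exE)
  have sT: "dyadic_support B ?T" using angular_diff_funpow_class[OF B supp F] by (rule conjunct2)
  obtain d d' where dd: "\<forall>\<^sub>F j in sequentially. \<forall>l. ?T j l \<noteq> 0 \<longrightarrow> d * B ^ j \<le> of_int l \<and> of_int l \<le> d' * B ^ j"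
    using sT unfolding dyadic_support_def by blast
  have "\<forall>\<^sub>F j in sequentially. \<forall>N. max c (d' + 1) * B ^ j \<le> real N \<longrightarrow> (\<forall>x. (2 * x) ^ Suc n * ?K (F j) N x = ?K ((angular_diff \<sigma> ^^ Suc n) (F j)) N x)"
    using c dd dyadic_support_positive[OF B sT, of "real \<sigma> + 2"]
  proof eventually_elim
    case (elim j)
    have Bj: "0 < B ^ j" using B by simp
    show ?case
    proof (intro allI impI)
      fix N x assume N: "max c (d' + 1) * B ^ j \<le> real N"
      have le: "c * B ^ j \<le> max c (d' + 1) * B ^ j" "(d' + 1) * B ^ j \<le> max c (d' + 1) * B ^ j"
        using Bj by (intro mult_right_mono; simp)+
      have N': "c * B ^ j \<le> real N" using le(1) N by linarith
      have "d' * B ^ j + B ^ j \<le> real N" using order_trans[OF le(2) N] by (simp only: distrib_right mult_1)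
      then have N'': "d' * B ^ j < real N" using Bj by linarith
      have "2 * x * ?K (?T j) N x = ?K (angular_diff \<sigma> (?T j)) N x"
      proof (rule angular_diff_kernel)
        fix l assume "l \<le> int \<sigma> + 1"
        then have "\<not> real \<sigma> + 2 \<le> of_int l" by linarith
        then show "?T j l = 0" using elim(3) by auto
      next
        fix l assume "int N \<le> l"
        then have "\<not> of_int l \<le> d' * B ^ j" using N'' by linarith
        then show "?T j l = 0" using elim(2) by auto
      qed
      moreover have "(2 * x) ^ n * ?K (F j) N x = ?K (?T j) N x" using elim(1) N' by blast
      ultimately show "(2 * x) ^ Suc n * ?K (F j) N x = ?K ((angular_diff \<sigma> ^^ Suc n) (F j)) N x"
        by (simp add: mult.assoc)
    qed
  qed
  then show ?case by (rule exI[where x = "max c (d' + 1)"])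
qed

definition needlet_kernel :: "real \<Rightarrow> (real \<Rightarrow> real) \<Rightarrow> int \<Rightarrow> nat \<Rightarrow> real^3 \<Rightarrow> real^3 \<Rightarrow> complex" where
  "needlet_kernel B b s j x y = (\<Sum>\<^sub>\<infinity>l\<in>multipoles s. of_real (b (sqrt (spin_eigenvalue l s) / B ^ j)) * spin_kernel s l x y)"

lemma spin_needlet_eq: "spin_needlet B b s \<xi> w j k x = of_real (sqrt (w j k)) * needlet_kernel B b s j x (\<xi> j k)"
  by (simp add: spin_needlet_def needlet_kernel_def spin_kernel_def)

text \<open>The cut can change the coefficient only at the lowest multipole, whose eigenvalue is
  fixed, while the rescaled window begins at \<open>B ^ j / B\<close> and so moves past it.\<close>

lemma window_eq_needlet_coeff:
  assumes B: "1 < B" and b: "needlet_window B b"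
  shows "\<forall>\<^sub>F j in sequentially. \<forall>l\<in>multipoles s. b (sqrt (spin_eigenvalue l s) / B ^ j) = needlet_coeff B b s j (int l)"
proof -
  define e where "e = sqrt (spin_eigenvalue (nat \<bar>s\<bar>) s) + 1"
  have "0 < 1 / B" using B by simp
  from eventually_power_ge[OF B this, of e] show ?thesis
  proof eventually_elim
    case (elim j)
    show ?case
    proof
      fix l assume l: "l \<in> multipoles s"
      show "b (sqrt (spin_eigenvalue l s) / B ^ j) = needlet_coeff B b s j (int l)"
      proof (cases "\<bar>s\<bar> < int l")
        case True
        then show ?thesis by (simp add: needlet_coeff_def scaled_root_def spin_eigenvalue_def)
      next
        case False
        then have "l = nat \<bar>s\<bar>" using l by (auto simp: multipoles_def)
        then have "sqrt (spin_eigenvalue l s) < 1 / B * B ^ j" using elim by (simp add: e_def)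
        then have "sqrt (spin_eigenvalue l s) / B ^ j < 1 / B" using B by (simp add: field_simps)
        then have "b (sqrt (spin_eigenvalue l s) / B ^ j) = 0"
          using needlet_window_deriv_zero[OF b, of _ 0] by simp
        then show ?thesis using False by (simp add: needlet_coeff_def)
      qed
    qed
  qed
qed

lemma needlet_kernel_finite_sum:
  assumes B: "1 < B" and b: "needlet_window B b"
  shows "\<exists>c. \<forall>\<^sub>F j in sequentially. \<forall>N. c * B ^ j \<le> real N \<longrightarrow> (\<forall>x y.
    needlet_kernel B b s j x y = (\<Sum>l\<le>N. of_real (needlet_coeff B b s j (int l)) * spin_kernel s l x y))"
proof -
  obtain d d' where dd: "\<forall>\<^sub>F j in sequentially. \<forall>l. needlet_coeff B b s j l \<noteq> 0 \<longrightarrow> d * B ^ j \<le> of_int l \<and> of_int l \<le> d' * B ^ j"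
    using needlet_coeff_support[OF B b, of s] unfolding dyadic_support_def by blast
  have "\<forall>\<^sub>F j in sequentially. \<forall>N. d' * B ^ j \<le> real N \<longrightarrow> (\<forall>x y.
    needlet_kernel B b s j x y = (\<Sum>l\<le>N. of_real (needlet_coeff B b s j (int l)) * spin_kernel s l x y))"
    using dd window_eq_needlet_coeff[OF B b, of s]
  proof eventually_elim
    case (elim j)
    show ?case
    proof (intro allI impI)
      fix N x y assume N: "d' * B ^ j \<le> real N"
      let ?f = "\<lambda>l. complex_of_real (needlet_coeff B b s j (int l)) * spin_kernel s l x y"
      have "needlet_kernel B b s j x y = infsum ?f (multipoles s)"
        unfolding needlet_kernel_def by (rule infsum_cong) (use elim(2) in auto)
      also have "\<dots> = infsum ?f {..N}"
      proof (rule infsum_cong_neutral)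
        fix l assume "l \<in> {..N} - multipoles s"
        then have "\<not> \<bar>s\<bar> < int l" by (auto simp: multipoles_def)
        then show "?f l = 0" by (simp add: needlet_coeff_def)
      next
        fix l assume "l \<in> multipoles s - {..N}"
        then have "\<not> of_int (int l) \<le> d' * B ^ j" using N by auto
        then have "needlet_coeff B b s j (int l) = 0" using elim(1) by blast
        then show "?f l = 0" by simp
      qed simp
      also have "\<dots> = sum ?f {..N}" by simp
      finally show "needlet_kernel B b s j x y = sum ?f {..N}" .
    qed
  qed
  then show ?thesis by (rule exI[where x = d'])
qed

text \<open>Multiplication by \<open>(1 - x \<bullet> y) ^ n\<close> replaces the coefficients by
  their \<open>n\<close>-fold \<open>angular_diff\<close>, of size \<open>1 / B ^ (n * j)\<close>.
  The trivial bound for about \<open>B ^ j\<close> multipoles with kernels of size at most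
  \<open>2 * l + 1\<close> accounts for \<open>B ^ (2 * j)\<close>.\<close>

lemma needlet_kernel_moment:
  assumes B: "1 < B" and b: "needlet_window B b"
  shows "\<exists>C. \<forall>\<^sub>F j in sequentially. \<forall>x\<in>sphere 0 1. \<forall>y\<in>sphere 0 1.
    (1 - x \<bullet> y) ^ n * cmod (needlet_kernel B b s j x y) \<le> C * B ^ (2 * j) / B ^ (n * j)"
proof -
  let ?f = "needlet_coeff B b s"
  define \<sigma> where "\<sigma> = nat \<bar>s\<bar>"
  let ?T = "\<lambda>j. (angular_diff \<sigma> ^^ n) (?f j)"
  note supp = needlet_coeff_support[OF B b, of s] and cls = needlet_coeff_class[OF B b, of _ s]
  have T: "symbol_class B 0 n ?T" "dyadic_support B ?T" using angular_diff_funpow_class[OF B supp cls] by blast+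
  obtain C where C: "\<forall>\<^sub>F j in sequentially. \<forall>l. \<bar>?T j l\<bar> \<le> C / B ^ (n * j)" using T(1) by auto
  obtain c1 where c1: "\<forall>\<^sub>F j in sequentially. \<forall>N. c1 * B ^ j \<le> real N \<longrightarrow> (\<forall>x.
    (2 * x) ^ n * (\<Sum>l\<le>N. ?f j (int l) * ((2 * real l + 1) * jacobi (2 * \<sigma>) (l - \<sigma>) x)) =
    (\<Sum>l\<le>N. ?T j (int l) * ((2 * real l + 1) * jacobi (2 * \<sigma>) (l - \<sigma>) x)))"
    using angular_diff_funpow_kernel[OF B supp cls] by (rule exE)
  obtain c2 where c2: "\<forall>\<^sub>F j in sequentially. \<forall>N. c2 * B ^ j \<le> real N \<longrightarrow> (\<forall>x y.
    needlet_kernel B b s j x y = (\<Sum>l\<le>N. of_real (?f j (int l)) * spin_kernel s l x y))"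
    using needlet_kernel_finite_sum[OF B b] by (rule exE)
  define c where "c = max 1 (max c1 c2)"
  have "\<forall>\<^sub>F j in sequentially. \<forall>x\<in>sphere 0 1. \<forall>y\<in>sphere 0 1.
    (1 - x \<bullet> y) ^ n * cmod (needlet_kernel B b s j x y) \<le> (\<bar>C\<bar> * (2 * c + 3)\<^sup>2) * B ^ (2 * j) / B ^ (n * j)"
    using C c1 c2 dyadic_support_positive[OF B supp, of "real \<sigma>"] dyadic_support_positive[OF B T(2), of "real \<sigma>"]
  proof eventually_elim
    case (elim j)
    have Bj: "1 \<le> B ^ j" "0 < B ^ (n * j)" using B by simp_all
    define N where "N = nat \<lceil>c * B ^ j\<rceil>"
    have c0: "1 \<le> c" "c1 \<le> c" "c2 \<le> c" by (simp_all add: c_def)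
    have N: "c * B ^ j \<le> real N" unfolding N_def by (rule real_nat_ceiling_ge)
    have "0 \<le> c * B ^ j" using c0 Bj by simp
    then have "real N \<le> c * B ^ j + 1" unfolding N_def by linarith
    then have N2: "2 * real N + 1 \<le> (2 * c + 3) * B ^ j" using Bj by (simp add: algebra_simps)
    have "c1 * B ^ j \<le> c * B ^ j" "c2 * B ^ j \<le> c * B ^ j" using c0 Bj by (intro mult_right_mono; simp)+
    then have N12: "c1 * B ^ j \<le> real N" "c2 * B ^ j \<le> real N" using N by linarith+
    show ?case
    proof (intro ballI)
      fix x y :: "real^3" assume x: "x \<in> sphere 0 1" and y: "y \<in> sphere 0 1"
      obtain \<zeta> where Z: "\<And>l. \<bar>s\<bar> \<le> int l \<Longrightarrow> spin_kernel s l x y =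
        of_real ((2 * real l + 1) / (4 * pi)) * \<zeta> * of_real (jacobi (2 * nat \<bar>s\<bar>) (l - nat \<bar>s\<bar>) ((1 - x \<bullet> y) / 2))"
        by (rule spin_kernel_jacobi[OF x y]) (rule that)
      let ?J = "\<lambda>l. jacobi (2 * \<sigma>) (l - \<sigma>) ((1 - x \<bullet> y) / 2)"
      \<comment> \<open>The Jacobi formula is available only from the absolute value of
        \<open>s\<close> on; below it the coefficients vanish and both sides are 0.\<close>
      have expand: "of_real (g (int l)) * spin_kernel s l x y = \<zeta> / (4 * of_real pi) * of_real (g (int l) * ((2 * real l + 1) * ?J l))"
        if g: "g (int l) \<noteq> 0 \<longrightarrow> real \<sigma> \<le> of_int (int l)" for g :: "int \<Rightarrow> real" and l
      proof (cases "g (int l) = 0")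
        case False
        then have "\<bar>s\<bar> \<le> int l" using g by (simp add: \<sigma>_def)
        from Z[OF this] show ?thesis by (simp add: \<sigma>_def)
      qed simp
      have "needlet_kernel B b s j x y = (\<Sum>l\<le>N. of_real (?f j (int l)) * spin_kernel s l x y)"
        using elim(3) N12(2) by blast
      also have "\<dots> = \<zeta> / (4 * of_real pi) * of_real (\<Sum>l\<le>N. ?f j (int l) * ((2 * real l + 1) * ?J l))"
        unfolding of_real_sum sum_distrib_left by (intro sum.cong refl expand) (use elim(4) in blast)
      finally have nk: "needlet_kernel B b s j x y =
        \<zeta> / (4 * of_real pi) * of_real (\<Sum>l\<le>N. ?f j (int l) * ((2 * real l + 1) * ?J l))" .
      have "(1 - x \<bullet> y) ^ n * cmod (needlet_kernel B b s j x y) = cmod (of_real ((1 - x \<bullet> y) ^ n) * needlet_kernel B b s j x y)"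
      proof -
        have "x \<bullet> y \<le> 1" using norm_cauchy_schwarz[of x y] x y by simp
        then have "0 \<le> (1 - x \<bullet> y) ^ n" by simp
        then show ?thesis unfolding norm_mult norm_of_real by simp
      qed
      also have "of_real ((1 - x \<bullet> y) ^ n) * needlet_kernel B b s j x y =
         \<zeta> / (4 * of_real pi) * of_real ((2 * ((1 - x \<bullet> y) / 2)) ^ n * (\<Sum>l\<le>N. ?f j (int l) * ((2 * real l + 1) * ?J l)))"
      proof -
        have "2 * ((1 - x \<bullet> y) / 2) = 1 - x \<bullet> y" by simp
        then show ?thesis unfolding nk by (simp only: of_real_mult mult_ac)
      qed
      also have "(2 * ((1 - x \<bullet> y) / 2)) ^ n * (\<Sum>l\<le>N. ?f j (int l) * ((2 * real l + 1) * ?J l)) =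
         (\<Sum>l\<le>N. ?T j (int l) * ((2 * real l + 1) * ?J l))"
        using elim(2) N12(1) by blast
      also have "\<zeta> / (4 * of_real pi) * of_real (\<Sum>l\<le>N. ?T j (int l) * ((2 * real l + 1) * ?J l)) =
         (\<Sum>l\<le>N. of_real (?T j (int l)) * spin_kernel s l x y)"
        unfolding of_real_sum sum_distrib_left by (intro sum.cong refl expand[symmetric]) (use elim(5) in blast)
      also have "cmod \<dots> \<le> (\<Sum>l\<le>N. \<bar>C\<bar> / B ^ (n * j) * (2 * real N + 1))"
      proof (rule order_trans[OF norm_sum sum_mono])
        fix l assume l: "l \<in> {..N}"
        show "cmod (of_real (?T j (int l)) * spin_kernel s l x y) \<le> \<bar>C\<bar> / B ^ (n * j) * (2 * real N + 1)"
        proof (cases "?T j (int l) = 0")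
          case True
          then show ?thesis using Bj by simp
        next
          case False
          then have "real \<sigma> \<le> of_int (int l)" using elim(5) by blast
          then have "\<bar>s\<bar> \<le> int l" by (simp add: \<sigma>_def)
          then have "cmod (spin_kernel s l x y) \<le> (2 * real l + 1) / (4 * pi)" by (rule spin_kernel_bound[OF x y])
          also have "\<dots> \<le> (2 * real l + 1) / 1" using pi_gt3 by (intro divide_left_mono) auto
          also have "\<dots> \<le> 2 * real N + 1" using l by simp
          finally have k: "cmod (spin_kernel s l x y) \<le> 2 * real N + 1" .
          have "C / B ^ (n * j) \<le> \<bar>C\<bar> / B ^ (n * j)" using Bj by (intro divide_right_mono) auto
          then have "\<bar>?T j (int l)\<bar> \<le> \<bar>C\<bar> / B ^ (n * j)" using elim(1) order_trans by blast
          then show ?thesis unfolding norm_mult norm_of_real using k by (intro mult_mono) auto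
        qed
      qed
      also have "\<dots> = \<bar>C\<bar> / B ^ (n * j) * ((real N + 1) * (2 * real N + 1))"
        unfolding sum_constant by (simp add: add.commute mult_ac)
      also have "\<dots> \<le> \<bar>C\<bar> / B ^ (n * j) * (((2 * c + 3) * B ^ j) * ((2 * c + 3) * B ^ j))"
        using N2 Bj c0 by (intro mult_left_mono mult_mono) auto
      also have "\<dots> = (\<bar>C\<bar> * (2 * c + 3)\<^sup>2) * B ^ (2 * j) / B ^ (n * j)"
      proof -
        have BB: "B ^ (2 * j) = B ^ j * B ^ j" by (simp only: mult_2 power_add)
        show ?thesis unfolding BB by (simp add: power2_eq_square mult_ac)
      qed
      finally show "(1 - x \<bullet> y) ^ n * cmod (needlet_kernel B b s j x y) \<le> (\<bar>C\<bar> * (2 * c + 3)\<^sup>2) * B ^ (2 * j) / B ^ (n * j)" .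
    qed
  qed
  then show ?thesis by (rule exI[where x = "\<bar>C\<bar> * (2 * c + 3)\<^sup>2"])
qed

text \<open>Away from the diagonal \<open>1 - x \<bullet> y\<close> is at least
  \<open>\<eta>\<close>; two extra moments pay for the factor \<open>B ^ (2 * j)\<close>.\<close>

lemma needlet_kernel_decay:
  assumes B: "1 < B" and b: "needlet_window B b" and \<eta>: "0 < \<eta>"
  shows "\<exists>C\<ge>0. \<forall>\<^sub>F j in sequentially. \<forall>x\<in>sphere 0 1. \<forall>y\<in>sphere 0 1.
    x \<bullet> y \<le> 1 - \<eta> \<longrightarrow> cmod (needlet_kernel B b s j x y) \<le> C / B ^ (n * j)"
proof -
  obtain C where C: "\<forall>\<^sub>F j in sequentially. \<forall>x\<in>sphere 0 1. \<forall>y\<in>sphere 0 1.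
    (1 - x \<bullet> y) ^ (n + 2) * cmod (needlet_kernel B b s j x y) \<le> C * B ^ (2 * j) / B ^ ((n + 2) * j)"
    using needlet_kernel_moment[OF B b] by (rule exE)
  have "\<forall>\<^sub>F j in sequentially. \<forall>x\<in>sphere 0 1. \<forall>y\<in>sphere 0 1.
    x \<bullet> y \<le> 1 - \<eta> \<longrightarrow> cmod (needlet_kernel B b s j x y) \<le> (\<bar>C\<bar> / \<eta> ^ (n + 2)) / B ^ (n * j)"
    using C
  proof eventually_elim
    case (elim j)
    show ?case
    proof (intro ballI impI)
      fix x y :: "real^3" assume xy: "x \<in> sphere 0 1" "y \<in> sphere 0 1" "x \<bullet> y \<le> 1 - \<eta>"
      let ?K = "cmod (needlet_kernel B b s j x y)"
      have Bp: "0 < B ^ (2 * j)" "0 < B ^ (n * j)" using B by simp_all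
      have "\<eta> ^ (n + 2) * ?K \<le> (1 - x \<bullet> y) ^ (n + 2) * ?K"
        using xy \<eta> by (intro mult_right_mono power_mono) auto
      also have "\<dots> \<le> C * B ^ (2 * j) / B ^ ((n + 2) * j)" using elim xy by blast
      also have "B ^ ((n + 2) * j) = B ^ (n * j) * B ^ (2 * j)" by (simp only: add_mult_distrib power_add)
      also have "C * B ^ (2 * j) / (B ^ (n * j) * B ^ (2 * j)) = C / B ^ (n * j)"
        using Bp(1) by (intro mult_divide_mult_cancel_right) linarith
      also have "\<dots> \<le> \<bar>C\<bar> / B ^ (n * j)" using Bp by (intro divide_right_mono) auto
      finally have "\<eta> ^ (n + 2) * ?K \<le> \<bar>C\<bar> / B ^ (n * j)" .
      moreover have "k \<le> (c / e) / d" if "e * k \<le> c / d" "0 < e" for k c d e :: real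
      proof -
        have "k \<le> c / d / e" by (subst pos_le_divide_eq) (use that in \<open>simp_all only: mult.commute\<close>)
        then show ?thesis by (simp add: mult.commute)
      qed
      ultimately show "?K \<le> (\<bar>C\<bar> / \<eta> ^ (n + 2)) / B ^ (n * j)"
        using zero_less_power[OF \<eta>, of "n + 2"] by blast
    qed
  qed
  moreover have "0 \<le> \<bar>C\<bar> / \<eta> ^ (n + 2)" using \<eta> by simp
  ultimately show ?thesis by blast
qed

section \<open>Mean-square approximation of the masked coefficients\<close>

context prob_space
begin

lemma Cauchy_Schwarz_expectation:
  fixes X Y :: "'a \<Rightarrow> real"
  assumes [measurable]: "random_variable borel X" "random_variable borel Y"
    and X: "integrable M (\<lambda>\<omega>. (X \<omega>)\<^sup>2)" and Y: "integrable M (\<lambda>\<omega>. (Y \<omega>)\<^sup>2)"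
  shows "(expectation (\<lambda>\<omega>. X \<omega> * Y \<omega>))\<^sup>2 \<le> expectation (\<lambda>\<omega>. (X \<omega>)\<^sup>2) * expectation (\<lambda>\<omega>. (Y \<omega>)\<^sup>2)"
proof -
  define a b c where "a = expectation (\<lambda>\<omega>. (X \<omega>)\<^sup>2)" and "b = expectation (\<lambda>\<omega>. X \<omega> * Y \<omega>)"
    and "c = expectation (\<lambda>\<omega>. (Y \<omega>)\<^sup>2)"
  have XY: "integrable M (\<lambda>\<omega>. X \<omega> * Y \<omega>)" by (rule integrable_mult_L2) fact+
  have q: "0 \<le> a + 2 * t * b + t\<^sup>2 * c" for t
  proof -
    have "0 \<le> expectation (\<lambda>\<omega>. (X \<omega> + t * Y \<omega>)\<^sup>2)" by (rule Bochner_Integration.integral_nonneg) simp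
    also have "(\<lambda>\<omega>. (X \<omega> + t * Y \<omega>)\<^sup>2) = (\<lambda>\<omega>. (X \<omega>)\<^sup>2 + 2 * t * (X \<omega> * Y \<omega>) + t\<^sup>2 * (Y \<omega>)\<^sup>2)"
      by (simp add: power2_eq_square algebra_simps)
    also have "expectation \<dots> = a + 2 * t * b + t\<^sup>2 * c"
      using X Y XY by (simp add: a_def b_def c_def)
    finally show ?thesis .
  qed
  have c0: "0 \<le> c" unfolding c_def by (rule Bochner_Integration.integral_nonneg) simp
  have "b\<^sup>2 \<le> a * c"
  proof (cases "c = 0")
    case True
    have "b = 0"
    proof (rule ccontr)
      assume "b \<noteq> 0"
      then show False using q[of "- (a + 1) / (2 * b)"] True by (simp add: field_simps)
    qed
    then show ?thesis using True by simp
  next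
    case False
    then have "0 < c" using c0 by simp
    have "0 \<le> (a + 2 * (- b / c) * b + (- b / c)\<^sup>2 * c) * c" using q[of "- b / c"] c0 by simp
    also have "\<dots> = a * c - b\<^sup>2" using \<open>0 < c\<close> by (simp add: field_simps power2_eq_square)
    finally show ?thesis by simp
  qed
  then show ?thesis by (simp add: a_def b_def c_def)
qed

lemma expectation_abs_le_L2:
  fixes X :: "'a \<Rightarrow> real"
  assumes [measurable]: "random_variable borel X" and X: "integrable M (\<lambda>\<omega>. (X \<omega>)\<^sup>2)"
  shows "expectation (\<lambda>\<omega>. \<bar>X \<omega>\<bar>) \<le> sqrt (expectation (\<lambda>\<omega>. (X \<omega>)\<^sup>2))"
proof (rule real_le_rsqrt)
  have "(expectation (\<lambda>\<omega>. \<bar>X \<omega>\<bar> * 1))\<^sup>2 \<le> expectation (\<lambda>\<omega>. \<bar>X \<omega>\<bar>\<^sup>2) * expectation (\<lambda>\<omega>. 1\<^sup>2)"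
    by (rule Cauchy_Schwarz_expectation) (use X in auto)
  then show "(expectation (\<lambda>\<omega>. \<bar>X \<omega>\<bar>))\<^sup>2 \<le> expectation (\<lambda>\<omega>. (X \<omega>)\<^sup>2)" by (simp add: prob_space)
qed

text \<open>Both sides are continuous in mean square: \<open>iexp\<close> is 1-Lipschitz, and second
  moments converge by Cauchy-Schwarz. No frequency appears because it can be absorbed into
  \<open>X\<close> and \<open>Y\<close>.\<close>

lemma gaussian_char_L2_limit:
  fixes X :: "'a \<Rightarrow> real" and Y :: "nat \<Rightarrow> 'a \<Rightarrow> real"
  assumes Xm[measurable]: "random_variable borel X" and Ym[measurable]: "\<And>n. random_variable borel (Y n)"
    and X: "integrable M (\<lambda>\<omega>. (X \<omega>)\<^sup>2)" and Y: "\<And>n. integrable M (\<lambda>\<omega>. (Y n \<omega>)\<^sup>2)"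
    and lim: "(\<lambda>n. expectation (\<lambda>\<omega>. (Y n \<omega> - X \<omega>)\<^sup>2)) \<longlonglongrightarrow> 0"
    and ch: "\<And>n. expectation (\<lambda>\<omega>. iexp (Y n \<omega>)) = of_real (exp (- expectation (\<lambda>\<omega>. (Y n \<omega>)\<^sup>2) / 2))"
  shows "expectation (\<lambda>\<omega>. iexp (X \<omega>)) = of_real (exp (- expectation (\<lambda>\<omega>. (X \<omega>)\<^sup>2) / 2))"
proof -
  define e where "e n = expectation (\<lambda>\<omega>. (Y n \<omega> - X \<omega>)\<^sup>2)" for n
  have D: "integrable M (\<lambda>\<omega>. (Y n \<omega> - X \<omega>)\<^sup>2)" for n
  proof -
    have "integrable M (\<lambda>\<omega>. (Y n \<omega>)\<^sup>2 + (X \<omega>)\<^sup>2 - 2 * (Y n \<omega> * X \<omega>))"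
      using X Y by (intro Bochner_Integration.integrable_add Bochner_Integration.integrable_diff integrable_mult_right integrable_mult_L2) auto
    then show ?thesis by (simp add: power2_diff mult.assoc)
  qed
  have "(\<lambda>n. sqrt (e n)) \<longlonglongrightarrow> sqrt 0" unfolding e_def by (intro tendsto_intros lim)
  then have se: "(\<lambda>n. sqrt (e n)) \<longlonglongrightarrow> 0" by simp
  have "(\<lambda>n. expectation (\<lambda>\<omega>. iexp (Y n \<omega>)) - expectation (\<lambda>\<omega>. iexp (X \<omega>))) \<longlonglongrightarrow> 0"
  proof (rule Lim_null_comparison[OF always_eventually se], rule allI)
    fix n
    have int: "integrable M (\<lambda>\<omega>. iexp (Y n \<omega>))" "integrable M (\<lambda>\<omega>. iexp (X \<omega>))"
      by (rule integrable_const_bound[of _ 1]; simp)+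
    have "cmod (expectation (\<lambda>\<omega>. iexp (Y n \<omega>)) - expectation (\<lambda>\<omega>. iexp (X \<omega>))) =
        cmod (expectation (\<lambda>\<omega>. iexp (Y n \<omega>) - iexp (X \<omega>)))" using int by simp
    also have "\<dots> \<le> expectation (\<lambda>\<omega>. cmod (iexp (Y n \<omega>) - iexp (X \<omega>)))" by (rule integral_norm_bound)
    also have "\<dots> \<le> expectation (\<lambda>\<omega>. \<bar>Y n \<omega> - X \<omega>\<bar>)"
    proof (rule integral_mono)
      show "integrable M (\<lambda>\<omega>. cmod (iexp (Y n \<omega>) - iexp (X \<omega>)))" using int by (intro integrable_norm) simp
      show "integrable M (\<lambda>\<omega>. \<bar>Y n \<omega> - X \<omega>\<bar>)"
        using square_integrable_imp_integrable[OF _ D] by simp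
      show "cmod (iexp (Y n \<omega>) - iexp (X \<omega>)) \<le> \<bar>Y n \<omega> - X \<omega>\<bar>" for \<omega>
      proof -
        have "iexp (Y n \<omega>) - iexp (X \<omega>) = iexp (X \<omega>) * (iexp (Y n \<omega> - X \<omega>) - 1)"
          by (simp add: right_diff_distrib flip: exp_add)
        then have "cmod (iexp (Y n \<omega>) - iexp (X \<omega>)) = cmod (iexp (Y n \<omega> - X \<omega>) - 1)"
          by (simp only: norm_mult norm_exp_i_times mult_1)
        then show ?thesis using iexp_approx1[of "Y n \<omega> - X \<omega>" 0] by simp
      qed
    qed
    also have "\<dots> \<le> sqrt (e n)" unfolding e_def by (rule expectation_abs_le_L2) (use D in auto)
    finally show "cmod (expectation (\<lambda>\<omega>. iexp (Y n \<omega>)) - expectation (\<lambda>\<omega>. iexp (X \<omega>))) \<le> sqrt (e n)" .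
  qed
  then have l1: "(\<lambda>n. expectation (\<lambda>\<omega>. iexp (Y n \<omega>))) \<longlonglongrightarrow> expectation (\<lambda>\<omega>. iexp (X \<omega>))"
    by (rule Lim_null[THEN iffD2])
  have "(\<lambda>n. expectation (\<lambda>\<omega>. (Y n \<omega>)\<^sup>2) - expectation (\<lambda>\<omega>. (X \<omega>)\<^sup>2)) \<longlonglongrightarrow> 0"
  proof (rule Lim_null_comparison[OF always_eventually], rule allI)
    fix n
    define b where "b = expectation (\<lambda>\<omega>. X \<omega> * (Y n \<omega> - X \<omega>))"
    have XD: "integrable M (\<lambda>\<omega>. X \<omega> * (Y n \<omega> - X \<omega>))" by (rule integrable_mult_L2) (use X D in auto)
    have "b\<^sup>2 \<le> expectation (\<lambda>\<omega>. (X \<omega>)\<^sup>2) * e n"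
      unfolding b_def e_def by (rule Cauchy_Schwarz_expectation) (use X D in auto)
    then have b: "\<bar>b\<bar> \<le> sqrt (expectation (\<lambda>\<omega>. (X \<omega>)\<^sup>2)) * sqrt (e n)"
      by (simp add: real_le_rsqrt real_sqrt_mult[symmetric])
    have "(\<lambda>\<omega>. (Y n \<omega>)\<^sup>2) = (\<lambda>\<omega>. (X \<omega>)\<^sup>2 + 2 * (X \<omega> * (Y n \<omega> - X \<omega>)) + (Y n \<omega> - X \<omega>)\<^sup>2)"
      by (auto simp: power2_eq_square algebra_simps)
    then have "expectation (\<lambda>\<omega>. (Y n \<omega>)\<^sup>2) = expectation (\<lambda>\<omega>. (X \<omega>)\<^sup>2) + 2 * b + e n"
      using X XD D by (simp add: b_def e_def)
    moreover have "0 \<le> e n" unfolding e_def by (rule Bochner_Integration.integral_nonneg) simp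
    ultimately show "norm (expectation (\<lambda>\<omega>. (Y n \<omega>)\<^sup>2) - expectation (\<lambda>\<omega>. (X \<omega>)\<^sup>2)) \<le>
       2 * (sqrt (expectation (\<lambda>\<omega>. (X \<omega>)\<^sup>2)) * sqrt (e n)) + e n"
      using b by simp
  next
    have "(\<lambda>n. 2 * (sqrt (expectation (\<lambda>\<omega>. (X \<omega>)\<^sup>2)) * sqrt (e n)) + e n) \<longlonglongrightarrow>
        2 * (sqrt (expectation (\<lambda>\<omega>. (X \<omega>)\<^sup>2)) * 0) + 0"
      by (intro tendsto_intros se) (use lim in \<open>simp add: e_def\<close>)
    then show "(\<lambda>n. 2 * (sqrt (expectation (\<lambda>\<omega>. (X \<omega>)\<^sup>2)) * sqrt (e n)) + e n) \<longlonglongrightarrow> 0" by simp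
  qed
  then have "(\<lambda>n. expectation (\<lambda>\<omega>. (Y n \<omega>)\<^sup>2)) \<longlonglongrightarrow> expectation (\<lambda>\<omega>. (X \<omega>)\<^sup>2)"
    by (rule Lim_null[THEN iffD2])
  then have "(\<lambda>n. complex_of_real (exp (- expectation (\<lambda>\<omega>. (Y n \<omega>)\<^sup>2) / 2))) \<longlonglongrightarrow> of_real (exp (- expectation (\<lambda>\<omega>. (X \<omega>)\<^sup>2) / 2))"
    by (intro tendsto_intros) auto
  then show ?thesis using l1 unfolding ch by (rule LIMSEQ_unique[rotated])
qed

text \<open>Point masses are treated apart from densities: a centred one sits at 0 and has the
  Gaussian characteristic function with variance 0.\<close>

lemma gaussian_rv_square_integrable:
  assumes "gaussian_rv M X"
  shows "random_variable borel X" "integrable M (\<lambda>\<omega>. (X \<omega>)\<^sup>2)"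
    and "expectation X = 0 \<Longrightarrow> expectation (\<lambda>\<omega>. iexp (X \<omega>)) = of_real (exp (- expectation (\<lambda>\<omega>. (X \<omega>)\<^sup>2) / 2))"
proof -
  show Xm[measurable]: "random_variable borel X" using assms by (simp add: gaussian_rv_def)
  have "integrable M (\<lambda>\<omega>. (X \<omega>)\<^sup>2) \<and>
    (expectation X = 0 \<longrightarrow> expectation (\<lambda>\<omega>. iexp (X \<omega>)) = of_real (exp (- expectation (\<lambda>\<omega>. (X \<omega>)\<^sup>2) / 2)))"
    using assms[unfolded gaussian_rv_def, THEN conjunct2]
  proof (elim disjE exE conjE)
    fix \<mu> assume d: "distr M borel X = return borel \<mu>"
    have E: "expectation (\<lambda>\<omega>. f (X \<omega>)) = f \<mu>" if [measurable]: "f \<in> borel_measurable borel" for f :: "real \<Rightarrow> complex"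
      using integral_distr[OF Xm that] d by (simp add: integral_return)
    have ER: "expectation (\<lambda>\<omega>. f (X \<omega>)) = f \<mu>" if [measurable]: "f \<in> borel_measurable borel" for f :: "real \<Rightarrow> real"
      using integral_distr[OF Xm that] d by (simp add: integral_return)
    have "integrable (return borel \<mu>) (\<lambda>x. x\<^sup>2)"
      by (rule integrableI_bounded) (auto simp: nn_integral_return)
    then have "integrable M (\<lambda>\<omega>. (X \<omega>)\<^sup>2)"
      using integrable_distr_eq[OF Xm, of "\<lambda>x. x\<^sup>2"] d by simp
    moreover have "expectation X = \<mu>" using ER[of "\<lambda>x. x"] by simp
    ultimately show ?thesis using E[of iexp] ER[of "\<lambda>x. x\<^sup>2"] by simp
  next
    fix \<mu> \<sigma> assume \<sigma>: "0 < \<sigma>" and d: "distributed M lborel X (normal_density \<mu> \<sigma>)"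
    define Z where "Z \<omega> = (X \<omega> - \<mu>) / \<sigma>" for \<omega>
    have Zm[measurable]: "random_variable borel Z" unfolding Z_def by measurable
    have X: "X \<omega> = \<mu> + \<sigma> * Z \<omega>" for \<omega> using \<sigma> by (simp add: Z_def)
    have "distributed M lborel Z std_normal_density"
      using normal_standard_normal_convert[OF \<sigma>, of X \<mu>] d unfolding Z_def by simp
    then have dZ: "distr M borel Z = std_normal_distribution"
      unfolding distributed_def by (simp cong: distr_cong)
    have iZ: "integrable M (\<lambda>\<omega>. Z \<omega> ^ k)" for k
      using integrable_distr_eq[OF Zm, of "\<lambda>x. x ^ k"] integrable_std_normal_distribution_moment[of k] by (simp add: dZ)
    have EZ: "expectation (\<lambda>\<omega>. Z \<omega>) = 0" "expectation (\<lambda>\<omega>. (Z \<omega>)\<^sup>2) = 1"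
      using integral_distr[OF Zm, of "\<lambda>x. x"] integral_distr[OF Zm, of "\<lambda>x. x\<^sup>2"]
        integral_std_normal_distribution_moment_odd[of 1] std_normal_distribution_even_moments(1)[of 1]
      by (simp_all add: dZ)
    have X2: "(\<lambda>\<omega>. (X \<omega>)\<^sup>2) = (\<lambda>\<omega>. \<mu>\<^sup>2 + 2 * \<mu> * \<sigma> * Z \<omega> + \<sigma>\<^sup>2 * (Z \<omega>)\<^sup>2)"
      by (auto simp: X power2_eq_square algebra_simps)
    have i1: "integrable M Z" using iZ[of 1] by simp
    have "integrable M (\<lambda>\<omega>. (X \<omega>)\<^sup>2)" unfolding X2 using i1 iZ[of 2] by simp
    moreover have EX: "expectation X = \<mu>" unfolding X[abs_def] using i1 EZ by (simp add: prob_space)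
    moreover have "expectation (\<lambda>\<omega>. iexp (X \<omega>)) = of_real (exp (- expectation (\<lambda>\<omega>. (X \<omega>)\<^sup>2) / 2))" if "\<mu> = 0"
    proof -
      have "expectation (\<lambda>\<omega>. iexp (X \<omega>)) = expectation (\<lambda>\<omega>. iexp (\<sigma> * Z \<omega>))" using that by (simp add: X)
      also have "\<dots> = char (distr M borel Z) \<sigma>" unfolding char_def by (subst integral_distr) auto
      also have "\<dots> = of_real (exp (- \<sigma>\<^sup>2 / 2))" by (simp add: dZ char_std_normal_distribution)
      also have "\<sigma>\<^sup>2 = expectation (\<lambda>\<omega>. (X \<omega>)\<^sup>2)" unfolding X2 using that EZ iZ[of 2] by simp
      finally show ?thesis .
    qed
    ultimately show ?thesis by simp
  qed
  then show "integrable M (\<lambda>\<omega>. (X \<omega>)\<^sup>2)"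
    and "expectation X = 0 \<Longrightarrow> expectation (\<lambda>\<omega>. iexp (X \<omega>)) = of_real (exp (- expectation (\<lambda>\<omega>. (X \<omega>)\<^sup>2) / 2))"
    by blast+
qed

end

text \<open>Cauchy-Schwarz with extended values, so that no integrability has to be known in
  advance. If \<open>f\<close> is not integrable on \<open>A\<close>, the left side is 0 by
  convention; if only its square has infinite integral, the right side is infinite unless the space
  is null.\<close>

lemma norm_set_integral_square_le:
  fixes f :: "'b \<Rightarrow> complex"
  assumes S: "finite_measure S" and A: "A \<in> sets S" and f[measurable]: "f \<in> borel_measurable S"
  shows "ennreal ((cmod (LINT x:A|S. f x))\<^sup>2) \<le> ennreal (measure S (space S)) * (\<integral>\<^sup>+x\<in>A. ennreal ((cmod (f x))\<^sup>2) \<partial>S)"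
proof (cases "set_integrable S A f \<and> (\<integral>\<^sup>+x\<in>A. ennreal ((cmod (f x))\<^sup>2) \<partial>S) < \<infinity>")
  case False
  interpret finite_measure S by fact
  show ?thesis
  proof (cases "set_integrable S A f")
    case True
    then have inf: "(\<integral>\<^sup>+x\<in>A. ennreal ((cmod (f x))\<^sup>2) \<partial>S) = \<infinity>" using False by (simp add: less_top[symmetric])
    show ?thesis
    proof (cases "measure S (space S) = 0")
      case True
      then have "emeasure S (space S) = 0" by (simp add: emeasure_eq_measure)
      then have "AE x in S. False" by (intro AE_I[of _ _ "space S"]) auto
      then have "(LINT x:A|S. f x) = (LINT x|S. 0)"
        unfolding set_lebesgue_integral_def using A by (intro integral_cong_AE) auto
      then show ?thesis by simp
    next
      case False
      then have "0 < measure S (space S)" by (simp add: zero_less_measure_iff measure_nonneg less_le)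
      then show ?thesis unfolding inf by (simp add: ennreal_mult_top)
    qed
  next
    case False
    then have "(LINT x:A|S. f x) = 0"
      unfolding set_lebesgue_integral_def set_integrable_def by (rule not_integrable_integral_eq)
    then show ?thesis by simp
  qed
next
  case True
  interpret finite_measure S by fact
  let ?g = "\<lambda>x. indicator A x * cmod (f x)"
  have [measurable]: "A \<in> sets S" by fact
  have "integrable S (\<lambda>x. norm (indicator A x *\<^sub>R f x))"
    using True unfolding set_integrable_def by (intro integrable_norm) simp
  then have g: "integrable S ?g" by simp
  have eq: "(\<integral>\<^sup>+x\<in>A. ennreal ((cmod (f x))\<^sup>2) \<partial>S) = (\<integral>\<^sup>+x. ennreal ((?g x)\<^sup>2) \<partial>S)"
    by (intro nn_integral_cong) (simp add: indicator_def)
  have g2: "integrable S (\<lambda>x. (?g x)\<^sup>2)"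
    using True unfolding eq by (intro integrableI_bounded) (auto simp: power_abs)
  define I J V where "I = (LINT x|S. ?g x)" and "J = (LINT x|S. (?g x)\<^sup>2)" and "V = measure S (space S)"
  have q: "0 \<le> J - 2 * t * I + t\<^sup>2 * V" for t
  proof -
    have "0 \<le> (LINT x|S. (?g x - t)\<^sup>2)" by (rule Bochner_Integration.integral_nonneg) simp
    also have "(\<lambda>x. (?g x - t)\<^sup>2) = (\<lambda>x. (?g x)\<^sup>2 - 2 * t * ?g x + t\<^sup>2)"
      by (auto simp: power2_diff)
    also have "(LINT x|S. (?g x)\<^sup>2 - 2 * t * ?g x + t\<^sup>2) = J - 2 * t * I + t\<^sup>2 * V"
      using g g2 unfolding I_def J_def V_def by (subst Bochner_Integration.integral_add) (auto simp: mult.commute)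
    finally show ?thesis .
  qed
  have V0: "0 \<le> V" by (simp add: V_def)
  have "I\<^sup>2 \<le> V * J"
  proof (cases "V = 0")
    case True
    have "I = 0"
    proof (rule ccontr)
      assume "I \<noteq> 0"
      then show False using q[of "(J + 1) / (2 * I)"] True by (simp add: field_simps)
    qed
    then show ?thesis using True by simp
  next
    case False
    then have V: "0 < V" using V0 by simp
    have "0 \<le> (J - 2 * (I / V) * I + (I / V)\<^sup>2 * V) * V" using q[of "I / V"] V by simp
    also have "\<dots> = V * J - I\<^sup>2" using V by (simp add: field_simps power2_eq_square)
    finally show ?thesis by simp
  qed
  moreover have "cmod (LINT x:A|S. f x) \<le> I"
    using integral_norm_bound[of S "\<lambda>x. indicator A x *\<^sub>R f x"] unfolding I_def set_lebesgue_integral_def by simp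
  then have "(cmod (LINT x:A|S. f x))\<^sup>2 \<le> I\<^sup>2" by (intro power_mono) auto
  ultimately have "ennreal ((cmod (LINT x:A|S. f x))\<^sup>2) \<le> ennreal (V * J)" by (intro ennreal_leI) linarith
  also have "\<dots> = ennreal V * ennreal J" using V0 by (simp add: ennreal_mult' )
  also have "ennreal J = (\<integral>\<^sup>+x. ennreal ((?g x)\<^sup>2) \<partial>S)"
    unfolding J_def by (rule nn_integral_eq_integral[symmetric, OF g2]) simp
  finally show ?thesis unfolding eq V_def .
qed

lemma cmod_add_square_le: "(cmod (x + y))\<^sup>2 \<le> 2 * (cmod x)\<^sup>2 + 2 * (cmod y)\<^sup>2"
proof -
  have "(cmod (x + y))\<^sup>2 \<le> (cmod x + cmod y)\<^sup>2" by (intro power_mono norm_triangle_ineq) simp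
  also have "\<dots> \<le> 2 * (cmod x)\<^sup>2 + 2 * (cmod y)\<^sup>2"
    using zero_le_power2[of "cmod x - cmod y"] by (simp add: power2_eq_square algebra_simps)
  finally show ?thesis .
qed

lemma cmod_square_mult_le: "cmod (x * y) \<le> (cmod x)\<^sup>2 + (cmod y)\<^sup>2"
proof -
  have "0 \<le> cmod x * cmod y" by simp
  moreover have "2 * (cmod x * cmod y) \<le> (cmod x)\<^sup>2 + (cmod y)\<^sup>2"
    using sum_squares_bound[of "cmod x" "cmod y"] by (simp only: mult.assoc)
  ultimately show ?thesis unfolding norm_mult by linarith
qed

lemma cnj_measurable[measurable]: "cnj \<in> borel_measurable borel"
  by (intro borel_measurable_continuous_onI continuous_intros)

lemma cmod_sum_mult_square_le:
  fixes z u :: "'i \<Rightarrow> complex"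
  shows "(cmod (\<Sum>i\<in>I. z i * u i))\<^sup>2 \<le> (\<Sum>i\<in>I. (cmod (z i))\<^sup>2) * (\<Sum>i\<in>I. (cmod (u i))\<^sup>2)"
proof -
  have "(cmod (\<Sum>i\<in>I. z i * u i))\<^sup>2 \<le> (\<Sum>i\<in>I. cmod (z i) * cmod (u i))\<^sup>2"
    by (intro power_mono order_trans[OF norm_sum]) (simp_all add: norm_mult)
  also have "\<dots> \<le> (\<Sum>i\<in>I. (cmod (z i))\<^sup>2) * (\<Sum>i\<in>I. (cmod (u i))\<^sup>2)" by (rule Cauchy_Schwarz_ineq_sum)
  finally show ?thesis .
qed

definition (in prob_space) L2_rv :: "('a \<Rightarrow> complex) \<Rightarrow> bool" where
  "L2_rv X \<longleftrightarrow> random_variable borel X \<and> integrable M (\<lambda>\<omega>. (cmod (X \<omega>))\<^sup>2)"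

definition (in prob_space) mean_square :: "('a \<Rightarrow> complex) \<Rightarrow> real" where
  "mean_square X = expectation (\<lambda>\<omega>. (cmod (X \<omega>))\<^sup>2)"

context prob_space
begin

lemma L2_rvD: "L2_rv X \<Longrightarrow> random_variable borel X" "L2_rv X \<Longrightarrow> integrable M (\<lambda>\<omega>. (cmod (X \<omega>))\<^sup>2)"
  by (simp_all add: L2_rv_def)

lemma mean_square_nonneg: "0 \<le> mean_square X"
  unfolding mean_square_def by (rule Bochner_Integration.integral_nonneg) simp

lemma L2_rv_add:
  assumes X: "L2_rv X" and Y: "L2_rv Y"
  shows "L2_rv (\<lambda>\<omega>. X \<omega> + Y \<omega>)" "mean_square (\<lambda>\<omega>. X \<omega> + Y \<omega>) \<le> 2 * mean_square X + 2 * mean_square Y"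
proof -
  note [measurable] = L2_rvD(1)[OF X] L2_rvD(1)[OF Y]
  have i: "integrable M (\<lambda>\<omega>. 2 * (cmod (X \<omega>))\<^sup>2 + 2 * (cmod (Y \<omega>))\<^sup>2)"
    using L2_rvD(2)[OF X] L2_rvD(2)[OF Y] by simp
  have i2: "integrable M (\<lambda>\<omega>. (cmod (X \<omega> + Y \<omega>))\<^sup>2)"
    by (rule Bochner_Integration.integrable_bound[OF i]) (auto intro!: order_trans[OF cmod_add_square_le])
  then show "L2_rv (\<lambda>\<omega>. X \<omega> + Y \<omega>)" by (simp add: L2_rv_def)
  have "mean_square (\<lambda>\<omega>. X \<omega> + Y \<omega>) \<le> expectation (\<lambda>\<omega>. 2 * (cmod (X \<omega>))\<^sup>2 + 2 * (cmod (Y \<omega>))\<^sup>2)"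
    unfolding mean_square_def by (rule integral_mono[OF i2 i cmod_add_square_le])
  also have "\<dots> = 2 * mean_square X + 2 * mean_square Y"
    unfolding mean_square_def using L2_rvD(2)[OF X] L2_rvD(2)[OF Y] by simp
  finally show "mean_square (\<lambda>\<omega>. X \<omega> + Y \<omega>) \<le> 2 * mean_square X + 2 * mean_square Y" .
qed

lemma L2_rv_mult:
  assumes X: "L2_rv X"
  shows "L2_rv (\<lambda>\<omega>. c * X \<omega>)" "mean_square (\<lambda>\<omega>. c * X \<omega>) = (cmod c)\<^sup>2 * mean_square X"
proof -
  note [measurable] = L2_rvD(1)[OF X]
  show "L2_rv (\<lambda>\<omega>. c * X \<omega>)"
    using L2_rvD(2)[OF X] unfolding L2_rv_def norm_mult power_mult_distrib by simp
  show "mean_square (\<lambda>\<omega>. c * X \<omega>) = (cmod c)\<^sup>2 * mean_square X"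
    by (simp add: mean_square_def norm_mult power_mult_distrib)
qed

lemma L2_rv_diff:
  assumes X: "L2_rv X" and Y: "L2_rv Y"
  shows "L2_rv (\<lambda>\<omega>. X \<omega> - Y \<omega>)" "mean_square (\<lambda>\<omega>. X \<omega> - Y \<omega>) \<le> 2 * mean_square X + 2 * mean_square Y"
  using L2_rv_add[OF X L2_rv_mult(1)[OF Y, of "-1"]] L2_rv_mult(2)[OF Y, of "-1"] by simp_all

lemma L2_rv_sum:
  assumes "\<And>i. i \<in> I \<Longrightarrow> L2_rv (X i)"
  shows "L2_rv (\<lambda>\<omega>. \<Sum>i\<in>I. X i \<omega>)"
  using assms
proof (induction I rule: infinite_finite_induct)
  case (insert i I)
  then have "L2_rv (\<lambda>\<omega>. X i \<omega> + (\<Sum>i\<in>I. X i \<omega>))" by (intro L2_rv_add(1)) auto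
  then show ?case using insert by simp
qed (simp_all add: L2_rv_def)

lemma L2_rv_parts:
  assumes X: "L2_rv X"
  shows "random_variable borel (\<lambda>\<omega>. Re (X \<omega>))" "random_variable borel (\<lambda>\<omega>. Im (X \<omega>))"
    and "integrable M (\<lambda>\<omega>. (Re (X \<omega>))\<^sup>2)" "integrable M (\<lambda>\<omega>. (Im (X \<omega>))\<^sup>2)"
    and "mean_square X = expectation (\<lambda>\<omega>. (Re (X \<omega>))\<^sup>2) + expectation (\<lambda>\<omega>. (Im (X \<omega>))\<^sup>2)"
proof -
  note [measurable] = L2_rvD(1)[OF X]
  show "random_variable borel (\<lambda>\<omega>. Re (X \<omega>))" "random_variable borel (\<lambda>\<omega>. Im (X \<omega>))" by simp_all
  show i: "integrable M (\<lambda>\<omega>. (Re (X \<omega>))\<^sup>2)" "integrable M (\<lambda>\<omega>. (Im (X \<omega>))\<^sup>2)"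
    by (rule Bochner_Integration.integrable_bound[OF L2_rvD(2)[OF X]]; simp add: cmod_power2)+
  show "mean_square X = expectation (\<lambda>\<omega>. (Re (X \<omega>))\<^sup>2) + expectation (\<lambda>\<omega>. (Im (X \<omega>))\<^sup>2)"
    unfolding mean_square_def cmod_power2 using i by (rule Bochner_Integration.integral_add)
qed

lemma L2_rvI_parts:
  assumes [measurable]: "random_variable borel (\<lambda>\<omega>. Re (X \<omega>))" "random_variable borel (\<lambda>\<omega>. Im (X \<omega>))"
    and "integrable M (\<lambda>\<omega>. (Re (X \<omega>))\<^sup>2)" "integrable M (\<lambda>\<omega>. (Im (X \<omega>))\<^sup>2)"
  shows "L2_rv X"
proof -
  have "random_variable borel (\<lambda>\<omega>. complex_of_real (Re (X \<omega>)) + \<i> * complex_of_real (Im (X \<omega>)))" by simp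
  then show ?thesis using assms(3,4) by (simp add: L2_rv_def cmod_power2 complex_eq[symmetric])
qed

lemma L2_rv_integrable_mult:
  assumes X: "L2_rv X" and Y: "L2_rv Y"
  shows "integrable M (\<lambda>\<omega>. X \<omega> * Y \<omega>)"
proof -
  note [measurable] = L2_rvD(1)[OF X] L2_rvD(1)[OF Y]
  have i: "integrable M (\<lambda>\<omega>. (cmod (X \<omega>))\<^sup>2 + (cmod (Y \<omega>))\<^sup>2)"
    using L2_rvD(2)[OF X] L2_rvD(2)[OF Y] by simp
  show ?thesis
    by (rule Bochner_Integration.integrable_bound[OF i]) (auto intro!: order_trans[OF cmod_square_mult_le])
qed

lemma L2_rv_cnj: "L2_rv X \<Longrightarrow> L2_rv (\<lambda>\<omega>. cnj (X \<omega>))"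
  unfolding L2_rv_def complex_mod_cnj by (auto intro: measurable_compose[OF _ cnj_measurable])

lemma L2_rv_const: "L2_rv (\<lambda>\<omega>. c)"
  by (simp add: L2_rv_def)

lemma L2_rv_integrable: "L2_rv X \<Longrightarrow> integrable M X"
  using L2_rv_integrable_mult[OF _ L2_rv_const[of 1]] by simp

lemma L2_rvI_nn_integral:
  assumes X: "random_variable borel X" and "(\<integral>\<^sup>+\<omega>. ennreal ((cmod (X \<omega>))\<^sup>2) \<partial>M) \<le> ennreal c" and c: "0 \<le> c"
  shows "L2_rv X" "mean_square X \<le> c"
proof -
  note [measurable] = X
  have i: "integrable M (\<lambda>\<omega>. (cmod (X \<omega>))\<^sup>2)"
    by (rule integrableI_bounded) (use assms in \<open>auto simp: power_abs intro: le_less_trans\<close>)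
  then show "L2_rv X" by (simp add: L2_rv_def)
  have "ennreal (mean_square X) = (\<integral>\<^sup>+\<omega>. ennreal ((cmod (X \<omega>))\<^sup>2) \<partial>M)"
    unfolding mean_square_def by (rule nn_integral_eq_integral[symmetric, OF i]) simp
  then have "ennreal (mean_square X) \<le> ennreal c" using assms(2) by (simp only:)
  then show "mean_square X \<le> c" by (rule ennreal_le_iff[OF c, THEN iffD1])
qed

text \<open>Unlike the triangle inequality with factors 2, this keeps the main term exact and
  charges the perturbation only through its norm, as a bias estimate requires.\<close>

lemma mean_square_perturbation:
  assumes X: "L2_rv X" and Y: "L2_rv Y"
  shows "\<bar>mean_square X - mean_square Y\<bar> \<le>
    2 * sqrt (mean_square Y * mean_square (\<lambda>\<omega>. X \<omega> - Y \<omega>)) + mean_square (\<lambda>\<omega>. X \<omega> - Y \<omega>)"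
proof -
  let ?D = "\<lambda>\<omega>. X \<omega> - Y \<omega>"
  have D: "L2_rv ?D" by (rule L2_rv_diff(1)[OF X Y])
  note [measurable] = L2_rvD(1)[OF X] L2_rvD(1)[OF Y] L2_rvD(1)[OF D]
  note XI = L2_rvD(2)[OF X] and YI = L2_rvD(2)[OF Y] and DI = L2_rvD(2)[OF D]
  have YD: "integrable M (\<lambda>\<omega>. cmod (Y \<omega>) * cmod (?D \<omega>))"
    by (rule integrable_mult_L2) (use YI DI in simp_all)
  have pw: "\<bar>(cmod x)\<^sup>2 - (cmod y)\<^sup>2\<bar> \<le> 2 * (cmod y * cmod (x - y)) + (cmod (x - y))\<^sup>2" for x y
  proof -
    have x: "cmod x \<le> cmod y + cmod (x - y)" using norm_triangle_ineq[of y "x - y"] by simp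
    have y: "cmod y \<le> cmod x + cmod (x - y)" using norm_triangle_ineq[of x "y - x"] by (simp add: norm_minus_commute)
    have 1: "(cmod x)\<^sup>2 \<le> (cmod y + cmod (x - y))\<^sup>2" using x by (intro power_mono) auto
    have "(cmod y)\<^sup>2 - (cmod x)\<^sup>2 = (cmod y - cmod x) * (cmod y + cmod x)" by (simp add: power2_eq_square algebra_simps)
    also have "\<dots> \<le> cmod (x - y) * (cmod y + (cmod y + cmod (x - y)))"
      using x y by (intro mult_mono) auto
    finally show ?thesis using 1 by (simp add: power2_eq_square algebra_simps abs_le_iff)
  qed
  have "\<bar>mean_square X - mean_square Y\<bar> = \<bar>expectation (\<lambda>\<omega>. (cmod (X \<omega>))\<^sup>2 - (cmod (Y \<omega>))\<^sup>2)\<bar>"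
    unfolding mean_square_def using XI YI by simp
  also have "\<dots> \<le> expectation (\<lambda>\<omega>. \<bar>(cmod (X \<omega>))\<^sup>2 - (cmod (Y \<omega>))\<^sup>2\<bar>)" by (rule integral_abs_bound)
  also have "\<dots> \<le> expectation (\<lambda>\<omega>. 2 * (cmod (Y \<omega>) * cmod (?D \<omega>)) + (cmod (?D \<omega>))\<^sup>2)"
    by (rule integral_mono) (use XI YI DI YD pw in auto)
  also have "\<dots> = 2 * expectation (\<lambda>\<omega>. cmod (Y \<omega>) * cmod (?D \<omega>)) + mean_square ?D"
    unfolding mean_square_def using YD DI by simp
  also have "expectation (\<lambda>\<omega>. cmod (Y \<omega>) * cmod (?D \<omega>)) \<le> sqrt (mean_square Y * mean_square ?D)"
    unfolding mean_square_def by (rule real_le_rsqrt, rule Cauchy_Schwarz_expectation) (use YI DI in simp_all)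
  finally show ?thesis by simp
qed

end

section \<open>The field and its truncated harmonic expansions\<close>

definition harmonic_index :: "int \<Rightarrow> (nat \<times> int) set" where
  "harmonic_index s = (SIGMA l:multipoles s. {- int l..int l})"

definition harmonics_upto :: "int \<Rightarrow> nat \<Rightarrow> (nat \<times> int) set" where
  "harmonics_upto s L = (SIGMA l:multipoles s \<inter> {..L}. {- int l..int l})"

abbreviation harmonic :: "int \<Rightarrow> nat \<times> int \<Rightarrow> real^3 \<Rightarrow> complex" where
  "harmonic s p x \<equiv> spin_harmonic (fst p) (snd p) s x"

lemma finite_harmonics_upto[simp]: "finite (harmonics_upto s L)"
  unfolding harmonics_upto_def by (intro finite_SigmaI) auto

lemma harmonics_upto_subset: "harmonics_upto s L \<subseteq> harmonic_index s"
  unfolding harmonics_upto_def harmonic_index_def by auto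

lemma harmonics_upto_mono: "L \<le> L' \<Longrightarrow> harmonics_upto s L \<subseteq> harmonics_upto s L'"
  unfolding harmonics_upto_def by auto

lemma sum_harmonics_upto:
  "(\<Sum>p\<in>harmonics_upto s L. f p) = (\<Sum>l\<in>multipoles s \<inter> {..L}. \<Sum>m = - int l..int l. f (l, m))"
  unfolding harmonics_upto_def by (subst sum.Sigma) auto

lemma harmonic_index_bounds:
  assumes "p \<in> harmonic_index s"
  shows "\<bar>s\<bar> \<le> int (fst p)" "\<bar>snd p\<bar> \<le> int (fst p)" "fst p \<in> multipoles s"
  using assms unfolding harmonic_index_def multipoles_def by auto

lemma harmonic_measurable[measurable]: "harmonic s p \<in> borel_measurable surface_measure"
  by (rule measurable_surface_measure[OF spin_harmonic_measurable])

lemma harmonic_orthonormal: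
  assumes "p \<in> harmonic_index s" "q \<in> harmonic_index s"
  shows "(LINT x|surface_measure. harmonic s p x * cnj (harmonic s q x)) = (if p = q then 1 else 0)"
  using spin_harmonic_orthonormal[OF harmonic_index_bounds(1)[OF assms(1)] harmonic_index_bounds(1)[OF assms(2)]
      harmonic_index_bounds(2)[OF assms(1)] harmonic_index_bounds(2)[OF assms(2)]]
  by (simp add: prod_eq_iff)

lemma set_integrable_surface_bounded:
  fixes f :: "real^3 \<Rightarrow> complex"
  assumes A[measurable]: "A \<in> sets surface_measure" and f[measurable]: "f \<in> borel_measurable surface_measure"
    and K: "\<And>x. x \<in> A \<Longrightarrow> cmod (f x) \<le> K"
  shows "set_integrable surface_measure A f"
proof -
  interpret finite_measure surface_measure by (rule finite_measure_surface_measure)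
  show ?thesis unfolding set_integrable_def
    by (rule integrable_const_bound[of _ "\<bar>K\<bar>"]) (auto simp: indicator_def intro!: AE_I2 order_trans[OF K])
qed

text \<open>The variance which the multipole \<open>l\<close> contributes to the field at any single
  point.\<close>

definition angular_power :: "int \<Rightarrow> (nat \<Rightarrow> real) \<Rightarrow> nat \<Rightarrow> real" where
  "angular_power s C l = (if l \<in> multipoles s then C l * ((2 * real l + 1) / (4 * pi)) else 0)"

locale spin_field = prob_space M for M :: "'a measure" +
  fixes s :: int and C :: "nat \<Rightarrow> real" and P :: "'a \<Rightarrow> real^3 \<Rightarrow> complex"
    and a :: "nat \<times> int \<Rightarrow> 'a \<Rightarrow> complex"
  assumes P_measurable[measurable]: "(\<lambda>(\<omega>, x). P \<omega> x) \<in> borel_measurable (M \<Otimes>\<^sub>M surface_measure)"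
    and gaussian: "jointly_gaussian M (harmonic_index s) a"
    and mean: "\<And>p. p \<in> harmonic_index s \<Longrightarrow> expectation (a p) = 0"
    and covariance: "\<And>p q. p \<in> harmonic_index s \<Longrightarrow> q \<in> harmonic_index s \<Longrightarrow>
      expectation (\<lambda>\<omega>. a p \<omega> * cnj (a q \<omega>)) = (if p = q then of_real (C (fst p)) else 0)"
    and mean_square_convergence: "\<And>x. x \<in> sphere 0 1 \<Longrightarrow>
      (\<lambda>L. \<integral>\<^sup>+\<omega>. ennreal ((cmod (P \<omega> x - (\<Sum>p\<in>harmonics_upto s L. a p \<omega> * harmonic s p x)))\<^sup>2) \<partial>M) \<longlonglongrightarrow> 0"
    and C_pos: "\<And>l. l \<in> multipoles s \<Longrightarrow> 0 < C l"
    and summable_power: "summable (angular_power s C)"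
begin

definition truncation :: "nat \<Rightarrow> 'a \<Rightarrow> real^3 \<Rightarrow> complex" where
  "truncation L \<omega> x = (\<Sum>p\<in>harmonics_upto s L. a p \<omega> * harmonic s p x)"

lemma coefficient_L2:
  assumes p: "p \<in> harmonic_index s"
  shows "L2_rv (a p)"
proof -
  have g: "gaussian_rv M (\<lambda>\<omega>. \<Sum>i\<in>{p}. u i * Re (a i \<omega>) + v i * Im (a i \<omega>))" for u v
    using gaussian p unfolding jointly_gaussian_def by blast
  have "gaussian_rv M (\<lambda>\<omega>. Re (a p \<omega>))" "gaussian_rv M (\<lambda>\<omega>. Im (a p \<omega>))"
    using g[of "\<lambda>_. 1" "\<lambda>_. 0"] g[of "\<lambda>_. 0" "\<lambda>_. 1"] by simp_all
  then show ?thesis by (intro L2_rvI_parts gaussian_rv_square_integrable)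
qed

lemma linear_combination_L2:
  assumes "J \<subseteq> harmonic_index s"
  shows "L2_rv (\<lambda>\<omega>. \<Sum>p\<in>J. a p \<omega> * z p)"
  using assms by (intro L2_rv_sum) (subst mult.commute, intro L2_rv_mult(1) coefficient_L2, auto)

lemma mean_square_linear_combination:
  assumes J: "finite J" "J \<subseteq> harmonic_index s"
  shows "mean_square (\<lambda>\<omega>. \<Sum>p\<in>J. a p \<omega> * z p) = (\<Sum>p\<in>J. C (fst p) * (cmod (z p))\<^sup>2)"
proof -
  have int: "integrable M (\<lambda>\<omega>. a p \<omega> * cnj (a q \<omega>))" if "p \<in> J" "q \<in> J" for p q
    using that J(2) by (intro L2_rv_integrable_mult L2_rv_cnj coefficient_L2) auto
  have eq: "complex_of_real ((cmod (\<Sum>p\<in>J. a p \<omega> * z p))\<^sup>2) =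
    (\<Sum>p\<in>J. \<Sum>q\<in>J. (z p * cnj (z q)) * (a p \<omega> * cnj (a q \<omega>)))" for \<omega>
    unfolding complex_norm_square cnj_sum sum_product by (intro sum.cong refl) (simp add: mult_ac)
  have "complex_of_real (mean_square (\<lambda>\<omega>. \<Sum>p\<in>J. a p \<omega> * z p)) =
      expectation (\<lambda>\<omega>. complex_of_real ((cmod (\<Sum>p\<in>J. a p \<omega> * z p))\<^sup>2))"
    unfolding mean_square_def by (rule integral_complex_of_real[symmetric])
  also have "\<dots> = (\<Sum>p\<in>J. \<Sum>q\<in>J. (z p * cnj (z q)) * expectation (\<lambda>\<omega>. a p \<omega> * cnj (a q \<omega>)))"
    unfolding eq using int
    by (subst Bochner_Integration.integral_sum, force, intro sum.cong refl, subst Bochner_Integration.integral_sum) auto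
  also have "\<dots> = (\<Sum>p\<in>J. \<Sum>q\<in>J. if p = q then complex_of_real (C (fst p) * (cmod (z p))\<^sup>2) else 0)"
    using J(2) by (intro sum.cong refl) (subst covariance, auto simp: complex_norm_square[symmetric] simp del: of_real_power)
  also have "\<dots> = of_real (\<Sum>p\<in>J. C (fst p) * (cmod (z p))\<^sup>2)" using J(1) by simp
  finally show ?thesis by (simp only: of_real_eq_iff)
qed

lemma linear_combination_gaussian:
  assumes J: "finite J" "J \<subseteq> harmonic_index s"
  shows "expectation (\<lambda>\<omega>. iexp (Re (\<Sum>p\<in>J. a p \<omega> * z p))) =
    of_real (exp (- expectation (\<lambda>\<omega>. (Re (\<Sum>p\<in>J. a p \<omega> * z p))\<^sup>2) / 2))"
proof (rule gaussian_rv_square_integrable(3))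
  have "gaussian_rv M (\<lambda>\<omega>. \<Sum>p\<in>J. Re (z p) * Re (a p \<omega>) + (- Im (z p)) * Im (a p \<omega>))"
    by (rule gaussian[unfolded jointly_gaussian_def, rule_format]) (use J in auto)
  moreover have "(\<lambda>\<omega>. \<Sum>p\<in>J. Re (z p) * Re (a p \<omega>) + (- Im (z p)) * Im (a p \<omega>)) = (\<lambda>\<omega>. Re (\<Sum>p\<in>J. a p \<omega> * z p))"
    by (intro ext) (simp add: Re_sum mult.commute)
  ultimately show "gaussian_rv M (\<lambda>\<omega>. Re (\<Sum>p\<in>J. a p \<omega> * z p))" by (simp only:)
  have int: "integrable M (\<lambda>\<omega>. a p \<omega> * z p)" if "p \<in> J" for p
    by (intro integrable_mult_left L2_rv_integrable coefficient_L2) (use that J in blast)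
  have "expectation (\<lambda>\<omega>. Re (\<Sum>p\<in>J. a p \<omega> * z p)) = Re (expectation (\<lambda>\<omega>. \<Sum>p\<in>J. a p \<omega> * z p))"
    by (rule integral_Re) (use int in auto)
  also have "expectation (\<lambda>\<omega>. \<Sum>p\<in>J. a p \<omega> * z p) = (\<Sum>p\<in>J. expectation (a p) * z p)"
    using int by (subst Bochner_Integration.integral_sum) (auto simp: integral_mult_left_zero)
  also have "\<dots> = 0" using J(2) mean by (intro sum.neutral) auto
  finally show "expectation (\<lambda>\<omega>. Re (\<Sum>p\<in>J. a p \<omega> * z p)) = 0" by simp
qed

lemma coefficient_measurable: "p \<in> harmonics_upto s L \<Longrightarrow> a p \<in> borel_measurable M"
  using harmonics_upto_subset by (intro L2_rvD(1) coefficient_L2) auto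

lemma truncation_measurable[measurable]: "(\<lambda>(\<omega>, x). truncation L \<omega> x) \<in> borel_measurable (M \<Otimes>\<^sub>M surface_measure)"
  unfolding truncation_def case_prod_beta'
proof (intro borel_measurable_sum borel_measurable_times)
  fix p assume "p \<in> harmonics_upto s L"
  note [measurable] = coefficient_measurable[OF this]
  show "(\<lambda>y. a p (fst y)) \<in> borel_measurable (M \<Otimes>\<^sub>M surface_measure)" by measurable
  show "(\<lambda>y. harmonic s p (snd y)) \<in> borel_measurable (M \<Otimes>\<^sub>M surface_measure)" by measurable
qed

lemma angular_power_nonneg: "0 \<le> angular_power s C l"
  unfolding angular_power_def using C_pos[of l]
  by (auto intro!: mult_nonneg_nonneg divide_nonneg_nonneg simp del: times_divide_eq_right)

definition tail :: "nat \<Rightarrow> real" where "tail L = suminf (angular_power s C) - (\<Sum>l\<le>L. angular_power s C l)"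

lemma sum_power_le: "finite A \<Longrightarrow> sum (angular_power s C) A \<le> suminf (angular_power s C)"
  by (rule sum_le_suminf[OF summable_power]) (simp_all add: angular_power_nonneg)

lemma tail_nonneg: "0 \<le> tail L"
  using sum_power_le[of "{..L}"] by (simp add: tail_def)

lemma tail_tendsto: "tail \<longlonglongrightarrow> 0"
proof -
  have "(\<lambda>L. suminf (angular_power s C) - (\<Sum>l\<le>L. angular_power s C l)) \<longlonglongrightarrow>
      suminf (angular_power s C) - suminf (angular_power s C)"
    by (intro tendsto_intros summable_LIMSEQ'[OF summable_power])
  then show ?thesis by (simp add: tail_def[abs_def])
qed

text \<open>The sum rule for the squared harmonics of one multipole removes the point from the
  variance; the bounds on truncation errors thereby become uniform over the sphere.\<close>

lemma mean_square_truncation: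
  assumes x: "x \<in> sphere 0 1"
  shows "mean_square (\<lambda>\<omega>. truncation L \<omega> x) = (\<Sum>l\<le>L. angular_power s C l)"
proof -
  have "mean_square (\<lambda>\<omega>. truncation L \<omega> x) = (\<Sum>p\<in>harmonics_upto s L. C (fst p) * (cmod (harmonic s p x))\<^sup>2)"
    unfolding truncation_def by (rule mean_square_linear_combination[OF finite_harmonics_upto harmonics_upto_subset])
  also have "\<dots> = (\<Sum>l\<in>multipoles s \<inter> {..L}. C l * (\<Sum>m = - int l..int l. (cmod (spin_harmonic l m s x))\<^sup>2))"
    unfolding sum_harmonics_upto by (simp add: sum_distrib_left)
  also have "\<dots> = (\<Sum>l\<in>multipoles s \<inter> {..L}. angular_power s C l)"
    using x by (intro sum.cong refl) (subst sum_spin_harmonic_norm, auto simp: angular_power_def multipoles_def)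
  also have "\<dots> = (\<Sum>l\<le>L. angular_power s C l)"
    by (rule sum.mono_neutral_left) (auto simp: angular_power_def)
  finally show ?thesis .
qed

lemma mean_square_truncation_diff:
  assumes x: "x \<in> sphere 0 1" and L: "L \<le> L'"
  shows "mean_square (\<lambda>\<omega>. truncation L' \<omega> x - truncation L \<omega> x) \<le> tail L"
proof -
  let ?D = "harmonics_upto s L' - harmonics_upto s L" and ?f = "\<lambda>p. C (fst p) * (cmod (harmonic s p x))\<^sup>2"
  note sub = harmonics_upto_mono[OF L, of s]
  have "(\<lambda>\<omega>. truncation L' \<omega> x - truncation L \<omega> x) = (\<lambda>\<omega>. \<Sum>p\<in>?D. a p \<omega> * harmonic s p x)"
    unfolding truncation_def by (subst sum_diff[OF finite_harmonics_upto sub]) simp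
  then have "mean_square (\<lambda>\<omega>. truncation L' \<omega> x - truncation L \<omega> x) = sum ?f ?D"
    using mean_square_linear_combination[of ?D "\<lambda>p. harmonic s p x"] harmonics_upto_subset[of s L'] by auto
  also have "\<dots> = sum ?f (harmonics_upto s L') - sum ?f (harmonics_upto s L)"
    by (rule sum_diff[OF finite_harmonics_upto sub])
  also have "\<dots> = mean_square (\<lambda>\<omega>. truncation L' \<omega> x) - mean_square (\<lambda>\<omega>. truncation L \<omega> x)"
    unfolding truncation_def by (subst (1 2) mean_square_linear_combination) (auto intro: subsetD[OF harmonics_upto_subset])
  also have "\<dots> = (\<Sum>l\<le>L'. angular_power s C l) - (\<Sum>l\<le>L. angular_power s C l)" by (simp only: mean_square_truncation[OF x])
  also have "\<dots> \<le> tail L" using sum_power_le[of "{..L'}"] by (simp add: tail_def)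
  finally show ?thesis .
qed

lemma truncation_L2: "L2_rv (\<lambda>\<omega>. truncation L \<omega> x)"
  unfolding truncation_def by (rule linear_combination_L2[OF harmonics_upto_subset])

lemma nn_integral_mean_square: "L2_rv X \<Longrightarrow> (\<integral>\<^sup>+\<omega>. ennreal ((cmod (X \<omega>))\<^sup>2) \<partial>M) = ennreal (mean_square X)"
  unfolding mean_square_def by (rule nn_integral_eq_integral) (auto simp: L2_rv_def)

lemma field_section_measurable:
  assumes "x \<in> sphere 0 1"
  shows "(\<lambda>\<omega>. P \<omega> x) \<in> borel_measurable M"
  using measurable_Pair1[OF P_measurable, of x] assms by simp

text \<open>Compare with a longer truncation and let its length tend to infinity. The pointwise
  convergence assumed of the field has no rate; the bound obtained here is uniform in
  \<open>x\<close> and can be integrated.\<close>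

lemma truncation_error:
  assumes x: "x \<in> sphere 0 1"
  shows "(\<integral>\<^sup>+\<omega>. ennreal ((cmod (P \<omega> x - truncation L \<omega> x))\<^sup>2) \<partial>M) \<le> ennreal (2 * tail L)"
proof -
  note [measurable] = field_section_measurable[OF x] L2_rvD(1)[OF truncation_L2]
  let ?E = "\<lambda>L'. \<integral>\<^sup>+\<omega>. ennreal ((cmod (P \<omega> x - truncation L' \<omega> x))\<^sup>2) \<partial>M"
  have lim: "(\<lambda>L'. 2 * ?E L' + ennreal (2 * tail L)) \<longlonglongrightarrow> 2 * 0 + ennreal (2 * tail L)"
    using mean_square_convergence[OF x] unfolding truncation_def[symmetric]
    by (intro tendsto_add tendsto_const ennreal_tendsto_cmult) auto
  have "?E L \<le> 2 * ?E L' + ennreal (2 * tail L)" if L': "L \<le> L'" for L'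
  proof -
    have "?E L \<le> (\<integral>\<^sup>+\<omega>. 2 * ennreal ((cmod (P \<omega> x - truncation L' \<omega> x))\<^sup>2) +
        2 * ennreal ((cmod (truncation L' \<omega> x - truncation L \<omega> x))\<^sup>2) \<partial>M)"
    proof (rule nn_integral_mono)
      fix \<omega>
      have "(cmod (P \<omega> x - truncation L \<omega> x))\<^sup>2 \<le> 2 * (cmod (P \<omega> x - truncation L' \<omega> x))\<^sup>2 + 2 * (cmod (truncation L' \<omega> x - truncation L \<omega> x))\<^sup>2"
        using cmod_add_square_le[of "P \<omega> x - truncation L' \<omega> x" "truncation L' \<omega> x - truncation L \<omega> x"] by simp
      then have "ennreal ((cmod (P \<omega> x - truncation L \<omega> x))\<^sup>2) \<le> ennreal (2 * (cmod (P \<omega> x - truncation L' \<omega> x))\<^sup>2 + 2 * (cmod (truncation L' \<omega> x - truncation L \<omega> x))\<^sup>2)"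
        by (rule ennreal_leI)
      also have "\<dots> = 2 * ennreal ((cmod (P \<omega> x - truncation L' \<omega> x))\<^sup>2) + 2 * ennreal ((cmod (truncation L' \<omega> x - truncation L \<omega> x))\<^sup>2)"
        by (simp add: ennreal_plus ennreal_mult)
      finally show "ennreal ((cmod (P \<omega> x - truncation L \<omega> x))\<^sup>2) \<le> 2 * ennreal ((cmod (P \<omega> x - truncation L' \<omega> x))\<^sup>2) +
          2 * ennreal ((cmod (truncation L' \<omega> x - truncation L \<omega> x))\<^sup>2)" .
    qed
    also have "\<dots> = 2 * ?E L' + 2 * (\<integral>\<^sup>+\<omega>. ennreal ((cmod (truncation L' \<omega> x - truncation L \<omega> x))\<^sup>2) \<partial>M)"
      by (subst nn_integral_add) (auto simp: nn_integral_cmult)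
    also have "(\<integral>\<^sup>+\<omega>. ennreal ((cmod (truncation L' \<omega> x - truncation L \<omega> x))\<^sup>2) \<partial>M) =
        ennreal (mean_square (\<lambda>\<omega>. truncation L' \<omega> x - truncation L \<omega> x))"
      by (rule nn_integral_mean_square[OF L2_rv_diff(1)[OF truncation_L2 truncation_L2]])
    also have "2 * ?E L' + 2 * ennreal (mean_square (\<lambda>\<omega>. truncation L' \<omega> x - truncation L \<omega> x)) \<le> 2 * ?E L' + 2 * ennreal (tail L)"
      by (intro add_left_mono mult_left_mono ennreal_leI mean_square_truncation_diff[OF x L']) simp
    also have "2 * ennreal (tail L) = ennreal (2 * tail L)" using tail_nonneg by (simp add: ennreal_mult)
    finally show ?thesis .
  qed
  then have "?E L \<le> 2 * 0 + ennreal (2 * tail L)"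
    by (intro tendsto_lowerbound[OF lim]) (auto simp: eventually_sequentially)
  then show ?thesis by simp
qed

abbreviation area :: real where "area \<equiv> measure surface_measure (space surface_measure)"

text \<open>Cauchy-Schwarz on the sphere for each sample, followed by Tonelli. The second conclusion
  yields that almost every path is square integrable on \<open>A\<close>.\<close>

lemma set_integral_mean_square_le:
  fixes R :: "'a \<Rightarrow> real^3 \<Rightarrow> complex"
  assumes R[measurable]: "(\<lambda>(\<omega>, x). R \<omega> x) \<in> borel_measurable (M \<Otimes>\<^sub>M surface_measure)"
    and A[measurable]: "A \<in> sets surface_measure"
    and \<psi>[measurable]: "\<psi> \<in> borel_measurable surface_measure" and K: "\<And>x. x \<in> A \<Longrightarrow> cmod (\<psi> x) \<le> K"
    and c: "\<And>x. x \<in> A \<Longrightarrow> (\<integral>\<^sup>+\<omega>. ennreal ((cmod (R \<omega> x))\<^sup>2) \<partial>M) \<le> ennreal c" and c0: "0 \<le> c"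
  shows "(\<integral>\<^sup>+\<omega>. ennreal ((cmod (LINT x:A|surface_measure. R \<omega> x * cnj (\<psi> x)))\<^sup>2) \<partial>M) \<le> ennreal (area\<^sup>2 * K\<^sup>2 * c)"
    and "(\<integral>\<^sup>+\<omega>. (\<integral>\<^sup>+x\<in>A. ennreal ((cmod (R \<omega> x))\<^sup>2) \<partial>surface_measure) \<partial>M) \<le> ennreal (area * c)"
proof -
  interpret S: finite_measure surface_measure by (rule finite_measure_surface_measure)
  interpret pair_sigma_finite M surface_measure by unfold_locales
  let ?V = area
  have Rm[measurable]: "(\<lambda>x. R \<omega> x) \<in> borel_measurable surface_measure" if "\<omega> \<in> space M" for \<omega>
    using measurable_Pair2[OF R that] by simp
  have Am: "A \<subseteq> space surface_measure" using A by (rule sets.sets_into_space)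
  have swap: "(\<integral>\<^sup>+\<omega>. (\<integral>\<^sup>+x\<in>A. ennreal ((cmod (R \<omega> x))\<^sup>2) \<partial>surface_measure) \<partial>M) =
      (\<integral>\<^sup>+x. (\<integral>\<^sup>+\<omega>. ennreal ((cmod (R \<omega> x))\<^sup>2) * indicator A x \<partial>M) \<partial>surface_measure)"
    by (rule Fubini'[symmetric]) measurable
  also have "\<dots> \<le> (\<integral>\<^sup>+x. ennreal c \<partial>surface_measure)"
  proof (rule nn_integral_mono)
    fix x show "(\<integral>\<^sup>+\<omega>. ennreal ((cmod (R \<omega> x))\<^sup>2) * indicator A x \<partial>M) \<le> ennreal c"
      using c[of x] by (cases "x \<in> A") auto
  qed
  also have "\<dots> = ennreal (?V * c)"
    using c0 by (simp add: S.emeasure_eq_measure ennreal_mult' mult.commute)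
  finally show T: "(\<integral>\<^sup>+\<omega>. (\<integral>\<^sup>+x\<in>A. ennreal ((cmod (R \<omega> x))\<^sup>2) \<partial>surface_measure) \<partial>M) \<le> ennreal (?V * c)" .
  have "(\<integral>\<^sup>+\<omega>. ennreal ((cmod (LINT x:A|surface_measure. R \<omega> x * cnj (\<psi> x)))\<^sup>2) \<partial>M) \<le>
      (\<integral>\<^sup>+\<omega>. ennreal (?V * K\<^sup>2) * (\<integral>\<^sup>+x\<in>A. ennreal ((cmod (R \<omega> x))\<^sup>2) \<partial>surface_measure) \<partial>M)"
  proof (rule nn_integral_mono)
    fix \<omega> assume \<omega>: "\<omega> \<in> space M"
    note [measurable] = Rm[OF \<omega>]
    have "ennreal ((cmod (LINT x:A|surface_measure. R \<omega> x * cnj (\<psi> x)))\<^sup>2) \<le>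
        ennreal ?V * (\<integral>\<^sup>+x\<in>A. ennreal ((cmod (R \<omega> x * cnj (\<psi> x)))\<^sup>2) \<partial>surface_measure)"
      by (rule norm_set_integral_square_le[OF finite_measure_surface_measure A]) measurable
    also have "\<dots> \<le> ennreal ?V * (\<integral>\<^sup>+x. ennreal (K\<^sup>2) * (ennreal ((cmod (R \<omega> x))\<^sup>2) * indicator A x) \<partial>surface_measure)"
    proof (intro mult_left_mono nn_integral_mono)
      fix x show "ennreal ((cmod (R \<omega> x * cnj (\<psi> x)))\<^sup>2) * indicator A x \<le>
          ennreal (K\<^sup>2) * (ennreal ((cmod (R \<omega> x))\<^sup>2) * indicator A x)"
      proof (cases "x \<in> A")
        case True
        have "(cmod (\<psi> x))\<^sup>2 \<le> K\<^sup>2" using K[OF True] by (intro power_mono) auto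
        then have "(cmod (R \<omega> x * cnj (\<psi> x)))\<^sup>2 \<le> K\<^sup>2 * (cmod (R \<omega> x))\<^sup>2"
          by (simp add: norm_mult power_mult_distrib mult.commute[of "(cmod (R \<omega> x))\<^sup>2"] mult_right_mono)
        then show ?thesis using True by (simp add: ennreal_mult[symmetric] ennreal_leI)
      qed simp
    qed simp
    also have "\<dots> = ennreal (?V * K\<^sup>2) * (\<integral>\<^sup>+x\<in>A. ennreal ((cmod (R \<omega> x))\<^sup>2) \<partial>surface_measure)"
      by (subst nn_integral_cmult) (auto simp: ennreal_mult' mult.assoc)
    finally show "ennreal ((cmod (LINT x:A|surface_measure. R \<omega> x * cnj (\<psi> x)))\<^sup>2) \<le>
      ennreal (?V * K\<^sup>2) * (\<integral>\<^sup>+x\<in>A. ennreal ((cmod (R \<omega> x))\<^sup>2) \<partial>surface_measure)" .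
  qed
  also have "\<dots> = ennreal (?V * K\<^sup>2) * (\<integral>\<^sup>+\<omega>. (\<integral>\<^sup>+x\<in>A. ennreal ((cmod (R \<omega> x))\<^sup>2) \<partial>surface_measure) \<partial>M)"
    by (rule nn_integral_cmult) measurable
  also have "\<dots> \<le> ennreal (?V * K\<^sup>2) * ennreal (?V * c)" by (intro mult_left_mono T) simp
  also have "ennreal (?V * K\<^sup>2) * ennreal (?V * c) = ennreal ((?V * K\<^sup>2) * (?V * c))"
    by (rule ennreal_mult[symmetric]) (simp_all add: c0)
  also have "(?V * K\<^sup>2) * (?V * c) = ?V\<^sup>2 * K\<^sup>2 * c" by (simp add: power2_eq_square mult_ac)
  finally show "(\<integral>\<^sup>+\<omega>. ennreal ((cmod (LINT x:A|surface_measure. R \<omega> x * cnj (\<psi> x)))\<^sup>2) \<partial>M) \<le> ennreal (?V\<^sup>2 * K\<^sup>2 * c)" .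
qed

end

lemma harmonic_cmod_le:
  assumes "p \<in> harmonic_index s" "x \<in> sphere 0 1"
  shows "cmod (harmonic s p x) \<le> sqrt ((2 * real (fst p) + 1) / (4 * pi))"
  by (rule real_le_rsqrt, rule spin_harmonic_bound[OF assms(2)]) (use harmonic_index_bounds[OF assms(1)] in auto)

lemma sets_surface_subset: "A \<in> sets surface_measure \<Longrightarrow> A \<subseteq> sphere 0 1"
  using sets.sets_into_space[of A surface_measure] by simp

lemma set_integrable_harmonic_mult:
  assumes p: "p \<in> harmonic_index s" and A: "A \<in> sets surface_measure"
    and \<psi>[measurable]: "\<psi> \<in> borel_measurable surface_measure" and K: "\<And>x. x \<in> A \<Longrightarrow> cmod (\<psi> x) \<le> K"
  shows "set_integrable surface_measure A (\<lambda>x. harmonic s p x * cnj (\<psi> x))"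
proof (rule set_integrable_surface_bounded[OF A])
  show "(\<lambda>x. harmonic s p x * cnj (\<psi> x)) \<in> borel_measurable surface_measure" by measurable
  fix x assume x: "x \<in> A"
  show "cmod (harmonic s p x * cnj (\<psi> x)) \<le> sqrt ((2 * real (fst p) + 1) / (4 * pi)) * K"
    unfolding norm_mult complex_mod_cnj
    by (intro mult_mono harmonic_cmod_le[OF p] K x subsetD[OF sets_surface_subset[OF A]]) auto
qed

lemma (in prob_space) mean_square_sum_le:
  assumes \<delta>: "\<And>k. k \<in> K \<Longrightarrow> L2_rv (\<delta> k)"
  shows "mean_square (\<lambda>\<omega>. \<Sum>k\<in>K. w k * \<delta> k \<omega>) \<le> (\<Sum>k\<in>K. (cmod (w k))\<^sup>2) * (\<Sum>k\<in>K. mean_square (\<delta> k))"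
proof -
  have L: "L2_rv (\<lambda>\<omega>. \<Sum>k\<in>K. w k * \<delta> k \<omega>)" by (intro L2_rv_sum L2_rv_mult(1) \<delta>)
  have i: "integrable M (\<lambda>\<omega>. \<Sum>k\<in>K. (cmod (\<delta> k \<omega>))\<^sup>2)"
    by (intro Bochner_Integration.integrable_sum L2_rvD(2) \<delta>)
  have "mean_square (\<lambda>\<omega>. \<Sum>k\<in>K. w k * \<delta> k \<omega>) \<le>
      expectation (\<lambda>\<omega>. (\<Sum>k\<in>K. (cmod (w k))\<^sup>2) * (\<Sum>k\<in>K. (cmod (\<delta> k \<omega>))\<^sup>2))"
    unfolding mean_square_def
    by (rule integral_mono[OF L2_rvD(2)[OF L] integrable_mult_right[OF i] cmod_sum_mult_square_le])
  also have "\<dots> = (\<Sum>k\<in>K. (cmod (w k))\<^sup>2) * expectation (\<lambda>\<omega>. \<Sum>k\<in>K. (cmod (\<delta> k \<omega>))\<^sup>2)"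
    by (rule integral_mult_right_zero)
  also have "expectation (\<lambda>\<omega>. \<Sum>k\<in>K. (cmod (\<delta> k \<omega>))\<^sup>2) = (\<Sum>k\<in>K. mean_square (\<delta> k))"
    unfolding mean_square_def by (rule Bochner_Integration.integral_sum) (rule L2_rvD(2)[OF \<delta>])
  finally show ?thesis .
qed

text \<open>Real combinations of real and imaginary parts are real parts of complex combinations,
  which lets complex mean-square bounds control the real Gaussian vector.\<close>

lemma sum_Re_Im:
  fixes z :: "'k \<Rightarrow> complex" and u :: "'k \<times> bool \<Rightarrow> real"
  shows "(\<Sum>i\<in>I \<times> UNIV. u i * (if snd i then Re else Im) (z (fst i))) =
    Re (\<Sum>k\<in>I. Complex (u (k, True)) (- u (k, False)) * z k)"
proof -
  have "(\<Sum>i\<in>I \<times> UNIV. u i * (if snd i then Re else Im) (z (fst i))) =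
      (\<Sum>k\<in>I. \<Sum>r\<in>UNIV. u (k, r) * (if r then Re else Im) (z k))"
    by (subst sum.cartesian_product) (simp add: case_prod_beta')
  also have "\<dots> = Re (\<Sum>k\<in>I. Complex (u (k, True)) (- u (k, False)) * z k)"
    by (simp add: UNIV_bool Re_sum add.commute)
  finally show ?thesis .
qed

section \<open>Integrals of the field against test functions\<close>

context spin_field
begin

lemma truncation_set_integral:
  assumes A: "A \<in> sets surface_measure" and \<psi>: "\<psi> \<in> borel_measurable surface_measure"
    and K: "\<And>x. x \<in> A \<Longrightarrow> cmod (\<psi> x) \<le> K"
  shows "set_integrable surface_measure A (\<lambda>x. truncation L \<omega> x * cnj (\<psi> x))"
    and "(LINT x:A|surface_measure. truncation L \<omega> x * cnj (\<psi> x)) =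
      (\<Sum>p\<in>harmonics_upto s L. a p \<omega> * (LINT x:A|surface_measure. harmonic s p x * cnj (\<psi> x)))"
proof -
  have int: "integrable surface_measure (\<lambda>x. a p \<omega> * (indicator A x *\<^sub>R (harmonic s p x * cnj (\<psi> x))))"
    if "p \<in> harmonics_upto s L" for p
    using set_integrable_harmonic_mult[OF subsetD[OF harmonics_upto_subset that] A \<psi> K]
    unfolding set_integrable_def by (rule integrable_mult_right)
  have eq: "(\<lambda>x. indicator A x *\<^sub>R (truncation L \<omega> x * cnj (\<psi> x))) =
      (\<lambda>x. \<Sum>p\<in>harmonics_upto s L. a p \<omega> * (indicator A x *\<^sub>R (harmonic s p x * cnj (\<psi> x))))"
    unfolding truncation_def sum_distrib_right scaleR_sum_right by (intro ext sum.cong refl) (simp add: mult.assoc)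
  show "set_integrable surface_measure A (\<lambda>x. truncation L \<omega> x * cnj (\<psi> x))"
    unfolding set_integrable_def eq by (intro Bochner_Integration.integrable_sum int)
  show "(LINT x:A|surface_measure. truncation L \<omega> x * cnj (\<psi> x)) =
      (\<Sum>p\<in>harmonics_upto s L. a p \<omega> * (LINT x:A|surface_measure. harmonic s p x * cnj (\<psi> x)))"
    unfolding set_lebesgue_integral_def eq
    by (subst Bochner_Integration.integral_sum[OF int]) (simp_all only: integral_mult_right_zero)
qed

text \<open>The difference between the field and a truncation has finite expected squared integral
  over \<open>A\<close>, so almost every path is integrable there. Measurability comes from the
  joint measurability of the field, and the finite sum obtained from the truncation transfers square
  integrability.\<close>

lemma field_set_integral:
  assumes A[measurable]: "A \<in> sets surface_measure" and \<psi>[measurable]: "\<psi> \<in> borel_measurable surface_measure"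
    and K: "\<And>x. x \<in> A \<Longrightarrow> cmod (\<psi> x) \<le> K"
  shows "L2_rv (\<lambda>\<omega>. LINT x:A|surface_measure. P \<omega> x * cnj (\<psi> x))" (is "L2_rv ?X")
    and "mean_square (\<lambda>\<omega>. (LINT x:A|surface_measure. P \<omega> x * cnj (\<psi> x)) -
      (LINT x:A|surface_measure. truncation L \<omega> x * cnj (\<psi> x))) \<le> area\<^sup>2 * K\<^sup>2 * (2 * tail L)"
      (is "mean_square (\<lambda>\<omega>. _ - ?T \<omega>) \<le> _")
proof -
  interpret S: finite_measure surface_measure by (rule finite_measure_surface_measure)
  let ?R = "\<lambda>\<omega> x. P \<omega> x - truncation L \<omega> x"
  have Rm[measurable]: "(\<lambda>(\<omega>, x). ?R \<omega> x) \<in> borel_measurable (M \<Otimes>\<^sub>M surface_measure)"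
    by measurable
  have c: "(\<integral>\<^sup>+\<omega>. ennreal ((cmod (?R \<omega> x))\<^sup>2) \<partial>M) \<le> ennreal (2 * tail L)" if "x \<in> A" for x
    using truncation_error[of x L] sets_surface_subset[OF A] that by blast
  have c0: "0 \<le> 2 * tail L" using tail_nonneg by simp
  note B = set_integral_mean_square_le[OF Rm A \<psi> K c c0]
  let ?N = "\<lambda>\<omega>. \<integral>\<^sup>+x\<in>A. ennreal ((cmod (?R \<omega> x))\<^sup>2) \<partial>surface_measure"
  have ne: "AE \<omega> in M. ?N \<omega> \<noteq> \<infinity>"
  proof (rule nn_integral_PInf_AE)
    show "?N \<in> borel_measurable M" by measurable
    show "(\<integral>\<^sup>+\<omega>. ?N \<omega> \<partial>M) \<noteq> \<infinity>"
      using B(2) ennreal_less_top[of "area * (2 * tail L)"] by (metis infinity_ennreal_def neq_top_trans ennreal_neq_top)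
  qed
  \<comment> \<open>On the exceptional event the integral of the path may take its default value 0
    and linearity may fail, hence the condition on \<open>?N\<close>.\<close>
  have key: "?X \<omega> - ?T \<omega> = (LINT x:A|surface_measure. ?R \<omega> x * cnj (\<psi> x))"
    if N: "?N \<omega> \<noteq> \<infinity>" and \<omega>: "\<omega> \<in> space M" for \<omega>
  proof -
    have m[measurable]: "(\<lambda>x. ?R \<omega> x) \<in> borel_measurable surface_measure"
      using measurable_Pair2[OF Rm \<omega>] by simp
    have i: "integrable surface_measure (\<lambda>x. indicator A x * (cmod (?R \<omega> x))\<^sup>2)"
    proof (rule integrableI_bounded)
      have "(\<integral>\<^sup>+x. ennreal (norm (indicator A x * (cmod (?R \<omega> x))\<^sup>2)) \<partial>surface_measure) = ?N \<omega>"
        by (intro nn_integral_cong) (simp add: indicator_def)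
      then show "(\<integral>\<^sup>+x. ennreal (norm (indicator A x * (cmod (?R \<omega> x))\<^sup>2)) \<partial>surface_measure) < \<infinity>"
        using N by (simp add: less_top)
    qed measurable
    have i2: "integrable surface_measure (\<lambda>x. \<bar>K\<bar> * (1 + indicator A x * (cmod (?R \<omega> x))\<^sup>2))"
      using i by simp
    have "set_integrable surface_measure A (\<lambda>x. ?R \<omega> x * cnj (\<psi> x))"
      unfolding set_integrable_def
    proof (rule Bochner_Integration.integrable_bound[OF i2])
      show "AE x in surface_measure. norm (indicator A x *\<^sub>R (?R \<omega> x * cnj (\<psi> x))) \<le>
          norm (\<bar>K\<bar> * (1 + indicator A x * (cmod (?R \<omega> x))\<^sup>2))"
      proof (rule AE_I2)
        fix x
        show "norm (indicator A x *\<^sub>R (?R \<omega> x * cnj (\<psi> x))) \<le> norm (\<bar>K\<bar> * (1 + indicator A x * (cmod (?R \<omega> x))\<^sup>2))"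
        proof (cases "x \<in> A")
          case True
          have "t \<le> 1 + t\<^sup>2" if "0 \<le> t" for t :: real
            using sum_squares_bound[of t 1] that by simp
          then have "cmod (?R \<omega> x) \<le> 1 + (cmod (?R \<omega> x))\<^sup>2" using norm_ge_zero by blast
          then have "cmod (?R \<omega> x) * cmod (\<psi> x) \<le> (1 + (cmod (?R \<omega> x))\<^sup>2) * \<bar>K\<bar>"
            using K[OF True] by (intro mult_mono) auto
          then show ?thesis using True by (simp add: norm_mult abs_mult mult.commute)
        qed simp
      qed
    qed measurable
    then have "(LINT x:A|surface_measure. ?R \<omega> x * cnj (\<psi> x) + truncation L \<omega> x * cnj (\<psi> x)) =
        (LINT x:A|surface_measure. ?R \<omega> x * cnj (\<psi> x)) + ?T \<omega>"
      by (rule set_integral_add(2)[OF _ truncation_set_integral(1)[OF A \<psi> K]])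
    moreover have "?R \<omega> x * cnj (\<psi> x) + truncation L \<omega> x * cnj (\<psi> x) = P \<omega> x * cnj (\<psi> x)" for x
      by (simp add: algebra_simps)
    ultimately show ?thesis by simp
  qed
  have ae: "AE \<omega> in M. ?X \<omega> - ?T \<omega> = (LINT x:A|surface_measure. ?R \<omega> x * cnj (\<psi> x))"
    using ne AE_space by eventually_elim (rule key)
  have Xm: "random_variable borel ?X"
    unfolding set_lebesgue_integral_def by (rule S.borel_measurable_lebesgue_integral) measurable
  have "?T = (\<lambda>\<omega>. \<Sum>p\<in>harmonics_upto s L. a p \<omega> * (LINT x:A|surface_measure. harmonic s p x * cnj (\<psi> x)))"
    by (intro ext truncation_set_integral(2)[OF A \<psi> K])
  then have TL: "L2_rv ?T" by (simp only: linear_combination_L2[OF harmonics_upto_subset])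
  have "(\<integral>\<^sup>+\<omega>. ennreal ((cmod (?X \<omega> - ?T \<omega>))\<^sup>2) \<partial>M) =
      (\<integral>\<^sup>+\<omega>. ennreal ((cmod (LINT x:A|surface_measure. ?R \<omega> x * cnj (\<psi> x)))\<^sup>2) \<partial>M)"
    using ae by (intro nn_integral_cong_AE) auto
  then have le: "(\<integral>\<^sup>+\<omega>. ennreal ((cmod (?X \<omega> - ?T \<omega>))\<^sup>2) \<partial>M) \<le> ennreal (area\<^sup>2 * K\<^sup>2 * (2 * tail L))"
    using B(1) by (simp only:)
  have Dm: "random_variable borel (\<lambda>\<omega>. ?X \<omega> - ?T \<omega>)" using Xm L2_rvD(1)[OF TL] by simp
  have c1: "0 \<le> area\<^sup>2 * K\<^sup>2 * (2 * tail L)" using c0 by simp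
  show "mean_square (\<lambda>\<omega>. ?X \<omega> - ?T \<omega>) \<le> area\<^sup>2 * K\<^sup>2 * (2 * tail L)" by (rule L2_rvI_nn_integral(2)[OF Dm le c1])
  have "L2_rv (\<lambda>\<omega>. (?X \<omega> - ?T \<omega>) + ?T \<omega>)" by (rule L2_rv_add(1)[OF L2_rvI_nn_integral(1)[OF Dm le c1] TL])
  then show "L2_rv ?X" by simp
qed

lemma masked_coeff_gaussian:
  assumes I: "finite I" and G: "G \<in> sets surface_measure"
    and \<psi>: "\<And>k. k \<in> I \<Longrightarrow> \<psi> k \<in> borel_measurable surface_measure"
    and K: "\<And>k x. k \<in> I \<Longrightarrow> x \<in> sphere 0 1 \<Longrightarrow> cmod (\<psi> k x) \<le> K k"
  shows "centred_gaussian (I \<times> UNIV)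
    (\<lambda>i \<omega>. (if snd i then Re else Im) (masked_coeff G P (\<psi> (fst i)) \<omega>))"
  unfolding centred_gaussian_def
proof (intro conjI ballI allI)
  let ?A = "sphere 0 1 - G"
  have A: "?A \<in> sets surface_measure" using sets.compl_sets[OF G] by simp
  have KA: "cmod (\<psi> k x) \<le> K k" if "k \<in> I" "x \<in> ?A" for k x using K that by simp
  let ?X = "\<lambda>k. masked_coeff G P (\<psi> k)"
  have X: "L2_rv (?X k)" if "k \<in> I" for k
    using field_set_integral(1)[OF A \<psi>[OF that] KA[OF that]] by (simp add: masked_coeff_def[abs_def])
  {
    fix i :: "'b \<times> bool" assume "i \<in> I \<times> UNIV"
    then have L: "L2_rv (?X (fst i))" using X by auto
    show "random_variable borel (\<lambda>\<omega>. (if snd i then Re else Im) (?X (fst i) \<omega>))"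
      using L2_rv_parts(1,2)[OF L] by (cases "snd i") simp_all
    show "integrable M (\<lambda>\<omega>. ((if snd i then Re else Im) (?X (fst i) \<omega>))\<^sup>2)"
      using L2_rv_parts(3,4)[OF L] by (cases "snd i") simp_all
  }
  fix u :: "'b \<times> bool \<Rightarrow> real"
  define w where "w k = Complex (u (k, True)) (- u (k, False))" for k
  define T where "T L k \<omega> = (LINT x:?A|surface_measure. truncation L \<omega> x * cnj (\<psi> k x))" for L k \<omega>
  define z where "z k p = (LINT x:?A|surface_measure. harmonic s p x * cnj (\<psi> k x))" for k p
  have T: "T L k \<omega> = (\<Sum>p\<in>harmonics_upto s L. a p \<omega> * z k p)" if "k \<in> I" for L k \<omega>
    unfolding T_def z_def by (rule truncation_set_integral(2)[OF A \<psi>[OF that] KA[OF that]])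
  have TL: "L2_rv (T L k)" if "k \<in> I" for L k
    unfolding T[OF that, abs_def] by (rule linear_combination_L2[OF harmonics_upto_subset])
  have XT: "mean_square (\<lambda>\<omega>. ?X k \<omega> - T L k \<omega>) \<le> area\<^sup>2 * (K k)\<^sup>2 * (2 * tail L)" if "k \<in> I" for L k
    using field_set_integral(2)[OF A \<psi>[OF that] KA[OF that]] by (simp add: masked_coeff_def T_def)
  let ?Z = "\<lambda>\<omega>. \<Sum>k\<in>I. w k * ?X k \<omega>" and ?ZL = "\<lambda>L \<omega>. \<Sum>k\<in>I. w k * T L k \<omega>"
  have Z: "L2_rv ?Z" by (intro L2_rv_sum L2_rv_mult(1) X)
  have ZL: "L2_rv (?ZL L)" for L by (intro L2_rv_sum L2_rv_mult(1) TL)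
  have eq: "(\<Sum>i\<in>I \<times> UNIV. u i * (if snd i then Re else Im) (?X (fst i) \<omega>)) = Re (?Z \<omega>)" for \<omega>
    unfolding w_def by (rule sum_Re_Im[where z = "\<lambda>k. ?X k \<omega>" and u = u])
  have ZLeq: "?ZL L \<omega> = (\<Sum>p\<in>harmonics_upto s L. a p \<omega> * (\<Sum>k\<in>I. w k * z k p))" for L \<omega>
  proof -
    have "?ZL L \<omega> = (\<Sum>k\<in>I. \<Sum>p\<in>harmonics_upto s L. w k * (a p \<omega> * z k p))"
      by (intro sum.cong refl) (simp only: T sum_distrib_left)
    also have "\<dots> = (\<Sum>p\<in>harmonics_upto s L. \<Sum>k\<in>I. w k * (a p \<omega> * z k p))" by (rule sum.swap)
    also have "\<dots> = (\<Sum>p\<in>harmonics_upto s L. a p \<omega> * (\<Sum>k\<in>I. w k * z k p))"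
      unfolding sum_distrib_left by (intro sum.cong refl) (simp add: mult_ac)
    finally show ?thesis .
  qed
  have diff: "expectation (\<lambda>\<omega>. (Re (?ZL L \<omega>) - Re (?Z \<omega>))\<^sup>2) \<le>
      (\<Sum>k\<in>I. (cmod (w k))\<^sup>2) * (\<Sum>k\<in>I. area\<^sup>2 * (K k)\<^sup>2 * (2 * tail L))" for L
  proof -
    have D: "L2_rv (\<lambda>\<omega>. ?Z \<omega> - ?ZL L \<omega>)" by (rule L2_rv_diff(1)[OF Z ZL])
    have "expectation (\<lambda>\<omega>. (Re (?ZL L \<omega>) - Re (?Z \<omega>))\<^sup>2) = expectation (\<lambda>\<omega>. (Re (?Z \<omega> - ?ZL L \<omega>))\<^sup>2)"
      by (simp only: minus_complex.sel power2_commute)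
    also have "\<dots> \<le> mean_square (\<lambda>\<omega>. ?Z \<omega> - ?ZL L \<omega>)"
      unfolding L2_rv_parts(5)[OF D] by (simp add: Bochner_Integration.integral_nonneg)
    also have "(\<lambda>\<omega>. ?Z \<omega> - ?ZL L \<omega>) = (\<lambda>\<omega>. \<Sum>k\<in>I. w k * (?X k \<omega> - T L k \<omega>))"
      by (simp only: right_diff_distrib sum_subtractf)
    also have "mean_square \<dots> \<le> (\<Sum>k\<in>I. (cmod (w k))\<^sup>2) * (\<Sum>k\<in>I. mean_square (\<lambda>\<omega>. ?X k \<omega> - T L k \<omega>))"
      by (rule mean_square_sum_le) (rule L2_rv_diff(1)[OF X TL])
    also have "\<dots> \<le> (\<Sum>k\<in>I. (cmod (w k))\<^sup>2) * (\<Sum>k\<in>I. area\<^sup>2 * (K k)\<^sup>2 * (2 * tail L))"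
      by (intro mult_left_mono sum_mono XT sum_nonneg) auto
    finally show ?thesis .
  qed
  have "(\<lambda>L. expectation (\<lambda>\<omega>. (Re (?ZL L \<omega>) - Re (?Z \<omega>))\<^sup>2)) \<longlonglongrightarrow> 0"
  proof (rule Lim_null_comparison[OF always_eventually], rule allI)
    fix L
    have "0 \<le> expectation (\<lambda>\<omega>. (Re (?ZL L \<omega>) - Re (?Z \<omega>))\<^sup>2)" by (rule Bochner_Integration.integral_nonneg) simp
    then show "norm (expectation (\<lambda>\<omega>. (Re (?ZL L \<omega>) - Re (?Z \<omega>))\<^sup>2)) \<le>
        (\<Sum>k\<in>I. (cmod (w k))\<^sup>2) * (\<Sum>k\<in>I. area\<^sup>2 * (K k)\<^sup>2 * (2 * tail L))"
      using diff[of L] by (simp only: real_norm_def abs_of_nonneg)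
  next
    have "(\<lambda>L. (\<Sum>k\<in>I. (cmod (w k))\<^sup>2) * (\<Sum>k\<in>I. area\<^sup>2 * (K k)\<^sup>2 * (2 * tail L))) \<longlonglongrightarrow>
        (\<Sum>k\<in>I. (cmod (w k))\<^sup>2) * (\<Sum>k\<in>I. area\<^sup>2 * (K k)\<^sup>2 * (2 * 0))"
      by (intro tendsto_intros tail_tendsto)
    then show "(\<lambda>L. (\<Sum>k\<in>I. (cmod (w k))\<^sup>2) * (\<Sum>k\<in>I. area\<^sup>2 * (K k)\<^sup>2 * (2 * tail L))) \<longlonglongrightarrow> 0" by simp
  qed
  then have "expectation (\<lambda>\<omega>. iexp (Re (?Z \<omega>))) = of_real (exp (- expectation (\<lambda>\<omega>. (Re (?Z \<omega>))\<^sup>2) / 2))"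
  proof (rule gaussian_char_L2_limit[OF L2_rv_parts(1)[OF Z] L2_rv_parts(1)[OF ZL] L2_rv_parts(3)[OF Z] L2_rv_parts(3)[OF ZL]])
    show "expectation (\<lambda>\<omega>. iexp (Re (?ZL L \<omega>))) = of_real (exp (- expectation (\<lambda>\<omega>. (Re (?ZL L \<omega>))\<^sup>2) / 2))" for L
      unfolding ZLeq by (rule linear_combination_gaussian[OF finite_harmonics_upto harmonics_upto_subset])
  qed
  then show "expectation (\<lambda>\<omega>. iexp (\<Sum>i\<in>I \<times> UNIV. u i * (if snd i then Re else Im) (?X (fst i) \<omega>))) =
      of_real (exp (- expectation (\<lambda>\<omega>. (\<Sum>i\<in>I \<times> UNIV. u i * (if snd i then Re else Im) (?X (fst i) \<omega>))\<^sup>2) / 2))"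
    by (simp only: eq)
qed

text \<open>The integral over the complement of \<open>G\<close> is the one over the sphere minus
  the one over \<open>G\<close>. By orthonormality the former equals the finite sum in the
  \<open>a p\<close>; the latter is small because \<open>\<psi>\<close> is at most
  \<open>\<kappa>\<close> on \<open>G\<close>. This is carried out for truncations and then passed
  to the limit.\<close>

lemma masked_coeff_error:
  assumes G: "G \<in> sets surface_measure" and \<psi>: "\<psi> \<in> borel_measurable surface_measure"
    and expansion: "\<And>x. x \<in> sphere 0 1 \<Longrightarrow> \<psi> x = (\<Sum>q\<in>harmonics_upto s N. c q * harmonic s q x)"
    and K: "\<And>x. x \<in> sphere 0 1 \<Longrightarrow> cmod (\<psi> x) \<le> K" and \<kappa>: "\<And>x. x \<in> G \<Longrightarrow> cmod (\<psi> x) \<le> \<kappa>"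
  shows "mean_square (\<lambda>\<omega>. masked_coeff G P \<psi> \<omega> - (\<Sum>p\<in>harmonics_upto s N. a p \<omega> * cnj (c p))) \<le>
    2 * (area\<^sup>2 * \<kappa>\<^sup>2 * suminf (angular_power s C))"
proof -
  interpret S: finite_measure surface_measure by (rule finite_measure_surface_measure)
  let ?A = "sphere 0 1 - G" and ?S = "sphere 0 1 :: (real^3) set"
  have A: "?A \<in> sets surface_measure" using sets.compl_sets[OF G] by simp
  have Sm: "?S \<in> sets surface_measure" using sets.top[of surface_measure] by simp
  have KA: "\<And>x. x \<in> ?A \<Longrightarrow> cmod (\<psi> x) \<le> K" using K by simp
  define g where "g p = (LINT x:G|surface_measure. harmonic s p x * cnj (\<psi> x))" for p
  define z where "z p = (LINT x:?A|surface_measure. harmonic s p x * cnj (\<psi> x))" for p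
  let ?\<beta> = "\<lambda>\<omega>. \<Sum>p\<in>harmonics_upto s N. a p \<omega> * cnj (c p)" and ?X = "masked_coeff G P \<psi>"
  have split: "z p + g p = (if p \<in> harmonics_upto s N then cnj (c p) else 0)" if p: "p \<in> harmonic_index s" for p
  proof -
    have "z p + g p = (LINT x:?A \<union> G|surface_measure. harmonic s p x * cnj (\<psi> x))"
      unfolding z_def g_def
      by (rule set_integral_Un[symmetric, OF _ set_integrable_harmonic_mult[OF p A \<psi> KA] set_integrable_harmonic_mult[OF p G \<psi> \<kappa>]]) auto
    also have "?A \<union> G = ?S" using sets_surface_subset[OF G] by blast
    also have "(LINT x:?S|surface_measure. harmonic s p x * cnj (\<psi> x)) =
        (LINT x|surface_measure. (\<Sum>q\<in>harmonics_upto s N. cnj (c q) * (harmonic s p x * cnj (harmonic s q x))))"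
      unfolding set_lebesgue_integral_def
    proof (rule Bochner_Integration.integral_cong[OF refl])
      fix x assume "x \<in> space surface_measure"
      then have x: "x \<in> ?S" by simp
      show "indicator ?S x *\<^sub>R (harmonic s p x * cnj (\<psi> x)) =
          (\<Sum>q\<in>harmonics_upto s N. cnj (c q) * (harmonic s p x * cnj (harmonic s q x)))"
        unfolding expansion[OF x] using x by (simp add: sum_distrib_left mult_ac)
    qed
    also have "\<dots> = (\<Sum>q\<in>harmonics_upto s N. cnj (c q) * (if p = q then 1 else 0))"
    proof -
      have int: "integrable surface_measure (\<lambda>x. cnj (c q) * (harmonic s p x * cnj (harmonic s q x)))"
        if q: "q \<in> harmonics_upto s N" for q
      proof (rule integrable_mult_right)
        have "set_integrable surface_measure ?S (\<lambda>x. harmonic s p x * cnj (harmonic s q x))"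
          by (rule set_integrable_harmonic_mult[OF p Sm harmonic_measurable])
            (rule harmonic_cmod_le[OF subsetD[OF harmonics_upto_subset q]])
        then show "integrable surface_measure (\<lambda>x. harmonic s p x * cnj (harmonic s q x))"
          unfolding set_integrable_def by (rule Bochner_Integration.integrable_cong[OF refl, THEN iffD1, rotated]) simp
      qed
      show ?thesis
        by (subst Bochner_Integration.integral_sum[OF int], assumption, intro sum.cong refl,
            subst integral_mult_right_zero, subst harmonic_orthonormal[OF p subsetD[OF harmonics_upto_subset]]) simp_all
    qed
    also have "\<dots> = (if p \<in> harmonics_upto s N then cnj (c p) else 0)"
      by (simp add: if_distrib[of "\<lambda>t. _ * t"] cong: if_cong)
    finally show ?thesis .
  qed
  \<comment> \<open>The bound \<open>K\<close> for the whole sphere may be large, but it multiplies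
    the tail of the power and disappears as \<open>L\<close> grows.\<close>
  have bound: "mean_square (\<lambda>\<omega>. ?X \<omega> - ?\<beta> \<omega>) \<le>
      2 * (area\<^sup>2 * K\<^sup>2 * (2 * tail L)) + 2 * (area\<^sup>2 * \<kappa>\<^sup>2 * suminf (angular_power s C))" if L: "N \<le> L" for L
  proof -
    let ?T = "\<lambda>\<omega>. LINT x:?A|surface_measure. truncation L \<omega> x * cnj (\<psi> x)"
    let ?U = "\<lambda>\<omega>. LINT x:G|surface_measure. truncation L \<omega> x * cnj (\<psi> x)"
    have T: "?T \<omega> = (\<Sum>p\<in>harmonics_upto s L. a p \<omega> * z p)" for \<omega>
      unfolding z_def by (rule truncation_set_integral(2)[OF A \<psi> KA])
    have U: "?U \<omega> = (\<Sum>p\<in>harmonics_upto s L. a p \<omega> * g p)" for \<omega>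
      unfolding g_def by (rule truncation_set_integral(2)[OF G \<psi> \<kappa>])
    have "?T \<omega> + ?U \<omega> = ?\<beta> \<omega>" for \<omega>
    proof -
      have "?T \<omega> + ?U \<omega> = (\<Sum>p\<in>harmonics_upto s L. a p \<omega> * (z p + g p))"
        by (simp only: T U sum.distrib[symmetric] distrib_left)
      also have "\<dots> = (\<Sum>p\<in>harmonics_upto s L. if p \<in> harmonics_upto s N then a p \<omega> * cnj (c p) else 0)"
        by (intro sum.cong refl) (subst split, auto intro: subsetD[OF harmonics_upto_subset])
      also have "\<dots> = ?\<beta> \<omega>"
        using harmonics_upto_mono[OF L, of s] by (subst sum.inter_restrict[symmetric]) (auto simp: Int_absorb1)
      finally show ?thesis .
    qed
    then have eq: "?X \<omega> - ?\<beta> \<omega> = (?X \<omega> - ?T \<omega>) - ?U \<omega>" for \<omega>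
      by (simp add: algebra_simps)
    have XL: "L2_rv ?X" using field_set_integral(1)[OF A \<psi> KA] by (simp add: masked_coeff_def[abs_def])
    have TL: "L2_rv ?T" unfolding T by (rule linear_combination_L2[OF harmonics_upto_subset])
    have UL: "L2_rv ?U" unfolding U by (rule linear_combination_L2[OF harmonics_upto_subset])
    have 1: "mean_square (\<lambda>\<omega>. ?X \<omega> - ?T \<omega>) \<le> area\<^sup>2 * K\<^sup>2 * (2 * tail L)"
      using field_set_integral(2)[OF A \<psi> KA] by (simp add: masked_coeff_def)
    have c1: "(\<integral>\<^sup>+\<omega>. ennreal ((cmod (truncation L \<omega> x))\<^sup>2) \<partial>M) \<le> ennreal (suminf (angular_power s C))" if "x \<in> G" for x
      using that sets_surface_subset[OF G] unfolding nn_integral_mean_square[OF truncation_L2]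
      by (intro ennreal_leI, subst mean_square_truncation) (auto intro: sum_power_le)
    have c0: "0 \<le> suminf (angular_power s C)"
      by (rule suminf_nonneg[OF summable_power angular_power_nonneg])
    have "(\<integral>\<^sup>+\<omega>. ennreal ((cmod (?U \<omega>))\<^sup>2) \<partial>M) \<le> ennreal (area\<^sup>2 * \<kappa>\<^sup>2 * suminf (angular_power s C))"
      by (rule set_integral_mean_square_le(1)[OF truncation_measurable G \<psi> \<kappa> c1 c0])
    then have 2: "mean_square ?U \<le> area\<^sup>2 * \<kappa>\<^sup>2 * suminf (angular_power s C)"
      by (rule L2_rvI_nn_integral(2)[OF L2_rvD(1)[OF UL]]) (use c0 in simp)
    have "mean_square (\<lambda>\<omega>. (?X \<omega> - ?T \<omega>) - ?U \<omega>) \<le> 2 * mean_square (\<lambda>\<omega>. ?X \<omega> - ?T \<omega>) + 2 * mean_square ?U"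
      by (rule L2_rv_diff(2)[OF L2_rv_diff(1)[OF XL TL] UL])
    then show ?thesis unfolding eq using 1 2 by linarith
  qed
  have lim: "(\<lambda>L. 2 * (area\<^sup>2 * K\<^sup>2 * (2 * tail L)) + 2 * (area\<^sup>2 * \<kappa>\<^sup>2 * suminf (angular_power s C))) \<longlonglongrightarrow>
      2 * (area\<^sup>2 * K\<^sup>2 * (2 * 0)) + 2 * (area\<^sup>2 * \<kappa>\<^sup>2 * suminf (angular_power s C))"
    by (intro tendsto_intros tail_tendsto)
  have "mean_square (\<lambda>\<omega>. ?X \<omega> - ?\<beta> \<omega>) \<le> 2 * (area\<^sup>2 * K\<^sup>2 * (2 * 0)) + 2 * (area\<^sup>2 * \<kappa>\<^sup>2 * suminf (angular_power s C))"
    by (rule LIMSEQ_le_const[OF lim]) (use bound in blast)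
  then show ?thesis by simp
qed

end

section \<open>Asymptotics of the unmasked estimator\<close>

lemma dist_le_geodesic_dist:
  fixes x y :: "real^3"
  assumes "x \<in> sphere 0 1" "y \<in> sphere 0 1"
  shows "dist x y \<le> geodesic_dist x y" "0 \<le> geodesic_dist x y"
proof -
  define t where "t = geodesic_dist x y"
  have n: "norm x = 1" "norm y = 1" using assms by simp_all
  have b: "-1 \<le> x \<bullet> y" "x \<bullet> y \<le> 1" using Cauchy_Schwarz_ineq2[of x y] n by (simp_all add: abs_le_iff)
  show t0: "0 \<le> geodesic_dist x y" unfolding geodesic_dist_def using b by (intro arccos_lbound)
  have c: "cos t = x \<bullet> y" unfolding t_def geodesic_dist_def using b by (simp add: cos_arccos)
  have "(dist x y)\<^sup>2 = 2 - 2 * cos t"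
    unfolding c dist_norm power2_norm_eq_inner using n
    by (simp add: inner_diff inner_commute norm_eq_1)
  also have "\<dots> = (2 * sin (t / 2))\<^sup>2"
    using cos_double_sin[of "t / 2"] by (simp add: power_mult_distrib)
  also have "\<dots> \<le> t\<^sup>2"
    using abs_sin_x_le_abs_x[of "t / 2"] by (intro abs_le_square_iff[THEN iffD1]) (simp add: abs_mult)
  finally show "dist x y \<le> geodesic_dist x y" unfolding t_def using t0 by (rule power2_le_imp_le)
qed

lemma geodesic_dist_bdd_below: "x \<in> sphere 0 1 \<Longrightarrow> G \<subseteq> sphere 0 1 \<Longrightarrow> bdd_below (geodesic_dist x ` G)"
  by (rule bdd_belowI[of _ 0]) (auto intro!: dist_le_geodesic_dist(2))

lemma inner_le_outside_enlargement:
  assumes G: "G \<subseteq> sphere 0 1" and \<epsilon>: "0 < \<epsilon>"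
  obtains \<eta> where "0 < \<eta>" "\<And>x \<xi>. x \<in> G \<Longrightarrow> \<xi> \<in> sphere 0 1 - enlargement G \<epsilon> \<Longrightarrow> x \<bullet> \<xi> \<le> 1 - \<eta>"
proof -
  \<comment> \<open>Geodesic distances never exceed \<open>pi\<close>, so for larger
    \<open>\<epsilon>\<close> no pair of such points exists and any positive value serves.\<close>
  define \<eta> where "\<eta> = (if \<epsilon> \<le> pi then 1 - cos \<epsilon> else 1)"
  have "0 < \<eta>" using cos_monotone_0_pi[of 0 \<epsilon>] \<epsilon> by (simp add: \<eta>_def)
  moreover have "x \<bullet> \<xi> \<le> 1 - \<eta>" if x: "x \<in> G" and \<xi>: "\<xi> \<in> sphere 0 1 - enlargement G \<epsilon>" for x \<xi>
  proof -
    have n: "norm x = 1" "norm \<xi> = 1" using x \<xi> G by auto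
    have b: "-1 \<le> \<xi> \<bullet> x" "\<xi> \<bullet> x \<le> 1" using Cauchy_Schwarz_ineq2[of \<xi> x] n by (simp_all add: abs_le_iff)
    have "\<epsilon> < (INF y\<in>G. geodesic_dist \<xi> y)" using \<xi> x by (auto simp: enlargement_def not_le split: if_splits)
    also have "\<dots> \<le> geodesic_dist \<xi> x" using geodesic_dist_bdd_below[OF _ G, of \<xi>] \<xi> x by (intro cINF_lower) auto
    finally have e: "\<epsilon> < arccos (\<xi> \<bullet> x)" by (simp add: geodesic_dist_def)
    have pi: "arccos (\<xi> \<bullet> x) \<le> pi" using b by (intro arccos_ubound)
    have "cos (arccos (\<xi> \<bullet> x)) < cos \<epsilon>" using \<epsilon> e pi by (intro cos_monotone_0_pi) auto
    then show ?thesis using b e pi by (simp add: \<eta>_def cos_arccos inner_commute)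
  qed
  ultimately show ?thesis by (rule that)
qed

text \<open>Inner products with a unit vector are 1-Lipschitz and \<open>arccos\<close> is uniformly
  continuous, so the distance to the mask varies little with the point. This takes the place of the
  triangle inequality for the geodesic distance.\<close>

lemma ball_outside_enlargement:
  assumes G: "G \<subseteq> sphere 0 1" and x: "x \<in> sphere 0 1 - enlargement G \<epsilon>"
  obtains r where "0 < r" "\<And>y. y \<in> sphere 0 1 \<Longrightarrow> dist x y < r \<Longrightarrow> y \<notin> enlargement G \<epsilon>"
proof (cases "G = {}")
  case True
  show ?thesis by (rule that[of 1]) (simp_all add: True enlargement_def)
next
  case False
  define \<tau> where "\<tau> = ((INF y\<in>G. geodesic_dist x y) - \<epsilon>) / 2"
  have mid: "p = q + 2 * ((p - q) / 2)" for p q :: real by (simp add: field_simps)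
  have \<tau>: "0 < \<tau>" using x False by (auto simp: \<tau>_def enlargement_def not_le)
  have "uniformly_continuous_on {-1..1} arccos"
    by (rule compact_uniformly_continuous[OF continuous_on_arccos']) simp
  then obtain r where r: "0 < r"
    and ur: "\<And>s t. s \<in> {-1..1} \<Longrightarrow> t \<in> {-1..1} \<Longrightarrow> dist t s < r \<Longrightarrow> dist (arccos t) (arccos s) < \<tau>"
    using \<tau> unfolding uniformly_continuous_on_def by meson
  have "y \<notin> enlargement G \<epsilon>" if y: "y \<in> sphere 0 1" and d: "dist x y < r" for y
  proof -
    have "\<epsilon> + \<tau> \<le> (INF z\<in>G. geodesic_dist y z)"
    proof (rule cINF_greatest[OF False])
      fix z assume z: "z \<in> G"
      have n: "norm x = 1" "norm y = 1" "norm z = 1" using x y z G by auto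
      have b: "x \<bullet> z \<in> {-1..1}" "y \<bullet> z \<in> {-1..1}"
        using Cauchy_Schwarz_ineq2[of x z] Cauchy_Schwarz_ineq2[of y z] n by (simp_all add: abs_le_iff)
      have "dist (y \<bullet> z) (x \<bullet> z) = \<bar>(y - x) \<bullet> z\<bar>" by (simp add: dist_real_def inner_diff_left)
      also have "\<dots> \<le> norm (y - x)" using Cauchy_Schwarz_ineq2[of "y - x" z] n by simp
      also have "\<dots> < r" using d by (simp add: dist_norm norm_minus_commute)
      finally have "\<bar>geodesic_dist y z - geodesic_dist x z\<bar> < \<tau>"
        using ur[OF b] by (simp add: dist_real_def geodesic_dist_def)
      moreover have "(INF y\<in>G. geodesic_dist x y) \<le> geodesic_dist x z"
        using geodesic_dist_bdd_below[OF _ G, of x] x z by (intro cINF_lower) auto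
      moreover have "(INF y\<in>G. geodesic_dist x y) = \<epsilon> + 2 * \<tau>" using mid[of "INF y\<in>G. geodesic_dist x y" \<epsilon>] by (simp only: \<tau>_def)
      ultimately show "\<epsilon> + \<tau> \<le> geodesic_dist y z" by linarith
    qed
    then show ?thesis using \<tau> False by (simp add: enlargement_def)
  qed
  then show ?thesis using r by (rule that[rotated])
qed

text \<open>The sphere is connected and has more than one point, hence it has no isolated
  point.\<close>

lemma infinite_sphere_ball:
  fixes x :: "real^3"
  assumes x: "x \<in> sphere 0 1" and r: "0 < r"
  shows "infinite (sphere 0 1 \<inter> ball x r)"
proof -
  have "connected (sphere (0::real^3) 1)" by (rule connected_sphere) simp
  moreover have "sphere (0::real^3) 1 \<noteq> {z}" for z
  proof
    assume e: "sphere (0::real^3) 1 = {z}"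
    have "- x \<in> sphere 0 1" using x by simp
    then have "- x = x" using x unfolding e by simp
    then have "x + x = 0" by (metis add.right_inverse)
    then have "2 *\<^sub>R x = 0" by (simp only: scaleR_2)
    then show False using x by simp
  qed
  ultimately have "x islimpt sphere 0 1" using x by (intro connected_imp_perfect)
  then show ?thesis using r by (simp add: islimpt_eq_infinite_ball)
qed

definition unmasked_points :: "(nat \<Rightarrow> nat) \<Rightarrow> (nat \<Rightarrow> nat \<Rightarrow> real^3) \<Rightarrow> (real^3) set \<Rightarrow> real \<Rightarrow> nat \<Rightarrow> nat set" where
  "unmasked_points N \<xi> G \<epsilon> j = {k. k < N j \<and> \<xi> j k \<in> sphere 0 1 - enlargement G \<epsilon>}"

text \<open>Fix \<open>n\<close> distinct unmasked positions. The mesh of the cubature shrinks, so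
  for large \<open>j\<close> each position has a cubature point so close to it that these points are
  distinct and unmasked.\<close>

lemma card_unmasked_points:
  assumes B: "1 < B" and cub: "spin_cubature B s N \<xi> w" and G: "G \<subseteq> sphere 0 1"
    and ne: "sphere 0 1 - enlargement G \<epsilon> \<noteq> {}"
  shows "filterlim (\<lambda>j. card (unmasked_points N \<xi> G \<epsilon> j)) at_top sequentially"
  unfolding filterlim_at_top
proof
  fix n :: nat
  obtain x where x: "x \<in> sphere 0 1 - enlargement G \<epsilon>" using ne by blast
  obtain r where r: "0 < r" and rE: "\<And>y. y \<in> sphere 0 1 \<Longrightarrow> dist x y < r \<Longrightarrow> y \<notin> enlargement G \<epsilon>"
    by (rule ball_outside_enlargement[OF G x]) (rule that)
  have xs: "x \<in> sphere 0 1" using x by blast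
  obtain Y where Y: "finite Y" "card Y = n" "Y \<subseteq> sphere 0 1 \<inter> ball x (r / 2)"
    using infinite_arbitrarily_large[OF infinite_sphere_ball[OF xs, of "r / 2"], of n] r by auto
  \<comment> \<open>Half of \<open>\<delta>\<close> separates the chosen positions, and added to
    \<open>r / 2\<close> it stays within the unmasked ball of radius \<open>r\<close>.\<close>
  define \<delta> where "\<delta> = Min (insert r ((\<lambda>(y, z). dist y z) ` {(y, z) \<in> Y \<times> Y. y \<noteq> z}))"
  have fin: "finite (insert r ((\<lambda>(y, z). dist y z) ` {(y, z) \<in> Y \<times> Y. y \<noteq> z}))"
    using Y(1) by (intro finite.insertI finite_imageI finite_subset[OF _ finite_cartesian_product[OF Y(1) Y(1)]]) auto
  have \<delta>: "0 < \<delta>" unfolding \<delta>_def using fin r by (subst Min_gr_iff) auto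
  have \<delta>r: "\<delta> \<le> r" unfolding \<delta>_def using fin by (intro Min_le) auto
  have sep: "\<delta> \<le> dist y z" if "y \<in> Y" "z \<in> Y" "y \<noteq> z" for y z
    unfolding \<delta>_def using fin that by (intro Min_le) auto
  obtain \<kappa> where \<kappa>: "0 < \<kappa>" "\<And>j x. x \<in> sphere 0 1 \<Longrightarrow> \<exists>k<N j. geodesic_dist x (\<xi> j k) \<le> \<kappa> / B ^ j"
    using cub unfolding spin_cubature_def by meson
  have \<xi>: "\<And>j k. k < N j \<Longrightarrow> \<xi> j k \<in> sphere 0 1" using cub unfolding spin_cubature_def by blast
  have "\<forall>\<^sub>F j in sequentially. 2 * \<kappa> + 1 \<le> \<delta> * B ^ j" by (rule eventually_power_ge[OF B \<delta>])
  then show "\<forall>\<^sub>F j in sequentially. n \<le> card (unmasked_points N \<xi> G \<epsilon> j)"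
  proof eventually_elim
    case (elim j)
    have Bj: "0 < B ^ j" using B by simp
    have small: "\<kappa> / B ^ j < \<delta> / 2" using elim Bj by (simp add: field_simps)
    have "\<forall>y\<in>Y. \<exists>k. k < N j \<and> geodesic_dist y (\<xi> j k) \<le> \<kappa> / B ^ j" using \<kappa>(2) Y(3) by blast
    then obtain k where k: "\<And>y. y \<in> Y \<Longrightarrow> k y < N j" "\<And>y. y \<in> Y \<Longrightarrow> geodesic_dist y (\<xi> j (k y)) \<le> \<kappa> / B ^ j"
      by metis
    have near: "dist y (\<xi> j (k y)) < \<delta> / 2" if y: "y \<in> Y" for y
    proof -
      have "y \<in> sphere 0 1" using y Y(3) by blast
      then show ?thesis using dist_le_geodesic_dist(1)[of y "\<xi> j (k y)"] \<xi>[OF k(1)[OF y]] k(2)[OF y] small by linarith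
    qed
    have "inj_on k Y"
    proof (rule inj_onI, rule ccontr)
      fix y z assume yz: "y \<in> Y" "z \<in> Y" "k y = k z" "y \<noteq> z"
      have "dist y z \<le> dist y (\<xi> j (k y)) + dist z (\<xi> j (k z))" using yz(3) by (simp add: dist_triangle2)
      then show False using near[OF yz(1)] near[OF yz(2)] sep[OF yz(1,2,4)] by linarith
    qed
    moreover have "k ` Y \<subseteq> unmasked_points N \<xi> G \<epsilon> j"
    proof
      fix i assume "i \<in> k ` Y"
      then obtain y where y: "y \<in> Y" "i = k y" by blast
      have "dist x y < r / 2" using y(1) Y(3) by auto
      then have "dist x (\<xi> j i) < r"
        using dist_triangle[of x "\<xi> j (k y)" y] near[OF y(1)] \<delta>r unfolding y(2) by linarith
      then show "i \<in> unmasked_points N \<xi> G \<epsilon> j"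
        using rE \<xi>[OF k(1)[OF y(1)]] k(1)[OF y(1)] y(2) by (simp add: unmasked_points_def)
    qed
    moreover have "finite (unmasked_points N \<xi> G \<epsilon> j)" by (simp add: unmasked_points_def)
    ultimately show ?case using Y(2) by (metis card_image card_mono)
  qed
qed

section \<open>Bessel's inequality and the mass of the window\<close>

lemma bessel_inequality_finite:
  fixes e :: "'p \<Rightarrow> 'k \<Rightarrow> complex" and v :: "'k \<Rightarrow> complex"
  assumes K: "finite K" and S: "finite S"
    and on: "\<And>p q. p \<in> S \<Longrightarrow> q \<in> S \<Longrightarrow> (\<Sum>k\<in>K. e p k * cnj (e q k)) = (if p = q then 1 else 0)"
  shows "(\<Sum>p\<in>S. (cmod (\<Sum>k\<in>K. v k * e p k))\<^sup>2) \<le> (\<Sum>k\<in>K. (cmod (v k))\<^sup>2)"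
proof -
  define t where "t p = (\<Sum>k\<in>K. v k * e p k)" for p
  define u where "u k = (\<Sum>p\<in>S. t p * cnj (e p k))" for k
  have vu: "(\<Sum>k\<in>K. v k * cnj (u k)) = (\<Sum>p\<in>S. t p * cnj (t p))"
  proof -
    have "(\<Sum>k\<in>K. v k * cnj (u k)) = (\<Sum>k\<in>K. \<Sum>p\<in>S. (v k * e p k) * cnj (t p))"
      unfolding u_def cnj_sum sum_distrib_left by (intro sum.cong refl) (simp add: mult_ac)
    also have "\<dots> = (\<Sum>p\<in>S. t p * cnj (t p))"
      unfolding t_def[of _] by (subst sum.swap) (simp add: sum_distrib_right)
    finally show ?thesis .
  qed
  have uu: "(\<Sum>k\<in>K. u k * cnj (u k)) = (\<Sum>p\<in>S. t p * cnj (t p))"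
  proof -
    have "(\<Sum>k\<in>K. u k * cnj (u k)) = (\<Sum>k\<in>K. \<Sum>q\<in>S. \<Sum>p\<in>S. t q * cnj (t p) * (e p k * cnj (e q k)))"
      unfolding u_def cnj_sum sum_product by (intro sum.cong refl) (simp add: mult_ac)
    also have "\<dots> = (\<Sum>q\<in>S. \<Sum>p\<in>S. t q * cnj (t p) * (\<Sum>k\<in>K. e p k * cnj (e q k)))"
      by (subst sum.swap, intro sum.cong refl, subst sum.swap) (simp add: sum_distrib_left)
    also have "\<dots> = (\<Sum>q\<in>S. \<Sum>p\<in>S. if q = p then t q * cnj (t p) else 0)"
      by (intro sum.cong refl) (simp add: on)
    also have "\<dots> = (\<Sum>p\<in>S. t p * cnj (t p))" using S by simp
    finally show ?thesis .
  qed
  have tt: "cnj (\<Sum>p\<in>S. t p * cnj (t p)) = (\<Sum>p\<in>S. t p * cnj (t p))"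
    by (simp add: mult.commute)
  have "complex_of_real (\<Sum>k\<in>K. (cmod (v k - u k))\<^sup>2) = (\<Sum>k\<in>K. (v k - u k) * cnj (v k - u k))"
    by (simp only: of_real_sum complex_norm_square)
  also have "\<dots> = (\<Sum>k\<in>K. v k * cnj (v k)) - (\<Sum>k\<in>K. v k * cnj (u k)) - cnj (\<Sum>k\<in>K. v k * cnj (u k)) + (\<Sum>k\<in>K. u k * cnj (u k))"
    by (simp add: sum.distrib sum_subtractf algebra_simps)
  also have "\<dots> = (\<Sum>k\<in>K. v k * cnj (v k)) - (\<Sum>p\<in>S. t p * cnj (t p))"
    unfolding vu uu tt by simp
  also have "\<dots> = complex_of_real ((\<Sum>k\<in>K. (cmod (v k))\<^sup>2) - (\<Sum>p\<in>S. (cmod (t p))\<^sup>2))"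
    by (simp only: of_real_diff of_real_sum complex_norm_square)
  finally have "(\<Sum>k\<in>K. (cmod (v k - u k))\<^sup>2) = (\<Sum>k\<in>K. (cmod (v k))\<^sup>2) - (\<Sum>p\<in>S. (cmod (t p))\<^sup>2)"
    by (simp only: of_real_eq_iff)
  moreover have "0 \<le> (\<Sum>k\<in>K. (cmod (v k - u k))\<^sup>2)" by (simp add: sum_nonneg)
  ultimately show ?thesis unfolding t_def by linarith
qed

lemma needlet_window_le_1:
  assumes "needlet_window B b" "0 < u"
  shows "b u \<le> 1"
proof -
  have "((\<lambda>j::int. (b (u / B powi j))\<^sup>2) has_sum 1) UNIV" using assms by (simp add: needlet_window_def)
  then have "(\<Sum>j\<in>{0::int}. (b (u / B powi j))\<^sup>2) \<le> 1" by (rule finite_sum_le_has_sum) auto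
  then have "(b u)\<^sup>2 \<le> 1\<^sup>2" by simp
  then show ?thesis by (rule power2_le_imp_le) simp
qed

text \<open>The partition of unity at the point 1 prevents the window from vanishing identically;
  continuity at a point where it is positive gives an interval.\<close>

lemma needlet_window_bounded_below:
  assumes B: "1 < B" and b: "needlet_window B b"
  obtains u v \<eta> where "0 < u" "u < v" "0 < \<eta>" "\<And>t. t \<in> {u..v} \<Longrightarrow> \<eta> \<le> b t"
proof -
  have hs: "((\<lambda>j::int. (b (1 / B powi j))\<^sup>2) has_sum 1) UNIV" using b by (simp add: needlet_window_def)
  have "\<exists>j::int. b (1 / B powi j) \<noteq> 0"
  proof (rule ccontr)
    assume "\<not> (\<exists>j::int. b (1 / B powi j) \<noteq> 0)"
    then have "((\<lambda>j::int. 0::real) has_sum 1) UNIV" using hs by simp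
    moreover have "((\<lambda>j::int. 0::real) has_sum 0) UNIV" by (rule has_sum_0) simp
    ultimately have "(1::real) = 0" by (rule has_sum_unique)
    then show False by simp
  qed
  then obtain t where t: "b t \<noteq> 0" by (rule exE)
  have "t \<in> {1 / B..B}" using t needlet_window_deriv_zero[OF b, of t 0] by auto
  then have t0: "0 < t" using B by (auto intro: less_le_trans[of 0 "1 / B"])
  have "(deriv ^^ 0) b field_differentiable (at t)"
    using b unfolding needlet_window_def smooth_on_def by blast
  then have d: "b field_differentiable (at t)" by simp
  have bt: "0 < b t" using t b by (simp add: needlet_window_def less_le)
  have "isCont b t" by (rule field_differentiable_imp_continuous_at[OF d])
  then have "\<exists>r>0. \<forall>x. dist x t < r \<longrightarrow> dist (b x) (b t) < b t / 2"
    unfolding continuous_at_eps_delta dist_real_def using bt by (elim allE[where x = "b t / 2"]) simp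
  then obtain r where r: "0 < r" "\<And>x. dist x t < r \<Longrightarrow> dist (b x) (b t) < b t / 2" by blast
  show ?thesis
  proof (rule that[of t "t + r / 2" "b t / 2"])
    fix x assume "x \<in> {t..t + r / 2}"
    then have "dist x t < r" using r(1) by (auto simp: dist_real_def)
    then have "\<bar>b x - b t\<bar> < b t / 2" unfolding dist_real_def[symmetric] by (rule r(2))
    then show "b t / 2 \<le> b x" by linarith
  qed (use t0 r bt in auto)
qed

text \<open>The radicand lies between the squares of
  \<open>real l - of_int \<bar>s\<bar> - 1\<close> and \<open>real l + 1\<close>. Multipoles can
  therefore be located by \<open>real l / B ^ j\<close> at the cost of a bounded shift of
  \<open>l\<close>.\<close>

lemma scaled_root_near:
  assumes B: "1 < B" and l: "\<bar>s\<bar> + 1 \<le> int l"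
  shows "(real l - of_int \<bar>s\<bar> - 1) / B ^ j \<le> scaled_root B s j (real l)"
    and "scaled_root B s j (real l) \<le> (real l + 1) / B ^ j"
proof -
  have Bj: "0 < B ^ j" using B by simp
  define \<sigma> :: real where "\<sigma> = of_int \<bar>s\<bar>"
  have ss: "real_of_int s * of_int s = \<sigma> * \<sigma>" "of_int s \<le> \<sigma>" "- of_int s \<le> \<sigma>" "0 \<le> \<sigma>"
    unfolding \<sigma>_def by (simp_all add: abs_mult_self_eq)
  have l': "\<sigma> + 1 \<le> real l" using l unfolding \<sigma>_def by linarith
  have m: "(\<sigma> + 1) * (2 * \<sigma> + 3) \<le> real l * (2 * \<sigma> + 3)" using l' ss by (intro mult_right_mono) auto
  have e: "(real l - of_int s) * (real l + of_int s + 1) = real l * real l + real l - \<sigma> * \<sigma> - of_int s"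
    using ss(1) by (simp add: algebra_simps)
  have 1: "(real l - \<sigma> - 1)\<^sup>2 \<le> (real l - of_int s) * (real l + of_int s + 1)"
    unfolding e using m ss by (simp add: power2_eq_square algebra_simps)
  have 2: "(real l - of_int s) * (real l + of_int s + 1) \<le> (real l + 1)\<^sup>2"
  proof -
    have "- of_int s \<le> \<sigma> * \<sigma> + real l" using ss l' mult_nonneg_nonneg[OF ss(4) ss(4)] by linarith
    then show ?thesis unfolding e by (simp add: power2_eq_square algebra_simps)
  qed
  have "real l - \<sigma> - 1 \<le> sqrt ((real l - of_int s) * (real l + of_int s + 1))" by (rule real_le_rsqrt[OF 1])
  then show "(real l - of_int \<bar>s\<bar> - 1) / B ^ j \<le> scaled_root B s j (real l)"
    unfolding scaled_root_def \<sigma>_def using Bj by (intro divide_right_mono) auto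
  have "sqrt ((real l - of_int s) * (real l + of_int s + 1)) \<le> real l + 1"
    by (rule real_le_lsqrt) (use 2 in auto)
  then show "scaled_root B s j (real l) \<le> (real l + 1) / B ^ j"
    unfolding scaled_root_def using Bj by (intro divide_right_mono) auto
qed

text \<open>The multipoles whose scaled root falls into an interval where the window is bounded
  below form a run of length proportional to \<open>B ^ j\<close>.\<close>

lemma needlet_coeff_square_sum:
  assumes B: "1 < B" and b: "needlet_window B b"
  obtains c x where "0 < c" "0 < x"
    "\<forall>\<^sub>F j in sequentially. \<exists>S. finite S \<and> S \<subseteq> multipoles s \<and> c * B ^ j \<le> real (card S) \<and>
      (\<forall>l\<in>S. c \<le> (needlet_coeff B b s j (int l))\<^sup>2 \<and> x * B ^ j \<le> real l)"
proof -
  obtain u v \<eta> where uv: "0 < u" "u < v" and \<eta>: "0 < \<eta>" "\<And>t. t \<in> {u..v} \<Longrightarrow> \<eta> \<le> b t"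
    by (rule needlet_window_bounded_below[OF B b]) (rule that)
  define \<sigma> :: real where "\<sigma> = of_int \<bar>s\<bar>"
  define c where "c = min (\<eta>\<^sup>2) ((v - u) / 2)"
  have c: "0 < c" using uv \<eta> by (simp add: c_def)
  \<comment> \<open>The spin shift and the rounding of both ends cost at most
    \<open>\<sigma> + 3\<close> multipoles; beyond this threshold at least half of the interval is
    left.\<close>
  have "\<forall>\<^sub>F j in sequentially. \<sigma> + 6 \<le> (v - u) / 2 * B ^ j"
    by (rule eventually_power_ge[OF B]) (use uv in simp)
  then have ev: "\<forall>\<^sub>F j in sequentially. \<exists>S. finite S \<and> S \<subseteq> multipoles s \<and> c * B ^ j \<le> real (card S) \<and>
      (\<forall>l\<in>S. c \<le> (needlet_coeff B b s j (int l))\<^sup>2 \<and> u * B ^ j \<le> real l)"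
  proof eventually_elim
    case (elim j)
    have Bj: "0 < B ^ j" using B by simp
    define U V where "U = u * B ^ j" and "V = v * B ^ j"
    define p q where "p = nat \<lceil>U + \<sigma> + 1\<rceil>" and "q = nat \<lfloor>V - 1\<rfloor>"
    have \<sigma>0: "0 \<le> \<sigma>" by (simp add: \<sigma>_def)
    have uB: "0 < U" using uv Bj by (simp add: U_def)
    have vu: "(v - u) / 2 * B ^ j = (V - U) / 2" by (simp add: U_def V_def left_diff_distrib diff_divide_distrib)
    have el: "\<sigma> + 6 \<le> (V - U) / 2" using elim unfolding vu .
    have p: "U + \<sigma> + 1 \<le> real p" "real p \<le> U + \<sigma> + 2"
      unfolding p_def using uB \<sigma>0 by linarith+
    have "0 \<le> \<lfloor>V - 1\<rfloor>" using uB \<sigma>0 el by simp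
    then have "real q = of_int \<lfloor>V - 1\<rfloor>" unfolding q_def by simp
    then have q: "real q \<le> V - 1" "V - 2 \<le> real q" by linarith+
    have l: "\<bar>s\<bar> + 1 \<le> int l \<and> 1 \<le> l \<and> scaled_root B s j (real l) \<in> {u..v} \<and> u * B ^ j \<le> real l" if "l \<in> {p..q}" for l
    proof -
      have lb: "U + \<sigma> + 1 \<le> real l" "real l \<le> V - 1"
        using that p(1) q(1) by (auto intro: order_trans)
      then have "of_int (\<bar>s\<bar> + 1) \<le> real_of_int (int l)" using uB unfolding \<sigma>_def by simp
      then have s: "\<bar>s\<bar> + 1 \<le> int l" by (simp only: of_int_le_iff)
      have "u \<le> (real l - of_int \<bar>s\<bar> - 1) / B ^ j" "(real l + 1) / B ^ j \<le> v"
        using lb Bj unfolding \<sigma>_def U_def V_def by (simp_all add: pos_le_divide_eq pos_divide_le_eq)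
      then show ?thesis using scaled_root_near[OF B s, of j] s lb(1) \<sigma>0 by (auto simp: U_def)
    qed
    have "real q + 1 - real p \<le> real (card {p..q})" by simp
    moreover have "2 * \<sigma> + 12 \<le> V - U" using el by simp
    ultimately have "V - U \<le> 2 * real (card {p..q})" using p(2) q(2) \<sigma>0 by linarith
    then have "(v - u) / 2 * B ^ j \<le> real (card {p..q})" unfolding vu by simp
    moreover have "c * B ^ j \<le> (v - u) / 2 * B ^ j" unfolding c_def by (intro mult_right_mono min.cobounded2) (use Bj in simp)
    ultimately have "c * B ^ j \<le> real (card {p..q})" by linarith
    moreover have "{p..q} \<subseteq> multipoles s" using l by (force simp: multipoles_def)
    moreover have "c \<le> (needlet_coeff B b s j (int l))\<^sup>2" if "l \<in> {p..q}" for l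
    proof -
      have "\<eta> \<le> needlet_coeff B b s j (int l)" using l[OF that] \<eta>(2) by (simp add: needlet_coeff_def)
      then have "\<eta>\<^sup>2 \<le> (needlet_coeff B b s j (int l))\<^sup>2" using \<eta>(1) by (intro power_mono) auto
      then show ?thesis by (simp add: c_def)
    qed
    ultimately show ?case using l by (intro exI[of _ "{p..q}"]) auto
  qed
  show ?thesis by (rule that[OF c uv(1) ev])
qed

section \<open>Needlet coefficients at high frequency\<close>

locale masked_needlets = spin_field M s C P a for M :: "'a measure" and s C P a +
  fixes B \<epsilon> \<alpha> c\<^sub>0 :: real and b :: "real \<Rightarrow> real"
    and N :: "nat \<Rightarrow> nat" and \<xi> :: "nat \<Rightarrow> nat \<Rightarrow> real^3" and w :: "nat \<Rightarrow> nat \<Rightarrow> real" and G :: "(real^3) set"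
  assumes B: "1 < B" and window: "needlet_window B b" and cubature: "spin_cubature B s N \<xi> w"
    and c\<^sub>0: "0 < c\<^sub>0" and \<alpha>: "2 < \<alpha>"
    and C_bounds: "\<And>l. l \<in> multipoles s \<Longrightarrow> real l powr (- \<alpha>) / c\<^sub>0 \<le> C l \<and> C l \<le> c\<^sub>0 * real l powr (- \<alpha>)"
    and G: "G \<subseteq> sphere 0 1" "G \<in> sets surface_measure" and \<epsilon>: "0 < \<epsilon>"
    and unmasked: "sphere 0 1 - enlargement G \<epsilon> \<noteq> {}"
begin

abbreviation f :: "nat \<Rightarrow> nat \<Rightarrow> real" where "f j l \<equiv> needlet_coeff B b s j (int l)"
abbreviation K :: "nat \<Rightarrow> nat set" where "K \<equiv> unmasked_points N \<xi> G \<epsilon>"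
abbreviation \<Gamma> :: "nat \<Rightarrow> real" where "\<Gamma> \<equiv> needlet_spectrum B b s C"

text \<open>The order of magnitude of \<open>C l\<close> for the multipoles visible at level
  \<open>j\<close>; all estimates below are relative to it.\<close>

definition decay :: "nat \<Rightarrow> real" where "decay j = (B ^ j) powr (- \<alpha>)"

definition observed :: "nat \<Rightarrow> nat \<Rightarrow> 'a \<Rightarrow> complex" where
  "observed j k = masked_coeff G P (spin_needlet B b s \<xi> w j k)"

definition weight :: "nat \<Rightarrow> nat \<Rightarrow> nat \<times> int \<Rightarrow> complex" where
  "weight j k p = of_real (sqrt (w j k) * f j (fst p)) * cnj (harmonic s p (\<xi> j k))"

text \<open>The coefficient which would be computed from the whole sphere.\<close>

definition unmasked_coeff :: "nat \<Rightarrow> nat \<Rightarrow> nat \<Rightarrow> 'a \<Rightarrow> complex" where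
  "unmasked_coeff L j k \<omega> = (\<Sum>p\<in>harmonics_upto s L. a p \<omega> * cnj (weight j k p))"

text \<open>This collects what holds once \<open>j\<close> and \<open>L\<close> are large, so that
  the lemmas using it are exact statements about a single level.\<close>

definition band_limit :: "nat \<Rightarrow> nat \<Rightarrow> bool" where
  "band_limit j L \<longleftrightarrow>
     (\<forall>x y. needlet_kernel B b s j x y = (\<Sum>l\<le>L. of_real (f j l) * spin_kernel s l x y)) \<and>
     (\<forall>l\<in>multipoles s. b (sqrt (spin_eigenvalue l s) / B ^ j) = f j l) \<and> (\<forall>l. f j l \<noteq> 0 \<longrightarrow> l \<le> L)"

lemma power_B_pos: "0 < B ^ j"
  using B by simp

lemma decay_pos: "0 < decay j"
  unfolding decay_def using B by simp

lemma cubature_facts: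
  shows "k < N j \<Longrightarrow> \<xi> j k \<in> sphere 0 1" "k < N j \<Longrightarrow> 0 < w j k" "k < N j \<Longrightarrow> w j k \<le> 4 * pi"
proof -
  show x: "k < N j \<Longrightarrow> \<xi> j k \<in> sphere 0 1" and p: "k < N j \<Longrightarrow> 0 < w j k" for k
    using cubature unfolding spin_cubature_def by blast+
  assume k: "k < N j"
  have "w j k \<le> (\<Sum>k<N j. w j k)" 
  proof (rule member_le_sum)
    fix i assume "i \<in> {..<N j} - {k}"
    then show "0 \<le> w j i" using p[of i] by simp
  qed (use k in simp_all)
  also have "\<dots> = 4 * pi" using cubature unfolding spin_cubature_def by (elim conjE) (rule spec)
  finally show "w j k \<le> 4 * pi" .
qed

lemma f_nonzero:
  assumes "f j l \<noteq> 0"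
  shows "l \<in> multipoles s" "sqrt (spin_eigenvalue l s) \<le> B ^ (j + 1)" "(f j l)\<^sup>2 \<le> 1"
proof -
  have l: "\<bar>s\<bar> < int l" and bn: "b (scaled_root B s j (real l)) \<noteq> 0"
    using assms by (auto simp: needlet_coeff_def split: if_splits)
  then show "l \<in> multipoles s" by (auto simp: multipoles_def)
  have r: "scaled_root B s j (real l) \<in> {1 / B..B}"
    using needlet_window_deriv_zero[OF window, of "scaled_root B s j (real l)" 0] bn by auto
  have e: "scaled_root B s j (real l) = sqrt (spin_eigenvalue l s) / B ^ j"
    by (simp add: scaled_root_def spin_eigenvalue_def)
  have "sqrt (spin_eigenvalue l s) / B ^ j \<le> B" using r unfolding e by simp
  then show "sqrt (spin_eigenvalue l s) \<le> B ^ (j + 1)" using power_B_pos[of j] by (simp add: pos_divide_le_eq)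
  have "0 < scaled_root B s j (real l)" using r B by (auto intro: less_le_trans[of 0 "1 / B"])
  then have "f j l \<le> 1" "0 \<le> f j l"
    using needlet_window_le_1[OF window] window l by (simp_all add: needlet_coeff_def needlet_window_def)
  then show "(f j l)\<^sup>2 \<le> 1" by (simp add: power_le_one)
qed

lemma band_limit_exists: "\<exists>c. \<forall>\<^sub>F j in sequentially. band_limit j (nat \<lceil>c * B ^ j\<rceil>)"
proof -
  obtain c where c: "\<forall>\<^sub>F j in sequentially. \<forall>L. c * B ^ j \<le> real L \<longrightarrow> (\<forall>x y.
    needlet_kernel B b s j x y = (\<Sum>l\<le>L. of_real (f j l) * spin_kernel s l x y))"
    using needlet_kernel_finite_sum[OF B window, of s] by (rule exE)
  obtain d' where d': "\<forall>\<^sub>F j in sequentially. \<forall>l. needlet_coeff B b s j l \<noteq> 0 \<longrightarrow> of_int l \<le> d' * B ^ j"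
  proof -
    obtain d d' where dd: "\<forall>\<^sub>F j in sequentially. \<forall>l. needlet_coeff B b s j l \<noteq> 0 \<longrightarrow> d * B ^ j \<le> of_int l \<and> of_int l \<le> d' * B ^ j"
      using needlet_coeff_support[OF B window, of s] unfolding dyadic_support_def by blast
    show thesis by (rule that[of d']) (use dd in \<open>eventually_elim, blast\<close>)
  qed
  have "\<forall>\<^sub>F j in sequentially. band_limit j (nat \<lceil>max c d' * B ^ j\<rceil>)"
    using c d' window_eq_needlet_coeff[OF B window, of s]
  proof eventually_elim
    case (elim j)
    let ?L = "nat \<lceil>max c d' * B ^ j\<rceil>"
    have L: "max c d' * B ^ j \<le> real ?L" by linarith
    have m: "c * B ^ j \<le> max c d' * B ^ j" "d' * B ^ j \<le> max c d' * B ^ j"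
      using power_B_pos[of j] by (intro mult_right_mono; simp)+
    have "l \<le> ?L" if "f j l \<noteq> 0" for l
    proof -
      have "real_of_int (int l) \<le> d' * B ^ j" using elim(2) that by blast
      then have "real l \<le> d' * B ^ j" by simp
      then have "real l \<le> real ?L" using m(2) L by linarith
      then show ?thesis by simp
    qed
    moreover have "c * B ^ j \<le> real ?L" using m(1) L by linarith
    ultimately show ?case using elim(1,3) unfolding band_limit_def by blast
  qed
  then show ?thesis by (rule exI)
qed

lemma needlet_expansion:
  assumes L: "band_limit j L"
  shows "spin_needlet B b s \<xi> w j k x = (\<Sum>p\<in>harmonics_upto s L. weight j k p * harmonic s p x)"
proof -
  have "needlet_kernel B b s j x (\<xi> j k) = (\<Sum>l\<le>L. of_real (f j l) * spin_kernel s l x (\<xi> j k))"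
    using L unfolding band_limit_def by blast
  also have "\<dots> = (\<Sum>l\<in>multipoles s \<inter> {..L}. of_real (f j l) * spin_kernel s l x (\<xi> j k))"
    by (rule sum.mono_neutral_right) (use f_nonzero(1) in auto)
  finally have "spin_needlet B b s \<xi> w j k x =
      (\<Sum>l\<in>multipoles s \<inter> {..L}. of_real (sqrt (w j k)) * (of_real (f j l) * spin_kernel s l x (\<xi> j k)))"
    unfolding spin_needlet_eq by (simp only: sum_distrib_left)
  also have "\<dots> = (\<Sum>p\<in>harmonics_upto s L. weight j k p * harmonic s p x)"
    unfolding sum_harmonics_upto
  proof (rule sum.cong[OF refl])
    fix l
    show "of_real (sqrt (w j k)) * (of_real (f j l) * spin_kernel s l x (\<xi> j k)) =
      (\<Sum>m = - int l..int l. weight j k (l, m) * harmonic s (l, m) x)"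
      unfolding spin_kernel_def sum_distrib_left weight_def
      by (intro sum.cong refl) (simp only: of_real_mult fst_conv snd_conv mult_ac)
  qed
  finally show ?thesis .
qed

lemma needlet_spectrum_finite_sum:
  assumes L: "band_limit j L"
  shows "\<Gamma> j = (\<Sum>l\<in>multipoles s \<inter> {..L}. (f j l)\<^sup>2 * ((2 * real l + 1) / (4 * pi)) * C l)"
proof -
  have "\<Gamma> j = (\<Sum>\<^sub>\<infinity>l\<in>multipoles s \<inter> {..L}. (f j l)\<^sup>2 * ((2 * real l + 1) / (4 * pi)) * C l)"
    unfolding needlet_spectrum_def
    by (rule infsum_cong_neutral) (use L in \<open>auto simp: band_limit_def\<close>)
  then show ?thesis by simp
qed

lemma mean_square_unmasked_coeff:
  assumes L: "band_limit j L" and k: "k < N j"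
  shows "mean_square (unmasked_coeff L j k) = w j k * \<Gamma> j"
proof -
  have w: "0 \<le> w j k" using cubature_facts(2)[OF k] by simp
  have cw: "(cmod (cnj (weight j k p)))\<^sup>2 = w j k * (f j (fst p))\<^sup>2 * (cmod (harmonic s p (\<xi> j k)))\<^sup>2" for p
    using w by (simp add: weight_def norm_mult power_mult_distrib abs_mult)
  have "mean_square (unmasked_coeff L j k) = (\<Sum>p\<in>harmonics_upto s L. C (fst p) * (cmod (cnj (weight j k p)))\<^sup>2)"
    unfolding unmasked_coeff_def[abs_def]
    by (rule mean_square_linear_combination[OF finite_harmonics_upto harmonics_upto_subset])
  also have "\<dots> = (\<Sum>l\<in>multipoles s \<inter> {..L}. w j k * (f j l)\<^sup>2 * C l * (\<Sum>m = - int l..int l. (cmod (spin_harmonic l m s (\<xi> j k)))\<^sup>2))"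
    unfolding sum_harmonics_upto cw by (simp add: sum_distrib_left mult_ac)
  also have "\<dots> = (\<Sum>l\<in>multipoles s \<inter> {..L}. w j k * ((f j l)\<^sup>2 * ((2 * real l + 1) / (4 * pi)) * C l))"
    by (intro sum.cong refl, subst sum_spin_harmonic_norm[OF cubature_facts(1)[OF k]]) (auto simp: multipoles_def)
  also have "\<dots> = w j k * \<Gamma> j" unfolding needlet_spectrum_finite_sum[OF L] by (simp only: sum_distrib_left)
  finally show ?thesis .
qed

lemma unmasked_coeff_L2: "L2_rv (unmasked_coeff L j k)"
  unfolding unmasked_coeff_def[abs_def] by (rule linear_combination_L2[OF harmonics_upto_subset])

text \<open>By the cubature formula the vectors
  \<open>sqrt (w j k) * harmonic s p (\<xi> j k)\<close>, indexed by \<open>k\<close>, are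
  orthonormal over the harmonics \<open>p\<close> in the band. Expanding the variance in the
  \<open>a p\<close> and applying Bessel's inequality leaves the largest \<open>C l\<close> of the
  band; the window contributes at most 1.\<close>

lemma mean_square_unmasked_combination:
  assumes A: "\<And>l. f j l \<noteq> 0 \<Longrightarrow> C l \<le> A" "0 \<le> A" and I: "I \<subseteq> {..<N j}"
  shows "mean_square (\<lambda>\<omega>. \<Sum>k\<in>I. v k * unmasked_coeff L j k \<omega>) \<le> A * (\<Sum>k\<in>I. (cmod (v k))\<^sup>2)"
proof -
  define e where "e p k = of_real (sqrt (w j k)) * harmonic s p (\<xi> j k)" for p k
  \<comment> \<open>The orthonormality needs all cubature points, so the vector is extended by 0
    from the chosen ones.\<close>
  define v' where "v' k = (if k \<in> I then v k else 0)" for k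
  define S where "S = {p \<in> harmonics_upto s L. f j (fst p) \<noteq> 0}"
  have fin: "finite S" by (simp add: S_def)
  have I': "{..<N j} \<inter> I = I" using I by blast
  have restrict: "(\<Sum>k\<in>I. g k) = (\<Sum>k<N j. if k \<in> I then g k else 0)" for g :: "nat \<Rightarrow> 'z::comm_monoid_add"
    using sum.inter_restrict[of "{..<N j}" g I] by (simp only: finite_lessThan I')
  have t: "(\<Sum>k\<in>I. v k * cnj (weight j k p)) = of_real (f j (fst p)) * (\<Sum>k<N j. v' k * e p k)" for p
  proof -
    have "(\<Sum>k<N j. v' k * e p k) = (\<Sum>k\<in>I. v k * e p k)"
      unfolding restrict by (intro sum.cong refl) (simp add: v'_def)
    then show ?thesis
      unfolding weight_def e_def by (simp add: sum_distrib_left mult_ac)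
  qed
  have "(\<lambda>\<omega>. \<Sum>k\<in>I. v k * unmasked_coeff L j k \<omega>) = (\<lambda>\<omega>. \<Sum>p\<in>harmonics_upto s L. a p \<omega> * (\<Sum>k\<in>I. v k * cnj (weight j k p)))"
    unfolding unmasked_coeff_def sum_distrib_left
    by (subst sum.swap) (simp add: mult_ac)
  then have "mean_square (\<lambda>\<omega>. \<Sum>k\<in>I. v k * unmasked_coeff L j k \<omega>) =
      (\<Sum>p\<in>harmonics_upto s L. C (fst p) * (cmod (\<Sum>k\<in>I. v k * cnj (weight j k p)))\<^sup>2)"
    by (simp only: mean_square_linear_combination[OF finite_harmonics_upto harmonics_upto_subset])
  also have "\<dots> = (\<Sum>p\<in>S. C (fst p) * (cmod (\<Sum>k\<in>I. v k * cnj (weight j k p)))\<^sup>2)"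
    unfolding t S_def by (rule sum.mono_neutral_right) auto
  also have "\<dots> \<le> (\<Sum>p\<in>S. A * (cmod (\<Sum>k<N j. v' k * e p k))\<^sup>2)"
  proof (rule sum_mono)
    fix p assume "p \<in> S"
    then have nz: "f j (fst p) \<noteq> 0" by (simp add: S_def)
    have "(cmod (\<Sum>k\<in>I. v k * cnj (weight j k p)))\<^sup>2 = (f j (fst p))\<^sup>2 * (cmod (\<Sum>k<N j. v' k * e p k))\<^sup>2"
      unfolding t by (simp add: norm_mult power_mult_distrib)
    also have "\<dots> \<le> 1 * (cmod (\<Sum>k<N j. v' k * e p k))\<^sup>2" by (intro mult_right_mono f_nonzero(3)[OF nz]) simp
    finally have "(cmod (\<Sum>k\<in>I. v k * cnj (weight j k p)))\<^sup>2 \<le> (cmod (\<Sum>k<N j. v' k * e p k))\<^sup>2" by simp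
    then show "C (fst p) * (cmod (\<Sum>k\<in>I. v k * cnj (weight j k p)))\<^sup>2 \<le> A * (cmod (\<Sum>k<N j. v' k * e p k))\<^sup>2"
      using A(1)[OF nz] A(2) by (intro mult_mono) auto
  qed
  also have "\<dots> = A * (\<Sum>p\<in>S. (cmod (\<Sum>k<N j. v' k * e p k))\<^sup>2)" by (simp only: sum_distrib_left)
  also have "\<dots> \<le> A * (\<Sum>k<N j. (cmod (v' k))\<^sup>2)"
  proof (intro mult_left_mono A(2) bessel_inequality_finite[OF finite_lessThan fin])
    fix p q assume pq: "p \<in> S" "q \<in> S"
    have ip: "p \<in> harmonic_index s" "q \<in> harmonic_index s" using pq harmonics_upto_subset by (auto simp: S_def)
    have nz: "f j (fst p) \<noteq> 0" "f j (fst q) \<noteq> 0" using pq by (auto simp: S_def)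
    have "(\<Sum>k<N j. e p k * cnj (e q k)) =
        (\<Sum>k<N j. of_real (w j k) * harmonic s p (\<xi> j k) * cnj (harmonic s q (\<xi> j k)))"
    proof (rule sum.cong[OF refl])
      fix k assume "k \<in> {..<N j}"
      then have "0 \<le> w j k" using cubature_facts(2)[of k j] by simp
      then have "sqrt (w j k) * sqrt (w j k) = w j k" by simp
      then have r: "complex_of_real (sqrt (w j k)) * complex_of_real (sqrt (w j k)) = complex_of_real (w j k)"
        by (simp only: of_real_mult[symmetric])
      have "e p k * cnj (e q k) = (complex_of_real (sqrt (w j k)) * complex_of_real (sqrt (w j k))) *
          harmonic s p (\<xi> j k) * cnj (harmonic s q (\<xi> j k))"
        unfolding e_def complex_cnj_mult complex_cnj_complex_of_real by (simp only: mult_ac)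
      then show "e p k * cnj (e q k) = of_real (w j k) * harmonic s p (\<xi> j k) * cnj (harmonic s q (\<xi> j k))"
        by (simp only: r)
    qed
    also have "\<dots> = (if fst p = fst q \<and> snd p = snd q then 1 else 0)"
    proof -
      have "\<forall>j l l' m m'. \<bar>s\<bar> \<le> int l \<and> \<bar>s\<bar> \<le> int l' \<and> \<bar>m\<bar> \<le> int l \<and> \<bar>m'\<bar> \<le> int l' \<and>
        sqrt (spin_eigenvalue l s) \<le> B ^ (j + 1) \<and> sqrt (spin_eigenvalue l' s) \<le> B ^ (j + 1) \<longrightarrow>
        (\<Sum>k<N j. of_real (w j k) * spin_harmonic l m s (\<xi> j k) * cnj (spin_harmonic l' m' s (\<xi> j k))) =
        (if l = l' \<and> m = m' then 1 else 0)"
        using cubature unfolding spin_cubature_def by (elim conjE)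
      note orthonormal = this[rule_format]
      show ?thesis
        by (rule orthonormal)
          (intro conjI harmonic_index_bounds(1,2)[OF ip(1)] harmonic_index_bounds(1,2)[OF ip(2)]
            f_nonzero(2)[OF nz(1)] f_nonzero(2)[OF nz(2)])
    qed
    finally show "(\<Sum>k<N j. e p k * cnj (e q k)) = (if p = q then 1 else 0)" by (simp add: prod_eq_iff)
  qed
  also have "(\<Sum>k<N j. (cmod (v' k))\<^sup>2) = (\<Sum>k\<in>I. (cmod (v k))\<^sup>2)"
    unfolding restrict by (intro sum.cong refl) (simp add: v'_def)
  finally show ?thesis .
qed

lemma band_decay:
  obtains A A' where "0 < A" "0 < A'"
    "\<forall>\<^sub>F j in sequentially. \<forall>l. f j l \<noteq> 0 \<longrightarrow> A * decay j \<le> C l \<and> C l \<le> A' * decay j"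
proof -
  obtain d d' where d: "0 < d" and dd: "\<forall>\<^sub>F j in sequentially. \<forall>l. needlet_coeff B b s j l \<noteq> 0 \<longrightarrow> d * B ^ j \<le> of_int l \<and> of_int l \<le> d' * B ^ j"
    using needlet_coeff_support[OF B window, of s] unfolding dyadic_support_def by blast
  \<comment> \<open>The maximum ensures a positive constant, to which the real power can be
    applied.\<close>
  define D where "D = max d' 1"
  have "\<forall>\<^sub>F j in sequentially. \<forall>l. f j l \<noteq> 0 \<longrightarrow> D powr (- \<alpha>) / c\<^sub>0 * decay j \<le> C l \<and> C l \<le> c\<^sub>0 * d powr (- \<alpha>) * decay j"
    using dd
  proof eventually_elim
    case (elim j)
    show ?case
    proof (intro allI impI)
      fix l assume nz: "f j l \<noteq> 0"
      have lm: "l \<in> multipoles s" by (rule f_nonzero(1)[OF nz])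
      then have l0: "0 < real l" by (simp add: multipoles_def)
      have lb: "d * B ^ j \<le> real l" "real l \<le> d' * B ^ j" using elim nz by force+
      have "d' * B ^ j \<le> D * B ^ j" using power_B_pos[of j] by (intro mult_right_mono) (auto simp: D_def)
      then have ub: "real l \<le> D * B ^ j" using lb(2) by linarith
      have D0: "0 < D" by (simp add: D_def)
      have "(D * B ^ j) powr (- \<alpha>) \<le> real l powr (- \<alpha>)" using \<alpha> l0 ub by (intro powr_mono2') auto
      then have 1: "D powr (- \<alpha>) * decay j \<le> real l powr (- \<alpha>)"
        using D0 B by (simp add: powr_mult decay_def)
      have "real l powr (- \<alpha>) \<le> (d * B ^ j) powr (- \<alpha>)" using \<alpha> d power_B_pos[of j] lb(1) by (intro powr_mono2') auto
      then have 2: "real l powr (- \<alpha>) \<le> d powr (- \<alpha>) * decay j"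
        using d B by (simp add: powr_mult decay_def)
      have "D powr (- \<alpha>) / c\<^sub>0 * decay j = (D powr (- \<alpha>) * decay j) / c\<^sub>0" by simp
      also have "\<dots> \<le> real l powr (- \<alpha>) / c\<^sub>0" using 1 c\<^sub>0 by (intro divide_right_mono) auto
      finally have 3: "D powr (- \<alpha>) / c\<^sub>0 * decay j \<le> C l" using C_bounds[OF lm] by linarith
      have "c\<^sub>0 * real l powr (- \<alpha>) \<le> c\<^sub>0 * (d powr (- \<alpha>) * decay j)" using 2 c\<^sub>0 by (intro mult_left_mono) auto
      then have "C l \<le> c\<^sub>0 * d powr (- \<alpha>) * decay j" using C_bounds[OF lm] by (simp only: mult.assoc) linarith
      then show "D powr (- \<alpha>) / c\<^sub>0 * decay j \<le> C l \<and> C l \<le> c\<^sub>0 * d powr (- \<alpha>) * decay j" using 3 by blast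
    qed
  qed
  moreover have "0 < D powr (- \<alpha>) / c\<^sub>0" "0 < c\<^sub>0 * d powr (- \<alpha>)" using c\<^sub>0 d by (simp_all add: D_def)
  ultimately show ?thesis by (intro that)
qed

text \<open>About \<open>B ^ j\<close> multipoles contribute, each with a factor
  \<open>2 * l + 1\<close> of order \<open>B ^ j\<close> and a \<open>C l\<close> of order
  \<open>decay j\<close>.\<close>

lemma spectrum_lower_bound:
  obtains c where "0 < c" "\<forall>\<^sub>F j in sequentially. c * B ^ (2 * j) * decay j \<le> \<Gamma> j"
proof -
  obtain A A' where A: "0 < A" and Ab: "\<forall>\<^sub>F j in sequentially. \<forall>l. f j l \<noteq> 0 \<longrightarrow> A * decay j \<le> C l \<and> C l \<le> A' * decay j"
    by (rule band_decay) (rule that)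
  obtain c x where c: "0 < c" "0 < x" and S: "\<forall>\<^sub>F j in sequentially. \<exists>S. finite S \<and> S \<subseteq> multipoles s \<and> c * B ^ j \<le> real (card S) \<and>
      (\<forall>l\<in>S. c \<le> (f j l)\<^sup>2 \<and> x * B ^ j \<le> real l)"
    by (rule needlet_coeff_square_sum[OF B window]) (rule that)
  obtain d where d: "\<forall>\<^sub>F j in sequentially. band_limit j (nat \<lceil>d * B ^ j\<rceil>)" using band_limit_exists by (rule exE)
  have "\<forall>\<^sub>F j in sequentially. (c * (c * (x / (2 * pi)) * A)) * B ^ (2 * j) * decay j \<le> \<Gamma> j"
    using Ab S d
  proof eventually_elim
    case (elim j)
    let ?L = "nat \<lceil>d * B ^ j\<rceil>" and ?g = "\<lambda>l. (f j l)\<^sup>2 * ((2 * real l + 1) / (4 * pi)) * C l"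
    obtain S where S: "finite S" "S \<subseteq> multipoles s" "c * B ^ j \<le> real (card S)"
      and Sl: "\<And>l. l \<in> S \<Longrightarrow> c \<le> (f j l)\<^sup>2" "\<And>l. l \<in> S \<Longrightarrow> x * B ^ j \<le> real l" using elim(2) by blast
    have nz: "f j l \<noteq> 0" if "l \<in> S" for l using Sl(1)[OF that] c by auto
    have sub: "S \<subseteq> multipoles s \<inter> {..?L}" using S(2) nz elim(3) unfolding band_limit_def by blast
    have g: "c * (x * B ^ j / (2 * pi)) * (A * decay j) \<le> ?g l" if l: "l \<in> S" for l
    proof (intro mult_mono Sl(1)[OF l])
      have "x * B ^ j / (2 * pi) = (2 * (x * B ^ j)) / (4 * pi)" by simp
      also have "\<dots> \<le> (2 * real l + 1) / (4 * pi)" using Sl(2)[OF l] by (intro divide_right_mono) auto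
      finally show "x * B ^ j / (2 * pi) \<le> (2 * real l + 1) / (4 * pi)" .
      show "A * decay j \<le> C l" using elim(1) nz[OF l] by blast
    qed (use c A decay_pos[of j] power_B_pos[of j] in \<open>auto intro!: mult_nonneg_nonneg divide_nonneg_nonneg\<close>)
    have "(c * B ^ j) * (c * (x * B ^ j / (2 * pi)) * (A * decay j)) \<le> real (card S) * (c * (x * B ^ j / (2 * pi)) * (A * decay j))"
      by (intro mult_right_mono S(3)) (use c A decay_pos[of j] power_B_pos[of j] in \<open>auto intro!: mult_nonneg_nonneg divide_nonneg_nonneg\<close>)
    also have "\<dots> = (\<Sum>l\<in>S. c * (x * B ^ j / (2 * pi)) * (A * decay j))" by simp
    also have "\<dots> \<le> (\<Sum>l\<in>S. ?g l)" by (rule sum_mono[OF g])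
    also have "\<dots> \<le> (\<Sum>l\<in>multipoles s \<inter> {..?L}. ?g l)"
    proof (rule sum_mono2[OF _ sub])
      fix l assume "l \<in> multipoles s \<inter> {..?L} - S"
      then show "0 \<le> ?g l" by (intro mult_nonneg_nonneg divide_nonneg_nonneg less_imp_le[OF C_pos]) auto
    qed simp
    also have "\<dots> = \<Gamma> j" by (rule needlet_spectrum_finite_sum[OF elim(3), symmetric])
    finally have "(c * B ^ j) * (c * (x * B ^ j / (2 * pi)) * (A * decay j)) \<le> \<Gamma> j" .
    moreover have "B ^ (2 * j) = B ^ j * B ^ j" by (simp only: mult_2 power_add)
    ultimately show ?case by (simp add: mult_ac)
  qed
  then show ?thesis by (rule that[rotated]) (use c A in simp)
qed

lemma needlet_cmod_bound:
  assumes L: "band_limit j L"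
  obtains R where "\<And>x. x \<in> sphere 0 1 \<Longrightarrow> cmod (spin_needlet B b s \<xi> w j k x) \<le> R"
proof (rule that)
  fix x :: "real^3" assume x: "x \<in> sphere 0 1"
  show "cmod (spin_needlet B b s \<xi> w j k x) \<le>
      (\<Sum>p\<in>harmonics_upto s L. cmod (weight j k p) * sqrt ((2 * real (fst p) + 1) / (4 * pi)))"
    unfolding needlet_expansion[OF L]
    by (intro sum_norm_le) (auto simp: norm_mult intro!: mult_left_mono harmonic_cmod_le[OF subsetD[OF harmonics_upto_subset] x])
qed

lemma needlet_measurable:
  assumes L: "band_limit j L"
  shows "spin_needlet B b s \<xi> w j k \<in> borel_measurable surface_measure"
proof -
  have "(\<lambda>x. \<Sum>p\<in>harmonics_upto s L. weight j k p * harmonic s p x) \<in> borel_measurable surface_measure" by measurable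
  then show ?thesis using needlet_expansion[OF L] by (simp only: ext[of "spin_needlet B b s \<xi> w j k"])
qed

lemma K_subset: "K j \<subseteq> {..<N j}" "finite (K j)"
  by (auto simp: unmasked_points_def)

text \<open>Centres in use keep a positive distance from \<open>G\<close>, so the kernel decays
  there faster than any power. The exponent 8 is chosen with its square root in mind: the number of
  points is of order \<open>B ^ (2 * j)\<close>, and cross terms retain
  \<open>B ^ (4 * j)\<close>.\<close>

lemma masking_error:
  obtains D where "0 \<le> D" "\<forall>\<^sub>F j in sequentially. \<forall>L k. band_limit j L \<longrightarrow> k \<in> K j \<longrightarrow>
    mean_square (\<lambda>\<omega>. observed j k \<omega> - unmasked_coeff L j k \<omega>) \<le> D * decay j / B ^ (8 * j)"
proof -
  obtain \<eta> where \<eta>: "0 < \<eta>" "\<And>x \<xi>. x \<in> G \<Longrightarrow> \<xi> \<in> sphere 0 1 - enlargement G \<epsilon> \<Longrightarrow> x \<bullet> \<xi> \<le> 1 - \<eta>"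
    by (rule inner_le_outside_enlargement[OF G(1) \<epsilon>]) (rule that)
  \<comment> \<open>The kernel bound is used with exponent \<open>m + 4\<close>. Squared, it gives
    \<open>B ^ (8 * j)\<close> and a further \<open>B ^ (2 * m * j)\<close>, which beats
    \<open>decay j\<close> because \<open>m\<close> is at least \<open>\<alpha>\<close>.\<close>
  define m where "m = nat \<lceil>\<alpha>\<rceil>"
  obtain D where D: "0 \<le> D" and ev: "\<forall>\<^sub>F j in sequentially. \<forall>x\<in>sphere 0 1. \<forall>y\<in>sphere 0 1.
    x \<bullet> y \<le> 1 - \<eta> \<longrightarrow> cmod (needlet_kernel B b s j x y) \<le> D / B ^ ((m + 4) * j)"
    using needlet_kernel_decay[OF B window \<eta>(1), where n = "m + 4" and s = s] by (elim exE conjE) (rule that)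
  define S where "S = suminf (angular_power s C)"
  have S: "0 \<le> S" unfolding S_def by (rule suminf_nonneg[OF summable_power angular_power_nonneg])
  have "\<forall>\<^sub>F j in sequentially. \<forall>L k. band_limit j L \<longrightarrow> k \<in> K j \<longrightarrow>
    mean_square (\<lambda>\<omega>. observed j k \<omega> - unmasked_coeff L j k \<omega>) \<le> (2 * (area\<^sup>2 * (4 * pi * D\<^sup>2) * S)) * decay j / B ^ (8 * j)"
    using ev
  proof eventually_elim
    case (elim j)
    show ?case
    proof (intro allI impI)
      fix L k assume L: "band_limit j L" and k: "k \<in> K j"
      have kN: "k < N j" and \<xi>: "\<xi> j k \<in> sphere 0 1 - enlargement G \<epsilon>" using k by (auto simp: unmasked_points_def)
      define \<kappa> where "\<kappa> = sqrt (4 * pi) * (D / B ^ ((m + 4) * j))"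
      obtain R where R: "\<And>x. x \<in> sphere 0 1 \<Longrightarrow> cmod (spin_needlet B b s \<xi> w j k x) \<le> R"
        by (rule needlet_cmod_bound[OF L]) (rule that)
      have \<kappa>: "cmod (spin_needlet B b s \<xi> w j k x) \<le> \<kappa>" if x: "x \<in> G" for x
      proof -
        have "cmod (needlet_kernel B b s j x (\<xi> j k)) \<le> D / B ^ ((m + 4) * j)"
          using elim \<eta>(2)[OF x \<xi>] x G(1) \<xi> by blast
        moreover have "sqrt (w j k) \<le> sqrt (4 * pi)" using cubature_facts(3)[OF kN] by simp
        moreover have "0 \<le> sqrt (w j k)" using cubature_facts(2)[OF kN] by simp
        ultimately show ?thesis unfolding spin_needlet_eq \<kappa>_def norm_mult
          by (intro mult_mono) (auto simp: norm_of_real)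
      qed
      have "mean_square (\<lambda>\<omega>. observed j k \<omega> - unmasked_coeff L j k \<omega>) \<le> 2 * (area\<^sup>2 * \<kappa>\<^sup>2 * S)"
        unfolding observed_def unmasked_coeff_def S_def
        by (rule masked_coeff_error[OF G(2) needlet_measurable[OF L] needlet_expansion[OF L] R \<kappa>])
      also have "\<kappa>\<^sup>2 = 4 * pi * D\<^sup>2 * (1 / (B ^ j) ^ (2 * m + 8))"
      proof -
        have "(B ^ ((m + 4) * j))\<^sup>2 = (B ^ j) ^ (2 * m + 8)" by (simp add: power_mult[symmetric] algebra_simps)
        then show ?thesis unfolding \<kappa>_def by (simp add: power_mult_distrib power_divide)
      qed
      also have "1 / (B ^ j) ^ (2 * m + 8) \<le> decay j / B ^ (8 * j)"
      proof -
        have y: "1 \<le> B ^ j" using B by (simp add: one_le_power)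
        have "(B ^ j) powr (- real (2 * m)) \<le> (B ^ j) powr (- \<alpha>)"
          using y \<alpha> by (intro powr_mono) (auto simp: m_def, linarith)
        then have "1 / (B ^ j) ^ (2 * m) \<le> decay j"
          using power_B_pos[of j] unfolding decay_def by (simp only: powr_minus_divide powr_realpow)
        then have "1 / (B ^ j) ^ (2 * m) / (B ^ j) ^ 8 \<le> decay j / (B ^ j) ^ 8"
          using power_B_pos[of j] by (intro divide_right_mono) auto
        then show ?thesis by (simp add: power_add power_mult[symmetric] mult.commute)
      qed
      finally have "mean_square (\<lambda>\<omega>. observed j k \<omega> - unmasked_coeff L j k \<omega>) \<le>
          2 * (area\<^sup>2 * (4 * pi * D\<^sup>2 * (decay j / B ^ (8 * j))) * S)"
        using S by (simp add: mult_left_mono mult_right_mono)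
      then show "mean_square (\<lambda>\<omega>. observed j k \<omega> - unmasked_coeff L j k \<omega>) \<le> (2 * (area\<^sup>2 * (4 * pi * D\<^sup>2) * S)) * decay j / B ^ (8 * j)"
        by (simp add: mult_ac)
    qed
  qed
  then show ?thesis by (rule that[rotated]) (use S in simp)
qed

end

lemma sum_bool_product:
  fixes g :: "'k \<times> bool \<Rightarrow> real"
  shows "(\<Sum>i\<in>I \<times> UNIV. g i) = (\<Sum>k\<in>I. g (k, True) + g (k, False))"
proof -
  have "(\<Sum>i\<in>I \<times> UNIV. g i) = (\<Sum>k\<in>I. \<Sum>r\<in>UNIV. g (k, r))"
    by (subst sum.cartesian_product) (simp add: case_prod_beta')
  then show ?thesis by (simp add: UNIV_bool add.commute)
qed

section \<open>The limit theorem for the masked estimator\<close>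

context masked_needlets
begin

text \<open>All eventual estimates are made to hold from one level \<open>j\<^sub>0\<close> on. The
  lower bound on variances arises because cubature weights of order \<open>1 / B ^ (2 * j)\<close>
  cancel the growth \<open>B ^ (2 * j)\<close> of the spectrum relative to
  \<open>decay j\<close>.\<close>

lemma asymptotic_frame:
  obtains j\<^sub>0 :: nat and L :: "nat \<Rightarrow> nat" and A A' D c' :: real
  where "0 < A" "0 < A'" "0 \<le> D" "0 < c'"
    and "\<And>j. j\<^sub>0 \<le> j \<Longrightarrow> band_limit j (L j)"
    and "\<And>j l. j\<^sub>0 \<le> j \<Longrightarrow> f j l \<noteq> 0 \<Longrightarrow> C l \<le> A' * decay j"
    and "\<And>j k. j\<^sub>0 \<le> j \<Longrightarrow> k \<in> K j \<Longrightarrow> A * decay j \<le> w j k * \<Gamma> j"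
    and "\<And>j k. j\<^sub>0 \<le> j \<Longrightarrow> k \<in> K j \<Longrightarrow>
      mean_square (\<lambda>\<omega>. observed j k \<omega> - unmasked_coeff (L j) j k \<omega>) \<le> D * decay j / B ^ (8 * j)"
    and "\<And>j. real (N j) \<le> c' * B ^ (2 * j)"
    and "\<And>j. j\<^sub>0 \<le> j \<Longrightarrow> 4 * D \<le> A * B ^ j"
    and "\<And>j. j\<^sub>0 \<le> j \<Longrightarrow> 1 \<le> card (K j)"
proof -
  obtain A1 A2 where A2: "0 < A2" and Ab: "\<forall>\<^sub>F j in sequentially. \<forall>l. f j l \<noteq> 0 \<longrightarrow> A1 * decay j \<le> C l \<and> C l \<le> A2 * decay j"
    by (rule band_decay) (rule that)
  obtain g where g: "0 < g" and gb: "\<forall>\<^sub>F j in sequentially. g * B ^ (2 * j) * decay j \<le> \<Gamma> j"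
    by (rule spectrum_lower_bound) (rule that)
  obtain d where d: "\<forall>\<^sub>F j in sequentially. band_limit j (nat \<lceil>d * B ^ j\<rceil>)" using band_limit_exists by (rule exE)
  obtain D where D: "0 \<le> D" and Db: "\<forall>\<^sub>F j in sequentially. \<forall>L k. band_limit j L \<longrightarrow> k \<in> K j \<longrightarrow>
    mean_square (\<lambda>\<omega>. observed j k \<omega> - unmasked_coeff L j k \<omega>) \<le> D * decay j / B ^ (8 * j)"
    by (rule masking_error) (rule that)
  obtain e where e: "0 < e" and eb: "\<And>j k. k < N j \<Longrightarrow> e / B ^ (2 * j) \<le> w j k"
  proof -
    have "\<exists>c>0. \<exists>c'>0. \<forall>j. \<forall>k<N j. c / B ^ (2 * j) \<le> w j k \<and> w j k \<le> c' / B ^ (2 * j)"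
      using cubature unfolding spin_cubature_def by (elim conjE)
    then show thesis by (elim exE conjE) (rule that, assumption, blast)
  qed
  obtain c' where c': "0 < c'" and cb: "\<And>j. real (N j) \<le> c' * B ^ (2 * j)"
  proof -
    have "\<exists>c>0. \<exists>c'>0. \<forall>j. c * B ^ (2 * j) \<le> real (N j) \<and> real (N j) \<le> c' * B ^ (2 * j)"
      using cubature unfolding spin_cubature_def by (elim conjE)
    then show thesis by (elim exE conjE) (rule that, assumption, blast)
  qed
  have eg: "0 < e * g" using e g by simp
  have card: "\<forall>\<^sub>F j in sequentially. 1 \<le> card (K j)"
    using card_unmasked_points[OF B cubature G(1) unmasked] unfolding filterlim_at_top by blast
  have "\<forall>\<^sub>F j in sequentially. (band_limit j (nat \<lceil>d * B ^ j\<rceil>)) \<and> (\<forall>l. f j l \<noteq> 0 \<longrightarrow> C l \<le> A2 * decay j) \<and>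
      (\<forall>k\<in>K j. e * g * decay j \<le> w j k * \<Gamma> j) \<and>
      (\<forall>k\<in>K j. mean_square (\<lambda>\<omega>. observed j k \<omega> - unmasked_coeff (nat \<lceil>d * B ^ j\<rceil>) j k \<omega>) \<le> D * decay j / B ^ (8 * j)) \<and>
      4 * D \<le> e * g * B ^ j \<and> 1 \<le> card (K j)"
    using Ab gb d Db card eventually_power_ge[OF B eg, of "4 * D"]
  proof eventually_elim
    case (elim j)
    have "e * g * decay j \<le> w j k * \<Gamma> j" if k: "k \<in> K j" for k
    proof -
      have kN: "k < N j" using k K_subset by auto
      have "e * g * decay j = (e / B ^ (2 * j)) * (g * B ^ (2 * j) * decay j)" using B by simp
      also have "\<dots> \<le> w j k * \<Gamma> j"
        using eb[OF kN] elim(2) cubature_facts(2)[OF kN] g decay_pos[of j] B by (intro mult_mono) auto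
      finally show ?thesis .
    qed
    then show ?case using elim by blast
  qed
  then obtain j\<^sub>0 where j\<^sub>0: "\<And>j. j\<^sub>0 \<le> j \<Longrightarrow> (band_limit j (nat \<lceil>d * B ^ j\<rceil>)) \<and> (\<forall>l. f j l \<noteq> 0 \<longrightarrow> C l \<le> A2 * decay j) \<and>
      (\<forall>k\<in>K j. e * g * decay j \<le> w j k * \<Gamma> j) \<and>
      (\<forall>k\<in>K j. mean_square (\<lambda>\<omega>. observed j k \<omega> - unmasked_coeff (nat \<lceil>d * B ^ j\<rceil>) j k \<omega>) \<le> D * decay j / B ^ (8 * j)) \<and>
      4 * D \<le> e * g * B ^ j \<and> 1 \<le> card (K j)"
    unfolding eventually_sequentially by blast
  show ?thesis
    by (rule that[OF eg A2 D c', of j\<^sub>0 "\<lambda>j. nat \<lceil>d * B ^ j\<rceil>"]) (use j\<^sub>0 cb in blast)+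
qed

lemma observed_L2:
  assumes L: "band_limit j L"
  shows "L2_rv (observed j k)"
proof -
  obtain R where R: "\<And>x. x \<in> sphere 0 1 \<Longrightarrow> cmod (spin_needlet B b s \<xi> w j k x) \<le> R"
    by (rule needlet_cmod_bound[OF L]) (rule that)
  have A: "sphere 0 1 - G \<in> sets surface_measure" using sets.compl_sets[OF G(2)] by simp
  have "L2_rv (\<lambda>\<omega>. LINT x:sphere 0 1 - G|surface_measure. P \<omega> x * cnj (spin_needlet B b s \<xi> w j k x))"
    by (rule field_set_integral(1)[OF A needlet_measurable[OF L]], rule R) simp
  then show ?thesis by (simp add: observed_def masked_coeff_def[abs_def])
qed

lemma observed_gaussian:
  assumes L: "band_limit j L"
  shows "centred_gaussian (K j \<times> UNIV) (\<lambda>i \<omega>. (if snd i then Re else Im) (observed j (fst i) \<omega>))"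
proof -
  have "\<exists>R. \<forall>x\<in>sphere 0 1. cmod (spin_needlet B b s \<xi> w j k x) \<le> R" for k
    by (rule needlet_cmod_bound[OF L]) blast
  then obtain R where R: "\<And>k x. x \<in> sphere 0 1 \<Longrightarrow> cmod (spin_needlet B b s \<xi> w j k x) \<le> R k" by metis
  show ?thesis unfolding observed_def
    by (rule masked_coeff_gaussian[OF K_subset(2) G(2) needlet_measurable[OF L]], rule R)
qed

theorem estimator_clt:
  "weak_conv_m
    (\<lambda>j. distr M borel
       (\<lambda>\<omega>. (masked_estimator B b s N \<xi> w G \<epsilon> P j \<omega> - \<Gamma> j) /
            sqrt (variance (masked_estimator B b s N \<xi> w G \<epsilon> P j))))
    std_normal_distribution"
proof -
  let ?F = "\<lambda>j \<omega>. (masked_estimator B b s N \<xi> w G \<epsilon> P j \<omega> - \<Gamma> j) / sqrt (variance (masked_estimator B b s N \<xi> w G \<epsilon> P j))"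
  obtain j\<^sub>0 :: nat and L :: "nat \<Rightarrow> nat" and A A' D c' :: real
  where pos: "0 < A" "0 < A'" "0 \<le> D" "0 < c'"
    and L: "\<And>j. j\<^sub>0 \<le> j \<Longrightarrow> band_limit j (L j)"
    and CA': "\<And>j l. j\<^sub>0 \<le> j \<Longrightarrow> f j l \<noteq> 0 \<Longrightarrow> C l \<le> A' * decay j"
    and lower: "\<And>j k. j\<^sub>0 \<le> j \<Longrightarrow> k \<in> K j \<Longrightarrow> A * decay j \<le> w j k * \<Gamma> j"
    and err: "\<And>j k. j\<^sub>0 \<le> j \<Longrightarrow> k \<in> K j \<Longrightarrow>
      mean_square (\<lambda>\<omega>. observed j k \<omega> - unmasked_coeff (L j) j k \<omega>) \<le> D * decay j / B ^ (8 * j)"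
    and Nb: "\<And>j. real (N j) \<le> c' * B ^ (2 * j)"
    and D4: "\<And>j. j\<^sub>0 \<le> j \<Longrightarrow> 4 * D \<le> A * B ^ j"
    and card: "\<And>j. j\<^sub>0 \<le> j \<Longrightarrow> 1 \<le> card (K j)"
    by (rule asymptotic_frame) (rule that)
  define \<delta> where "\<delta> j k \<omega> = observed j k \<omega> - unmasked_coeff (L j) j k \<omega>" for j k \<omega>
  define X where "X j i \<omega> = (if snd i then Re else Im) (observed j (fst i) \<omega>)" for j and i :: "nat \<times> bool" and \<omega>
  define Q where "Q j \<omega> = (\<Sum>i\<in>K j \<times> UNIV. (X j i \<omega>)\<^sup>2)" for j \<omega>
  define T where "T j = (\<Sum>i\<in>K j \<times> UNIV. (expectation (\<lambda>\<omega>. (X j i \<omega>)\<^sup>2))\<^sup>2)" for j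
  define W where "W j = (\<Sum>k\<in>K j. w j k)" for j
  \<comment> \<open>An observed combination is a full-sphere combination plus an error combination;
    the factors 2 come from the square of this sum.\<close>
  define \<nu> where "\<nu> j = (2 * A' + 2 * (c' * D)) * decay j" for j
  \<comment> \<open>The lower bound \<open>A\<close> and an error of at most \<open>A / 4\<close>
    leave an observed mean square of at least \<open>A / 4\<close>. Its two real parts have squares
    summing to at least \<open>A\<^sup>2 / 32\<close>, which exceeds
    \<open>A\<^sup>2 / 36\<close>.\<close>
  define h where "h = A / 6"
  \<comment> \<open>The constant of the total bias: \<open>2 * sqrt (A' * D) + D\<close> bounds the
    effect of the mask on one variance, and \<open>c'\<close> counts the points.\<close>
  define E where "E = c' * (2 * sqrt (A' * D) + D)"
  have h: "0 < h" using pos by (simp add: h_def)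
  have E: "0 \<le> E" using pos by (simp add: E_def)
  have obs: "L2_rv (observed j k)" if "j\<^sub>0 \<le> j" for j k by (rule observed_L2[OF L[OF that]])
  have \<delta>: "L2_rv (\<delta> j k)" if "j\<^sub>0 \<le> j" for j k
    unfolding \<delta>_def[abs_def] by (rule L2_rv_diff(1)[OF obs[OF that] unmasked_coeff_L2])
  have \<delta>b: "mean_square (\<delta> j k) \<le> D * decay j / B ^ (8 * j)" if "j\<^sub>0 \<le> j" "k \<in> K j" for j k
    using err[OF that] by (simp add: \<delta>_def[abs_def])
  have Bp: "1 \<le> B ^ n" for n using B by (simp add: one_le_power)
  have cK: "real (card (K j)) \<le> c' * B ^ (2 * j)" for j
    using card_mono[OF finite_lessThan K_subset(1), of j] Nb[of j] by simp
  have g: "centred_gaussian (K j \<times> UNIV) (X j)" if "j\<^sub>0 \<le> j" for j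
    unfolding X_def[abs_def] by (rule observed_gaussian[OF L[OF that]])
  have op: "expectation (\<lambda>\<omega>. (\<Sum>i\<in>K j \<times> UNIV. u i * X j i \<omega>)\<^sup>2) \<le> \<nu> j * (\<Sum>i\<in>K j \<times> UNIV. (u i)\<^sup>2)"
    if j: "j\<^sub>0 \<le> j" for j u
  proof -
    define v where "v k = Complex (u (k, True)) (- u (k, False))" for k
    define V where "V = (\<Sum>k\<in>K j. (cmod (v k))\<^sup>2)"
    let ?Z = "\<lambda>\<omega>. \<Sum>k\<in>K j. v k * observed j k \<omega>"
    let ?U = "\<lambda>\<omega>. \<Sum>k\<in>K j. v k * unmasked_coeff (L j) j k \<omega>" and ?R = "\<lambda>\<omega>. \<Sum>k\<in>K j. v k * \<delta> j k \<omega>"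
    have V0: "0 \<le> V" unfolding V_def by (simp add: sum_nonneg)
    have Veq: "(\<Sum>i\<in>K j \<times> UNIV. (u i)\<^sup>2) = V"
      unfolding V_def sum_bool_product v_def by (simp add: cmod_power2)
    have Z: "L2_rv ?Z" by (intro L2_rv_sum L2_rv_mult(1) obs j)
    have U: "L2_rv ?U" by (intro L2_rv_sum L2_rv_mult(1) unmasked_coeff_L2)
    have R: "L2_rv ?R" by (intro L2_rv_sum L2_rv_mult(1) \<delta> j)
    have ReZ: "(\<Sum>i\<in>K j \<times> UNIV. u i * X j i \<omega>) = Re (?Z \<omega>)" for \<omega>
      unfolding X_def v_def by (rule sum_Re_Im[where z = "\<lambda>k. observed j k \<omega>" and u = u])
    have "expectation (\<lambda>\<omega>. (\<Sum>i\<in>K j \<times> UNIV. u i * X j i \<omega>)\<^sup>2) \<le> mean_square ?Z"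
      unfolding ReZ L2_rv_parts(5)[OF Z] by (simp add: Bochner_Integration.integral_nonneg)
    also have "?Z = (\<lambda>\<omega>. ?U \<omega> + ?R \<omega>)"
      by (simp add: \<delta>_def sum.distrib[symmetric] distrib_left[symmetric])
    also have "mean_square (\<lambda>\<omega>. ?U \<omega> + ?R \<omega>) \<le> 2 * mean_square ?U + 2 * mean_square ?R" by (rule L2_rv_add(2)[OF U R])
    also have "mean_square ?U \<le> A' * decay j * V"
      unfolding V_def
      by (rule mean_square_unmasked_combination[OF CA'[OF j] _ K_subset(1)]) (use pos decay_pos[of j] in auto)
    also have "mean_square ?R \<le> V * (\<Sum>k\<in>K j. mean_square (\<delta> j k))"
      unfolding V_def by (rule mean_square_sum_le[OF \<delta>[OF j]])
    also have "(\<Sum>k\<in>K j. mean_square (\<delta> j k)) \<le> c' * D * decay j"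
    proof -
      have "(\<Sum>k\<in>K j. mean_square (\<delta> j k)) \<le> real (card (K j)) * (D * decay j / B ^ (8 * j))"
        by (rule sum_bounded_above) (rule \<delta>b[OF j])
      also have "\<dots> \<le> (c' * B ^ (2 * j)) * (D * decay j / B ^ (8 * j))"
        by (rule mult_right_mono[OF cK]) (use pos decay_pos[of j] B in simp)
      also have "\<dots> = c' * D * decay j * (B ^ (2 * j) / B ^ (8 * j))" by simp
      also have "\<dots> \<le> c' * D * decay j * 1"
        using pos decay_pos[of j] B by (intro mult_left_mono) (simp_all add: power_increasing)
      finally show ?thesis by simp
    qed
    finally have "expectation (\<lambda>\<omega>. (\<Sum>i\<in>K j \<times> UNIV. u i * X j i \<omega>)\<^sup>2) \<le> 2 * (A' * decay j * V) + 2 * (V * (c' * D * decay j))"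
      using V0 by (simp add: mult_left_mono)
    also have "\<dots> = \<nu> j * V" by (simp add: \<nu>_def algebra_simps)
    finally show ?thesis unfolding Veq .
  qed
  have msX: "mean_square (observed j k) = expectation (\<lambda>\<omega>. (X j (k, True) \<omega>)\<^sup>2) + expectation (\<lambda>\<omega>. (X j (k, False) \<omega>)\<^sup>2)"
    if "j\<^sub>0 \<le> j" for j k unfolding L2_rv_parts(5)[OF obs[OF that]] by (simp add: X_def)
  have Qeq: "Q j \<omega> = (\<Sum>k\<in>K j. (cmod (observed j k \<omega>))\<^sup>2)" for j \<omega>
    unfolding Q_def sum_bool_product by (simp add: X_def cmod_power2)
  \<comment> \<open>Every unmasked point adds at least \<open>(h * decay j)\<^sup>2\<close> to
    \<open>T j\<close>; correlations between points do not enter.\<close>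
  have Tlow: "sqrt (real (card (K j))) * (h * decay j) \<le> sqrt (T j)" if j: "j\<^sub>0 \<le> j" for j
  proof -
    have "(h * decay j)\<^sup>2 \<le> (expectation (\<lambda>\<omega>. (X j (k, True) \<omega>)\<^sup>2))\<^sup>2 + (expectation (\<lambda>\<omega>. (X j (k, False) \<omega>)\<^sup>2))\<^sup>2"
      if k: "k \<in> K j" for k
    proof -
      have kN: "k < N j" using k K_subset by auto
      have "D / B ^ (8 * j) \<le> A / 4"
      proof -
        have "B ^ j \<le> B ^ (8 * j)" using B by (intro power_increasing) auto
        then have "A * B ^ j \<le> A * B ^ (8 * j)" using pos by (intro mult_left_mono) auto
        then have "4 * D \<le> A * B ^ (8 * j)" using D4[OF j] by linarith
        then show ?thesis using B by (simp add: pos_divide_le_eq)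
      qed
      then have dd: "D / B ^ (8 * j) * decay j \<le> A / 4 * decay j" using decay_pos[of j] by (intro mult_right_mono) auto
      have de: "D * decay j / B ^ (8 * j) = D / B ^ (8 * j) * decay j" by simp
      have d: "mean_square (\<delta> j k) \<le> A / 4 * decay j"
        by (rule order_trans[OF \<delta>b[OF j k]]) (use dd in \<open>simp only: de\<close>)
      have "unmasked_coeff (L j) j k = (\<lambda>\<omega>. observed j k \<omega> - \<delta> j k \<omega>)" by (simp add: \<delta>_def)
      then have "mean_square (unmasked_coeff (L j) j k) \<le> 2 * mean_square (observed j k) + 2 * mean_square (\<delta> j k)"
        using L2_rv_diff(2)[OF obs[OF j] \<delta>[OF j]] by (simp only:)
      then have m: "A / 4 * decay j \<le> mean_square (observed j k)"
        using mean_square_unmasked_coeff[OF L[OF j] kN] lower[OF j k] d by linarith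
      have sq: "(A / 6 * t)\<^sup>2 \<le> p\<^sup>2 + r\<^sup>2" if "A / 4 * t \<le> p + r" "0 \<le> t" for p r t :: real
      proof -
        have "(A / 4 * t)\<^sup>2 \<le> (p + r)\<^sup>2" using that pos by (intro power_mono) auto
        also have "\<dots> \<le> 2 * (p\<^sup>2 + r\<^sup>2)" using sum_squares_bound[of p r] by (simp add: power2_sum)
        finally have "(A * t)\<^sup>2 / 16 \<le> 2 * (p\<^sup>2 + r\<^sup>2)" by (simp add: power_mult_distrib power_divide)
        moreover have "y / 36 \<le> z" if "y / 16 \<le> 2 * z" "0 \<le> y" for y z :: real
        proof -
          have "y \<le> 32 * z" using that(1) by simp
          then have "y \<le> 36 * z" using that(2) by linarith
          then show ?thesis by simp
        qed
        moreover have "(A / 6 * t)\<^sup>2 = (A * t)\<^sup>2 / 36" by (simp add: power_mult_distrib power_divide)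
        moreover have "0 \<le> (A * t)\<^sup>2" by simp
        ultimately show ?thesis by (simp only:)
      qed
      show ?thesis unfolding h_def by (rule sq) (use m msX[OF j] decay_pos[of j] in auto)
    qed
    then have "real (card (K j)) * (h * decay j)\<^sup>2 \<le> T j"
      unfolding T_def sum_bool_product by (rule sum_bounded_below)
    then have "sqrt (real (card (K j)) * (h * decay j)\<^sup>2) \<le> sqrt (T j)" by (rule real_sqrt_le_mono)
    then show ?thesis using h decay_pos[of j] by (simp add: real_sqrt_mult)
  qed
  have cpos: "0 < sqrt (real (card (K j)))" if "j\<^sub>0 \<le> j" for j using card[OF that] by simp
  have Tpos: "0 < sqrt (T j)" if "j\<^sub>0 \<le> j" for j
    by (rule less_le_trans[OF _ Tlow[OF that]]) (use cpos[OF that] h decay_pos[of j] in simp)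
  have EQ: "\<bar>expectation (Q j) - W j * \<Gamma> j\<bar> \<le> E * decay j" if j: "j\<^sub>0 \<le> j" for j
  proof -
    have "expectation (Q j) = (\<Sum>k\<in>K j. mean_square (observed j k))"
      unfolding Qeq[abs_def] mean_square_def by (rule Bochner_Integration.integral_sum) (rule L2_rvD(2)[OF obs[OF j]])
    moreover have "W j * \<Gamma> j = (\<Sum>k\<in>K j. mean_square (unmasked_coeff (L j) j k))"
      unfolding W_def sum_distrib_right
      by (intro sum.cong refl mean_square_unmasked_coeff[OF L[OF j], symmetric]) (use K_subset in auto)
    ultimately have "\<bar>expectation (Q j) - W j * \<Gamma> j\<bar> =
        \<bar>\<Sum>k\<in>K j. (mean_square (observed j k) - mean_square (unmasked_coeff (L j) j k))\<bar>" by (simp only: sum_subtractf)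
    also have "\<dots> \<le> (\<Sum>k\<in>K j. \<bar>mean_square (observed j k) - mean_square (unmasked_coeff (L j) j k)\<bar>)" by (rule sum_abs)
    \<comment> \<open>The cross term is the geometric mean of a variance of order
      \<open>decay j\<close> and an error smaller by \<open>B ^ (8 * j)\<close>, hence smaller by
      \<open>B ^ (4 * j)\<close>. This still outweighs the number of points.\<close>
    also have "\<dots> \<le> real (card (K j)) * ((2 * sqrt (A' * D) + D) * decay j / B ^ (4 * j))"
    proof (rule sum_bounded_above)
      fix k assume k: "k \<in> K j"
      have B48: "B ^ (8 * j) = (B ^ (4 * j))\<^sup>2" "B ^ (4 * j) \<le> B ^ (8 * j)"
        using B by (simp_all add: power_mult[symmetric] power_increasing)
      have "mean_square (\<lambda>\<omega>. \<Sum>k\<in>{k}. 1 * unmasked_coeff (L j) j k \<omega>) \<le> A' * decay j * (\<Sum>k\<in>{k}. (cmod 1)\<^sup>2)"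
        by (rule mean_square_unmasked_combination[OF CA'[OF j]]) (use pos decay_pos[of j] k K_subset in auto)
      then have u: "mean_square (unmasked_coeff (L j) j k) \<le> A' * decay j" by simp
      have "sqrt (mean_square (unmasked_coeff (L j) j k) * mean_square (\<delta> j k)) \<le>
          sqrt ((A' * decay j) * (D * decay j / B ^ (8 * j)))"
        by (intro real_sqrt_le_mono mult_mono u \<delta>b[OF j k] mean_square_nonneg) (use pos decay_pos[of j] in auto)
      also have "(A' * decay j) * (D * decay j / B ^ (8 * j)) = (A' * D) * (decay j / B ^ (4 * j))\<^sup>2"
        unfolding B48(1) by (simp add: power_divide power2_eq_square)
      also have "sqrt \<dots> = sqrt (A' * D) * (decay j / B ^ (4 * j))"
        using decay_pos[of j] B by (simp add: real_sqrt_mult)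
      finally have s: "sqrt (mean_square (unmasked_coeff (L j) j k) * mean_square (\<delta> j k)) \<le> sqrt (A' * D) * (decay j / B ^ (4 * j))" .
      have "D * decay j / B ^ (8 * j) \<le> D * decay j / B ^ (4 * j)"
        using B48(2) pos decay_pos[of j] B by (intro divide_left_mono mult_nonneg_nonneg) auto
      then have "mean_square (\<delta> j k) \<le> D * (decay j / B ^ (4 * j))" using \<delta>b[OF j k] by simp
      then have "\<bar>mean_square (observed j k) - mean_square (unmasked_coeff (L j) j k)\<bar> \<le>
          2 * (sqrt (A' * D) * (decay j / B ^ (4 * j))) + D * (decay j / B ^ (4 * j))"
        using mean_square_perturbation[OF obs[OF j] unmasked_coeff_L2, of k "L j" j k] s
        unfolding \<delta>_def[abs_def] by linarith
      also have "\<dots> = (2 * sqrt (A' * D) + D) * decay j / B ^ (4 * j)" by (simp add: algebra_simps add_divide_distrib)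
      finally show "\<bar>mean_square (observed j k) - mean_square (unmasked_coeff (L j) j k)\<bar> \<le>
          (2 * sqrt (A' * D) + D) * decay j / B ^ (4 * j)" .
    qed
    also have "\<dots> \<le> (c' * B ^ (2 * j)) * ((2 * sqrt (A' * D) + D) * decay j / B ^ (4 * j))"
      by (rule mult_right_mono[OF cK]) (use pos decay_pos[of j] B in simp)
    also have "\<dots> = E * decay j * (B ^ (2 * j) / B ^ (4 * j))" by (simp add: E_def)
    also have "\<dots> \<le> E * decay j * 1"
      using E decay_pos[of j] B by (intro mult_left_mono) (simp_all add: power_increasing)
    finally show ?thesis by simp
  qed
  have ratio: "\<bar>c * decay j\<bar> / sqrt (T j) \<le> \<bar>c\<bar> / h / sqrt (real (card (K j)))" if j: "j\<^sub>0 \<le> j" for c j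
  proof -
    have "\<bar>c * decay j\<bar> / sqrt (T j) \<le> \<bar>c * decay j\<bar> / (sqrt (real (card (K j))) * (h * decay j))"
      using cpos[OF j] h decay_pos[of j] Tpos[OF j] by (intro divide_left_mono Tlow[OF j]) auto
    also have "\<dots> = \<bar>c\<bar> / h / sqrt (real (card (K j)))"
      using decay_pos[of j] h by (simp add: abs_mult)
    finally show ?thesis .
  qed
  have null: "(\<lambda>i. c / h / sqrt (real (card (K (i + j\<^sub>0))))) \<longlonglongrightarrow> 0" for c
  proof -
    have "filterlim (\<lambda>i. card (K (i + j\<^sub>0))) at_top sequentially"
      by (rule filterlim_compose[OF card_unmasked_points[OF B cubature G(1) unmasked] filterlim_add_const_nat_at_top])
    then have "filterlim (\<lambda>i. sqrt (real (card (K (i + j\<^sub>0))))) at_top sequentially"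
      by (intro filterlim_compose[OF sqrt_at_top] filterlim_compose[OF filterlim_real_sequentially])
    then show ?thesis by (intro tendsto_divide_0[OF tendsto_const] filterlim_at_top_imp_at_infinity)
  qed
  have W: "0 < W j" if "j\<^sub>0 \<le> j" for j
    unfolding W_def
  proof (rule sum_pos)
    show "finite (K j)" by (rule K_subset(2))
    show "K j \<noteq> {}" using card[OF that] by auto
    show "0 < w j k" if "k \<in> K j" for k using that K_subset by (intro cubature_facts(2)) auto
  qed
  have est: "masked_estimator B b s N \<xi> w G \<epsilon> P j = (\<lambda>\<omega>. Q j \<omega> / W j)" for j
    by (intro ext) (simp add: masked_estimator_def Let_def Qeq W_def observed_def unmasked_points_def)
  \<comment> \<open>The deterministic normalisation \<open>W j\<close> scales the centred estimator
    and its standard deviation alike, so the studentised quantity is that of the plain quadratic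
    form \<open>Q j\<close> centred at \<open>W j * \<Gamma> j\<close>.\<close>
  have F: "?F j \<omega> = (Q j \<omega> - W j * \<Gamma> j) / sqrt (variance (Q j))" if j: "j\<^sub>0 \<le> j" for j \<omega>
  proof -
    have "variance (\<lambda>\<omega>. Q j \<omega> / W j) = variance (Q j) / (W j)\<^sup>2"
      by (simp add: diff_divide_distrib[symmetric] power_divide)
    then have "sqrt (variance (\<lambda>\<omega>. Q j \<omega> / W j)) = sqrt (variance (Q j)) / W j"
      using W[OF j] by (simp add: real_sqrt_divide)
    moreover have "Q j \<omega> / W j - \<Gamma> j = (Q j \<omega> - W j * \<Gamma> j) / W j" using W[OF j] by (simp add: diff_divide_distrib)
    ultimately show ?thesis unfolding est using W[OF j] by simp
  qed
  \<comment> \<open>Gaussianity and the estimates are known only from \<open>j\<^sub>0\<close> on,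
    so the limit theorem is applied to the shifted sequence; weak convergence does not see the
    shift.\<close>
  have shifted: "weak_conv_m (\<lambda>i. distr M borel (?F (i + j\<^sub>0))) std_normal_distribution"
  proof (rule gaussian_quadratic_form_clt[where I = "\<lambda>i. K (i + j\<^sub>0) \<times> UNIV" and X = "\<lambda>i. X (i + j\<^sub>0)" and \<nu> = "\<lambda>i. \<nu> (i + j\<^sub>0)"
        and Q = "\<lambda>i. Q (i + j\<^sub>0)" and T = "\<lambda>i. T (i + j\<^sub>0)" and m = "\<lambda>i. W (i + j\<^sub>0) * \<Gamma> (i + j\<^sub>0)"])
    show "finite (K (i + j\<^sub>0) \<times> (UNIV :: bool set))" for i using K_subset(2) by simp
    show "centred_gaussian (K (i + j\<^sub>0) \<times> UNIV) (X (i + j\<^sub>0))" for i by (rule g) simp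
    show "expectation (\<lambda>\<omega>. (\<Sum>p\<in>K (i + j\<^sub>0) \<times> UNIV. u p * X (i + j\<^sub>0) p \<omega>)\<^sup>2) \<le> \<nu> (i + j\<^sub>0) * (\<Sum>p\<in>K (i + j\<^sub>0) \<times> UNIV. (u p)\<^sup>2)" for u i
      by (rule op) simp
    show "Q (i + j\<^sub>0) = (\<lambda>\<omega>. \<Sum>p\<in>K (i + j\<^sub>0) \<times> UNIV. (X (i + j\<^sub>0) p \<omega>)\<^sup>2)" for i by (simp add: Q_def[abs_def])
    show "T (i + j\<^sub>0) = (\<Sum>p\<in>K (i + j\<^sub>0) \<times> UNIV. (expectation (\<lambda>\<omega>. (X (i + j\<^sub>0) p \<omega>)\<^sup>2))\<^sup>2)" for i by (simp add: T_def)
    show "\<forall>\<^sub>F i in sequentially. 0 < T (i + j\<^sub>0)" using Tpos by (intro always_eventually allI) simp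
    show "(\<lambda>i. \<nu> (i + j\<^sub>0) / sqrt (T (i + j\<^sub>0))) \<longlonglongrightarrow> 0"
    proof (rule Lim_null_comparison[OF always_eventually null], rule allI)
      fix i show "norm (\<nu> (i + j\<^sub>0) / sqrt (T (i + j\<^sub>0))) \<le> \<bar>2 * A' + 2 * (c' * D)\<bar> / h / sqrt (real (card (K (i + j\<^sub>0))))"
        using ratio[of "i + j\<^sub>0" "2 * A' + 2 * (c' * D)"] Tpos[of "i + j\<^sub>0"] by (simp add: \<nu>_def)
    qed
    show "(\<lambda>i. (expectation (Q (i + j\<^sub>0)) - W (i + j\<^sub>0) * \<Gamma> (i + j\<^sub>0)) / sqrt (T (i + j\<^sub>0))) \<longlonglongrightarrow> 0"
    proof (rule Lim_null_comparison[OF always_eventually null], rule allI)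
      fix i
      have j: "j\<^sub>0 \<le> i + j\<^sub>0" by simp
      have "norm ((expectation (Q (i + j\<^sub>0)) - W (i + j\<^sub>0) * \<Gamma> (i + j\<^sub>0)) / sqrt (T (i + j\<^sub>0))) =
          \<bar>expectation (Q (i + j\<^sub>0)) - W (i + j\<^sub>0) * \<Gamma> (i + j\<^sub>0)\<bar> / sqrt (T (i + j\<^sub>0))"
        using Tpos[OF j] by simp
      also have "\<dots> \<le> \<bar>E * decay (i + j\<^sub>0)\<bar> / sqrt (T (i + j\<^sub>0))"
        using EQ[OF j] Tpos[OF j] by (intro divide_right_mono) auto
      also have "\<dots> \<le> \<bar>E\<bar> / h / sqrt (real (card (K (i + j\<^sub>0))))" by (rule ratio[OF j])
      finally show "norm ((expectation (Q (i + j\<^sub>0)) - W (i + j\<^sub>0) * \<Gamma> (i + j\<^sub>0)) / sqrt (T (i + j\<^sub>0))) \<le> \<bar>E\<bar> / h / sqrt (real (card (K (i + j\<^sub>0))))" .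
    qed
    show "?F (i + j\<^sub>0) \<in> borel_measurable M" for i
    proof -
      have "(\<lambda>\<omega>. (X (i + j\<^sub>0) p \<omega>)\<^sup>2) \<in> borel_measurable M" if "p \<in> K (i + j\<^sub>0) \<times> UNIV" for p
        using centred_gaussianD(1)[OF g[of "i + j\<^sub>0"] that] by (intro borel_measurable_power) auto
      then have "Q (i + j\<^sub>0) \<in> borel_measurable M" unfolding Q_def[abs_def] by (intro borel_measurable_sum)
      then show ?thesis unfolding F[OF le_add2] by (intro borel_measurable_divide borel_measurable_diff borel_measurable_const)
    qed
    show "\<forall>\<^sub>F i in sequentially. \<forall>\<omega>. ?F (i + j\<^sub>0) \<omega> =
        (Q (i + j\<^sub>0) \<omega> - W (i + j\<^sub>0) * \<Gamma> (i + j\<^sub>0)) / sqrt (variance (Q (i + j\<^sub>0)))"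
      by (intro always_eventually allI) (rule F[OF le_add2])
  qed
  show ?thesis
    unfolding weak_conv_m_def weak_conv_def
  proof (intro allI impI)
    fix x assume "isCont (cdf std_normal_distribution) x"
    then have "(\<lambda>i. cdf (distr M borel (?F (i + j\<^sub>0))) x) \<longlonglongrightarrow> cdf std_normal_distribution x"
      using shifted unfolding weak_conv_m_def weak_conv_def by blast
    then show "(\<lambda>j. cdf (distr M borel (?F j)) x) \<longlonglongrightarrow> cdf std_normal_distribution x"
      by (rule LIMSEQ_offset)
  qed
qed

end

section \<open>Finite variance of the field and conclusion\<close>

lemma summable_angular_power:
  assumes "2 < \<alpha>" and C: "\<And>l. l \<in> multipoles s \<Longrightarrow> 0 < C l \<and> C l \<le> c\<^sub>0 * real l powr (- \<alpha>)"
  shows "summable (angular_power s C)"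
proof (rule summable_comparison_test')
  \<comment> \<open>The contribution of a multipole to the variance at a point is of order
    \<open>real l powr (1 - \<alpha>)\<close>, which is summable because
    \<open>2 < \<alpha>\<close>.\<close>
  have "summable (\<lambda>l. real l powr (1 - \<alpha>))" using assms(1) by (subst summable_real_powr_iff) simp
  then show "summable (\<lambda>l. c\<^sub>0 * real l powr (1 - \<alpha>))" by (rule summable_mult)
  fix l :: nat assume "0 \<le> l"
  show "norm (angular_power s C l) \<le> c\<^sub>0 * real l powr (1 - \<alpha>)"
  proof (cases "l \<in> multipoles s")
    case True
    then have l: "1 \<le> real l" by (simp add: multipoles_def)
    have eq: "c\<^sub>0 * real l powr (1 - \<alpha>) = (c\<^sub>0 * real l powr (- \<alpha>)) * real l"
      using l by (simp add: powr_diff powr_minus_divide)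
    have "(2 * real l + 1) / (4 * pi) \<le> real l"
    proof -
      have "2 * real l + 1 \<le> 3 * real l" using l by linarith
      also have "\<dots> \<le> real l * (4 * pi)" using pi_gt3 l by (simp add: mult.commute mult_left_mono)
      finally show ?thesis by (simp add: pos_divide_le_eq)
    qed
    then have le: "C l * ((2 * real l + 1) / (4 * pi)) \<le> (c\<^sub>0 * real l powr (- \<alpha>)) * real l"
      using C[OF True] l by (intro mult_mono) auto
    have nn: "0 \<le> C l * ((2 * real l + 1) / (4 * pi))" using C[OF True] by (intro mult_nonneg_nonneg) auto
    have "norm (angular_power s C l) = C l * ((2 * real l + 1) / (4 * pi))"
      using True nn by (simp only: angular_power_def if_True real_norm_def abs_of_nonneg)
    then show ?thesis using le unfolding eq by (simp only:)
  next
    case False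
    have "0 \<le> c\<^sub>0"
    proof -
      have m: "nat \<bar>s\<bar> + 1 \<in> multipoles s" by (simp add: multipoles_def)
      then have "0 < c\<^sub>0 * real (nat \<bar>s\<bar> + 1) powr (- \<alpha>)" using C[OF m] by linarith
      then show ?thesis by (simp add: zero_less_mult_iff)
    qed
    then show ?thesis using False by (simp add: angular_power_def)
  qed
qed

theorem theorem5:
  fixes s :: int and B \<epsilon> :: real and b :: "real \<Rightarrow> real"
    and N :: "nat \<Rightarrow> nat" and \<xi> :: "nat \<Rightarrow> nat \<Rightarrow> real^3" and w :: "nat \<Rightarrow> nat \<Rightarrow> real"
    and M :: "'a measure" and C :: "nat \<Rightarrow> real" and P :: "'a \<Rightarrow> real^3 \<Rightarrow> complex"
    and G :: "(real^3) set"
  assumes "1 < B"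
    and "needlet_window B b"
    and "spin_cubature B s N \<xi> w"
    and "prob_space M"
    and "gaussian_spin_field M s C P"
    and "spectrum_condition s C"
    and "G \<subseteq> sphere 0 1" and "G \<in> sets surface_measure"
    and "0 < \<epsilon>"
    and "sphere 0 1 - enlargement G \<epsilon> \<noteq> {}"
  shows "weak_conv_m
    (\<lambda>j. distr M borel
       (\<lambda>\<omega>. (masked_estimator B b s N \<xi> w G \<epsilon> P j \<omega> - needlet_spectrum B b s C j) /
            sqrt (prob_space.variance M (masked_estimator B b s N \<xi> w G \<epsilon> P j))))
    std_normal_distribution"
proof -
  interpret prob_space M by fact
  obtain a :: "nat \<Rightarrow> int \<Rightarrow> 'a \<Rightarrow> complex" where
    Pm: "(\<lambda>(\<omega>, x). P \<omega> x) \<in> borel_measurable (M \<Otimes>\<^sub>M surface_measure)"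
    and jg: "jointly_gaussian M (SIGMA l:multipoles s. {- int l..int l}) (\<lambda>(l, m). a l m)"
    and mean: "\<forall>l\<in>multipoles s. \<forall>m\<in>{- int l..int l}. expectation (a l m) = 0"
    and cov: "\<forall>l\<in>multipoles s. \<forall>m\<in>{- int l..int l}. \<forall>l'\<in>multipoles s. \<forall>m'\<in>{- int l'..int l'}.
           expectation (\<lambda>\<omega>. a l m \<omega> * cnj (a l' m' \<omega>)) = (if l = l' \<and> m = m' then of_real (C l) else 0) \<and>
           expectation (\<lambda>\<omega>. a l m \<omega> * a l' m' \<omega>) = 0"
    and conv: "\<forall>x\<in>sphere 0 1.
           (\<lambda>L. \<integral>\<^sup>+\<omega>. ennreal ((cmod (P \<omega> x -
                  (\<Sum>l\<in>multipoles s \<inter> {..L}. \<Sum>m = - int l..int l.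
                     a l m \<omega> * spin_harmonic l m s x)))\<^sup>2) \<partial>M) \<longlonglongrightarrow> 0"
    using assms(5) unfolding gaussian_spin_field_def by (elim conjE exE) (rule that)
  obtain \<alpha> c\<^sub>0 and g :: "real \<Rightarrow> real" where \<alpha>: "2 < \<alpha>" and c\<^sub>0: "0 < c\<^sub>0"
    and g: "\<forall>l\<in>multipoles s. C l = real l powr (- \<alpha>) * g (real l) \<and> 0 < C l \<and> 1 / c\<^sub>0 \<le> g (real l) \<and> g (real l) \<le> c\<^sub>0"
    using assms(6) unfolding spectrum_condition_def by (elim exE conjE) (rule that)
  have Cb: "real l powr (- \<alpha>) / c\<^sub>0 \<le> C l \<and> C l \<le> c\<^sub>0 * real l powr (- \<alpha>)" if "l \<in> multipoles s" for l
  proof -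
    have gl: "C l = real l powr (- \<alpha>) * g (real l)" "1 / c\<^sub>0 \<le> g (real l)" "g (real l) \<le> c\<^sub>0" using g that by blast+
    have "real l powr (- \<alpha>) * (1 / c\<^sub>0) \<le> C l" "C l \<le> real l powr (- \<alpha>) * c\<^sub>0"
      unfolding gl(1) using gl(2,3) by (intro mult_left_mono; simp)+
    then show ?thesis by (simp add: mult.commute)
  qed
  have Cp: "0 < C l" if "l \<in> multipoles s" for l using g that by blast
  interpret spin_field M s C P "\<lambda>(l, m). a l m"
  proof unfold_locales
    fix p q assume pq: "p \<in> harmonic_index s" "q \<in> harmonic_index s"
    show "expectation (case p of (l, m) \<Rightarrow> a l m) = 0"
      using mean pq(1) unfolding harmonic_index_def by auto
    show "expectation (\<lambda>\<omega>. (case p of (l, m) \<Rightarrow> a l m) \<omega> * cnj ((case q of (l, m) \<Rightarrow> a l m) \<omega>)) =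
        (if p = q then of_real (C (fst p)) else 0)"
      using cov pq unfolding harmonic_index_def by (auto split: if_splits)
  next
    fix x :: "real^3" assume x: "x \<in> sphere 0 1"
    show "(\<lambda>L. \<integral>\<^sup>+\<omega>. ennreal ((cmod (P \<omega> x - (\<Sum>p\<in>harmonics_upto s L. (case p of (l, m) \<Rightarrow> a l m) \<omega> * harmonic s p x)))\<^sup>2) \<partial>M) \<longlonglongrightarrow> 0"
      using conv x unfolding sum_harmonics_upto by simp
  next
    show "summable (angular_power s C)"
      by (rule summable_angular_power[OF \<alpha>]) (use Cp Cb in blast)
  qed (use Pm jg Cp in \<open>simp_all add: harmonic_index_def\<close>)
  interpret masked_needlets M s C P "\<lambda>(l, m). a l m" B \<epsilon> \<alpha> c\<^sub>0 b N \<xi> w G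
    by unfold_locales (use assms \<alpha> c\<^sub>0 Cb in blast)+
  show ?thesis by (rule estimator_clt)
qed

end
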